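(* Let $\Omega\subseteq[0,1]^2$ be a closed Peano–Jordan measurable set with positive measure, and let $A:\Omega\to\mathbb C^{2\times2}$, $\mathbf b:\Omega\to\mathbb C^2$, $c:\Omega\to\mathbb C$ be $L^1$ functions. Let $\tilde A,\tilde{\mathbf b},\tilde c$ be the extensions of $A,\mathbf b,c$ to $(0,1)^2$ obtained by setting them equal to zero outside $\Omega$. With $B_1=(1,1)$, $B_2=(1,0)$, $B_3=(0,1)$, let $$\tilde k(x,\theta)=r_{0,0}(x)+r_{0,1}(x)e^{-\mathrm i\theta_2}+r_{1,0}(x)e^{-\mathrm i\theta_1}+r_{-1,0}(x)e^{\mathrm i\theta_1}+r_{0,-1}(x)e^{\mathrm i\theta_2}+r_{1,-1}(x)e^{-\mathrm i\theta_1+\mathrm i\theta_2}+r_{-1,1}(x)e^{\mathrm i\theta_1-\mathrm i\theta_2},$$ where $$r_{0,0}=B_1\tilde AB_1^T+B_2\tilde AB_2^T+B_3\tilde AB_3^T,\qquad r_{0,1}=r_{0,-1}=-\tfrac12B_3\tilde AB_1^T-\tfrac12B_1\tilde AB_3^T,$$ $$r_{1,-1}=r_{-1,1}=\tfrac12B_2\tilde AB_3^T+\tfrac12B_3\tilde AB_2^T,\qquad r_{-1,0}=r_{1,0}=-\tfrac12B_1\tilde AB_2^T-\tfrac12B_2\tilde AB_1^T,$$ and let $k=\tilde k|_{x\in\Omega^\circ}$ be the restriction of $\tilde k$ to $\Omega^\circ\times[-\pi,\pi]^2$. If $S^\Omega_{\mathbf n}$ is the matrix resulting from the $P_1$ discretization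 using the grid $\Xi_n(\Omega)$, as defined in the context, then $$\{S^\Omega_{\mathbf n}\}_n\sim_\sigma k,$$ and if $A(x)$ is Hermitian for every $x\in\Omega$, then also $\{S^\Omega_{\mathbf n}\}_n\sim_\lambda k$.
   Context: A set is Peano–Jordan measurable iff its boundary has Lebesgue measure zero. $\Omega^\circ$ is the interior of $\Omega$ (in $\mathbb R^2$). $\mu$ is Lebesgue measure. $P_1$ matrices. Let $h=1/(n+1)$ and $\Xi_n=\{(ih,jh):0\le i,j\le n+1\}$. With $e_1=(1,0)$, $e_2=(0,1)$, for $p\in\Xi_n$ let $T_{1,p},\dots,T_{6,p}$ be the closed triangles with vertex $p$ and other two vertices, respectively, $\{p+he_1,p+he_2\}$, $\{p+he_1,p+h(e_1-e_2)\}$, $\{p+h(e_1-e_2),p-he_2\}$, $\{p-he_2,p-he_1\}$, $\{p-he_1,p+h(e_2-e_1)\}$, $\{p+h(e_2-e_1),p+he_2\}$, and $T_p=\bigcup_iT_{i,p}$. Let $\Xi_n(\Omega)=\{p\in\Xi_n:T_p\subseteq\Omega\}$. For $p\in\Xi_n(\Omega)$, $\psi_{p,n}$ is the continuous function supported on $T_p$, linear on each $T_{i,p}$, equal to $1$ at $p$ and $0$ at all other points of $\Xi_n$. The matrix $S^\Omega_{\mathbf n}$ (here $\mathbf n=(n,n)$) has size $|\Xi_n(\Omega)|$, rows and columns indexed by $q,p\in\Xi_n(\Omega)$ in lexicographic order, and entries $$(S^\Omega_{\mathbf n})_{q,p}=\int_{\Omega^\circ}(\nabla\psi_{p,n})^TA\nabla\psi_{q,n}+(\nabla\psi_{p,n})^T\mathbf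 b\,\psi_{q,n}+c\,\psi_{p,n}\psi_{q,n}.$$ Symbols. For a sequence $\{A_n\}_n$ of square matrices of size $d_n\to\infty$ and a measurable $f:D\to\mathbb C$ with $D\subset\mathbb R^q$ measurable, $0<\mu(D)<\infty$: $\{A_n\}_n\sim_\sigma f$ means $\lim_n\frac1{d_n}\sum_{i=1}^{d_n}F(\sigma_i(A_n))=\frac1{\mu(D)}\int_DF(|f|)$ for all $F\in C_c(\mathbb R)$ ($\sigma_i$ singular values); $\{A_n\}_n\sim_\lambda f$ means $\lim_n\frac1{d_n}\sum_iF(\lambda_i(A_n))=\frac1{\mu(D)}\int_DF(f)$ for all $F\in C_c(\mathbb C)$ ($\lambda_i$ eigenvalues). *)

theory Defs
  imports
    "Jordan_Normal_Form.Schur_Decomposition"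
    "HOL-Analysis.Analysis"
begin

no_notation Matrix.vec_index (infixl \<open>$\<close> 100)
no_notation Matrix.scalar_prod (infix \<open>\<bullet>\<close> 70)

section \<open>Spectral and singular value symbols\<close>

definition eigenvalues :: "complex mat \<Rightarrow> complex multiset" where
  "eigenvalues M = proots (char_poly M)"

text \<open>The eigenvalues of \<open>M\<^sup>* M\<close> are real and nonnegative, so \<^const>\<open>Re\<close> only changes the type.\<close>

definition singular_values :: "complex mat \<Rightarrow> real multiset" where
  "singular_values M = image_mset (\<lambda>z. sqrt (Re z)) (eigenvalues (mat_adjoint M * M))"

definition compactly_supported :: "('a::topological_space \<Rightarrow> complex) \<Rightarrow> bool" where
  "compactly_supported F \<longleftrightarrow> continuous_on UNIV F \<and> compact (closure {x. F x \<noteq> 0})"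

text \<open>
  The conditions under which the two asymptotic relations below are meaningful. A function with
  domain \<open>D\<close> is represented by a total function together with the set \<open>D\<close>.
\<close>

definition symbol_setting ::
    "(nat \<Rightarrow> complex mat) \<Rightarrow> ('a::euclidean_space \<Rightarrow> complex) \<Rightarrow> 'a set \<Rightarrow> bool" where
  "symbol_setting M f D \<longleftrightarrow>
     (\<forall>n. square_mat (M n)) \<and>
     filterlim (\<lambda>n. dim_row (M n)) at_top sequentially \<and>
     D \<in> sets lebesgue \<and> 0 < emeasure lebesgue D \<and> emeasure lebesgue D < \<infinity> \<and>
     f \<in> borel_measurable (lebesgue_on D)"

definition sv_distributed ::
    "(nat \<Rightarrow> complex mat) \<Rightarrow> ('a::euclidean_space \<Rightarrow> complex) \<Rightarrow> 'a set \<Rightarrow> bool" where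
  "sv_distributed M f D \<longleftrightarrow> symbol_setting M f D \<and>
     (\<forall>F :: real \<Rightarrow> complex. compactly_supported F \<longrightarrow>
        (\<lambda>n. (\<Sum>s\<in>#singular_values (M n). F s) / of_nat (dim_row (M n)))
          \<longlonglongrightarrow> (LINT x:D|lebesgue. F (cmod (f x))) / of_real (measure lebesgue D))"

definition ev_distributed ::
    "(nat \<Rightarrow> complex mat) \<Rightarrow> ('a::euclidean_space \<Rightarrow> complex) \<Rightarrow> 'a set \<Rightarrow> bool" where
  "ev_distributed M f D \<longleftrightarrow> symbol_setting M f D \<and>
     (\<forall>F :: complex \<Rightarrow> complex. compactly_supported F \<longrightarrow>
        (\<lambda>n. (\<Sum>z\<in>#eigenvalues (M n). F z) / of_nat (dim_row (M n)))
          \<longlonglongrightarrow> (LINT x:D|lebesgue. F (f x)) / of_real (measure lebesgue D))"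


section \<open>The \<open>P\<^sub>1\<close> matrices\<close>

definition peano_jordan_measurable :: "(real^2) set \<Rightarrow> bool" where
  "peano_jordan_measurable S \<longleftrightarrow> frontier S \<in> null_sets lebesgue"

definition mesh :: "nat \<Rightarrow> real" where
  "mesh n = 1 / (real n + 1)"

definition grid_point :: "nat \<Rightarrow> nat \<times> nat \<Rightarrow> real^2" where
  "grid_point n = (\<lambda>(i, j). vector [real i * mesh n, real j * mesh n])"

text \<open>\<^const>\<open>List.product\<close> enumerates the index pairs in lexicographic order.\<close>

definition grid :: "nat \<Rightarrow> (real^2) list" where
  "grid n = map (grid_point n) (List.product [0..<n+2] [0..<n+2])"

definition triangles :: "nat \<Rightarrow> real^2 \<Rightarrow> (real^2) set set" where
  "triangles n p = (let h = mesh n; e1 = axis 1 1; e2 = axis 2 1 in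
     {convex hull {p, p + h *\<^sub>R e1, p + h *\<^sub>R e2},
      convex hull {p, p + h *\<^sub>R e1, p + h *\<^sub>R (e1 - e2)},
      convex hull {p, p + h *\<^sub>R (e1 - e2), p - h *\<^sub>R e2},
      convex hull {p, p - h *\<^sub>R e2, p - h *\<^sub>R e1},
      convex hull {p, p - h *\<^sub>R e1, p + h *\<^sub>R (e2 - e1)},
      convex hull {p, p + h *\<^sub>R (e2 - e1), p + h *\<^sub>R e2}})"

definition patch :: "nat \<Rightarrow> real^2 \<Rightarrow> (real^2) set" where
  "patch n p = \<Union> (triangles n p)"

definition grid_in :: "nat \<Rightarrow> (real^2) set \<Rightarrow> (real^2) list" where
  "grid_in n \<Omega> = filter (\<lambda>p. patch n p \<subseteq> \<Omega>) (grid n)"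

definition is_hat :: "nat \<Rightarrow> real^2 \<Rightarrow> (real^2 \<Rightarrow> real) \<Rightarrow> bool" where
  "is_hat n p \<psi> \<longleftrightarrow>
     continuous_on UNIV \<psi> \<and>
     (\<forall>x. x \<notin> patch n p \<longrightarrow> \<psi> x = 0) \<and>
     (\<forall>T\<in>triangles n p. \<exists>a d. \<forall>x\<in>T. \<psi> x = a \<bullet> x + d) \<and>
     \<psi> p = 1 \<and> (\<forall>q\<in>set (grid n) - {p}. \<psi> q = 0)"

text \<open>
  Determined by \<^const>\<open>is_hat\<close> whenever the patch of \<open>p\<close> lies in the unit square
  (see \<open>ex1_is_hat\<close> below), hence for all \<open>p\<close> in \<open>grid_in n \<Omega>\<close> if \<open>\<Omega>\<close> does.
\<close>

definition hat :: "nat \<Rightarrow> real^2 \<Rightarrow> real^2 \<Rightarrow> real" where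
  "hat n p = (THE \<psi>. is_hat n p \<psi>)"

text \<open>
  Pointwise gradient, with complex entries. It is unspecified where \<open>\<psi>\<close> is not differentiable;
  for a hat function this is a null set (the edges of the triangles).
\<close>

definition grad :: "(real^2 \<Rightarrow> real) \<Rightarrow> real^2 \<Rightarrow> complex^2" where
  "grad \<psi> x = (\<chi> i. of_real (frechet_derivative \<psi> (at x) (axis i 1)))"

text \<open>\<^const>\<open>scalar_product\<close> is bilinear: \<open>u\<^sup>T v\<close> without complex conjugation.\<close>

definition P1_matrix :: "(real^2) set \<Rightarrow> (real^2 \<Rightarrow> complex^2^2) \<Rightarrow> (real^2 \<Rightarrow> complex^2) \<Rightarrow>
    (real^2 \<Rightarrow> complex) \<Rightarrow> nat \<Rightarrow> complex mat" where
  "P1_matrix \<Omega> A b c n = (let ps = grid_in n \<Omega> in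
     Matrix.mat (length ps) (length ps) (\<lambda>(r, s). let q = ps ! r; p = ps ! s in
       (LINT x:interior \<Omega>|lebesgue.
          scalar_product (grad (hat n p) x) (A x *v grad (hat n q) x)
          + scalar_product (grad (hat n p) x) (b x) * of_real (hat n q x)
          + c x * of_real (hat n p x) * of_real (hat n q x))))"


section \<open>The symbol\<close>

definition zero_extension :: "'a set \<Rightarrow> ('a \<Rightarrow> 'b::zero) \<Rightarrow> 'a \<Rightarrow> 'b" where
  "zero_extension S f x = (if x \<in> S then f x else 0)"

definition P1_symbol ::
    "(real^2) set \<Rightarrow> (real^2 \<Rightarrow> complex^2^2) \<Rightarrow> (real^2) \<times> (real^2) \<Rightarrow> complex" where
  "P1_symbol \<Omega> A = (\<lambda>(x, \<theta>).
     let \<beta> = (\<lambda>u v. scalar_product u (zero_extension \<Omega> A x *v v));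
         B1 = vector [1, 1]; B2 = vector [1, 0]; B3 = vector [0, 1];
         r00 = \<beta> B1 B1 + \<beta> B2 B2 + \<beta> B3 B3;
         r01 = - (1/2) * \<beta> B3 B1 - (1/2) * \<beta> B1 B3;
         r11 = (1/2) * \<beta> B2 B3 + (1/2) * \<beta> B3 B2;
         r10 = - (1/2) * \<beta> B1 B2 - (1/2) * \<beta> B2 B1;
         t1 = complex_of_real (\<theta> $ 1); t2 = complex_of_real (\<theta> $ 2)
     in r00 + r01 * exp (- \<i> * t2) + r10 * exp (- \<i> * t1)
        + r10 * exp (\<i> * t1) + r01 * exp (\<i> * t2)
        + r11 * exp (- \<i> * t1 + \<i> * t2) + r11 * exp (\<i> * t1 - \<i> * t2))"

definition symbol_domain :: "(real^2) set \<Rightarrow> ((real^2) \<times> (real^2)) set" where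
  "symbol_domain \<Omega> = interior \<Omega> \<times> cbox (vector [-pi, -pi]) (vector [pi, pi])"


section \<open>Existence and uniqueness of the hat functions\<close>

lemma mesh_pos: "mesh n > 0"
  by (simp add: mesh_def add_pos_nonneg)

lemma set_grid: "set (grid n) = {grid_point n (i, j) |i j. i < n + 2 \<and> j < n + 2}"
  unfolding grid_def set_map set_product set_upt image_def Bex_def mem_Sigma_iff
    atLeastLessThan_iff split_paired_Ex by blast

lemma grid_iff:
  "q \<in> set (grid n) \<longleftrightarrow>
     (\<exists>i j. i \<le> n + 1 \<and> j \<le> n + 1 \<and> q $ 1 = real i * mesh n \<and> q $ 2 = real j * mesh n)"
proof
  assume "q \<in> set (grid n)"
  then show "\<exists>i j. i \<le> n + 1 \<and> j \<le> n + 1 \<and> q $ 1 = real i * mesh n \<and> q $ 2 = real j * mesh n"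
  proof -
    obtain i j where "i < n + 2" "j < n + 2" "q = grid_point n (i, j)"
      using \<open>q \<in> set (grid n)\<close> unfolding set_grid by blast
    then show ?thesis
      by (intro exI[of _ i] exI[of _ j]) (simp add: grid_point_def)
  qed
next
  assume "\<exists>i j. i \<le> n + 1 \<and> j \<le> n + 1 \<and> q $ 1 = real i * mesh n \<and> q $ 2 = real j * mesh n"
  then obtain i j where ij: "i \<le> n + 1" "j \<le> n + 1" "q $ 1 = real i * mesh n" "q $ 2 = real j * mesh n"
    by blast
  then have "q = grid_point n (i, j)"
    by (simp add: vec_eq_iff forall_2 grid_point_def)
  with ij show "q \<in> set (grid n)"
    unfolding set_grid by (intro CollectI exI[of _ i] exI[of _ j]) simp
qed

lemma shifted_grid:
  fixes k l :: int
  assumes p: "p \<in> set (grid n)" and q: "q \<in> cbox 0 1"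
    and q1: "q $ 1 = p $ 1 + mesh n * of_int k" and q2: "q $ 2 = p $ 2 + mesh n * of_int l"
  shows "q \<in> set (grid n)"
proof -
  have range: "\<exists>i'. i' \<le> n + 1 \<and> real i * mesh n + mesh n * of_int m = real i' * mesh n"
    if "0 \<le> real i * mesh n + mesh n * of_int m" "real i * mesh n + mesh n * of_int m \<le> 1" for i m
  proof -
    have eq: "real i * mesh n + mesh n * of_int m = of_int (int i + m) * mesh n"
      by (simp add: algebra_simps)
    have "(real_of_int (int i + m)) \<ge> 0"
      using that(1) mesh_pos[of n] unfolding eq by (simp add: zero_le_mult_iff)
    then have nn: "int i + m \<ge> 0" by linarith
    have "real_of_int (int i + m) \<le> real n + 1"
      using that(2) unfolding eq by (simp add: mesh_def field_simps)
    then have "int i + m \<le> int n + 1" by linarith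
    then show ?thesis
      using nn unfolding eq by (intro exI[of _ "nat (int i + m)"]) auto
  qed
  obtain i j where ij: "p $ 1 = real i * mesh n" "p $ 2 = real j * mesh n"
    using p unfolding grid_iff by blast
  have b: "0 \<le> q $ 1" "q $ 1 \<le> 1" "0 \<le> q $ 2" "q $ 2 \<le> 1"
    using q by (auto simp: mem_box_cart)
  obtain i' where "i' \<le> n + 1" "q $ 1 = real i' * mesh n"
    using range[of i k] b unfolding q1 ij by auto
  moreover obtain j' where "j' \<le> n + 1" "q $ 2 = real j' * mesh n"
    using range[of j l] b unfolding q2 ij by auto
  ultimately show ?thesis unfolding grid_iff by blast
qed

lemma triangle_iff:
  fixes p d e x :: "real^2"
  assumes "h > 0"
  shows "x \<in> convex hull {p, p + h *\<^sub>R d, p + h *\<^sub>R e} \<longleftrightarrow>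
    (\<exists>s t. 0 \<le> s \<and> 0 \<le> t \<and> s + t \<le> 1 \<and>
       (x $ 1 - p $ 1) / h = s * d $ 1 + t * e $ 1 \<and> (x $ 2 - p $ 2) / h = s * d $ 2 + t * e $ 2)"
proof
  assume "x \<in> convex hull {p, p + h *\<^sub>R d, p + h *\<^sub>R e}"
  then obtain r s t where rst: "0 \<le> r" "0 \<le> s" "0 \<le> t" "r + s + t = 1"
    "x = r *\<^sub>R p + s *\<^sub>R (p + h *\<^sub>R d) + t *\<^sub>R (p + h *\<^sub>R e)"
    unfolding convex_hull_3 by blast
  have r: "r = 1 - s - t" using rst by simp
  show "\<exists>s t. 0 \<le> s \<and> 0 \<le> t \<and> s + t \<le> 1 \<and>
       (x $ 1 - p $ 1) / h = s * d $ 1 + t * e $ 1 \<and> (x $ 2 - p $ 2) / h = s * d $ 2 + t * e $ 2"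
    using rst(1-4) assms by (intro exI[of _ s] exI[of _ t]) (auto simp: rst(5) r field_simps)
next
  assume "\<exists>s t. 0 \<le> s \<and> 0 \<le> t \<and> s + t \<le> 1 \<and>
       (x $ 1 - p $ 1) / h = s * d $ 1 + t * e $ 1 \<and> (x $ 2 - p $ 2) / h = s * d $ 2 + t * e $ 2"
  then obtain s t where st: "0 \<le> s" "0 \<le> t" "s + t \<le> 1"
    "(x $ 1 - p $ 1) / h = s * d $ 1 + t * e $ 1" "(x $ 2 - p $ 2) / h = s * d $ 2 + t * e $ 2"
    by blast
  have "x = (1 - s - t) *\<^sub>R p + s *\<^sub>R (p + h *\<^sub>R d) + t *\<^sub>R (p + h *\<^sub>R e)"
    using st(4,5) assms by (simp add: vec_eq_iff forall_2 field_simps)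
  then show "x \<in> convex hull {p, p + h *\<^sub>R d, p + h *\<^sub>R e}"
    unfolding convex_hull_3 using st
    by (intro CollectI exI[of _ "1 - s - t"] exI[of _ s] exI[of _ t]) auto
qed

lemma triangles_offsets:
  "triangles n p = (\<lambda>(d, e). convex hull {p, p + mesh n *\<^sub>R d, p + mesh n *\<^sub>R e}) `
     {(axis 1 1, axis 2 1), (axis 1 1, axis 1 1 - axis 2 1), (axis 1 1 - axis 2 1, - axis 2 1),
      (- axis 2 1, - axis 1 1), (- axis 1 1, axis 2 1 - axis 1 1), (axis 2 1 - axis 1 1, axis 2 1)}"
  by (simp add: triangles_def Let_def)

lemma hat_unique:
  assumes p: "p \<in> set (grid n)" "patch n p \<subseteq> cbox 0 1"
    and \<psi>: "is_hat n p \<psi>" and \<eta>: "is_hat n p \<eta>"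
  shows "\<psi> = \<eta>"
proof
  fix x
  show "\<psi> x = \<eta> x"
  proof (cases "x \<in> patch n p")
    case False
    then show ?thesis using \<psi> \<eta> unfolding is_hat_def by simp
  next
    case True
    then obtain T where T: "T \<in> triangles n p" "x \<in> T" unfolding patch_def by blast
    then obtain a a' where Ta: "T = convex hull {p, a, a'}"
      and av: "a \<in> set (grid n) - {p}" "a' \<in> set (grid n) - {p}"
    proof -
      obtain d e where de: "T = convex hull {p, p + mesh n *\<^sub>R d, p + mesh n *\<^sub>R e}"
        "(d, e) \<in> {(axis 1 1, axis 2 1), (axis 1 1, axis 1 1 - axis 2 1), (axis 1 1 - axis 2 1, - axis 2 1),
          (- axis 2 1, - axis 1 1), (- axis 1 1, axis 2 1 - axis 1 1), (axis 2 1 - axis 1 1, axis 2 1)}"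
        using T(1) unfolding triangles_offsets by blast
      have *: "v \<in> set (grid n) - {p}"
        if "v \<in> T" and v: "v = p + mesh n *\<^sub>R w"
          and w: "w \<in> {axis 1 1, axis 2 1, axis 1 1 - axis 2 1, - axis 2 1, - axis 1 1, axis 2 1 - axis 1 1}"
        for v w
      proof -
        have cb: "v \<in> cbox 0 1" using that(1) T(1) p(2) unfolding patch_def by blast
        have nz: "w \<noteq> 0" using w by (auto simp: vec_eq_iff forall_2 axis_def)
        obtain k l where "w $ 1 = of_int k" "w $ 2 = of_int l"
        proof -
          have "w $ 1 \<in> \<int>" "w $ 2 \<in> \<int>" using w by (auto simp: axis_def)
          then show ?thesis using that by (auto elim!: Ints_cases)
        qed
        then have "v \<in> set (grid n)"
          using shifted_grid[OF p(1) cb, of k l] by (simp add: v)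
        then show ?thesis using nz mesh_pos[of n] by (simp add: v)
      qed
      show ?thesis
      proof (rule that[OF de(1)])
        have "p + mesh n *\<^sub>R d \<in> T" "p + mesh n *\<^sub>R e \<in> T"
          unfolding de(1) by (auto intro: hull_inc)
        moreover have "d \<in> {axis 1 1, axis 2 1, axis 1 1 - axis 2 1, - axis 2 1, - axis 1 1, axis 2 1 - axis 1 1}"
            "e \<in> {axis 1 1, axis 2 1, axis 1 1 - axis 2 1, - axis 2 1, - axis 1 1, axis 2 1 - axis 1 1}"
          using de(2) by blast+
        ultimately show "p + mesh n *\<^sub>R d \<in> set (grid n) - {p}" "p + mesh n *\<^sub>R e \<in> set (grid n) - {p}"
          using * by blast+
      qed
    qed
    obtain r s t where rst: "r + s + t = 1" "x = r *\<^sub>R p + s *\<^sub>R a + t *\<^sub>R a'"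
      using T(2) unfolding Ta convex_hull_3 by blast
    have val: "\<phi> x = r" if hat: "is_hat n p \<phi>" for \<phi>
    proof -
      obtain g k where g: "\<forall>x\<in>T. \<phi> x = g \<bullet> x + k"
        using hat T(1) unfolding is_hat_def by blast
      have "p \<in> T" "a \<in> T" "a' \<in> T" unfolding Ta by (auto intro: hull_inc)
      then have vals: "g \<bullet> p + k = 1" "g \<bullet> a + k = 0" "g \<bullet> a' + k = 0"
        using g av hat unfolding is_hat_def by auto
      have "\<phi> x = g \<bullet> x + (r + s + t) * k" using g T(2) rst(1) by simp
      also have "\<dots> = r * (g \<bullet> p + k) + s * (g \<bullet> a + k) + t * (g \<bullet> a' + k)"
        unfolding rst(2) by (simp add: inner_add_right algebra_simps)
      finally show ?thesis using vals by simp
    qed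
    show ?thesis using val[OF \<psi>] val[OF \<eta>] by simp
  qed
qed

lemma triangles_coords:
  fixes p :: "real^2" and n :: nat
  defines "U \<equiv> \<lambda>x. (x $ 1 - p $ 1) / mesh n" and "V \<equiv> \<lambda>x. (x $ 2 - p $ 2) / mesh n"
  shows "triangles n p =
    {{x. 0 \<le> U x \<and> 0 \<le> V x \<and> U x + V x \<le> 1}, {x. V x \<le> 0 \<and> 0 \<le> U x + V x \<and> U x \<le> 1},
     {x. 0 \<le> U x \<and> U x + V x \<le> 0 \<and> -1 \<le> V x}, {x. U x \<le> 0 \<and> V x \<le> 0 \<and> -1 \<le> U x + V x},
     {x. 0 \<le> V x \<and> U x + V x \<le> 0 \<and> -1 \<le> U x}, {x. U x \<le> 0 \<and> 0 \<le> U x + V x \<and> V x \<le> 1}}"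
proof -
  define T where "T = (\<lambda>d e. convex hull {p, p + mesh n *\<^sub>R d, p + mesh n *\<^sub>R e})"
  have T: "x \<in> T d e \<longleftrightarrow> (\<exists>s t. 0 \<le> s \<and> 0 \<le> t \<and> s + t \<le> 1 \<and>
      U x = s * d $ 1 + t * e $ 1 \<and> V x = s * d $ 2 + t * e $ 2)" for x d e
    unfolding T_def U_def V_def by (rule triangle_iff[OF mesh_pos])
  have 1: "T (axis 1 1) (axis 2 1) = {x. 0 \<le> U x \<and> 0 \<le> V x \<and> U x + V x \<le> 1}"
    by (auto simp: T axis_def)
  have 2: "T (axis 1 1) (axis 1 1 - axis 2 1) = {x. V x \<le> 0 \<and> 0 \<le> U x + V x \<and> U x \<le> 1}"
  proof (intro Set.set_eqI iffI)
    fix x assume "x \<in> {x. V x \<le> 0 \<and> 0 \<le> U x + V x \<and> U x \<le> 1}"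
    then show "x \<in> T (axis 1 1) (axis 1 1 - axis 2 1)"
      unfolding T by (intro exI[of _ "U x + V x"] exI[of _ "- V x"]) (auto simp: axis_def)
  qed (auto simp: T axis_def)
  have 3: "T (axis 1 1 - axis 2 1) (- axis 2 1) = {x. 0 \<le> U x \<and> U x + V x \<le> 0 \<and> -1 \<le> V x}"
  proof (intro Set.set_eqI iffI)
    fix x assume "x \<in> {x. 0 \<le> U x \<and> U x + V x \<le> 0 \<and> -1 \<le> V x}"
    then show "x \<in> T (axis 1 1 - axis 2 1) (- axis 2 1)"
      unfolding T by (intro exI[of _ "U x"] exI[of _ "- U x - V x"]) (auto simp: axis_def)
  qed (auto simp: T axis_def)
  have 4: "T (- axis 2 1) (- axis 1 1) = {x. U x \<le> 0 \<and> V x \<le> 0 \<and> -1 \<le> U x + V x}"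
  proof (intro Set.set_eqI iffI)
    fix x assume "x \<in> {x. U x \<le> 0 \<and> V x \<le> 0 \<and> -1 \<le> U x + V x}"
    then show "x \<in> T (- axis 2 1) (- axis 1 1)"
      unfolding T by (intro exI[of _ "- V x"] exI[of _ "- U x"]) (auto simp: axis_def)
  qed (auto simp: T axis_def)
  have 5: "T (- axis 1 1) (axis 2 1 - axis 1 1) = {x. 0 \<le> V x \<and> U x + V x \<le> 0 \<and> -1 \<le> U x}"
  proof (intro Set.set_eqI iffI)
    fix x assume "x \<in> {x. 0 \<le> V x \<and> U x + V x \<le> 0 \<and> -1 \<le> U x}"
    then show "x \<in> T (- axis 1 1) (axis 2 1 - axis 1 1)"
      unfolding T by (intro exI[of _ "- U x - V x"] exI[of _ "V x"]) (auto simp: axis_def)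
  qed (auto simp: T axis_def)
  have 6: "T (axis 2 1 - axis 1 1) (axis 2 1) = {x. U x \<le> 0 \<and> 0 \<le> U x + V x \<and> V x \<le> 1}"
  proof (intro Set.set_eqI iffI)
    fix x assume "x \<in> {x. U x \<le> 0 \<and> 0 \<le> U x + V x \<and> V x \<le> 1}"
    then show "x \<in> T (axis 2 1 - axis 1 1) (axis 2 1)"
      unfolding T by (intro exI[of _ "- U x"] exI[of _ "U x + V x"]) (auto simp: axis_def)
  qed (auto simp: T axis_def)
  show ?thesis
    unfolding triangles_offsets T_def[symmetric] image_insert image_empty prod.case 1 2 3 4 5 6
    by (rule refl)
qed

lemma is_hat_formula:
  assumes p: "p \<in> set (grid n)"
  defines "U \<equiv> \<lambda>x. (x $ 1 - p $ 1) / mesh n" and "V \<equiv> \<lambda>x. (x $ 2 - p $ 2) / mesh n"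
  shows "is_hat n p (\<lambda>x. max 0 (1 - max \<bar>U x\<bar> (max \<bar>V x\<bar> \<bar>U x + V x\<bar>)))"
    (is "is_hat n p ?\<phi>")
proof -
  have tri: "triangles n p =
    {{x. 0 \<le> U x \<and> 0 \<le> V x \<and> U x + V x \<le> 1}, {x. V x \<le> 0 \<and> 0 \<le> U x + V x \<and> U x \<le> 1},
     {x. 0 \<le> U x \<and> U x + V x \<le> 0 \<and> -1 \<le> V x}, {x. U x \<le> 0 \<and> V x \<le> 0 \<and> -1 \<le> U x + V x},
     {x. 0 \<le> V x \<and> U x + V x \<le> 0 \<and> -1 \<le> U x}, {x. U x \<le> 0 \<and> 0 \<le> U x + V x \<and> V x \<le> 1}}"
    unfolding U_def V_def by (rule triangles_coords)
  have affine: "\<exists>g d. \<forall>x. k + l * U x + m * V x = g \<bullet> x + d" for k l m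
  proof (intro exI allI)
    fix x :: "real^2"
    show "k + l * U x + m * V x = (vector [l / mesh n, m / mesh n] :: real^2) \<bullet> x
        + (k - (l * p $ 1 + m * p $ 2) / mesh n)"
      using mesh_pos[of n] by (simp add: U_def V_def inner_vec_def sum_2 field_simps)
  qed
  have ball_affine: "\<exists>g d. \<forall>x\<in>T. ?\<phi> x = g \<bullet> x + d"
    if "\<And>x. x \<in> T \<Longrightarrow> ?\<phi> x = k + l * U x + m * V x" for T k l m
    using affine[of k l m] that by metis
  have aff: "\<exists>g d. \<forall>x\<in>T. ?\<phi> x = g \<bullet> x + d" if "T \<in> triangles n p" for T
    using that unfolding tri
  proof (elim insertE emptyE)
    assume "T = {x. 0 \<le> U x \<and> 0 \<le> V x \<and> U x + V x \<le> 1}"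
    then show ?thesis by (intro ball_affine[of T 1 "-1" "-1"]) auto
  next
    assume "T = {x. V x \<le> 0 \<and> 0 \<le> U x + V x \<and> U x \<le> 1}"
    then show ?thesis by (intro ball_affine[of T 1 "-1" 0]) auto
  next
    assume "T = {x. 0 \<le> U x \<and> U x + V x \<le> 0 \<and> -1 \<le> V x}"
    then show ?thesis by (intro ball_affine[of T 1 0 1]) auto
  next
    assume "T = {x. U x \<le> 0 \<and> V x \<le> 0 \<and> -1 \<le> U x + V x}"
    then show ?thesis by (intro ball_affine[of T 1 1 1]) auto
  next
    assume "T = {x. 0 \<le> V x \<and> U x + V x \<le> 0 \<and> -1 \<le> U x}"
    then show ?thesis by (intro ball_affine[of T 1 1 0]) auto
  next
    assume "T = {x. U x \<le> 0 \<and> 0 \<le> U x + V x \<and> V x \<le> 1}"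
    then show ?thesis by (intro ball_affine[of T 1 0 "-1"]) auto
  qed
  have "\<bar>U x\<bar> > 1 \<or> \<bar>V x\<bar> > 1 \<or> \<bar>U x + V x\<bar> > 1" if "x \<notin> patch n p" for x
    using that unfolding patch_def tri by (simp, linarith)
  then have supp: "?\<phi> x = 0" if "x \<notin> patch n p" for x
    using that by fastforce
  have nodes: "?\<phi> q = 0" if q: "q \<in> set (grid n) - {p}" for q
  proof -
    obtain i j where ij: "p $ 1 = real i * mesh n" "p $ 2 = real j * mesh n"
      using p unfolding grid_iff by blast
    obtain i' j' where ij': "q $ 1 = real i' * mesh n" "q $ 2 = real j' * mesh n"
      using q unfolding grid_iff Diff_iff by blast
    have "U q = real i' - real i" "V q = real j' - real j"
      using mesh_pos[of n] by (auto simp: U_def V_def ij ij' field_simps)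
    moreover have "i' \<noteq> i \<or> j' \<noteq> j"
      using q ij ij' by (auto simp: vec_eq_iff forall_2)
    ultimately have "\<bar>U q\<bar> \<ge> 1 \<or> \<bar>V q\<bar> \<ge> 1" by linarith
    then show ?thesis by linarith
  qed
  have "U p = 0" "V p = 0" by (simp_all add: U_def V_def)
  moreover have "continuous_on UNIV ?\<phi>"
    unfolding U_def V_def using mesh_pos[of n] by (intro continuous_intros) auto
  ultimately show ?thesis
    unfolding is_hat_def using aff supp nodes by simp
qed

lemma ex1_is_hat:
  assumes "p \<in> set (grid n)" "patch n p \<subseteq> cbox 0 1"
  shows "\<exists>!\<psi>. is_hat n p \<psi>"
  using is_hat_formula[OF assms(1)] hat_unique[OF assms] by blast

end

theory Submission
  imports Defs
begin

text \<open>
  Everything is tested against the functions \<open>1 / (\<bar>k - t\<bar>\<^sup>2 + s)\<close> with \<open>t\<close> real and \<open>s\<close> in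
  \<open>[1, 2)\<close>. On the matrix side these are the resolvent traces \<open>tr ((M - t)\<^sup>* (M - t) + s)\<^sup>-\<^sup>1\<close>, which
  are Lipschitz in the entrywise \<open>\<ell>\<^sup>1\<close> distance of matrices; linear combinations of the functions
  with different \<open>s\<close> and \<open>t\<close> reach every continuous function of compact support.

  For a continuous \<open>A\<close> and \<open>b = 0\<close>, \<open>c = 0\<close>, the wave packets \<open>v(p) = w(p - y) exp(\<i> \<theta>\<cdot>p/h)\<close>
  with a narrow window \<open>w\<close> are approximate eigenvectors of \<open>S\<close> and of \<open>S\<^sup>*\<close> for \<open>k(y, \<theta>)\<close> and its
  conjugate, up to the few grid points near the boundary of \<open>\<Omega>\<close>, hence approximate eigenvectors of the
  resolvent. Integrating \<open><v, R v>\<close> over \<open>\<theta>\<close> and \<open>y\<close> gives the trace of the resolvent \<open>R\<close> on one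
  side and \<open>\<integral>\<integral> 1 / (\<bar>k - t\<bar>\<^sup>2 + s)\<close> on the other, the Riemann sums converging because the boundary is a
  null set. The Lipschitz bound extends this to \<open>L\<^sup>1\<close> coefficients, an \<open>L\<^sup>1\<close> perturbation of \<open>A\<close>
  contributing \<open>O(h\<^sup>-\<^sup>2)\<close> times its norm to the entrywise distance.

  If \<open>A\<close> is Hermitian, only \<open>b\<close> and \<open>c\<close> contribute to \<open>S - S\<^sup>*\<close>, and its squared Frobenius norm
  is \<open>o(h\<^sup>-\<^sup>2)\<close>. By a Schur triangularization the imaginary parts of the eigenvalues are then
  negligible, and the real parts have the same limits of resolvent sums as the resolvent traces.
\<close>

section \<open>Schur triangularization\<close>

text \<open>As \<open>A\<close> is merely integrable, the matrices have no uniform norm bound, and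
  moments of the spectrum are out of reach. The inverse \<open>R\<close> of
  \<open>M\<^sup>* M + s\<close> with \<open>s \<ge> 1\<close> avoids this: \<open>R\<close> and
  \<open>M R\<close> are contractions whatever \<open>M\<close> is, so every estimate is uniform in
  the size and the entries of the matrix. Gradients of hats are of size 1/h on triangles of area
  h^2/2, so for bounded \<open>A\<close> the entries are of order one and no rescaling occurs;
  relative to the dimension, of order h^-2, the entrywise norms of the parts from \<open>b\<close>
  and \<open>c\<close> are O(h) and O(h^2) and leave no trace in the limit. Eigenvalues of
  non-normal matrices are not stable under perturbations that are small in this sense, hence the
  detour over the Hermitian defect in the Frobenius norm. Since \<open>b\<close> is only integrable,
  the smallness of that norm comes from playing the maximum of the entries against their sum. The
  shift \<open>t\<close> restores the sign that the modulus of a real symbol forgets.\<close>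

lemma mat_adjoint_dim [simp]:
  "dim_row (mat_adjoint M) = dim_col M" "dim_col (mat_adjoint M) = dim_row M"
  by (simp_all add: mat_adjoint_def)

lemma mat_adjoint_index [simp]:
  "i < dim_col M \<Longrightarrow> j < dim_row M \<Longrightarrow> mat_adjoint M $$ (i, j) = conjugate (M $$ (j, i))"
  by (simp add: mat_adjoint_def mat_of_rows_index)

lemma mat_adjoint_carrier [simp]:
  "M \<in> carrier_mat m n \<Longrightarrow> mat_adjoint M \<in> carrier_mat n m"
  by (metis carrier_matD(1) carrier_matD(2) carrier_matI mat_adjoint_dim)

lemma mat_mult_entry:
  assumes "A \<in> carrier_mat l m" "B \<in> carrier_mat m n" "i < l" "j < n"
  shows "(A * B) $$ (i, j) = (\<Sum>k<m. A $$ (i, k) * B $$ (k, j))"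
  using assms by (auto simp: scalar_prod_def atLeast0LessThan intro!: sum.cong)

lemma mat_adjoint_mult:
  fixes A B :: "complex mat"
  assumes "A \<in> carrier_mat l m" "B \<in> carrier_mat m n"
  shows "mat_adjoint (A * B) = mat_adjoint B * mat_adjoint A"
proof (rule eq_matI)
  fix i j assume "i < dim_row (mat_adjoint B * mat_adjoint A)" "j < dim_col (mat_adjoint B * mat_adjoint A)"
  then have ij: "i < n" "j < l" using assms by auto
  have c: "mat_adjoint B \<in> carrier_mat n m" "mat_adjoint A \<in> carrier_mat m l" using assms by auto
  have "mat_adjoint (A * B) $$ (i, j) = cnj ((A * B) $$ (j, i))" using assms ij by simp
  also have "\<dots> = (\<Sum>k<m. cnj (A $$ (j, k)) * cnj (B $$ (k, i)))"
    unfolding mat_mult_entry[OF assms ij(2,1)] by simp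
  also have "\<dots> = (\<Sum>k<m. mat_adjoint B $$ (i, k) * mat_adjoint A $$ (k, j))"
    using assms ij by (intro sum.cong) auto
  also have "\<dots> = (mat_adjoint B * mat_adjoint A) $$ (i, j)"
    by (rule mat_mult_entry[OF c ij, symmetric])
  finally show "mat_adjoint (A * B) $$ (i, j) = (mat_adjoint B * mat_adjoint A) $$ (i, j)" .
qed (use assms in auto)

lemma complex_cscalar_prod_self:
  fixes w :: "complex Matrix.vec"
  shows "w \<bullet>c w = of_real (\<Sum>i<dim_vec w. (cmod (vec_index w i))\<^sup>2)"
  by (simp add: scalar_prod_def atLeast0LessThan flip: complex_norm_square)

text \<open>Gram-Schmidt applied to a basis that starts with \<open>v\<close> keeps \<open>v\<close>
  as its first vector, so after normalisation the first column is a multiple of \<open>v\<close>.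
  This change of basis splits off one eigenvector in the Schur form.\<close>

lemma exists_unitary_first_col:
  fixes v :: "complex Matrix.vec"
  assumes v: "v \<in> carrier_vec n" "v \<noteq> 0\<^sub>v n"
  obtains U c where "U \<in> carrier_mat n n" "mat_adjoint U * U = 1\<^sub>m n" "col U 0 = c \<cdot>\<^sub>v v" "n \<noteq> 0"
proof -
  interpret cof_vec_space n "TYPE(complex)" .
  have n: "n \<noteq> 0"
  proof
    assume "n = 0"
    then have "v = 0\<^sub>v n" using v(1) by (intro eq_vecI) auto
    with v(2) show False by simp
  qed
  define b where "b = basis_completion v"
  define ws where "ws = gram_schmidt n b"
  have bc: "span (set b) = carrier_vec n" "distinct b" "\<not> lin_dep (set b)" "set b \<subseteq> carrier_vec n"
      "hd b = v" "length b = n"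
    using basis_completion[OF v, folded b_def] by auto
  obtain vs where bv: "b = v # vs" using bc n by (cases b) auto
  have ws: "set ws \<subseteq> carrier_vec n" "corthogonal ws" "length ws = n"
    using gram_schmidt_result[OF bc(4,2,3) refl, folded ws_def] bc by auto
  have hd: "ws ! 0 = v"
    using gram_schmidt_hd[OF v(1), of vs, folded bv] ws(3) n
    unfolding ws_def by (cases "gram_schmidt n b") auto
  have wi: "ws ! i \<in> carrier_vec n" if "i < n" for i using ws that by auto
  define nr where "nr = (\<lambda>w::complex Matrix.vec. sqrt (\<Sum>i<dim_vec w. (cmod (vec_index w i))\<^sup>2))"
  have nr: "w \<bullet>c w = of_real (nr w) * of_real (nr w)" for w
    unfolding complex_cscalar_prod_self nr_def by (simp flip: of_real_mult add: sum_nonneg)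
  define U where "U = Matrix.mat n n (\<lambda>(i, j). vec_index (ws ! j) i / of_real (nr (ws ! j)))"
  have U: "U \<in> carrier_mat n n" by (simp add: U_def)
  have nz: "nr (ws ! i) \<noteq> 0" if "i < n" for i
    using corthogonalD[OF ws(2), of i i] that ws(3) nr[of "ws ! i"] by auto
  have "mat_adjoint U * U = 1\<^sub>m n"
  proof (rule eq_matI)
    fix i j assume "i < dim_row (1\<^sub>m n :: complex mat)" "j < dim_col (1\<^sub>m n :: complex mat)"
    then have ij: "i < n" "j < n" by auto
    have "(mat_adjoint U * U) $$ (i, j) = (\<Sum>k<n. mat_adjoint U $$ (i, k) * U $$ (k, j))"
      by (rule mat_mult_entry[of _ n n _ n]) (use U ij in auto)
    also have "\<dots> = (\<Sum>k<n. vec_index (ws ! j) k * cnj (vec_index (ws ! i) k)) / of_real (nr (ws ! i)) / of_real (nr (ws ! j))"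
      unfolding sum_divide_distrib using ij U by (intro sum.cong) (auto simp: U_def)
    also have "(\<Sum>k<n. vec_index (ws ! j) k * cnj (vec_index (ws ! i) k)) = (ws ! j) \<bullet>c (ws ! i)"
      using wi[OF ij(1)] wi[OF ij(2)] by (auto simp: scalar_prod_def atLeast0LessThan intro!: sum.cong)
    also have "\<dots> / of_real (nr (ws ! i)) / of_real (nr (ws ! j)) = (1\<^sub>m n :: complex mat) $$ (i, j)"
    proof (cases "i = j")
      case True
      then show ?thesis using nr[of "ws ! i"] nz ij by simp
    next
      case False
      then show ?thesis using corthogonalD[OF ws(2), of j i] ij ws(3) by simp
    qed
    finally show "(mat_adjoint U * U) $$ (i, j) = (1\<^sub>m n) $$ (i, j)" .
  qed (use U in auto)
  moreover have "col U 0 = (1 / of_real (nr v)) \<cdot>\<^sub>v v"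
    using n hd v(1) by (intro eq_vecI) (auto simp: U_def)
  ultimately show ?thesis using that U n by blast
qed

lemma unitary_both:
  fixes U :: "complex mat"
  assumes "U \<in> carrier_mat n n" "mat_adjoint U * U = 1\<^sub>m n"
  shows "U * mat_adjoint U = 1\<^sub>m n"
  using assms mat_mult_left_right_inverse[of "mat_adjoint U" n U] by simp

text \<open>Induction over the roots: a unitary matrix whose first column is an eigenvector clears
  the first column below the diagonal, and the lower right block carries the remaining roots.
  Prescribing the diagonal as a list lets the eigenvalues be read off with multiplicity.\<close>

lemma unitary_schur_char_poly:
  fixes A :: "complex mat"
  assumes "A \<in> carrier_mat n n" and "char_poly A = (\<Prod>e\<leftarrow>es. [:- e, 1:])"
  shows "\<exists>U B. U \<in> carrier_mat n n \<and> B \<in> carrier_mat n n \<and> mat_adjoint U * U = 1\<^sub>m n \<and>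
    A = U * B * mat_adjoint U \<and> upper_triangular B \<and> diag_mat B = es"
  using assms
proof (induction es arbitrary: n A)
  case Nil
  then have "n = 0" using degree_monic_char_poly[of A n] by auto
  then have "1\<^sub>m n \<in> carrier_mat n n" "A \<in> carrier_mat n n" "mat_adjoint (1\<^sub>m n) * (1\<^sub>m n) = (1\<^sub>m n :: complex mat)"
    "A = 1\<^sub>m n * A * mat_adjoint (1\<^sub>m n)" "upper_triangular A" "diag_mat A = []"
    using Nil(1) by (auto simp: diag_mat_def intro!: eq_matI)
  then show ?case by blast
next
  case (Cons e es)
  note A = Cons.prems(1)
  have "eigenvalue A e"
    unfolding eigenvalue_root_char_poly[OF A] Cons.prems(2) by simp
  then obtain v where v: "v \<in> carrier_vec n" "v \<noteq> 0\<^sub>v n" and Av: "A *\<^sub>v v = e \<cdot>\<^sub>v v"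
    using A unfolding eigenvalue_def eigenvector_def by auto
  obtain U c where U: "U \<in> carrier_mat n n" "mat_adjoint U * U = 1\<^sub>m n" "col U 0 = c \<cdot>\<^sub>v v" "n \<noteq> 0"
    using exists_unitary_first_col[OF v] .
  obtain m where m: "n = Suc m" using U(4) by (cases n) auto
  note UU = unitary_both[OF U(1,2)]
  have aU: "mat_adjoint U \<in> carrier_mat n n" using U(1) by simp
  define A' where "A' = mat_adjoint U * A * U"
  have A': "A' \<in> carrier_mat n n" unfolding A'_def using A U(1) aU by (intro mult_carrier_mat)
  have AU: "A = U * A' * mat_adjoint U"
  proof -
    have "U * A' * mat_adjoint U = (U * mat_adjoint U) * A * (U * mat_adjoint U)"
      unfolding A'_def using A U(1) aU by (simp add: assoc_mult_mat[of _ n n _ n _ n] mult_carrier_mat[of _ n n _ n])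
    then show ?thesis unfolding UU using A by simp
  qed
  have col0: "A' $$ (i, 0) = (if i = 0 then e else 0)" if i: "i < n" for i
  proof -
    have "A' $$ (i, 0) = (mat_adjoint U * (A * U)) $$ (i, 0)"
      unfolding A'_def using A U(1) aU by (simp add: assoc_mult_mat[of _ n n _ n _ n])
    also have "\<dots> = scalar_prod (Matrix.row (mat_adjoint U) i) (col (A * U) 0)"
      using A U(1) aU U(4) i by simp
    also have "col (A * U) 0 = A *\<^sub>v col U 0"
      using A U(1,4) by (intro col_mult2[of _ n n _ n]) auto
    also have "\<dots> = e \<cdot>\<^sub>v col U 0"
      unfolding U(3) using A v Av by (simp add: mult_mat_vec smult_smult_assoc mult.commute)
    also have "scalar_prod (Matrix.row (mat_adjoint U) i) \<dots> = e * scalar_prod (Matrix.row (mat_adjoint U) i) (col U 0)"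
      using U(1,4) i by (intro scalar_prod_smult_distrib[of _ n]) auto
    also have "scalar_prod (Matrix.row (mat_adjoint U) i) (col U 0) = (mat_adjoint U * U) $$ (i, 0)"
      using U(1,4) i by simp
    finally show ?thesis unfolding U(2) using i U(4) by simp
  qed
  obtain A1 A2 A0 A3 where split: "split_block A' 1 1 = (A1, A2, A0, A3)"
    by (cases "split_block A' 1 1") auto
  have dA': "dim_row A' = 1 + m" "dim_col A' = 1 + m" using A' m by auto
  note sb = split_block[OF split dA']
  have A1: "A1 = Matrix.mat 1 1 (\<lambda>_. e)" and A0: "A0 = 0\<^sub>m m 1"
    using split col0 A' m by (auto simp: split_block_def Let_def intro!: eq_matI)
  have cp: "char_poly A' = [:- e, 1:] * (\<Prod>e\<leftarrow>es. [:- e, 1:])"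
  proof -
    have "similar_mat A A'"
      unfolding similar_mat_def using similar_mat_witI[OF UU U(2) AU A A' U(1) aU] by blast
    then have "char_poly A' = char_poly A" by (rule char_poly_similar[symmetric])
    then show ?thesis unfolding Cons.prems(2) by simp
  qed
  have "char_poly A' = char_poly A1 * char_poly A3"
    unfolding sb(5) A0 by (rule char_poly_four_block_zeros_col) (use sb in auto)
  moreover have "char_poly A1 = [:- e, 1:]"
    unfolding A1 by (subst char_poly_upper_triangular[of _ 1]) (auto simp: diag_mat_def)
  ultimately have cp3: "char_poly A3 = (\<Prod>e\<leftarrow>es. [:- e, 1:])"
    using cp by (metis mult_cancel_left pCons_eq_0_iff zero_neq_one)
  from Cons.IH[OF sb(4) cp3] obtain V B where V: "V \<in> carrier_mat m m" "B \<in> carrier_mat m m"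
    "mat_adjoint V * V = 1\<^sub>m m" "A3 = V * B * mat_adjoint V" "upper_triangular B" "diag_mat B = es"
    by blast
  have aV: "mat_adjoint V \<in> carrier_mat m m" using V(1) by simp
  \<comment> \<open>\<open>W\<close> fixes the first basis vector and acts as \<open>V\<close> on
    the others: conjugation by it makes the lower right block triangular and leaves the cleared
    first column alone.\<close>
  define W where "W = four_block_mat (1\<^sub>m 1) (0\<^sub>m 1 m) (0\<^sub>m m 1) V"
  define C where "C = four_block_mat A1 (A2 * V) (0\<^sub>m m 1) B"
  have cW: "W \<in> carrier_mat n n" and cC: "C \<in> carrier_mat n n"
    using four_block_carrier_mat[of "1\<^sub>m 1" 1 1 V m m] four_block_carrier_mat[OF sb(1) V(2)] V(1) m
    unfolding W_def C_def by auto
  have aW: "mat_adjoint W = four_block_mat (1\<^sub>m 1) (0\<^sub>m 1 m) (0\<^sub>m m 1) (mat_adjoint V)"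
    using V(1) by (intro eq_matI) (auto simp: W_def)
  have WW: "mat_adjoint W * W = 1\<^sub>m n"
    unfolding aW unfolding W_def
    by (subst mult_four_block_mat[of _ 1 1 _ m _ m _ _ 1 _ m])
       (use V(1,3) aV m in \<open>auto intro!: eq_matI\<close>)
  have WCW: "W * C * mat_adjoint W = A'"
  proof -
    have "W * C = four_block_mat A1 (A2 * V) (0\<^sub>m m 1) (V * B)"
      unfolding W_def C_def
      by (subst mult_four_block_mat[of _ 1 1 _ m _ m _ _ 1 _ m]) (use V(1,2) aV sb(1,2) in auto)
    moreover have "four_block_mat A1 (A2 * V) (0\<^sub>m m 1) (V * B) * mat_adjoint W
        = four_block_mat A1 (A2 * V * mat_adjoint V) (0\<^sub>m m 1) (V * B * mat_adjoint V)"
      unfolding aW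
      by (subst mult_four_block_mat[of _ 1 1 _ m _ m _ _ 1 _ m]) (use V(1,2) aV sb(1,2) in auto)
    moreover have "A2 * V * mat_adjoint V = A2"
      using V(1) aV sb(2) unitary_both[OF V(1,3)] by (simp add: assoc_mult_mat[of _ 1 m _ m _ m])
    ultimately show ?thesis using sb(5) V(4) A0 by simp
  qed
  have cWU: "U * W \<in> carrier_mat n n" using U(1) cW by simp
  have caW: "mat_adjoint W \<in> carrier_mat n n" using cW by simp
  have adj: "mat_adjoint (U * W) = mat_adjoint W * mat_adjoint U"
    by (rule mat_adjoint_mult[OF U(1) cW])
  have "mat_adjoint (U * W) * (U * W) = mat_adjoint W * (mat_adjoint U * U) * W"
    unfolding adj using U(1) aU cW caW by (simp add: assoc_mult_mat[of _ n n _ n _ n] mult_carrier_mat[of _ n n _ n])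
  then have un: "mat_adjoint (U * W) * (U * W) = 1\<^sub>m n"
    unfolding U(2) right_mult_one_mat[OF caW] WW .
  have "(U * W) * C * mat_adjoint (U * W) = U * (W * C * mat_adjoint W) * mat_adjoint U"
    unfolding adj using U(1) aU cW caW cC by (simp add: assoc_mult_mat[of _ n n _ n _ n] mult_carrier_mat[of _ n n _ n])
  then have eqA: "A = (U * W) * C * mat_adjoint (U * W)"
    unfolding WCW using AU by simp
  have ut: "upper_triangular C"
    unfolding C_def by (intro upper_triangular_four_block[OF _ V(2) _ V(5)]) (auto simp: A1)
  have dg: "diag_mat C = e # es"
    unfolding C_def using diag_four_block_mat[of A1 1 B m] V(2,6) sb(1)
    by (simp add: A1 diag_mat_def)
  show ?case using cWU cC un eqA ut dg by blast
qed

lemma eigenvalues_list: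
  assumes "M \<in> carrier_mat n n"
  obtains es where "char_poly M = (\<Prod>e\<leftarrow>es. [:- e, 1:])" "eigenvalues M = mset es" "length es = n"
proof -
  have cp: "lead_coeff (char_poly M) = 1" "degree (char_poly M) = n"
    using degree_monic_char_poly[OF assms] by auto
  obtain es where es: "mset es = proots (char_poly M)" using ex_mset by blast
  have "char_poly M = smult (lead_coeff (char_poly M)) (\<Prod>x\<in>#proots (char_poly M). [:- x, 1:])"
    by (rule complex_poly_decompose_multiset[symmetric])
  also have "\<dots> = (\<Prod>e\<leftarrow>es. [:- e, 1:])"
    unfolding cp(1) smult_1_left es[symmetric] mset_map[symmetric] prod_mset_prod_list by (rule refl)
  finally show ?thesis
    using that es size_proots_complex[of "char_poly M"] cp(2)
    by (metis eigenvalues_def size_mset)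
qed

lemma unitary_schur:
  fixes M :: "complex mat"
  assumes M: "M \<in> carrier_mat n n"
  obtains U B where "U \<in> carrier_mat n n" "B \<in> carrier_mat n n" "mat_adjoint U * U = 1\<^sub>m n"
    "U * mat_adjoint U = 1\<^sub>m n" "M = U * B * mat_adjoint U" "upper_triangular B"
    "eigenvalues M = image_mset (\<lambda>i. B $$ (i, i)) (mset_set {..<n})"
proof -
  obtain es where es: "char_poly M = (\<Prod>e\<leftarrow>es. [:- e, 1:])" "eigenvalues M = mset es" "length es = n"
    using eigenvalues_list[OF M] .
  obtain U B where UB: "U \<in> carrier_mat n n" "B \<in> carrier_mat n n" "mat_adjoint U * U = 1\<^sub>m n"
    "M = U * B * mat_adjoint U" "upper_triangular B" "diag_mat B = es"
    using unitary_schur_char_poly[OF M es(1)] by blast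
  have "mset es = image_mset (\<lambda>i. B $$ (i, i)) (mset_set {..<n})"
    unfolding UB(6)[symmetric] diag_mat_def using UB(2) 
    by (simp add: atLeast0LessThan flip: mset_set_set)
  then show ?thesis using that UB unitary_both[OF UB(1,3)] es(2) by simp
qed

section \<open>Approximate resolvents\<close>

text \<open>Vectors and matrices are functions on all indices of which only those below
  \<open>d\<close> count; columns, rows and sampled grid functions can thus be used without
  conversion.\<close>

definition mv :: "nat \<Rightarrow> (nat \<Rightarrow> nat \<Rightarrow> complex) \<Rightarrow> (nat \<Rightarrow> complex) \<Rightarrow> nat \<Rightarrow> complex" where
  "mv d M v i = (\<Sum>j<d. M i j * v j)"

definition adj :: "(nat \<Rightarrow> nat \<Rightarrow> complex) \<Rightarrow> nat \<Rightarrow> nat \<Rightarrow> complex" where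
  "adj M i j = cnj (M j i)"

definition ip :: "nat \<Rightarrow> (nat \<Rightarrow> complex) \<Rightarrow> (nat \<Rightarrow> complex) \<Rightarrow> complex" where
  "ip d u v = (\<Sum>i<d. cnj (u i) * v i)"

definition nrm :: "nat \<Rightarrow> (nat \<Rightarrow> complex) \<Rightarrow> real" where
  "nrm d v = L2_set (\<lambda>i. cmod (v i)) {..<d}"

lemma nrm_nonneg [simp]: "0 \<le> nrm d v"
  by (simp add: nrm_def L2_set_nonneg)

lemma nrm_sq: "(nrm d v)\<^sup>2 = (\<Sum>i<d. (cmod (v i))\<^sup>2)"
  by (simp add: nrm_def L2_set_def sum_nonneg)

lemma ip_self: "ip d v v = of_real ((nrm d v)\<^sup>2)"
  by (simp add: ip_def nrm_sq mult.commute flip: complex_norm_square)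

lemma norm_ip_le: "cmod (ip d u v) \<le> nrm d u * nrm d v"
proof -
  have "cmod (ip d u v) \<le> (\<Sum>i<d. \<bar>cmod (u i)\<bar> * \<bar>cmod (v i)\<bar>)"
    unfolding ip_def by (rule order_trans[OF norm_sum]) (simp add: norm_mult)
  also have "\<dots> \<le> nrm d u * nrm d v"
    unfolding nrm_def by (rule L2_set_mult_ineq)
  finally show ?thesis .
qed

lemma mv_cong: "(\<And>j. j < d \<Longrightarrow> M i j = N i j) \<Longrightarrow> (\<And>j. j < d \<Longrightarrow> u j = v j) \<Longrightarrow> mv d M u i = mv d N v i"
  unfolding mv_def by (intro sum.cong) auto

lemma ip_cong: "(\<And>j. j < d \<Longrightarrow> u j = u' j) \<Longrightarrow> (\<And>j. j < d \<Longrightarrow> v j = v' j) \<Longrightarrow> ip d u v = ip d u' v'"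
  unfolding ip_def by (intro sum.cong) auto

lemma nrm_cong: "(\<And>j. j < d \<Longrightarrow> u j = u' j) \<Longrightarrow> nrm d u = nrm d u'"
  unfolding nrm_def by (intro L2_set_cong) auto

lemma mv_diff: "mv d M (\<lambda>j. u j - v j) i = mv d M u i - mv d M v i"
  by (simp add: mv_def sum_subtractf algebra_simps)

lemma mv_scale: "mv d M (\<lambda>j. c * v j) i = c * mv d M v i"
  by (simp add: mv_def sum_distrib_left mult.left_commute)

lemma mv_diff_left: "mv d (\<lambda>i j. M i j - N i j) v i = mv d M v i - mv d N v i"
  by (simp add: mv_def sum_subtractf algebra_simps)

lemma ip_diff: "ip d u (\<lambda>j. v j - w j) = ip d u v - ip d u w"
  by (simp add: ip_def sum_subtractf algebra_simps)

lemma ip_add: "ip d u (\<lambda>j. v j + w j) = ip d u v + ip d u w"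
  by (simp add: ip_def sum.distrib algebra_simps)

lemma ip_scale: "ip d u (\<lambda>j. c * v j) = c * ip d u v"
  by (simp add: ip_def sum_distrib_left mult.left_commute)

lemma ip_add_left: "ip d (\<lambda>j. u j + w j) v = ip d u v + ip d w v"
  by (simp add: ip_def sum.distrib algebra_simps)

lemma ip_diff_left: "ip d (\<lambda>j. u j - w j) v = ip d u v - ip d w v"
  by (simp add: ip_def sum_subtractf algebra_simps)

lemma ip_scale_left: "ip d (\<lambda>j. c * u j) v = cnj c * ip d u v"
  by (simp add: ip_def sum_distrib_left mult_ac)

lemma adj_adj [simp]: "adj (adj M) = M"
  by (simp add: adj_def fun_eq_iff)

lemma ip_mv: "ip d u (mv d M v) = ip d (mv d (adj M) u) v"
proof -
  have "ip d u (mv d M v) = (\<Sum>i<d. \<Sum>j<d. cnj (u i) * M i j * v j)"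
    by (simp add: ip_def mv_def sum_distrib_left mult.assoc)
  also have "\<dots> = (\<Sum>j<d. \<Sum>i<d. cnj (u i) * M i j * v j)" by (rule sum.swap)
  also have "\<dots> = ip d (mv d (adj M) u) v"
    by (simp add: ip_def mv_def adj_def sum_distrib_right sum_distrib_left mult_ac)
  finally show ?thesis .
qed

lemma mv_mat_mult:
  assumes "A \<in> carrier_mat d d" "B \<in> carrier_mat d d" "i < d"
  shows "mv d (\<lambda>i j. A $$ (i, j)) (mv d (\<lambda>i j. B $$ (i, j)) v) i = mv d (\<lambda>i j. (A * B) $$ (i, j)) v i"
proof -
  have "mv d (\<lambda>i j. A $$ (i, j)) (mv d (\<lambda>i j. B $$ (i, j)) v) i
      = (\<Sum>k<d. \<Sum>j<d. A $$ (i, k) * B $$ (k, j) * v j)"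
    by (simp add: mv_def sum_distrib_left mult.assoc)
  also have "\<dots> = (\<Sum>j<d. \<Sum>k<d. A $$ (i, k) * B $$ (k, j) * v j)" by (rule sum.swap)
  also have "\<dots> = (\<Sum>j<d. (A * B) $$ (i, j) * v j)"
    using assms by (intro sum.cong) (auto simp: scalar_prod_def atLeast0LessThan sum_distrib_right)
  finally show ?thesis by (simp add: mv_def)
qed

lemma ip_adj_right: "ip d u (mv d (adj M) v) = ip d (mv d M u) v"
  by (subst ip_mv) simp

lemma ip_adj_left: "ip d (mv d (adj M) u) v = ip d u (mv d M v)"
  by (rule ip_mv[symmetric])

text \<open>\<open>R\<close> is the inverse of \<open>M\<^sup>* M + s\<close>, expressed through its
  action on vectors, which is the form in which all estimates use it.\<close>

definition is_resolvent :: "nat \<Rightarrow> (nat \<Rightarrow> nat \<Rightarrow> complex) \<Rightarrow> real \<Rightarrow> (nat \<Rightarrow> nat \<Rightarrow> complex) \<Rightarrow> bool" where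
  "is_resolvent d M s R \<longleftrightarrow>
     (\<forall>v. \<forall>i<d. mv d (adj M) (mv d M (mv d R v)) i + of_real s * mv d R v i = v i) \<and>
     (\<forall>i<d. \<forall>j<d. R i j = cnj (R j i))"

context
  fixes d M s R
  assumes res: "is_resolvent d M s R" and s: "1 \<le> s"
begin

lemma resolvent_eq: "i < d \<Longrightarrow> mv d (adj M) (mv d M (mv d R v)) i + of_real s * mv d R v i = v i"
  using res by (simp add: is_resolvent_def)

lemma resolvent_adj: "i < d \<Longrightarrow> mv d (adj R) v i = mv d R v i"
  by (rule mv_cong) (metis adj_def is_resolvent_def res, rule refl)

lemma ip_resolvent: "ip d (mv d R u) v = ip d u (mv d R v)"
  unfolding ip_mv[of d u R v] by (rule ip_cong) (simp_all add: resolvent_adj)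

text \<open>Pairing the equation for \<open>w = R v\<close> with \<open>w\<close> itself gives |M
  w|^2 + s |w|^2 = <w, v>. The norm of \<open>M\<close> does not enter, and the bounds on
  \<open>R\<close> and \<open>M R\<close> follow at once.\<close>

lemma resolvent_energy: "(nrm d (mv d M (mv d R v)))\<^sup>2 + s * (nrm d (mv d R v))\<^sup>2 \<le> nrm d (mv d R v) * nrm d v"
proof -
  let ?w = "mv d R v"
  have "ip d ?w v = ip d ?w (\<lambda>i. mv d (adj M) (mv d M ?w) i + of_real s * ?w i)"
    by (rule ip_cong) (simp_all add: resolvent_eq)
  also have "\<dots> = ip d (mv d M ?w) (mv d M ?w) + of_real s * ip d ?w ?w"
    unfolding ip_add ip_scale ip_mv[of d ?w "adj M"] adj_adj ..
  also have "\<dots> = of_real ((nrm d (mv d M ?w))\<^sup>2 + s * (nrm d ?w)\<^sup>2)"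
    by (simp add: ip_self)
  finally have "cmod (ip d ?w v) = \<bar>(nrm d (mv d M ?w))\<^sup>2 + s * (nrm d ?w)\<^sup>2\<bar>"
    by (simp only: norm_of_real)
  then show ?thesis using norm_ip_le[of d ?w v] by linarith
qed

lemma nrm_resolvent_le: "nrm d (mv d R v) \<le> nrm d v"
proof -
  have "nrm d (mv d R v) * nrm d (mv d R v) \<le> s * (nrm d (mv d R v))\<^sup>2"
    using s mult_right_mono[of 1 s "(nrm d (mv d R v))\<^sup>2"] by (simp add: power2_eq_square)
  also have "\<dots> \<le> nrm d (mv d R v) * nrm d v"
    using resolvent_energy[of v] zero_le_power2[of "nrm d (mv d M (mv d R v))"] by linarith
  finally show ?thesis
    using nrm_nonneg[of d "mv d R v"] nrm_nonneg[of d v]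
    by (cases "nrm d (mv d R v) = 0") (auto simp: mult_le_cancel_left)
qed

lemma nrm_M_resolvent_le: "nrm d (mv d M (mv d R v)) \<le> nrm d v"
proof -
  have "(nrm d (mv d M (mv d R v)))\<^sup>2 \<le> nrm d (mv d R v) * nrm d v"
    using resolvent_energy[of v] s mult_nonneg_nonneg[OF _ zero_le_power2, of s "nrm d (mv d R v)"] by linarith
  also have "\<dots> \<le> (nrm d v)\<^sup>2"
    using nrm_resolvent_le[of v] by (simp add: power2_eq_square mult_right_mono)
  finally show ?thesis by (rule power2_le_imp_le) simp
qed

text \<open>\<open>R M\<^sup>*\<close> is the adjoint of \<open>M R\<close> and inherits its
  bound.\<close>

lemma nrm_resolvent_adj_le: "nrm d (mv d R (mv d (adj M) v)) \<le> nrm d v"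
proof -
  let ?w = "mv d R (mv d (adj M) v)"
  have "of_real ((nrm d ?w)\<^sup>2) = ip d ?w (mv d R (mv d (adj M) v))" by (simp add: ip_self)
  also have "\<dots> = ip d (mv d M (mv d R ?w)) v"
    unfolding ip_resolvent[symmetric, of ?w] ip_mv[of d _ "adj M"] adj_adj ..
  finally have "cmod (ip d (mv d M (mv d R ?w)) v) = \<bar>(nrm d ?w)\<^sup>2\<bar>"
    by (metis norm_of_real)
  then have "(nrm d ?w)\<^sup>2 = cmod (ip d (mv d M (mv d R ?w)) v)" by simp
  also have "\<dots> \<le> nrm d ?w * nrm d v"
    using norm_ip_le[of d "mv d M (mv d R ?w)" v] nrm_M_resolvent_le[of ?w]
    by (meson mult_right_mono nrm_nonneg order_trans)
  finally show ?thesis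
    using nrm_nonneg[of d ?w] nrm_nonneg[of d v]
    by (cases "nrm d ?w = 0") (auto simp: power2_eq_square mult_le_cancel_left)
qed

text \<open>An approximate eigenvector of \<open>M\<close> that is also one of \<open>M\<^sup>*\<close>, for the conjugate
  value, is an approximate eigenvector of the resolvent.\<close>

lemma quasimode:
  "cmod (ip d v (mv d R v) - of_real ((nrm d v)\<^sup>2 / ((cmod \<kappa>)\<^sup>2 + s)))
    \<le> nrm d v * (nrm d (\<lambda>i. mv d M v i - \<kappa> * v i) + nrm d (\<lambda>i. mv d (adj M) v i - cnj \<kappa> * v i))"
proof -
  let ?w = "mv d R v" and ?z = "\<lambda>i. mv d M v i - \<kappa> * v i" and ?z' = "\<lambda>i. mv d (adj M) v i - cnj \<kappa> * v i"
  define N where "N = (cmod \<kappa>)\<^sup>2 + s"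
  have N: "N \<ge> 1" "cmod \<kappa> \<le> N"
  proof -
    show "N \<ge> 1" using s by (simp add: N_def add_increasing)
    \<comment> \<open>With this estimate \<open>N\<close> absorbs the factor \<open>\<kappa>\<close>
      in front of the residual of the adjoint.\<close>
    have "0 \<le> (cmod \<kappa> - 1/2)\<^sup>2" by simp
    then have "cmod \<kappa> \<le> (cmod \<kappa>)\<^sup>2 + 1" by (simp add: power2_eq_square algebra_simps)
    then show "cmod \<kappa> \<le> N" using s by (simp add: N_def)
  qed
  have "of_real N * ip d v ?w - of_real ((nrm d v)\<^sup>2)
      = of_real N * ip d ?w v - ip d ?w (\<lambda>i. mv d (adj M) (mv d M v) i + of_real s * v i)"
  proof -
    have "of_real ((nrm d v)\<^sup>2) = ip d (\<lambda>i. mv d (adj M) (mv d M ?w) i + of_real s * ?w i) v"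
      unfolding ip_self[symmetric] by (rule ip_cong) (simp_all add: resolvent_eq)
    also have "\<dots> = ip d ?w (\<lambda>i. mv d (adj M) (mv d M v) i + of_real s * v i)"
      by (simp add: ip_add_left ip_scale_left ip_add ip_scale ip_adj_left ip_adj_right)
    finally show ?thesis by (simp add: ip_resolvent)
  qed
  \<comment> \<open>Inserting both residuals gives
    \<open>(M\<^sup>* M + s) v = N v + M\<^sup>* z + \<kappa> z'\<close>. The adjoint in front of
    \<open>z\<close> is then moved to the other side, where \<open>M w\<close> is under
    control.\<close>
  also have "\<dots> = - (ip d ?w (mv d (adj M) ?z) + \<kappa> * ip d ?w ?z')"
  proof -
    have "N = of_real s + \<kappa> * cnj \<kappa>" by (simp add: N_def complex_norm_square[symmetric])
    moreover have "mv d (adj M) ?z = (\<lambda>i. mv d (adj M) (mv d M v) i - \<kappa> * mv d (adj M) v i)"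
      by (simp add: fun_eq_iff mv_diff mv_scale)
    ultimately show ?thesis
      by (simp add: ip_add ip_scale ip_diff algebra_simps)
  qed
  also have "ip d ?w (mv d (adj M) ?z) = ip d (mv d M ?w) ?z" by (simp add: ip_adj_right)
  finally have "cmod (of_real N * ip d v ?w - of_real ((nrm d v)\<^sup>2)) = cmod (ip d (mv d M ?w) ?z + \<kappa> * ip d ?w ?z')"
    by (simp only: norm_minus_cancel)
  also have "\<dots> \<le> cmod (ip d (mv d M ?w) ?z) + cmod \<kappa> * cmod (ip d ?w ?z')"
    by (rule order_trans[OF norm_triangle_ineq]) (simp add: norm_mult)
  also have "\<dots> \<le> nrm d v * nrm d ?z + N * (nrm d v * nrm d ?z')"
  proof (intro add_mono mult_mono)
    show "cmod (ip d (mv d M ?w) ?z) \<le> nrm d v * nrm d ?z"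
      by (rule order_trans[OF norm_ip_le]) (simp add: mult_right_mono nrm_M_resolvent_le)
    show "cmod (ip d ?w ?z') \<le> nrm d v * nrm d ?z'"
      by (rule order_trans[OF norm_ip_le]) (simp add: mult_right_mono nrm_resolvent_le)
  qed (use N in auto)
  also have "\<dots> \<le> N * (nrm d v * (nrm d ?z + nrm d ?z'))"
    using N(1) mult_right_mono[of 1 N "nrm d v * nrm d ?z"] by (simp add: algebra_simps)
  also have "of_real N * ip d v ?w - of_real ((nrm d v)\<^sup>2) = of_real N * (ip d v ?w - of_real ((nrm d v)\<^sup>2 / N))"
    using N(1) by (simp add: algebra_simps)
  also have "cmod \<dots> = N * cmod (ip d v ?w - of_real ((nrm d v)\<^sup>2 / N))"
    using N(1) by (simp only: norm_mult) simp
  finally show ?thesis using N(1) by (simp add: N_def)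
qed

end

section \<open>Perturbation of resolvent traces\<close>

definition unitv :: "nat \<Rightarrow> nat \<Rightarrow> complex" where
  "unitv k i = (if i = k then 1 else 0)"

lemma nrm_unitv: "k < d \<Longrightarrow> nrm d (unitv k) = 1"
proof -
  assume "k < d"
  have "(nrm d (unitv k))\<^sup>2 = (\<Sum>i<d. if i = k then 1 else 0)"
    unfolding nrm_sq by (intro sum.cong) (auto simp: unitv_def)
  also have "\<dots> = 1" using \<open>k < d\<close> by simp
  finally show ?thesis using nrm_nonneg[of d "unitv k"] by (simp add: power2_eq_1_iff)
qed

lemma mv_unitv: "k < d \<Longrightarrow> mv d M (unitv k) i = M i k"
  by (simp add: mv_def unitv_def if_distrib cong: if_cong)

lemma ip_unitv: "k < d \<Longrightarrow> ip d (unitv k) v = v k"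
  by (simp add: ip_def unitv_def if_distrib[of cnj] if_distrib[of "\<lambda>x. x * _"] cong: if_cong)

text \<open>Columns of \<open>R\<close> and of \<open>M R\<close> are images of unit vectors. Rows
  of \<open>R\<close> are conjugated columns of \<open>R\<close>, and rows of \<open>M R\<close> are
  conjugated columns of \<open>R M\<^sup>*\<close>; the trace estimate sums over the column index
  with the row held fixed.\<close>

lemma resolvent_col_sum_le:
  assumes "is_resolvent d M s R" "1 \<le> s" "k < d"
  shows "(\<Sum>i<d. (cmod (R i k))\<^sup>2) \<le> 1" "(\<Sum>i<d. (cmod (mv d M (\<lambda>j. R j k) i))\<^sup>2) \<le> 1"
    "(\<Sum>i<d. (cmod (R k i))\<^sup>2) \<le> 1" "(\<Sum>i<d. (cmod (mv d M (\<lambda>j. R j i) k))\<^sup>2) \<le> 1"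
proof -
  show 1: "(\<Sum>i<d. (cmod (R i k))\<^sup>2) \<le> 1"
  proof -
    have "(nrm d (mv d R (unitv k)))\<^sup>2 \<le> 1"
      using nrm_resolvent_le[OF assms(1,2), of "unitv k"] assms(3)
      by (simp only: nrm_unitv) (simp add: power_le_one)
    then show ?thesis unfolding nrm_sq using assms(3) by (simp add: mv_unitv)
  qed
  show "(\<Sum>i<d. (cmod (mv d M (\<lambda>j. R j k) i))\<^sup>2) \<le> 1"
  proof -
    have "(nrm d (mv d M (mv d R (unitv k))))\<^sup>2 \<le> 1"
      using nrm_M_resolvent_le[OF assms(1,2), of "unitv k"] assms(3)
      by (simp only: nrm_unitv) (simp add: power_le_one)
    moreover have "mv d R (unitv k) = (\<lambda>i. R i k)"
      using assms(3) by (simp add: fun_eq_iff mv_unitv)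
    ultimately show ?thesis unfolding nrm_sq by simp
  qed
  have "(\<Sum>i<d. (cmod (R k i))\<^sup>2) = (\<Sum>i<d. (cmod (R i k))\<^sup>2)"
    using assms(1,3) by (intro sum.cong refl) (metis complex_mod_cnj is_resolvent_def lessThan_iff)
  with 1 show "(\<Sum>i<d. (cmod (R k i))\<^sup>2) \<le> 1" by simp
  have "cmod (mv d M (\<lambda>j. R j i) k) = cmod (mv d R (mv d (adj M) (unitv k)) i)" if "i < d" for i
  proof -
    have "mv d M (\<lambda>j. R j i) k = (\<Sum>j<d. M k j * cnj (R i j))"
      unfolding mv_def using assms(1) that by (intro sum.cong refl) (metis is_resolvent_def lessThan_iff)
    also have "\<dots> = cnj (mv d R (mv d (adj M) (unitv k)) i)"
      using assms(3) by (simp add: mv_def[of d R] mv_unitv adj_def mult.commute)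
    finally show ?thesis by simp
  qed
  then have "(\<Sum>i<d. (cmod (mv d M (\<lambda>j. R j i) k))\<^sup>2) = (nrm d (mv d R (mv d (adj M) (unitv k))))\<^sup>2"
    unfolding nrm_sq by (intro sum.cong) auto
  also have "\<dots> \<le> 1"
    using nrm_resolvent_adj_le[OF assms(1,2), of "unitv k"] assms(3) by (simp add: nrm_unitv power_le_one)
  finally show "(\<Sum>i<d. (cmod (mv d M (\<lambda>j. R j i) k))\<^sup>2) \<le> 1" .
qed

lemma sum_mult_le_1:
  fixes f g :: "nat \<Rightarrow> complex"
  assumes "(\<Sum>i<d. (cmod (f i))\<^sup>2) \<le> 1" "(\<Sum>i<d. (cmod (g i))\<^sup>2) \<le> 1"
  shows "(\<Sum>i<d. cmod (f i) * cmod (g i)) \<le> 1"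
proof -
  have "(\<Sum>i<d. cmod (f i) * cmod (g i)) = (\<Sum>i<d. \<bar>cmod (f i)\<bar> * \<bar>cmod (g i)\<bar>)" by simp
  also have "\<dots> \<le> L2_set (\<lambda>i. cmod (f i)) {..<d} * L2_set (\<lambda>i. cmod (g i)) {..<d}"
    by (rule L2_set_mult_ineq)
  also have "\<dots> \<le> 1 * 1"
    using assms by (intro mult_mono) (auto simp: L2_set_def sum_nonneg)
  finally show ?thesis by simp
qed

text \<open>With \<open>E = N - M\<close>, the resolvent identity reads
  \<open>R - R' = R (E\<^sup>* N + M\<^sup>* E) R'\<close>. In the trace every entry of
  \<open>E\<close> is multiplied by two sums over \<open>k\<close>, each a product of a row of a
  resolvent with a row of \<open>N R'\<close> or \<open>M R\<close>, and by Cauchy-Schwarz each is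
  at most 1. Hence the constant 2, independent of the dimension and of the size of the
  matrices.\<close>

lemma resolvent_trace_perturb:
  assumes R: "is_resolvent d M s R" and R': "is_resolvent d N s R'" and s: "1 \<le> s"
  shows "cmod ((\<Sum>i<d. R i i) - (\<Sum>i<d. R' i i)) \<le> 2 * (\<Sum>i<d. \<Sum>j<d. cmod (M i j - N i j))"
proof -
  define E where "E = (\<lambda>i j. N i j - M i j)"
  let ?c = "\<lambda>R k j. (R :: nat \<Rightarrow> nat \<Rightarrow> complex) j k"
  have Rk: "mv d S (unitv k) = ?c S k" if "k < d" for k S
    using that by (simp add: fun_eq_iff mv_unitv)
  have eqR: "mv d (adj M) (mv d M (?c R k)) i + of_real s * R i k = unitv k i" if "k < d" "i < d" for k i
    using resolvent_eq[OF R s that(2), of "unitv k"] that(1) by (simp add: Rk)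
  have eqR': "mv d (adj N) (mv d N (?c R' k)) i + of_real s * R' i k = unitv k i" if "k < d" "i < d" for k i
    using resolvent_eq[OF R' s that(2), of "unitv k"] that(1) by (simp add: Rk)
  have diag: "R k k - R' k k = ip d (mv d E (?c R k)) (mv d N (?c R' k)) + ip d (mv d M (?c R k)) (mv d E (?c R' k))"
    if k: "k < d" for k
  proof -
    have "R k k = ip d (mv d R (unitv k)) (unitv k)"
      using k by (simp add: ip_resolvent[OF R s] ip_unitv mv_unitv)
    also have "\<dots> = ip d (?c R k) (\<lambda>i. mv d (adj N) (mv d N (?c R' k)) i + of_real s * R' i k)"
      using k by (intro ip_cong) (simp_all add: eqR' mv_unitv)
    also have "\<dots> = ip d (mv d N (?c R k)) (mv d N (?c R' k)) + of_real s * ip d (?c R k) (?c R' k)"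
      using k by (simp add: ip_add ip_scale ip_adj_right Rk)
    finally have 1: "R k k = \<dots>" .
    have "R' k k = ip d (unitv k) (mv d R' (unitv k))"
      using k by (simp add: ip_unitv Rk)
    also have "\<dots> = ip d (\<lambda>i. mv d (adj M) (mv d M (?c R k)) i + of_real s * R i k) (?c R' k)"
      using k by (intro ip_cong) (simp_all add: eqR mv_unitv)
    also have "\<dots> = ip d (mv d M (?c R k)) (mv d M (?c R' k)) + of_real s * ip d (?c R k) (?c R' k)"
      using k by (simp add: ip_add_left ip_scale_left ip_adj_left Rk)
    finally have 2: "R' k k = \<dots>" .
    have E: "mv d E v i = mv d N v i - mv d M v i" for v i
      by (simp add: E_def mv_diff_left)
    show ?thesis
      unfolding 1 2 E[abs_def] ip_diff ip_diff_left by simp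
  qed
  have b1: "cmod (ip d (mv d E (?c R k)) (mv d N (?c R' k))) \<le> (\<Sum>i<d. \<Sum>j<d. cmod (E i j) * (cmod (R j k) * cmod (mv d N (?c R' k) i)))" for k
  proof -
    have "ip d (mv d E (?c R k)) (mv d N (?c R' k)) = (\<Sum>i<d. \<Sum>j<d. cnj (E i j * R j k) * mv d N (?c R' k) i)"
      by (simp add: ip_def mv_def[of d E] sum_distrib_right)
    then show ?thesis
      by (simp only:) (intro order_trans[OF norm_sum] sum_mono, simp add: norm_mult mult_ac)
  qed
  have b2: "cmod (ip d (mv d M (?c R k)) (mv d E (?c R' k))) \<le> (\<Sum>i<d. \<Sum>j<d. cmod (E i j) * (cmod (mv d M (?c R k) i) * cmod (R' j k)))" for k
  proof -
    have "ip d (mv d M (?c R k)) (mv d E (?c R' k)) = (\<Sum>i<d. \<Sum>j<d. cnj (mv d M (?c R k) i) * (E i j * R' j k))"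
      by (simp add: ip_def mv_def[of d E] sum_distrib_left)
    then show ?thesis
      by (simp only:) (intro order_trans[OF norm_sum] sum_mono, simp add: norm_mult mult_ac)
  qed
  have "cmod ((\<Sum>i<d. R i i) - (\<Sum>i<d. R' i i)) \<le> (\<Sum>k<d. cmod (R k k - R' k k))"
    unfolding sum_subtractf[symmetric] by (rule norm_sum)
  also have "\<dots> \<le> (\<Sum>k<d. (\<Sum>i<d. \<Sum>j<d. cmod (E i j) * (cmod (R j k) * cmod (mv d N (?c R' k) i)))
      + (\<Sum>i<d. \<Sum>j<d. cmod (E i j) * (cmod (mv d M (?c R k) i) * cmod (R' j k))))"
    by (intro sum_mono) (use diag b1 b2 in \<open>auto intro!: order_trans[OF norm_triangle_ineq] add_mono\<close>)
  also have "\<dots> = (\<Sum>i<d. \<Sum>j<d. cmod (E i j) * (\<Sum>k<d. cmod (R j k) * cmod (mv d N (?c R' k) i)))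
      + (\<Sum>i<d. \<Sum>j<d. cmod (E i j) * (\<Sum>k<d. cmod (mv d M (?c R k) i) * cmod (R' j k)))"
  proof -
    have swap: "(\<Sum>k<d. \<Sum>i<d. \<Sum>j<d. h i j * g i j k) = (\<Sum>i<d. \<Sum>j<d. h i j * (\<Sum>k<d. g i j k))" for h and g :: "nat \<Rightarrow> nat \<Rightarrow> nat \<Rightarrow> real"
      unfolding sum_distrib_left
      by (subst sum.swap) (intro sum.cong refl sum.swap)
    show ?thesis unfolding sum.distrib swap ..
  qed
  also have "\<dots> \<le> (\<Sum>i<d. \<Sum>j<d. cmod (E i j) * 1) + (\<Sum>i<d. \<Sum>j<d. cmod (E i j) * 1)"
    by (intro add_mono sum_mono mult_left_mono sum_mult_le_1)
       (auto intro: resolvent_col_sum_le[OF R s] resolvent_col_sum_le[OF R' s])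
  finally show ?thesis by (simp add: E_def norm_minus_commute)
qed

section \<open>Resolvent traces\<close>

lemma mv_mat_adjoint:
  assumes "M \<in> carrier_mat d d" "i < d"
  shows "mv d (adj (\<lambda>i j. M $$ (i, j))) v i = mv d (\<lambda>i j. mat_adjoint M $$ (i, j)) v i"
  using assms by (intro mv_cong) (auto simp: adj_def)

lemma nrm_mv_isometry:
  assumes "\<And>j l. j < d \<Longrightarrow> l < d \<Longrightarrow> (\<Sum>k<d. cnj (W k j) * W k l) = (if j = l then 1 else 0)"
  shows "nrm d (mv d W e) = nrm d e"
proof -
  have "of_real ((nrm d (mv d W e))\<^sup>2) = ip d (mv d W e) (mv d W e)" by (simp add: ip_self)
  also have "\<dots> = ip d e (mv d (adj W) (mv d W e))"
    by (rule ip_adj_right[symmetric])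
  also have "\<dots> = ip d e e"
  proof (rule ip_cong)
    fix j assume j: "j < d"
    have "mv d (adj W) (mv d W e) j = (\<Sum>k<d. \<Sum>l<d. cnj (W k j) * W k l * e l)"
      by (simp add: mv_def adj_def sum_distrib_left mult.assoc)
    also have "\<dots> = (\<Sum>l<d. (\<Sum>k<d. cnj (W k j) * W k l) * e l)"
      by (subst sum.swap) (simp add: sum_distrib_right)
    also have "\<dots> = (\<Sum>l<d. (if j = l then 1 else 0) * e l)"
      using assms[OF j] by (intro sum.cong) auto
    also have "\<dots> = e j" using j by (simp add: if_distrib[of "\<lambda>x. x * _"] cong: if_cong)
    finally show "mv d (adj W) (mv d W e) j = e j" .
  qed simp
  also have "\<dots> = of_real ((nrm d e)\<^sup>2)" by (simp add: ip_self)
  finally have "(nrm d (mv d W e))\<^sup>2 = (nrm d e)\<^sup>2" by (simp only: of_real_eq_iff)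
  then show ?thesis by (simp add: power2_eq_iff_nonneg)
qed

lemma unitary_cols:
  assumes "U \<in> carrier_mat d d" "mat_adjoint U * U = 1\<^sub>m d" "j < d" "l < d"
  shows "(\<Sum>k<d. cnj (U $$ (k, j)) * U $$ (k, l)) = (if j = l then 1 else 0)"
proof -
  have "(\<Sum>k<d. cnj (U $$ (k, j)) * U $$ (k, l)) = (\<Sum>k<d. mat_adjoint U $$ (j, k) * U $$ (k, l))"
    using assms by (intro sum.cong) auto
  also have "\<dots> = (mat_adjoint U * U) $$ (j, l)"
    using assms by (intro mat_mult_entry[symmetric]) auto
  finally show ?thesis using assms by simp
qed

lemma unitary_rows:
  assumes "U \<in> carrier_mat d d" "U * mat_adjoint U = 1\<^sub>m d" "j < d" "l < d"
  shows "(\<Sum>k<d. U $$ (j, k) * cnj (U $$ (l, k))) = (if j = l then 1 else 0)"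
proof -
  have "(\<Sum>k<d. U $$ (j, k) * cnj (U $$ (l, k))) = (\<Sum>k<d. U $$ (j, k) * mat_adjoint U $$ (k, l))"
    using assms by (intro sum.cong) auto
  also have "\<dots> = (U * mat_adjoint U) $$ (j, l)"
    using assms by (intro mat_mult_entry[symmetric]) auto
  finally show ?thesis using assms by simp
qed

lemma unitary_conj_mult:
  fixes U :: "complex mat"
  assumes "U \<in> carrier_mat d d" "B \<in> carrier_mat d d" "mat_adjoint U * U = 1\<^sub>m d"
  shows "U * B * mat_adjoint U * U = U * B"
  using assms assoc_mult_mat[of "U * B" d d "mat_adjoint U" d U d] mult_carrier_mat[of U d d B d]
    right_mult_one_mat[of "U * B" d d] by simp

text \<open>The trace of the inverse of \<open>M\<^sup>* M + s\<close>, as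
  \<open>resolvent_exists\<close> confirms.\<close>

definition rtr :: "real \<Rightarrow> complex mat \<Rightarrow> real" where
  "rtr s M = (\<Sum>\<sigma>\<in>#singular_values M. 1 / (\<sigma>\<^sup>2 + s))"

text \<open>In a Schur basis of \<open>M\<^sup>* M\<close> the triangular factor is the Gram matrix
  of the columns of \<open>M U\<close>. Being Hermitian and triangular it is diagonal, and its
  diagonal consists of squared column norms.\<close>

lemma gram_schur:
  fixes M :: "complex mat"
  assumes M: "M \<in> carrier_mat d d"
  shows "\<exists>U b. U \<in> carrier_mat d d \<and> mat_adjoint U * U = 1\<^sub>m d \<and> U * mat_adjoint U = 1\<^sub>m d \<and>
    (\<forall>i. 0 \<le> b i) \<and> mat_adjoint M * M * U = U * Matrix.mat d d (\<lambda>(i, j). if i = j then of_real (b i) else 0) \<and>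
    singular_values M = image_mset (\<lambda>i. sqrt (b i)) (mset_set {..<d})"
proof -
  have aM: "mat_adjoint M \<in> carrier_mat d d" using M by simp
  have H: "mat_adjoint M * M \<in> carrier_mat d d" by (rule mult_carrier_mat[OF aM M])
  obtain U B where UB: "U \<in> carrier_mat d d" "B \<in> carrier_mat d d" "mat_adjoint U * U = 1\<^sub>m d"
    "U * mat_adjoint U = 1\<^sub>m d" "mat_adjoint M * M = U * B * mat_adjoint U" "upper_triangular B"
    "eigenvalues (mat_adjoint M * M) = image_mset (\<lambda>i. B $$ (i, i)) (mset_set {..<d})"
    using unitary_schur[OF H] .
  have aU: "mat_adjoint U \<in> carrier_mat d d" using UB(1) by simp
  have HU: "mat_adjoint M * M * U = U * B"
    unfolding UB(5) by (rule unitary_conj_mult[OF UB(1,2,3)])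
  have "mat_adjoint U * (mat_adjoint M * M * U) = B"
    unfolding HU using assoc_mult_mat[OF aU UB(1,2)] UB(2,3) by simp
  moreover have "mat_adjoint U * (mat_adjoint M * M * U) = mat_adjoint (M * U) * (M * U)"
    unfolding mat_adjoint_mult[OF M UB(1)] using M aM UB(1) aU
    by (simp add: assoc_mult_mat[of _ d d _ d _ d] mult_carrier_mat[of _ d d _ d])
  ultimately have B: "B = mat_adjoint (M * U) * (M * U)" by simp
  have MU: "M * U \<in> carrier_mat d d" using M UB(1) by simp
  have Be: "B $$ (i, j) = (\<Sum>k<d. cnj ((M * U) $$ (k, i)) * (M * U) $$ (k, j))" if "i < d" "j < d" for i j
  proof -
    have "B $$ (i, j) = (\<Sum>k<d. mat_adjoint (M * U) $$ (i, k) * (M * U) $$ (k, j))"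
      unfolding B by (rule mat_mult_entry[of _ d d _ d]) (use MU that in auto)
    also have "\<dots> = (\<Sum>k<d. cnj ((M * U) $$ (k, i)) * (M * U) $$ (k, j))"
      using MU that M UB(1) by (intro sum.cong) auto
    finally show ?thesis .
  qed
  \<comment> \<open>Zero beyond \<open>d\<close>, so that nonnegativity holds at every index without
    a range condition.\<close>
  define b where "b = (\<lambda>i. if i < d then (\<Sum>k<d. (cmod ((M * U) $$ (k, i)))\<^sup>2) else 0)"
  have diag: "B $$ (i, i) = of_real (b i)" if "i < d" for i
    using that unfolding Be[OF that that] b_def by (simp add: mult.commute flip: complex_norm_square)
  have off: "B $$ (i, j) = 0" if "i < d" "j < d" "i \<noteq> j" for i j
  proof -
    have "B $$ (i, j) = cnj (B $$ (j, i))"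
      unfolding Be[OF that(1,2)] Be[OF that(2,1)] by (simp add: mult.commute)
    then show ?thesis
      using that UB(2,6) upper_triangularD[of B j i] upper_triangularD[of B i j] by (cases "i < j") auto
  qed
  have BD: "B = Matrix.mat d d (\<lambda>(i, j). if i = j then of_real (b i) else 0)"
    using UB(2) diag off by (intro eq_matI) auto
  have "singular_values M = image_mset (\<lambda>i. sqrt (b i)) (mset_set {..<d})"
    unfolding singular_values_def UB(7) image_mset.compositionality o_def
    using diag by (intro image_mset_cong) auto
  then show ?thesis
    using UB(1,3,4) HU BD by (intro exI[of _ U] exI[of _ b]) (simp add: b_def sum_nonneg)
qed

text \<open>\<open>R\<close> is the diagonal matrix of the numbers \<open>1 / (b k + s)\<close>
  conjugated by \<open>U\<close>; its trace is the sum of that diagonal because the columns of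
  \<open>U\<close> are unit vectors.\<close>

lemma resolvent_exists:
  assumes M: "M \<in> carrier_mat d d" and s: "0 < s"
  obtains R where "is_resolvent d (\<lambda>i j. M $$ (i, j)) s R" "(\<Sum>i<d. R i i) = of_real (rtr s M)"
proof -
  obtain U b where U: "U \<in> carrier_mat d d" "mat_adjoint U * U = 1\<^sub>m d" "U * mat_adjoint U = 1\<^sub>m d"
    and b: "\<forall>i. 0 \<le> b i"
    and HU: "mat_adjoint M * M * U = U * Matrix.mat d d (\<lambda>(i, j). if i = j then of_real (b i) else 0)"
    and sv: "singular_values M = image_mset (\<lambda>i. sqrt (b i)) (mset_set {..<d})"
    using gram_schur[OF M] by blast
  define R where "R = (\<lambda>i j. \<Sum>k<d. U $$ (i, k) * cnj (U $$ (j, k)) / of_real (b k + s))"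
  have bs: "b k + s \<noteq> 0" "complex_of_real (b k) + of_real s \<noteq> 0" for k
    using b[rule_format, of k] s by (auto simp flip: of_real_add)
  let ?M = "\<lambda>i j. M $$ (i, j)" and ?U = "\<lambda>i j. U $$ (i, j)"
  have eig: "mv d (adj ?M) (mv d ?M (mv d ?U w)) i = mv d ?U (\<lambda>k. of_real (b k) * w k) i" if i: "i < d" for w i
  proof -
    have c: "mat_adjoint M \<in> carrier_mat d d" "mat_adjoint M * M \<in> carrier_mat d d" using M by auto
    have "mv d (adj ?M) (mv d ?M (mv d ?U w)) i = mv d (\<lambda>i j. (mat_adjoint M * M * U) $$ (i, j)) w i"
      unfolding mv_mat_adjoint[OF M i] mv_mat_mult[OF c(1) M i] mv_mat_mult[OF c(2) U(1) i] ..
    also have "\<dots> = mv d ?U (mv d (\<lambda>i j. Matrix.mat d d (\<lambda>(i, j). if i = j then of_real (b i) else 0) $$ (i, j)) w) i"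
      unfolding HU by (rule mv_mat_mult[symmetric]) (use U i in auto)
    also have "\<dots> = mv d ?U (\<lambda>k. of_real (b k) * w k) i"
      by (rule mv_cong) (simp_all add: mv_def if_distrib[of "\<lambda>x. x * _"] cong: if_cong)
    finally show ?thesis .
  qed
  have Rv: "mv d R v = mv d ?U (\<lambda>k. (\<Sum>j<d. cnj (U $$ (j, k)) * v j) / of_real (b k + s))" for v
  proof
    fix i
    have "mv d R v i = (\<Sum>j<d. \<Sum>k<d. U $$ (i, k) * cnj (U $$ (j, k)) / of_real (b k + s) * v j)"
      by (simp add: mv_def R_def sum_distrib_right)
    also have "\<dots> = (\<Sum>k<d. \<Sum>j<d. U $$ (i, k) * cnj (U $$ (j, k)) / of_real (b k + s) * v j)"
      by (rule sum.swap)
    also have "\<dots> = mv d ?U (\<lambda>k. (\<Sum>j<d. cnj (U $$ (j, k)) * v j) / of_real (b k + s)) i"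
      by (simp add: mv_def sum_distrib_left sum_divide_distrib mult_ac)
    finally show "mv d R v i = mv d ?U (\<lambda>k. (\<Sum>j<d. cnj (U $$ (j, k)) * v j) / of_real (b k + s)) i" .
  qed
  have inv: "mv d (adj ?M) (mv d ?M (mv d R v)) i + of_real s * mv d R v i = v i" if i: "i < d" for v i
  proof -
    let ?w = "\<lambda>k. (\<Sum>j<d. cnj (U $$ (j, k)) * v j)"
    have "mv d (adj ?M) (mv d ?M (mv d R v)) i + of_real s * mv d R v i
        = mv d ?U (\<lambda>k. of_real (b k) * (?w k / of_real (b k + s)) + of_real s * (?w k / of_real (b k + s))) i"
      unfolding Rv eig[OF i] by (simp add: mv_def sum.distrib sum_distrib_left ring_distribs mult_ac)
    also have "\<dots> = mv d ?U ?w i"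
    proof (rule mv_cong, rule refl)
      fix k
      show "of_real (b k) * (?w k / of_real (b k + s)) + of_real s * (?w k / of_real (b k + s)) = ?w k"
        using bs(2)[of k] unfolding distrib_right[symmetric] by simp
    qed
    also have "\<dots> = (\<Sum>k<d. \<Sum>j<d. U $$ (i, k) * cnj (U $$ (j, k)) * v j)"
      by (simp add: mv_def sum_distrib_left mult.assoc)
    also have "\<dots> = (\<Sum>j<d. (\<Sum>k<d. U $$ (i, k) * cnj (U $$ (j, k))) * v j)"
      by (subst sum.swap) (simp add: sum_distrib_right)
    also have "\<dots> = (\<Sum>j<d. (if i = j then 1 else 0) * v j)"
      using unitary_rows[OF U(1,3) i] by (intro sum.cong) auto
    also have "\<dots> = v i" using i by (simp add: if_distrib[of "\<lambda>x. x * _"] cong: if_cong)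
    finally show ?thesis .
  qed
  have "R i j = cnj (R j i)" for i j
    by (simp add: R_def mult.commute)
  with inv have 1: "is_resolvent d ?M s R" unfolding is_resolvent_def by blast
  have "(\<Sum>i<d. R i i) = (\<Sum>k<d. (\<Sum>i<d. cnj (U $$ (i, k)) * U $$ (i, k)) / of_real (b k + s))"
    unfolding R_def by (subst sum.swap) (simp add: sum_divide_distrib mult.commute)
  also have "\<dots> = (\<Sum>k<d. of_real (1 / (b k + s)))"
    using unitary_cols[OF U(1,2)] by (intro sum.cong) auto
  also have "\<dots> = of_real (rtr s M)"
    unfolding rtr_def sv by (simp add: image_mset.compositionality o_def b sum_unfold_sum_mset)
  finally show ?thesis using that 1 by blast
qed

lemma rtr_perturb:
  assumes "M \<in> carrier_mat d d" "N \<in> carrier_mat d d" "1 \<le> s"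
  shows "\<bar>rtr s M - rtr s N\<bar> \<le> 2 * (\<Sum>i<d. \<Sum>j<d. cmod (M $$ (i, j) - N $$ (i, j)))"
proof -
  have s: "0 < s" using assms(3) by simp
  obtain R where R: "is_resolvent d (\<lambda>i j. M $$ (i, j)) s R" "(\<Sum>i<d. R i i) = of_real (rtr s M)"
    using resolvent_exists[OF assms(1) s] .
  obtain R' where R': "is_resolvent d (\<lambda>i j. N $$ (i, j)) s R'" "(\<Sum>i<d. R' i i) = of_real (rtr s N)"
    using resolvent_exists[OF assms(2) s] .
  show ?thesis
    using resolvent_trace_perturb[OF R(1) R'(1) assms(3)] unfolding R(2) R'(2)
    by (simp only: of_real_diff[symmetric] norm_of_real)
qed

section \<open>Real shifts and the Hermitian defect\<close>

definition shift_mat :: "real \<Rightarrow> complex mat \<Rightarrow> complex mat" where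
  "shift_mat t M = Matrix.mat (dim_row M) (dim_row M) (\<lambda>(i, j). M $$ (i, j) - (if i = j then of_real t else 0))"

lemma shift_mat_carrier [simp]: "M \<in> carrier_mat d d \<Longrightarrow> shift_mat t M \<in> carrier_mat d d"
  by (simp add: shift_mat_def)

lemma shift_mat_0: "M \<in> carrier_mat d d \<Longrightarrow> shift_mat 0 M = M"
  by (intro eq_matI) (auto simp: shift_mat_def)

lemma mv_shift_mat:
  assumes "M \<in> carrier_mat d d" "i < d"
  shows "mv d (\<lambda>i j. shift_mat t M $$ (i, j)) v i = mv d (\<lambda>i j. M $$ (i, j)) v i - of_real t * v i"
    and "mv d (adj (\<lambda>i j. shift_mat t M $$ (i, j))) v i = mv d (adj (\<lambda>i j. M $$ (i, j))) v i - of_real t * v i"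
proof -
  have *: "(\<Sum>j<d. (if i = j then of_real t else 0) * v j) = of_real t * v i"
    using assms(2) by (simp add: if_distrib[of "\<lambda>x. x * _"] cong: if_cong)
  have "mv d (\<lambda>i j. shift_mat t M $$ (i, j)) v i
      = (\<Sum>j<d. M $$ (i, j) * v j - (if i = j then of_real t else 0) * v j)"
    unfolding mv_def using assms by (intro sum.cong) (auto simp: shift_mat_def algebra_simps)
  then show "mv d (\<lambda>i j. shift_mat t M $$ (i, j)) v i = mv d (\<lambda>i j. M $$ (i, j)) v i - of_real t * v i"
    unfolding sum_subtractf * mv_def .
  have "mv d (adj (\<lambda>i j. shift_mat t M $$ (i, j))) v i
      = (\<Sum>j<d. cnj (M $$ (j, i)) * v j - (if i = j then of_real t else 0) * v j)"
    unfolding mv_def using assms by (intro sum.cong) (auto simp: shift_mat_def adj_def algebra_simps)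
  then show "mv d (adj (\<lambda>i j. shift_mat t M $$ (i, j))) v i = mv d (adj (\<lambda>i j. M $$ (i, j))) v i - of_real t * v i"
    unfolding sum_subtractf * by (simp add: mv_def adj_def)
qed

lemma sum_le_sqrt_card:
  fixes a :: "nat \<Rightarrow> real"
  assumes "(\<Sum>k<d. (a k)\<^sup>2) \<le> F"
  shows "(\<Sum>k<d. a k) \<le> sqrt (real d) * sqrt F"
proof -
  have "(\<Sum>k<d. a k) \<le> (\<Sum>k<d. \<bar>1\<bar> * \<bar>a k\<bar>)" by (intro sum_mono) auto
  also have "\<dots> \<le> L2_set (\<lambda>_. 1) {..<d} * L2_set a {..<d}" by (rule L2_set_mult_ineq)
  also have "\<dots> \<le> sqrt (real d) * sqrt F"
    using assms by (intro mult_mono) (auto simp: L2_set_def sum_nonneg)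
  finally show ?thesis .
qed

text \<open>The Hermitian defect \<open>S - S\<^sup>*\<close> controls both the imaginary parts of the eigenvalues and
  the strictly upper triangular part of a Schur form, so that the Schur vectors
  are approximate eigenvectors of \<open>S\<close> and of \<open>S\<^sup>*\<close>.\<close>

lemma eigenvalues_hermitian_defect:
  fixes S :: "complex mat"
  assumes S: "S \<in> carrier_mat d d" and s: "1 \<le> s"
  defines "F \<equiv> (\<Sum>i<d. \<Sum>j<d. (cmod (S $$ (i, j) - cnj (S $$ (j, i))))\<^sup>2)"
  shows "\<bar>rtr s (shift_mat t S) - (\<Sum>z\<in>#eigenvalues S. 1 / ((Re z - t)\<^sup>2 + s))\<bar> \<le> 2 * sqrt (real d) * sqrt F"
    and "(\<Sum>z\<in>#eigenvalues S. (Im z)\<^sup>2) \<le> F"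
proof -
  obtain U B where UB: "U \<in> carrier_mat d d" "B \<in> carrier_mat d d" "mat_adjoint U * U = 1\<^sub>m d"
    "U * mat_adjoint U = 1\<^sub>m d" "S = U * B * mat_adjoint U" "upper_triangular B"
    "eigenvalues S = image_mset (\<lambda>i. B $$ (i, i)) (mset_set {..<d})"
    using unitary_schur[OF S] .
  have aU: "mat_adjoint U \<in> carrier_mat d d" and aB: "mat_adjoint B \<in> carrier_mat d d"
    and aS: "mat_adjoint S \<in> carrier_mat d d" using UB S by auto
  let ?S = "\<lambda>i j. S $$ (i, j)" and ?U = "\<lambda>i j. U $$ (i, j)"
  define q where "q = (\<lambda>k i. U $$ (i, k))"
  have q: "q k = mv d ?U (unitv k)" if "k < d" for k
    using that by (simp add: q_def fun_eq_iff mv_unitv)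
  have SU: "S * U = U * B"
    unfolding UB(5) by (rule unitary_conj_mult[OF UB(1,2,3)])
  have "mat_adjoint S = U * mat_adjoint B * mat_adjoint U"
  proof -
    have "mat_adjoint S = mat_adjoint (mat_adjoint U) * (mat_adjoint B * mat_adjoint U)"
      unfolding UB(5) mat_adjoint_mult[OF mult_carrier_mat[OF UB(1,2)] aU] mat_adjoint_mult[OF UB(1,2)] ..
    also have "mat_adjoint (mat_adjoint U) = U"
      using UB(1) by (intro eq_matI) auto
    finally show ?thesis using assoc_mult_mat[OF UB(1) aB aU] by simp
  qed
  then have SaU: "mat_adjoint S * U = U * mat_adjoint B"
    using unitary_conj_mult[OF UB(1) aB UB(3)] by simp
  have Sq: "mv d ?S (q k) i = mv d ?U (\<lambda>l. B $$ (l, k)) i" if "k < d" "i < d" for k i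
  proof -
    have "mv d ?S (q k) i = mv d ?U (mv d (\<lambda>i j. B $$ (i, j)) (unitv k)) i"
      unfolding q[OF that(1)] mv_mat_mult[OF S UB(1) that(2)] mv_mat_mult[OF UB(1,2) that(2)] SU ..
    also have "\<dots> = mv d ?U (\<lambda>l. B $$ (l, k)) i"
      using that by (intro mv_cong) (auto simp: mv_unitv)
    finally show ?thesis .
  qed
  have Saq: "mv d (adj ?S) (q k) i = mv d ?U (\<lambda>l. cnj (B $$ (k, l))) i" if "k < d" "i < d" for k i
  proof -
    have "mv d (adj ?S) (q k) i = mv d ?U (mv d (\<lambda>i j. mat_adjoint B $$ (i, j)) (unitv k)) i"
      unfolding q[OF that(1)] mv_mat_adjoint[OF S that(2)] mv_mat_mult[OF aS UB(1) that(2)]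
        mv_mat_mult[OF UB(1) aB that(2)] SaU ..
    also have "\<dots> = mv d ?U (\<lambda>l. cnj (B $$ (k, l))) i"
      using that UB(2) by (intro mv_cong) (auto simp: mv_unitv)
    finally show ?thesis .
  qed
  have iso: "nrm d (mv d ?U e) = nrm d e" for e
    by (rule nrm_mv_isometry) (rule unitary_cols[OF UB(1,3)])
  have iso': "nrm d (mv d (\<lambda>k j. U $$ (j, k)) e) = nrm d e" for e
  proof (rule nrm_mv_isometry)
    fix j l assume "j < d" "l < d"
    then show "(\<Sum>k<d. cnj (U $$ (j, k)) * U $$ (l, k)) = (if j = l then 1 else 0)"
      using unitary_rows[OF UB(1,4), of l j] by (auto simp: mult.commute)
  qed
  \<comment> \<open>Unitary invariance of the Frobenius norm: up to the isometry \<open>U\<close>,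
    column \<open>k\<close> of \<open>B - B\<^sup>*\<close> is the image of \<open>q k\<close> under
    \<open>S - S\<^sup>*\<close>. Exchanging the sums leaves the rows of
    \<open>S - S\<^sup>*\<close>, on which the transpose of \<open>U\<close> is an isometry as
    well.\<close>
  have Fk: "(\<Sum>k<d. \<Sum>l<d. (cmod (B $$ (l, k) - cnj (B $$ (k, l))))\<^sup>2) = F"
  proof -
    let ?E = "\<lambda>i j. S $$ (i, j) - cnj (S $$ (j, i))"
    have "(\<Sum>l<d. (cmod (B $$ (l, k) - cnj (B $$ (k, l))))\<^sup>2) = (\<Sum>i<d. (cmod (mv d ?E (q k) i))\<^sup>2)" if k: "k < d" for k
    proof -
      have "(\<Sum>l<d. (cmod (B $$ (l, k) - cnj (B $$ (k, l))))\<^sup>2) = (nrm d (mv d ?U (\<lambda>l. B $$ (l, k) - cnj (B $$ (k, l)))))\<^sup>2"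
        unfolding iso nrm_sq ..
      also have "\<dots> = (nrm d (mv d ?E (q k)))\<^sup>2"
      proof (rule arg_cong[of _ _ "\<lambda>x. x\<^sup>2"], rule nrm_cong)
        fix i assume i: "i < d"
        have "mv d ?E (q k) i = mv d ?S (q k) i - mv d (adj ?S) (q k) i"
          unfolding mv_diff_left[symmetric] by (simp add: adj_def)
        then show "mv d ?U (\<lambda>l. B $$ (l, k) - cnj (B $$ (k, l))) i = mv d ?E (q k) i"
          unfolding mv_diff Sq[OF k i] Saq[OF k i] by simp
      qed
      finally show ?thesis unfolding nrm_sq .
    qed
    then have "(\<Sum>k<d. \<Sum>l<d. (cmod (B $$ (l, k) - cnj (B $$ (k, l))))\<^sup>2) = (\<Sum>k<d. \<Sum>i<d. (cmod (mv d ?E (q k) i))\<^sup>2)"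
      by (simp cong: sum.cong_simp)
    also have "\<dots> = (\<Sum>i<d. \<Sum>k<d. (cmod (mv d ?E (q k) i))\<^sup>2)" by (rule sum.swap)
    also have "\<dots> = (\<Sum>i<d. (nrm d (mv d (\<lambda>k j. U $$ (j, k)) (?E i)))\<^sup>2)"
      unfolding nrm_sq by (intro sum.cong refl) (simp add: mv_def q_def mult.commute)
    also have "\<dots> = F" unfolding iso' nrm_sq F_def ..
    finally show ?thesis .
  qed
  let ?\<delta> = "\<lambda>k l. if k = l then complex_of_real (Re (B $$ (k, k))) else 0"
  \<comment> \<open>Off the diagonal one of the two entries of the triangular \<open>B\<close> is
    zero, so nothing cancels in the difference; on the diagonal the difference is twice the
    imaginary part.\<close>
  have entry: "(cmod (B $$ (l, k) - ?\<delta> k l))\<^sup>2 \<le> (cmod (B $$ (l, k) - cnj (B $$ (k, l))))\<^sup>2"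
    if "l < d" "k < d" for l k
  proof (cases "k = l")
    case True
    then show ?thesis by (simp only: cmod_power2) (simp add: power2_eq_square)
  next
    case False
    then show ?thesis
      using that UB(2) upper_triangularD[OF UB(6), of k l] upper_triangularD[OF UB(6), of l k]
      by (cases "k < l") auto
  qed
  have "(\<Sum>z\<in>#eigenvalues S. (Im z)\<^sup>2) = (\<Sum>k<d. (Im (B $$ (k, k)))\<^sup>2)"
    unfolding UB(7) by (simp add: image_mset.compositionality o_def sum_unfold_sum_mset)
  also have "\<dots> \<le> (\<Sum>k<d. \<Sum>l<d. (cmod (B $$ (l, k) - cnj (B $$ (k, l))))\<^sup>2)"
  proof (intro sum_mono)
    fix k assume "k \<in> {..<d}"
    then have "(cmod (B $$ (k, k) - cnj (B $$ (k, k))))\<^sup>2 \<le> (\<Sum>l<d. (cmod (B $$ (l, k) - cnj (B $$ (k, l))))\<^sup>2)"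
      by (intro member_le_sum) auto
    then show "(Im (B $$ (k, k)))\<^sup>2 \<le> (\<Sum>l<d. (cmod (B $$ (l, k) - cnj (B $$ (k, l))))\<^sup>2)"
      by (rule order_trans[rotated]) (simp only: cmod_power2, simp add: power2_eq_square)
  qed
  finally show "(\<Sum>z\<in>#eigenvalues S. (Im z)\<^sup>2) \<le> F" unfolding Fk .
  have D: "(\<Sum>k<d. \<Sum>l<d. (cmod (B $$ (l, k) - ?\<delta> k l))\<^sup>2) \<le> F"
    unfolding Fk[symmetric] by (intro sum_mono entry) auto
  have s0: "0 < s" using s by simp
  let ?M = "\<lambda>i j. shift_mat t S $$ (i, j)"
  obtain R where R: "is_resolvent d ?M s R" "(\<Sum>i<d. R i i) = of_real (rtr s (shift_mat t S))"
    using resolvent_exists[OF shift_mat_carrier[OF S] s0] .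
  \<comment> \<open>The trace is computed in the orthonormal basis of Schur vectors.\<close>
  have tr: "(\<Sum>k<d. ip d (q k) (mv d R (q k))) = (\<Sum>i<d. R i i)"
  proof -
    have "(\<Sum>k<d. ip d (q k) (mv d R (q k))) = (\<Sum>k<d. \<Sum>i<d. \<Sum>j<d. R i j * (U $$ (j, k) * cnj (U $$ (i, k))))"
      by (simp add: ip_def mv_def q_def sum_distrib_left mult_ac)
    also have "\<dots> = (\<Sum>i<d. \<Sum>j<d. R i j * (\<Sum>k<d. U $$ (j, k) * cnj (U $$ (i, k))))"
      unfolding sum_distrib_left by (subst sum.swap) (intro sum.cong refl sum.swap)
    also have "\<dots> = (\<Sum>i<d. \<Sum>j<d. R i j * (if j = i then 1 else 0))"
      using unitary_rows[OF UB(1,4)] by (intro sum.cong) auto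
    also have "\<dots> = (\<Sum>i<d. R i i)"
      by (intro sum.cong refl) (simp add: if_distrib[of "\<lambda>x. _ * x"] cong: if_cong)
    finally show ?thesis .
  qed
  \<comment> \<open>A real value serves \<open>S\<close> and \<open>S\<^sup>*\<close> alike, and it
    makes the main term the test function at the real part of the eigenvalue. The residuals
    \<open>a\<close> and \<open>a'\<close> are the norms of column and row \<open>k\<close> of
    \<open>B\<close> after subtraction of the real diagonal.\<close>
  define \<kappa> where "\<kappa> = (\<lambda>k. complex_of_real (Re (B $$ (k, k)) - t))"
  define a where "a = (\<lambda>k. nrm d (\<lambda>i. mv d ?M (q k) i - \<kappa> k * q k i))"
  define a' where "a' = (\<lambda>k. nrm d (\<lambda>i. mv d (adj ?M) (q k) i - cnj (\<kappa> k) * q k i))"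
  have nq: "nrm d (q k) = 1" if "k < d" for k
    using that by (simp add: q iso nrm_unitv)
  have qd: "c * q k i = mv d ?U (\<lambda>l. if k = l then c else 0) i" if "k < d" for c k i
    using that by (simp add: mv_def q_def if_distrib[of "\<lambda>x. _ * x"] mult.commute cong: if_cong)
  have a: "a k = nrm d (\<lambda>l. B $$ (l, k) - ?\<delta> k l)" if k: "k < d" for k
  proof -
    have "a k = nrm d (mv d ?U (\<lambda>l. B $$ (l, k) - ?\<delta> k l))"
      unfolding a_def
    proof (rule nrm_cong)
      fix i assume i: "i < d"
      show "mv d ?M (q k) i - \<kappa> k * q k i = mv d ?U (\<lambda>l. B $$ (l, k) - ?\<delta> k l) i"
        unfolding mv_diff mv_shift_mat(1)[OF S i] Sq[OF k i] qd[OF k, symmetric] by (simp add: \<kappa>_def algebra_simps)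
    qed
    then show ?thesis unfolding iso .
  qed
  have a': "a' k = nrm d (\<lambda>l. cnj (B $$ (k, l)) - ?\<delta> k l)" if k: "k < d" for k
  proof -
    have "a' k = nrm d (mv d ?U (\<lambda>l. cnj (B $$ (k, l)) - ?\<delta> k l))"
      unfolding a'_def
    proof (rule nrm_cong)
      fix i assume i: "i < d"
      show "mv d (adj ?M) (q k) i - cnj (\<kappa> k) * q k i = mv d ?U (\<lambda>l. cnj (B $$ (k, l)) - ?\<delta> k l) i"
        unfolding mv_diff mv_shift_mat(2)[OF S i] Saq[OF k i] qd[OF k, symmetric] by (simp add: \<kappa>_def algebra_simps)
    qed
    then show ?thesis unfolding iso .
  qed
  have "(\<Sum>k<d. (a k)\<^sup>2) \<le> F"
    using D by (simp add: a nrm_sq)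
  then have suma: "(\<Sum>k<d. a k) \<le> sqrt (real d) * sqrt F" by (rule sum_le_sqrt_card)
  have "(\<Sum>k<d. (a' k)\<^sup>2) = (\<Sum>k<d. \<Sum>l<d. (cmod (B $$ (k, l) - ?\<delta> l k))\<^sup>2)"
  proof (intro sum.cong refl)
    fix k assume "k \<in> {..<d}"
    moreover have "cmod (cnj (B $$ (k, l)) - ?\<delta> k l) = cmod (B $$ (k, l) - ?\<delta> l k)" for l
    proof -
      have "cnj (B $$ (k, l)) - ?\<delta> k l = cnj (B $$ (k, l) - ?\<delta> l k)" by simp
      then show ?thesis by (simp only: complex_mod_cnj)
    qed
    ultimately show "(a' k)\<^sup>2 = (\<Sum>l<d. (cmod (B $$ (k, l) - ?\<delta> l k))\<^sup>2)"
      by (simp add: a' nrm_sq)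
  qed
  also have "\<dots> = (\<Sum>k<d. \<Sum>l<d. (cmod (B $$ (l, k) - ?\<delta> k l))\<^sup>2)" by (rule sum.swap)
  finally have "(\<Sum>k<d. (a' k)\<^sup>2) \<le> F" using D by simp
  then have suma': "(\<Sum>k<d. a' k) \<le> sqrt (real d) * sqrt F" by (rule sum_le_sqrt_card)
  have ev: "(\<Sum>z\<in>#eigenvalues S. 1 / ((Re z - t)\<^sup>2 + s)) = (\<Sum>k<d. 1 / ((cmod (\<kappa> k))\<^sup>2 + s))"
    unfolding UB(7) by (simp add: image_mset.compositionality o_def sum_unfold_sum_mset \<kappa>_def norm_of_real del: of_real_diff)
  have "complex_of_real (rtr s (shift_mat t S) - (\<Sum>z\<in>#eigenvalues S. 1 / ((Re z - t)\<^sup>2 + s)))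
      = (\<Sum>k<d. ip d (q k) (mv d R (q k)) - of_real ((nrm d (q k))\<^sup>2 / ((cmod (\<kappa> k))\<^sup>2 + s)))"
    unfolding ev of_real_diff R(2)[symmetric] tr[symmetric] sum_subtractf by (simp add: nq)
  from arg_cong[OF this, of cmod] have "\<bar>rtr s (shift_mat t S) - (\<Sum>z\<in>#eigenvalues S. 1 / ((Re z - t)\<^sup>2 + s))\<bar>
      = cmod (\<Sum>k<d. ip d (q k) (mv d R (q k)) - of_real ((nrm d (q k))\<^sup>2 / ((cmod (\<kappa> k))\<^sup>2 + s)))"
    by (simp only: norm_of_real)
  also have "\<dots> \<le> (\<Sum>k<d. a k + a' k)"
  proof (rule order_trans[OF norm_sum], rule sum_mono)
    fix k assume "k \<in> {..<d}"
    then show "cmod (ip d (q k) (mv d R (q k)) - of_real ((nrm d (q k))\<^sup>2 / ((cmod (\<kappa> k))\<^sup>2 + s))) \<le> a k + a' k"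
      using quasimode[OF R(1) s, of "q k" "\<kappa> k"] by (simp add: nq a_def a'_def)
  qed
  also have "\<dots> \<le> 2 * sqrt (real d) * sqrt F"
    unfolding sum.distrib using suma suma' by simp
  finally show "\<bar>rtr s (shift_mat t S) - (\<Sum>z\<in>#eigenvalues S. 1 / ((Re z - t)\<^sup>2 + s))\<bar> \<le> 2 * sqrt (real d) * sqrt F" .
qed

section \<open>From resolvents to compactly supported test functions\<close>

text \<open>Convergence of the empirical distributions of \<open>X n\<close> to the law of
  \<open>g\<close> under the normalised measure \<open>M\<close>. It is used for the singular values
  with the modulus of the symbol, and for the real parts of the eigenvalues with the real part of
  the symbol. Nonemptiness is asked only eventually, since a coarse grid may have no admissible
  point.\<close>

locale empirical =
  fixes M :: "'a measure" and X :: "nat \<Rightarrow> real multiset" and g :: "'a \<Rightarrow> real"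
  assumes finite_M: "finite_measure M" and g_meas [measurable]: "g \<in> borel_measurable M"
    and pos_M: "0 < measure M (space M)" and X_ne: "\<forall>\<^sub>F n in sequentially. X n \<noteq> {#}"
begin

definition avg :: "nat \<Rightarrow> (real \<Rightarrow> real) \<Rightarrow> real" where
  "avg n F = (\<Sum>x\<in>#X n. F x) / real (size (X n))"

definition mean :: "(real \<Rightarrow> real) \<Rightarrow> real" where
  "mean F = (LINT x|M. F (g x)) / measure M (space M)"

text \<open>With measurability and boundedness built in, linear combinations of such test functions
  raise no questions of integrability.\<close>

definition conv :: "(real \<Rightarrow> real) \<Rightarrow> bool" where
  "conv F \<longleftrightarrow> F \<in> borel_measurable borel \<and> bounded (range F) \<and> (\<lambda>n. avg n F) \<longlonglongrightarrow> mean F"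

lemma integrable_comp:
  fixes F :: "real \<Rightarrow> real"
  assumes "F \<in> borel_measurable borel" "bounded (range F)"
  shows "integrable M (\<lambda>x. F (g x))"
proof -
  obtain B where "\<And>x. norm (F x) \<le> B" using assms(2) unfolding bounded_iff by auto
  note B = this
  show ?thesis
    by (rule finite_measure.integrable_const_bound[OF finite_M, where B = B])
       (use assms(1) B g_meas in \<open>auto intro: measurable_compose\<close>)
qed

lemma avg_add: "avg n (\<lambda>x. F x + G x) = avg n F + avg n G"
  by (simp add: avg_def sum_mset.distrib add_divide_distrib)

lemma avg_cmult: "avg n (\<lambda>x. c * F x) = c * avg n F"
  by (simp add: avg_def sum_mset_distrib_left image_mset.compositionality o_def)

lemma conv_cmult: "conv F \<Longrightarrow> conv (\<lambda>x. c * F x)"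
proof -
  assume F: "conv F"
  have "bounded (range (\<lambda>x. c * F x))"
    using bounded_scaling[of "range F" c] F by (auto simp: conv_def image_image)
  moreover have "mean (\<lambda>x. c * F x) = c * mean F" by (simp add: mean_def)
  ultimately show ?thesis
    using F unfolding conv_def avg_cmult by (auto intro!: tendsto_mult_left)
qed

lemma conv_add: "conv F \<Longrightarrow> conv G \<Longrightarrow> conv (\<lambda>x. F x + G x)"
proof -
  assume F: "conv F" and G: "conv G"
  have "mean (\<lambda>x. F x + G x) = mean F + mean G"
    using F G integrable_comp[of F] integrable_comp[of G]
    by (simp add: mean_def conv_def add_divide_distrib)
  moreover have "bounded (range (\<lambda>x. F x + G x))"
    using F G by (intro bounded_plus_comp) (auto simp: conv_def)
  ultimately show ?thesis
    using F G unfolding conv_def avg_add by (auto intro!: tendsto_add)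
qed

lemma conv_diff: "conv F \<Longrightarrow> conv G \<Longrightarrow> conv (\<lambda>x. F x - G x)"
  using conv_add[OF _ conv_cmult[of G "-1"], of F] by simp

lemma conv_0: "conv (\<lambda>_. 0)"
  by (simp add: conv_def avg_def mean_def)

lemma conv_1: "conv (\<lambda>_. 1)"
proof -
  have "\<forall>\<^sub>F n in sequentially. avg n (\<lambda>_. 1) = 1"
    using X_ne by eventually_elim (simp add: avg_def size_eq_0_iff_empty)
  moreover have "mean (\<lambda>_. 1) = 1" using pos_M by (simp add: mean_def)
  ultimately show ?thesis by (simp add: conv_def tendsto_eventually)
qed

lemma conv_sum: "finite A \<Longrightarrow> (\<And>a. a \<in> A \<Longrightarrow> conv (F a)) \<Longrightarrow> conv (\<lambda>x. \<Sum>a\<in>A. F a x)"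
  by (induction A rule: finite_induct) (auto intro: conv_0 conv_add)

lemma avg_diff_le:
  assumes "\<And>x. \<bar>F x - G x\<bar> \<le> H x"
  shows "\<bar>avg n F - avg n G\<bar> \<le> avg n H"
proof -
  have "\<bar>(\<Sum>x\<in>#A. F x) - (\<Sum>x\<in>#A. G x)\<bar> \<le> (\<Sum>x\<in>#A. H x)" for A :: "real multiset"
  proof (induction A)
    case (add x A)
    then show ?case using assms[of x] by simp
  qed simp
  then show ?thesis
    by (simp add: avg_def divide_right_mono flip: diff_divide_distrib)
qed

text \<open>Only an inequality, because the average over an empty multiset is zero.\<close>

lemma avg_const_le: "0 \<le> e \<Longrightarrow> avg n (\<lambda>_. e) \<le> e"
  by (cases "size (X n) = 0") (auto simp: avg_def)

lemma mean_diff_le: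
  assumes "\<And>x. \<bar>F x - G x\<bar> \<le> H x"
    and "F \<in> borel_measurable borel" "bounded (range F)" "G \<in> borel_measurable borel" "bounded (range G)"
    and "H \<in> borel_measurable borel" "bounded (range H)"
  shows "\<bar>mean F - mean G\<bar> \<le> mean H"
proof -
  note i = integrable_comp[OF assms(2,3)] integrable_comp[OF assms(4,5)] integrable_comp[OF assms(6,7)]
  have "\<bar>(LINT x|M. F (g x)) - (LINT x|M. G (g x))\<bar> = \<bar>LINT x|M. F (g x) - G (g x)\<bar>"
    using i by simp
  also have "\<dots> \<le> (LINT x|M. \<bar>F (g x) - G (g x)\<bar>)" by (rule integral_abs_bound)
  also have "\<dots> \<le> (LINT x|M. H (g x))"
    using i assms(1) by (intro integral_mono) auto
  finally show ?thesis
    using pos_M by (simp add: mean_def divide_right_mono flip: diff_divide_distrib)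
qed

lemma conv_uniform_limit:
  assumes F: "F \<in> borel_measurable borel"
    and approx: "\<And>e. 0 < e \<Longrightarrow> \<exists>G. conv G \<and> (\<forall>x. \<bar>F x - G x\<bar> \<le> e)"
  shows "conv F"
proof -
  obtain G0 where G0: "conv G0" "\<And>x. \<bar>F x - G0 x\<bar> \<le> 1" using approx[of 1] by auto
  obtain B where B: "\<And>x. norm (G0 x) \<le> B" using G0(1) unfolding conv_def bounded_iff by auto
  have bF: "bounded (range F)"
    unfolding bounded_iff
  proof (intro exI ballI)
    fix y assume "y \<in> range F"
    then obtain x where "y = F x" by blast
    then show "norm y \<le> B + 1" using B[of x] G0(2)[of x] by (simp add: abs_le_iff)
  qed
  have "(\<lambda>n. avg n F) \<longlonglongrightarrow> mean F"
  proof (rule LIMSEQ_I)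
    fix r :: real assume r: "0 < r"
    obtain G where G: "conv G" "\<And>x. \<bar>F x - G x\<bar> \<le> r / 4" using approx[of "r / 4"] r by auto
    obtain N where N: "\<And>n. n \<ge> N \<Longrightarrow> norm (avg n G - mean G) < r / 4"
      using LIMSEQ_D[of "\<lambda>n. avg n G" "mean G" "r / 4"] G(1) r by (auto simp: conv_def)
    have "\<bar>mean F - mean G\<bar> \<le> mean (\<lambda>_. r / 4)"
      by (rule mean_diff_le) (use G F bF in \<open>auto simp: conv_def\<close>)
    also have "\<dots> = r / 4" using pos_M by (simp add: mean_def)
    finally have m: "\<bar>mean F - mean G\<bar> \<le> r / 4" .
    have "norm (avg n F - mean F) < r" if "n \<ge> N" for n
    proof -
      have "\<bar>avg n F - avg n G\<bar> \<le> r / 4"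
        using avg_diff_le[of F G "\<lambda>_. r / 4" n] avg_const_le[of "r / 4" n] G(2) r by force
      then show ?thesis using N[OF that] m r unfolding real_norm_def by linarith
    qed
    then show "\<exists>N. \<forall>n\<ge>N. norm (avg n F - mean F) < r" by blast
  qed
  then show ?thesis using F bF by (simp add: conv_def)
qed

text \<open>Powers of \<open>u = 1 / (h\<^sup>2 + 1)\<close> are reached by difference quotients in \<open>s\<close> at \<open>s = 1\<close>, and
  polynomials in \<open>u\<close> without constant term are dense by Weierstrass' theorem.\<close>

context
  fixes h :: "real \<Rightarrow> real"
  assumes h [measurable]: "h \<in> borel_measurable borel"
    and base: "\<And>s. 1 \<le> s \<Longrightarrow> s < 2 \<Longrightarrow> conv (\<lambda>x. 1 / ((h x)\<^sup>2 + s))"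
begin

definition u :: "real \<Rightarrow> real" where "u x = 1 / ((h x)\<^sup>2 + 1)"

lemma u_bounds: "0 < u x" "u x \<le> 1"
  by (auto simp: u_def add_nonneg_pos divide_le_eq)

lemma u_meas [measurable]: "u \<in> borel_measurable borel"
  unfolding u_def[abs_def] by measurable

lemma conv_power_u: "conv (\<lambda>x. u x ^ Suc j)"
proof (induction j rule: less_induct)
  case (less j)
  show ?case
  proof (rule conv_uniform_limit)
    fix e :: real assume e: "0 < e"
    define \<eta> where "\<eta> = min e (1/2)"
    have \<eta>: "0 < \<eta>" "\<eta> \<le> e" "\<eta> < 1" using e by (auto simp: \<eta>_def)
    \<comment> \<open>From \<open>1 / (h\<^sup>2 + 1 + \<eta>) = u / (1 + \<eta> u)\<close> the
      first \<open>j\<close> terms of the geometric series, known by induction, are subtracted. The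
      remainder divided by \<open>(-\<eta>) ^ j\<close> is
      \<open>u ^ Suc j / (1 + \<eta> u)\<close>, within \<open>\<eta>\<close> of the power sought;
      \<open>\<eta> < 1\<close> keeps the parameter below 2.\<close>
    define G where "G = (\<lambda>x. (1 / (-\<eta>) ^ j) * (1 / ((h x)\<^sup>2 + (1 + \<eta>)) - (\<Sum>i<j. (-\<eta>) ^ i * u x ^ Suc i)))"
    have "conv G"
      unfolding G_def using \<eta> by (intro conv_cmult conv_diff conv_sum base less.IH) auto
    moreover have "\<bar>u x ^ Suc j - G x\<bar> \<le> e" for x
    proof -
      define r where "r = - \<eta> * u x"
      have r: "1 - r > 0" "\<bar>r\<bar> \<le> \<eta>" "r \<le> 0"
        using u_bounds[of x] \<eta> mult_left_mono[OF u_bounds(2)[of x], of \<eta>]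
        by (auto simp: r_def abs_mult zero_le_mult_iff intro: add_pos_nonneg)
      have "1 / ((h x)\<^sup>2 + (1 + \<eta>)) = u x / (1 - r)"
      proof -
        have "(h x)\<^sup>2 + 1 > 0" "(h x)\<^sup>2 + (1 + \<eta>) > 0" using \<eta> by (auto simp: add_nonneg_pos)
        then show ?thesis by (simp add: r_def u_def field_simps)
      qed
      also have "\<dots> = u x * ((\<Sum>i<j. r ^ i) + r ^ j / (1 - r))"
      proof -
        have "1 / (1 - r) = (\<Sum>i<j. r ^ i) + r ^ j / (1 - r)"
          using r one_diff_power_eq[of r j] by (simp add: field_simps)
        then show ?thesis by (metis times_divide_eq_right mult.right_neutral)
      qed
      also have "\<dots> = (\<Sum>i<j. (-\<eta>) ^ i * u x ^ Suc i) + (-\<eta>) ^ j * (u x ^ Suc j / (1 - r))"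
      proof -
        have "r ^ i = (-\<eta>) ^ i * u x ^ i" for i unfolding r_def by (rule power_mult_distrib)
        then show ?thesis by (simp add: sum_distrib_left distrib_left mult.left_commute)
      qed
      finally have "G x = u x ^ Suc j / (1 - r)"
        using \<eta> by (simp add: G_def)
      then have "u x ^ Suc j - G x = u x ^ Suc j * (- r) / (1 - r)"
        using r by (simp add: field_simps)
      also have "\<bar>\<dots>\<bar> = u x ^ Suc j * (\<bar>r\<bar> / (1 - r))"
        using r u_bounds[of x] divide_nonpos_pos[of r "1 - r"] by (simp add: abs_mult)
      also have "\<dots> \<le> 1 * (\<bar>r\<bar> / 1)"
        using r u_bounds[of x] by (intro mult_mono power_le_one divide_left_mono) (use r in \<open>auto intro: less_imp_le divide_nonpos_pos\<close>)
      finally show ?thesis using r \<eta> by simp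
    qed
    ultimately show "\<exists>G. conv G \<and> (\<forall>x. \<bar>u x ^ Suc j - G x\<bar> \<le> e)" by blast
  qed measurable
qed

text \<open>Each factor \<open>1 - u\<close> is resolved into a difference; the extra power of
  \<open>u\<close> keeps the products free of a constant term.\<close>

lemma conv_power_u_bernstein: "conv (\<lambda>x. u x ^ Suc k * (1 - u x) ^ l)"
proof (induction l arbitrary: k)
  case 0
  then show ?case using conv_power_u[of k] by simp
next
  case (Suc l)
  have "conv (\<lambda>x. u x ^ Suc k * (1 - u x) ^ l - u x ^ Suc (Suc k) * (1 - u x) ^ l)"
    by (intro conv_diff Suc)
  then show ?case by (simp add: algebra_simps)
qed

text \<open>\<open>F \<bar>h\<bar>\<close> equals \<open>u * \<phi> u\<close> with
  \<open>\<phi>\<close> continuous on the unit interval. Bernstein polynomials approximate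
  \<open>\<phi>\<close> uniformly, and multiplication by \<open>u \<le> 1\<close> keeps the error
  and produces only powers covered above.\<close>

lemma conv_abs_compact:
  assumes F: "continuous_on UNIV F" and supp: "\<And>x. K < \<bar>x\<bar> \<Longrightarrow> F x = 0"
  shows "conv (\<lambda>x. F \<bar>h x\<bar>)"
proof (rule conv_uniform_limit)
  have [measurable]: "F \<in> borel_measurable borel" by (rule borel_measurable_continuous_onI[OF F])
  show "(\<lambda>x. F \<bar>h x\<bar>) \<in> borel_measurable borel" by measurable
  fix e :: real assume e: "0 < e"
  define L where "L = \<bar>K\<bar> + 1"
  have L: "L > 0" "F L = 0" using supp[of L] by (auto simp: L_def)
  \<comment> \<open>The value of \<open>u\<close> at \<open>\<bar>h\<bar> = L\<close>. For smaller
    values of \<open>u\<close> the modulus exceeds \<open>L > K\<close> and \<open>F\<close>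
    vanishes, so freezing the argument of \<open>\<phi>\<close> at \<open>v0\<close> removes the
    singularity at zero without changing the product.\<close>
  define v0 where "v0 = 1 / (1 + L\<^sup>2)"
  have v0: "0 < v0" "v0 < 1" using L by (auto simp: v0_def add_pos_nonneg)
  define \<phi> where "\<phi> = (\<lambda>v. F (sqrt (1 / max v v0 - 1)) / max v v0)"
  have mx: "max v v0 \<noteq> 0" for v using v0 by (auto simp: max_def)
  have "continuous_on {0..1} \<phi>"
    unfolding \<phi>_def
    by (intro continuous_intros continuous_on_compose2[OF F]) (use mx in auto)
  then obtain N where N: "\<And>v. v \<in> {0..1} \<Longrightarrow> \<bar>\<phi> v - (\<Sum>k\<le>N. \<phi> (real k / real N) * Bernstein N k v)\<bar> < e"
    using Bernstein_Weierstrass[of \<phi> e] e by blast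
  define G where "G = (\<lambda>x. \<Sum>k\<le>N. (\<phi> (real k / real N) * real (N choose k)) * (u x ^ Suc k * (1 - u x) ^ (N - k)))"
  have "conv G"
    unfolding G_def by (intro conv_sum conv_cmult conv_power_u_bernstein) auto
  moreover have "\<bar>F \<bar>h x\<bar> - G x\<bar> \<le> e" for x
  proof -
    have "G x = u x * (\<Sum>k\<le>N. \<phi> (real k / real N) * Bernstein N k (u x))"
      unfolding G_def sum_distrib_left by (intro sum.cong refl) (simp add: Bernstein_def algebra_simps)
    moreover have "F \<bar>h x\<bar> = u x * \<phi> (u x)"
    proof (cases "v0 \<le> u x")
      case True
      have "1 / u x - 1 = (h x)\<^sup>2" by (simp add: u_def)
      then show ?thesis using True u_bounds(1)[of x] by (simp add: \<phi>_def max_def)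
    next
      case False
      have "L\<^sup>2 < (h x)\<^sup>2"
      proof (rule ccontr)
        assume "\<not> L\<^sup>2 < (h x)\<^sup>2"
        then have "v0 \<le> u x"
          unfolding v0_def u_def
          by (intro divide_left_mono mult_pos_pos) (auto intro: add_nonneg_pos add_pos_nonneg simp del: power2_less_eq_zero_iff)
        with False show False by simp
      qed
      then have "L < \<bar>h x\<bar>"
        using power2_less_imp_less[of L "\<bar>h x\<bar>"] by simp
      then have "K < \<bar>h x\<bar>" unfolding L_def by linarith
      moreover have "sqrt (1 / v0 - 1) = L" using L by (simp add: v0_def)
      ultimately show ?thesis using False L supp[of "\<bar>h x\<bar>"] by (simp add: \<phi>_def max_def)
    qed
    ultimately have "\<bar>F \<bar>h x\<bar> - G x\<bar> = u x * \<bar>\<phi> (u x) - (\<Sum>k\<le>N. \<phi> (real k / real N) * Bernstein N k (u x))\<bar>"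
      using u_bounds(1)[of x] by (simp add: abs_mult flip: right_diff_distrib)
    also have "\<dots> \<le> 1 * e"
      using u_bounds[of x] N[of "u x"] by (intro mult_mono) auto
    finally show ?thesis by simp
  qed
  ultimately show "\<exists>G. conv G \<and> (\<forall>x. \<bar>F \<bar>h x\<bar> - G x\<bar> \<le> e)" by blast
qed

end

text \<open>A function supported in \<open>[-K, K]\<close> is seen through \<open>\<bar>x - t\<bar>\<close> for \<open>t\<close> far to the left, up to its
  reflection at \<open>t\<close>, which only charges the tail of the distribution.\<close>

lemma conv_compact:
  assumes base: "\<And>s t. 1 \<le> s \<Longrightarrow> s < 2 \<Longrightarrow> conv (\<lambda>x. 1 / ((x - t)\<^sup>2 + s))"
    and F: "continuous_on UNIV F" and supp: "\<And>x. K < \<bar>x\<bar> \<Longrightarrow> F x = 0"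
  shows "conv F"
proof -
  have Fm [measurable]: "F \<in> borel_measurable borel" by (rule borel_measurable_continuous_onI[OF F])
  have abs: "conv (\<lambda>x. G \<bar>x - t\<bar>)" if "continuous_on UNIV G" "\<And>x. K' < \<bar>x\<bar> \<Longrightarrow> G x = 0" for G :: "real \<Rightarrow> real" and K' t
    by (rule conv_abs_compact[of "\<lambda>x. x - t"]) (use base that in auto)
  have "compact (F ` {-\<bar>K\<bar>..\<bar>K\<bar>})"
    by (rule compact_continuous_image) (use F in \<open>auto intro: continuous_on_subset\<close>)
  then have "bounded (F ` {-\<bar>K\<bar>..\<bar>K\<bar>})" by (rule compact_imp_bounded)
  then obtain B where "\<forall>y\<in>F ` {-\<bar>K\<bar>..\<bar>K\<bar>}. norm y \<le> B"
    unfolding bounded_iff by blast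
  then have B: "\<And>x. x \<in> {-\<bar>K\<bar>..\<bar>K\<bar>} \<Longrightarrow> \<bar>F x\<bar> \<le> B" by simp
  have Bx: "\<bar>F x\<bar> \<le> \<bar>B\<bar>" for x
    using B[of x] supp[of x] by (cases "x \<in> {-\<bar>K\<bar>..\<bar>K\<bar>}") (auto simp: abs_if split: if_splits)
  have bF: "bounded (range F)" unfolding bounded_iff using Bx by auto
  define cut where "cut = (\<lambda>T (r::real). max 0 (min 1 (T + 1 - \<bar>r\<bar>)))"
  \<comment> \<open>A continuous stand-in for the indicator of large \<open>\<bar>x\<bar>\<close>.
    As 1 minus an even function of compact support it is already a convergent test function, so the
    tails of the averages are controlled by the tail of the limit law.\<close>
  define \<psi> where "\<psi> = (\<lambda>T r. 1 - cut T r)"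
  have \<psi>b: "0 \<le> \<psi> T r" "\<psi> T r \<le> 1" for T r by (auto simp: \<psi>_def cut_def)
  have conv\<psi>: "conv (\<psi> T)" for T
  proof -
    have "conv (\<lambda>x. cut T \<bar>x - 0\<bar>)"
      by (rule abs[of _ "\<bar>T\<bar> + 1"]) (auto simp: cut_def intro!: continuous_intros)
    then have "conv (\<lambda>x. 1 - cut T x)" by (intro conv_diff conv_1) (simp add: cut_def)
    then show ?thesis by (simp add: \<psi>_def[abs_def])
  qed
  have tail: "(\<lambda>T. mean (\<psi> (real T))) \<longlonglongrightarrow> 0"
  proof -
    have "(\<lambda>T. LINT x|M. \<psi> (real T) (g x)) \<longlonglongrightarrow> (LINT x|M. 0)"
    proof (rule integral_dominated_convergence[where w = "\<lambda>_. 1"])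
      show "AE x in M. (\<lambda>T. \<psi> (real T) (g x)) \<longlonglongrightarrow> 0"
      proof (intro AE_I2 tendsto_eventually)
        fix x
        show "\<forall>\<^sub>F T in sequentially. \<psi> (real T) (g x) = 0"
          using eventually_gt_at_top[of "nat \<lceil>\<bar>g x\<bar>\<rceil>"]
          by eventually_elim (simp add: \<psi>_def cut_def, linarith)
      qed
    qed (use \<psi>b conv\<psi> finite_measure.emeasure_finite[OF finite_M] in
        \<open>auto simp: conv_def less_top finite_measure.integrable_const[OF finite_M]
          intro!: measurable_compose[OF g_meas]\<close>)
    then show ?thesis using tendsto_divide[of _ 0 sequentially "\<lambda>_. measure M (space M)" "measure M (space M)"] pos_M
      by (simp add: mean_def)
  qed
  have "(\<lambda>n. avg n F) \<longlonglongrightarrow> mean F"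
  proof (rule LIMSEQ_I)
    fix r :: real assume r: "0 < r"
    define e where "e = r / (4 * (\<bar>B\<bar> + 1))"
    have e: "0 < e" "\<bar>B\<bar> * e \<le> r / 4" using r by (auto simp: e_def field_simps)
    obtain T0 where T0: "\<And>T. T \<ge> T0 \<Longrightarrow> norm (mean (\<psi> (real T)) - 0) < e / 2"
      using LIMSEQ_D[OF tail, of "e / 2"] e by auto
    define T where "T = T0 + nat \<lceil>\<bar>K\<bar>\<rceil>"
    have T: "mean (\<psi> (real T)) < e / 2" "\<bar>K\<bar> \<le> real T"
      using T0[of T] by (auto simp: T_def) linarith
    \<comment> \<open>Left of this \<open>t\<close> the function \<open>F\<close> vanishes and
      \<open>\<psi>\<close> equals 1, so the reflected copy of \<open>F\<close> contained in
      \<open>G\<close> is dominated by a multiple of \<open>\<psi>\<close>.\<close>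
    define t where "t = - (real T + \<bar>K\<bar> + 2)"
    define G where "G = (\<lambda>x. F (t + \<bar>x - t\<bar>))"
    have G: "conv G"
      unfolding G_def
      by (rule abs[of "\<lambda>r. F (t + r)" "\<bar>K\<bar> + \<bar>t\<bar>"])
         (use supp in \<open>auto intro!: continuous_on_compose2[OF F] continuous_intros\<close>)
    have GF: "\<bar>F x - G x\<bar> \<le> \<bar>B\<bar> * \<psi> (real T) x" for x
    proof (cases "t \<le> x")
      case True
      then show ?thesis using \<psi>b by (simp add: G_def)
    next
      case False
      then have "F x = 0" "\<psi> (real T) x = 1"
        using supp[of x] T(2) by (auto simp: t_def \<psi>_def cut_def)
      then show ?thesis using Bx by (simp add: G_def)
    qed
    have \<psi>T: "conv (\<lambda>x. \<bar>B\<bar> * \<psi> (real T) x)" by (intro conv_cmult conv\<psi>)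
    have "mean (\<lambda>x. \<bar>B\<bar> * \<psi> (real T) x) = \<bar>B\<bar> * mean (\<psi> (real T))" by (simp add: mean_def)
    also have "\<dots> \<le> \<bar>B\<bar> * (e / 2)" using T(1) by (intro mult_left_mono) auto
    finally have m: "mean (\<lambda>x. \<bar>B\<bar> * \<psi> (real T) x) \<le> r / 8" using e by simp
    have mFG: "\<bar>mean F - mean G\<bar> \<le> r / 8"
      by (rule order_trans[OF mean_diff_le[OF GF] m]) (use G \<psi>T bF in \<open>auto simp: conv_def\<close>)
    obtain N1 where N1: "\<And>n. n \<ge> N1 \<Longrightarrow> norm (avg n G - mean G) < r / 8"
      using LIMSEQ_D[of "\<lambda>n. avg n G" "mean G" "r / 8"] G r by (auto simp: conv_def)
    obtain N2 where N2: "\<And>n. n \<ge> N2 \<Longrightarrow>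
        norm (avg n (\<lambda>x. \<bar>B\<bar> * \<psi> (real T) x) - mean (\<lambda>x. \<bar>B\<bar> * \<psi> (real T) x)) < r / 8"
      using LIMSEQ_D[of "\<lambda>n. avg n (\<lambda>x. \<bar>B\<bar> * \<psi> (real T) x)" _ "r / 8"] \<psi>T r by (auto simp: conv_def)
    have "norm (avg n F - mean F) < r" if n: "n \<ge> max N1 N2" for n
    proof -
      have "\<bar>avg n F - avg n G\<bar> \<le> avg n (\<lambda>x. \<bar>B\<bar> * \<psi> (real T) x)" by (rule avg_diff_le[OF GF])
      moreover have "\<bar>avg n G - mean G\<bar> < r / 8" using N1[of n] n by simp
      moreover have "\<bar>avg n (\<lambda>x. \<bar>B\<bar> * \<psi> (real T) x) - mean (\<lambda>x. \<bar>B\<bar> * \<psi> (real T) x)\<bar> < r / 8"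
        using N2[of n] n by simp
      ultimately show ?thesis using mFG m r unfolding real_norm_def by linarith
    qed
    then show "\<exists>N. \<forall>n\<ge>N. norm (avg n F - mean F) < r" by blast
  qed
  then show ?thesis using Fm bF by (simp add: conv_def)
qed

lemma conv_complex:
  fixes F :: "real \<Rightarrow> complex"
  assumes "conv (\<lambda>x. Re (F x))" "conv (\<lambda>x. Im (F x))"
  shows "(\<lambda>n. (\<Sum>x\<in>#X n. F x) / of_nat (size (X n))) \<longlonglongrightarrow> (LINT x|M. F (g x)) / of_real (measure M (space M))"
proof -
  have s: "Re (\<Sum>x\<in>#A. F x) = (\<Sum>x\<in>#A. Re (F x))" "Im (\<Sum>x\<in>#A. F x) = (\<Sum>x\<in>#A. Im (F x))" for A :: "real multiset"
    by (induction A) auto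
  have "complex_integrable M (\<lambda>x. F (g x))"
  proof -
    obtain B where B: "\<And>x. \<bar>Re (F x)\<bar> \<le> B" using assms(1) unfolding conv_def bounded_iff by auto
    obtain B' where B': "\<And>x. \<bar>Im (F x)\<bar> \<le> B'" using assms(2) unfolding conv_def bounded_iff by auto
    have "F \<in> borel_measurable borel"
      using assms by (subst borel_measurable_complex_iff) (simp add: conv_def)
    moreover have "cmod (F x) \<le> B + B'" for x
      using cmod_le[of "F x"] B[of x] B'[of x] by linarith
    ultimately show ?thesis
      by (intro finite_measure.integrable_const_bound[OF finite_M, where B = "B + B'"])
         (use g_meas in \<open>auto intro: measurable_compose\<close>)
  qed
  then have i: "Re (LINT x|M. F (g x)) = (LINT x|M. Re (F (g x)))" "Im (LINT x|M. F (g x)) = (LINT x|M. Im (F (g x)))"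
    by simp_all
  show ?thesis
    using assms unfolding tendsto_complex_iff conv_def avg_def mean_def
    by (simp add: s i Re_divide_of_nat Im_divide_of_nat)
qed

end

section \<open>The grid and the hat functions\<close>

text \<open>Integer coordinates in mesh units: the index of a grid point, and for any other point
  the lower left corner of its half-open square. Offsets between grid points become differences of
  integer pairs.\<close>

definition flr :: "nat \<Rightarrow> real^2 \<Rightarrow> int \<times> int" where
  "flr n x = (\<lfloor>x $ 1 / mesh n\<rfloor>, \<lfloor>x $ 2 / mesh n\<rfloor>)"

definition pt :: "nat \<Rightarrow> int \<times> int \<Rightarrow> real^2" where
  "pt n c = vector [of_int (fst c) * mesh n, of_int (snd c) * mesh n]"

text \<open>A triangle of the mesh is given by the lower left corner \<open>c\<close> of its square, in units of the mesh
  size, and by the flag \<open>up\<close> that tells on which side of the antidiagonal it lies: true at the corner \<open>c\<close>,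
  false at \<open>c + (1, 1)\<close>. On it \<open>gr k u a / h\<close> is the \<open>k\<close>-th partial derivative of the hat function of the
  vertex \<open>c + a\<close>.\<close>

definition up :: "nat \<Rightarrow> real^2 \<Rightarrow> bool" where
  "up n x \<longleftrightarrow> frac (x $ 1 / mesh n) + frac (x $ 2 / mesh n) < 1"

definition gr1 :: "bool \<Rightarrow> int \<Rightarrow> int \<Rightarrow> real" where
  "gr1 u a b = (if u then (if a = 0 \<and> b = 0 then -1 else if a = 1 \<and> b = 0 then 1 else 0)
                else (if a = 1 \<and> b = 1 then 1 else if a = 0 \<and> b = 1 then -1 else 0))"

definition gr :: "2 \<Rightarrow> bool \<Rightarrow> int \<times> int \<Rightarrow> real" where
  "gr k u a = (if k = 1 then gr1 u (fst a) (snd a) else gr1 u (snd a) (fst a))"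

text \<open>The points off all mesh lines; near them the hat of every grid point is affine.\<close>

definition generic :: "nat \<Rightarrow> real^2 \<Rightarrow> bool" where
  "generic n x \<longleftrightarrow> x $ 1 / mesh n \<notin> \<int> \<and> x $ 2 / mesh n \<notin> \<int> \<and> x $ 1 / mesh n + x $ 2 / mesh n \<notin> \<int>"

text \<open>One minus the distance to \<open>p\<close> in the norm whose unit ball is the hexagonal
  patch in mesh units, cut off at zero. It is explicit and meaningful for every \<open>p\<close>;
  \<open>hat_eq_hatf\<close> identifies it with the hat where the latter is determined.\<close>

definition hatf :: "nat \<Rightarrow> real^2 \<Rightarrow> real^2 \<Rightarrow> real" where
  "hatf n p x = max 0 (1 - max \<bar>(x $ 1 - p $ 1) / mesh n\<bar> (max \<bar>(x $ 2 - p $ 2) / mesh n\<bar>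
     \<bar>(x $ 1 - p $ 1) / mesh n + (x $ 2 - p $ 2) / mesh n\<bar>))"

definition hgrad :: "2 \<Rightarrow> nat \<Rightarrow> real^2 \<Rightarrow> real^2 \<Rightarrow> real" where
  "hgrad k n p x = gr k (up n x) (flr n p - flr n x) / mesh n"

text \<open>The four half-open squares with corner \<open>p\<close>, outside which the hat and its
  gradient vanish. Integer offsets make them easier to count than the hexagons.\<close>

definition near :: "nat \<Rightarrow> real^2 \<Rightarrow> real^2 \<Rightarrow> bool" where
  "near n p x \<longleftrightarrow> flr n p - flr n x \<in> {0, 1} \<times> {0, 1}"

lemma mesh_nz [simp]: "mesh n \<noteq> 0" using mesh_pos[of n] by simp

lemma flr_pt [simp]: "flr n (pt n c) = c"
  by (simp add: flr_def pt_def)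

lemma grid_pt:
  assumes "p \<in> set (grid n)"
  shows "pt n (flr n p) = p"
proof -
  obtain i j where "p $ 1 = real i * mesh n" "p $ 2 = real j * mesh n"
    using assms unfolding grid_iff by blast
  then show ?thesis by (simp add: vec_eq_iff forall_2 pt_def flr_def)
qed

lemma abs_gr_le: "\<bar>gr k u a\<bar> \<le> 1"
proof -
  have "\<bar>gr1 u i j\<bar> \<le> 1" for i j by (auto simp: gr1_def)
  then show ?thesis by (auto simp: gr_def)
qed

lemma gr_eq_0: "a \<notin> {0, 1} \<times> {0, 1} \<Longrightarrow> gr k u a = 0"
proof -
  assume "a \<notin> {0, 1} \<times> {0, 1}"
  then have "fst a \<notin> {0, 1} \<or> snd a \<notin> {0, 1}" unfolding mem_Times_iff by blast
  moreover have "gr1 u i j = 0" if "i \<notin> {0, 1} \<or> j \<notin> {0, 1}" for i j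
    using that unfolding gr1_def by auto
  ultimately show ?thesis unfolding gr_def by (simp only: if_cancel disj_commute)
qed

lemma abs_hgrad_le: "\<bar>hgrad k n p x\<bar> \<le> 1 / mesh n"
  using abs_gr_le mesh_pos[of n] by (simp add: hgrad_def abs_divide divide_right_mono)

lemma hgrad_near: "\<not> near n p x \<Longrightarrow> hgrad k n p x = 0"
  by (simp add: hgrad_def near_def gr_eq_0)

lemma hatf_bounds: "0 \<le> hatf n p x" "hatf n p x \<le> 1"
  by (auto simp: hatf_def le_max_iff_disj)

lemma hatf_near:
  assumes "p \<in> set (grid n)" "\<not> near n p x"
  shows "hatf n p x = 0"
proof (rule ccontr)
  assume nz: "hatf n p x \<noteq> 0"
  have fl: "\<lfloor>p $ k / mesh n\<rfloor> - \<lfloor>x $ k / mesh n\<rfloor> \<in> {0, 1}"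
    if less: "\<bar>(x $ k - p $ k) / mesh n\<bar> < 1" and int: "p $ k / mesh n \<in> \<int>" for k
  proof -
    obtain m where m: "p $ k / mesh n = of_int m" using int by (auto elim: Ints_cases)
    have "\<bar>x $ k / mesh n - of_int m\<bar> < 1" using less unfolding diff_divide_distrib m .
    then have "\<lfloor>x $ k / mesh n\<rfloor> < m + 1" "m - 1 \<le> \<lfloor>x $ k / mesh n\<rfloor>"
      unfolding floor_less_iff le_floor_iff by auto
    then show ?thesis unfolding m by auto
  qed
  have int: "p $ 1 / mesh n \<in> \<int>" "p $ 2 / mesh n \<in> \<int>"
    using assms(1) unfolding grid_iff by auto
  have less: "\<bar>(x $ 1 - p $ 1) / mesh n\<bar> < 1" "\<bar>(x $ 2 - p $ 2) / mesh n\<bar> < 1"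
  proof -
    have "max \<bar>(x $ 1 - p $ 1) / mesh n\<bar> (max \<bar>(x $ 2 - p $ 2) / mesh n\<bar>
        \<bar>(x $ 1 - p $ 1) / mesh n + (x $ 2 - p $ 2) / mesh n\<bar>) < 1"
    proof -
      have "M < 1" if "max 0 (1 - M) \<noteq> 0" for M :: real
        using that by (cases "M < 1") simp_all
      from this[OF nz[unfolded hatf_def]] show ?thesis .
    qed
    then show "\<bar>(x $ 1 - p $ 1) / mesh n\<bar> < 1" "\<bar>(x $ 2 - p $ 2) / mesh n\<bar> < 1"
      unfolding max_less_iff_conj by blast+
  qed
  have "\<lfloor>p $ 1 / mesh n\<rfloor> - \<lfloor>x $ 1 / mesh n\<rfloor> \<in> {0, 1}" by (rule fl[OF less(1) int(1)])
  moreover have "\<lfloor>p $ 2 / mesh n\<rfloor> - \<lfloor>x $ 2 / mesh n\<rfloor> \<in> {0, 1}" by (rule fl[OF less(2) int(2)])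
  ultimately have "near n p x" unfolding near_def flr_def mem_Times_iff fst_diff snd_diff fst_conv snd_conv by blast
  with assms(2) show False by simp
qed

lemma near_bounds:
  assumes "p \<in> set (grid n)" "near n p x"
  shows "\<bar>x $ k - p $ k\<bar> \<le> mesh n"
proof -
  have fl: "\<bar>x $ k - p $ k\<bar> \<le> mesh n"
    if less: "\<lfloor>p $ k / mesh n\<rfloor> - \<lfloor>x $ k / mesh n\<rfloor> \<in> {0, 1}" and int: "p $ k / mesh n \<in> \<int>" for k
  proof -
    obtain m where m: "p $ k / mesh n = of_int m" using int by (auto elim: Ints_cases)
    then have "real_of_int m = of_int \<lfloor>x $ k / mesh n\<rfloor> \<or> real_of_int m = of_int \<lfloor>x $ k / mesh n\<rfloor> + 1"
      using less by (simp add: algebra_simps) (metis of_int_1 of_int_add)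
    then have "\<bar>x $ k / mesh n - p $ k / mesh n\<bar> \<le> 1"
      unfolding m using floor_correct[of "x $ k / mesh n"] by linarith
    then have "\<bar>(x $ k - p $ k) / mesh n\<bar> \<le> 1" by (simp add: diff_divide_distrib)
    then show ?thesis using mesh_pos[of n] by (simp add: abs_divide divide_le_eq)
  qed
  have "p $ 1 / mesh n \<in> \<int>" "p $ 2 / mesh n \<in> \<int>"
    using assms(1) unfolding grid_iff by auto
  then show ?thesis
    using fl[of 1] fl[of 2] assms(2) exhaust_2[of k] by (auto simp: near_def flr_def)
qed

text \<open>On each of the triangles the tent function is the affine function given by the
  three vertices; the constant term is \<open>1\<close> exactly when the gradient does not vanish.\<close>

lemma tent_affine:
  fixes s t :: real and a b :: int
  assumes "0 < s" "s < 1" "0 < t" "t < 1" "s + t \<noteq> 1"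
  defines "U \<equiv> s - of_int a" and "V \<equiv> t - of_int b" and "u \<equiv> s + t < 1"
  shows "max 0 (1 - max \<bar>U\<bar> (max \<bar>V\<bar> \<bar>U + V\<bar>))
      = (if gr1 u a b = 0 \<and> gr1 u b a = 0 then 0 else 1) + gr1 u a b * U + gr1 u b a * V"
    and "gr1 u a b \<noteq> 0 \<or> gr1 u b a \<noteq> 0 \<Longrightarrow> max 0 (1 - max \<bar>U\<bar> (max \<bar>V\<bar> \<bar>U + V\<bar>)) \<noteq> 0"
proof -
  define m where "m = max \<bar>U\<bar> (max \<bar>V\<bar> \<bar>U + V\<bar>)"
  have m_eq: "m = e" if "e = \<bar>U\<bar> \<or> e = \<bar>V\<bar> \<or> e = \<bar>U + V\<bar>" "\<bar>U\<bar> \<le> e" "\<bar>V\<bar> \<le> e" "\<bar>U + V\<bar> \<le> e" for e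
    using that unfolding m_def by (elim disjE) (simp_all add: max_absorb1 max_absorb2)
  have m_ge: "\<bar>U\<bar> \<le> m" "\<bar>V\<bar> \<le> m" unfolding m_def by simp_all
  let ?P = "max 0 (1 - m) = (if gr1 u a b = 0 \<and> gr1 u b a = 0 then 0 else 1) + gr1 u a b * U + gr1 u b a * V
    \<and> (gr1 u a b \<noteq> 0 \<or> gr1 u b a \<noteq> 0 \<longrightarrow> max 0 (1 - m) \<noteq> 0)"
  consider "a < 0 \<or> a > 1" | "b < 0 \<or> b > 1" | "a = 0" "b = 0" | "a = 1" "b = 0" | "a = 0" "b = 1" | "a = 1" "b = 1"
    by linarith
  then have *: ?P
  proof cases
    case 1
    then have "real_of_int a \<le> -1 \<or> real_of_int a \<ge> 2" by linarith
    then have "\<bar>U\<bar> \<ge> 1" using assms(1,2) unfolding U_def by linarith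
    moreover have "gr1 u a b = 0" "gr1 u b a = 0" using 1 by (auto simp: gr1_def)
    ultimately show ?thesis using m_ge by simp
  next
    case 2
    then have "real_of_int b \<le> -1 \<or> real_of_int b \<ge> 2" by linarith
    then have "\<bar>V\<bar> \<ge> 1" using assms(3,4) unfolding V_def by linarith
    moreover have "gr1 u a b = 0" "gr1 u b a = 0" using 2 by (auto simp: gr1_def)
    ultimately show ?thesis using m_ge by simp
  next
    case 3
    then have UV: "U = s" "V = t" by (simp_all add: U_def V_def)
    have "m = s + t" by (rule m_eq) (use UV assms(1-4) in auto)
    then show ?thesis using 3 UV assms(1-4) by (cases u) (auto simp: gr1_def u_def)
  next
    case 4
    then have UV: "U = s - 1" "V = t" by (simp_all add: U_def V_def)
    have "m = (if u then 1 - s else t)"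
      by (rule m_eq) (use UV assms(1-5) in \<open>auto simp: u_def\<close>)
    then show ?thesis using 4 UV assms(1-4) by (cases u) (auto simp: gr1_def)
  next
    case 5
    then have UV: "U = s" "V = t - 1" by (simp_all add: U_def V_def)
    have "m = (if u then 1 - t else s)"
      by (rule m_eq) (use UV assms(1-5) in \<open>auto simp: u_def\<close>)
    then show ?thesis using 5 UV assms(1-4) by (cases u) (auto simp: gr1_def)
  next
    case 6
    then have UV: "U = s - 1" "V = t - 1" by (simp_all add: U_def V_def)
    have "m = 2 - s - t" by (rule m_eq) (use UV assms(1-4) in auto)
    then show ?thesis using 6 UV assms(1-5) by (cases u) (auto simp: gr1_def u_def)
  qed
  from *[unfolded m_def] show "max 0 (1 - max \<bar>U\<bar> (max \<bar>V\<bar> \<bar>U + V\<bar>))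
      = (if gr1 u a b = 0 \<and> gr1 u b a = 0 then 0 else 1) + gr1 u a b * U + gr1 u b a * V" by blast
  from *[unfolded m_def] show "gr1 u a b \<noteq> 0 \<or> gr1 u b a \<noteq> 0 \<Longrightarrow> max 0 (1 - max \<bar>U\<bar> (max \<bar>V\<bar> \<bar>U + V\<bar>)) \<noteq> 0" by blast
qed

text \<open>The square and the triangle are parameters instead of being read off from
  \<open>y\<close>, so that the formula holds with fixed coefficients on a whole open triangle, as
  differentiation requires. A gradient that does not vanish also certifies a point of the
  support.\<close>

lemma hatf_affine:
  assumes p: "p \<in> set (grid n)"
    and c: "of_int i < y $ 1 / mesh n" "y $ 1 / mesh n < of_int i + 1"
      "of_int j < y $ 2 / mesh n" "y $ 2 / mesh n < of_int j + 1"
    and u: "if u then y $ 1 / mesh n + y $ 2 / mesh n < of_int i + of_int j + 1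
      else y $ 1 / mesh n + y $ 2 / mesh n > of_int i + of_int j + 1"
  defines "g \<equiv> \<lambda>k. gr k u (flr n p - (i, j))"
  shows "hatf n p y = (if g 1 = 0 \<and> g 2 = 0 then 0 else 1) + g 1 * ((y $ 1 - p $ 1) / mesh n) + g 2 * ((y $ 2 - p $ 2) / mesh n)"
    and "g 1 \<noteq> 0 \<or> g 2 \<noteq> 0 \<Longrightarrow> hatf n p y \<noteq> 0"
proof -
  obtain i' j' where ij: "p $ 1 = real i' * mesh n" "p $ 2 = real j' * mesh n"
    using p unfolding grid_iff by blast
  have fp: "flr n p = (int i', int j')" by (simp add: flr_def ij)
  let ?s = "y $ 1 / mesh n - of_int i" and ?t = "y $ 2 / mesh n - of_int j"
  have U: "(y $ 1 - p $ 1) / mesh n = ?s - of_int (int i' - i)" "(y $ 2 - p $ 2) / mesh n = ?t - of_int (int j' - j)"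
    by (simp_all add: ij diff_divide_distrib)
  have st: "0 < ?s" "?s < 1" "0 < ?t" "?t < 1" "?s + ?t \<noteq> 1" and u': "(?s + ?t < 1) = u"
    using c u by (auto split: if_splits)
  note ta = tent_affine[OF st, of "int i' - i" "int j' - j", unfolded u', folded U]
  have g: "g 1 = gr1 u (int i' - i) (int j' - j)" "g 2 = gr1 u (int j' - j) (int i' - i)"
    by (simp_all add: g_def gr_def fp)
  show "hatf n p y = (if g 1 = 0 \<and> g 2 = 0 then 0 else 1) + g 1 * ((y $ 1 - p $ 1) / mesh n) + g 2 * ((y $ 2 - p $ 2) / mesh n)"
    unfolding hatf_def g by (rule ta(1))
  show "g 1 \<noteq> 0 \<or> g 2 \<noteq> 0 \<Longrightarrow> hatf n p y \<noteq> 0"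
    unfolding hatf_def g by (rule ta(2))
qed

lemma generic_cell:
  assumes "generic n x"
  shows "of_int (fst (flr n x)) < x $ 1 / mesh n" "x $ 1 / mesh n < of_int (fst (flr n x)) + 1"
    "of_int (snd (flr n x)) < x $ 2 / mesh n" "x $ 2 / mesh n < of_int (snd (flr n x)) + 1"
    "if up n x then x $ 1 / mesh n + x $ 2 / mesh n < of_int (fst (flr n x)) + of_int (snd (flr n x)) + 1
      else x $ 1 / mesh n + x $ 2 / mesh n > of_int (fst (flr n x)) + of_int (snd (flr n x)) + 1"
proof -
  have fl: "of_int \<lfloor>r\<rfloor> < r" "r < of_int \<lfloor>r\<rfloor> + 1" if "r \<notin> \<int>" for r :: real
    using that floor_correct[of r] by (auto simp: order_le_less)
  show 1: "of_int (fst (flr n x)) < x $ 1 / mesh n" "x $ 1 / mesh n < of_int (fst (flr n x)) + 1"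
    "of_int (snd (flr n x)) < x $ 2 / mesh n" "x $ 2 / mesh n < of_int (snd (flr n x)) + 1"
    using assms fl by (auto simp: generic_def flr_def)
  have "x $ 1 / mesh n + x $ 2 / mesh n \<noteq> of_int (fst (flr n x) + snd (flr n x) + 1)"
    using assms unfolding generic_def by (metis Ints_of_int)
  then show "if up n x then x $ 1 / mesh n + x $ 2 / mesh n < of_int (fst (flr n x)) + of_int (snd (flr n x)) + 1
      else x $ 1 / mesh n + x $ 2 / mesh n > of_int (fst (flr n x)) + of_int (snd (flr n x)) + 1"
    by (auto simp: up_def frac_def flr_def)
qed

lemma hatf_has_derivative:
  assumes p: "p \<in> set (grid n)" and x: "generic n x"
  shows "(hatf n p has_derivative (\<lambda>d. hgrad 1 n p x * d $ 1 + hgrad 2 n p x * d $ 2)) (at x)"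
proof -
  obtain i j where c: "flr n x = (i, j)" by (cases "flr n x")
  define g where "g = (\<lambda>k. gr k (up n x) (flr n p - (i, j)))"
  let ?A = "\<lambda>y::real^2. (if g 1 = 0 \<and> g 2 = 0 then 0 else 1) + g 1 * ((y $ 1 - p $ 1) / mesh n) + g 2 * ((y $ 2 - p $ 2) / mesh n)"
  define O1 where "O1 = {y::real^2. of_int i < y $ 1 / mesh n \<and> y $ 1 / mesh n < of_int i + 1 \<and>
      of_int j < y $ 2 / mesh n \<and> y $ 2 / mesh n < of_int j + 1}"
  define O2 where "O2 = {y::real^2. if up n x then y $ 1 / mesh n + y $ 2 / mesh n < of_int i + of_int j + 1
      else y $ 1 / mesh n + y $ 2 / mesh n > of_int i + of_int j + 1}"
  have "open O1" unfolding O1_def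
    by (intro open_Collect_conj open_Collect_less continuous_intros) auto
  moreover have "open O2" unfolding O2_def
    by (cases "up n x") (auto intro!: open_Collect_less continuous_intros)
  ultimately have op: "open (O1 \<inter> O2)" by blast
  have xO: "x \<in> O1 \<inter> O2"
    using generic_cell[OF x, unfolded c fst_conv snd_conv] unfolding O1_def O2_def by simp
  have eq: "?A y = hatf n p y" if "y \<in> O1 \<inter> O2" for y
    unfolding g_def by (rule hatf_affine(1)[OF p, symmetric]) (use that in \<open>auto simp: O1_def O2_def\<close>)
  have "(?A has_derivative (\<lambda>d. hgrad 1 n p x * d $ 1 + hgrad 2 n p x * d $ 2)) (at x)"
    by (auto intro!: derivative_eq_intros bounded_linear.has_derivative[OF bounded_linear_vec_nth]
        simp: hgrad_def g_def c)
  then show ?thesis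
    by (rule has_derivative_transform_within_open[OF _ op xO eq])
qed

lemma hat_eq_hatf:
  assumes "p \<in> set (grid n)" "patch n p \<subseteq> cbox 0 1"
  shows "hat n p = hatf n p"
  unfolding hat_def hatf_def[abs_def]
  by (rule the1_equality[where P = "is_hat n p", OF ex1_is_hat[OF assms] is_hat_formula[OF assms(1)]])

lemma grad_hat:
  assumes "p \<in> set (grid n)" "patch n p \<subseteq> cbox 0 1" "generic n x"
  shows "grad (hat n p) x $ k = of_real (hgrad k n p x)"
proof -
  have "frechet_derivative (hatf n p) (at x) = (\<lambda>d. hgrad 1 n p x * d $ 1 + hgrad 2 n p x * d $ 2)"
    by (rule frechet_derivative_at[OF hatf_has_derivative[OF assms(1,3)], symmetric])
  then show ?thesis
    using exhaust_2[of k] by (auto simp: grad_def hat_eq_hatf[OF assms(1,2)] axis_def)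
qed

text \<open>A nonzero gradient forces a nonzero value, which occurs only inside the hexagon. Since
  the patch of an admissible point lies in the domain, this lets integrals of products of gradients
  over the interior be taken over full triangles.\<close>

lemma hgrad_patch:
  assumes "p \<in> set (grid n)" "generic n x" "hgrad k n p x \<noteq> 0"
  shows "x \<in> patch n p"
proof (rule ccontr)
  assume x: "x \<notin> patch n p"
  obtain i j where c: "flr n x = (i, j)" by (cases "flr n x")
  have "hatf n p x = 0"
    using is_hat_formula[OF assms(1)] x unfolding is_hat_def hatf_def by blast
  moreover have "hatf n p x \<noteq> 0"
    using generic_cell[OF assms(2)] assms(3) exhaust_2[of k] unfolding c
    by (intro hatf_affine(2)[OF assms(1), of i x j "up n x"]) (auto simp: hgrad_def c)
  ultimately show False by simp
qed

lemma patch_bounds: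
  assumes "y \<in> patch n p"
  shows "\<bar>y $ k - p $ k\<bar> \<le> mesh n"
proof -
  have "\<bar>(y $ 1 - p $ 1) / mesh n\<bar> \<le> 1 \<and> \<bar>(y $ 2 - p $ 2) / mesh n\<bar> \<le> 1"
  proof -
    have key: "\<bar>U\<bar> \<le> 1 \<and> \<bar>V\<bar> \<le> 1"
      if "0 \<le> U \<and> 0 \<le> V \<and> U + V \<le> 1 \<or> V \<le> 0 \<and> 0 \<le> U + V \<and> U \<le> 1 \<or> 0 \<le> U \<and> U + V \<le> 0 \<and> -1 \<le> V \<or>
        U \<le> 0 \<and> V \<le> 0 \<and> -1 \<le> U + V \<or> 0 \<le> V \<and> U + V \<le> 0 \<and> -1 \<le> U \<or> U \<le> 0 \<and> 0 \<le> U + V \<and> V \<le> 1"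
      for U V :: real using that by linarith
    show ?thesis by (rule key) (use assms in \<open>unfold patch_def triangles_coords, blast\<close>)
  qed
  then show ?thesis
    using exhaust_2[of k] mesh_pos[of n] by (auto simp: abs_divide divide_le_eq)
qed

lemma center_in_patch: "p \<in> patch n p"
  unfolding patch_def triangles_def Let_def by (auto intro: hull_inc)

lemma negligible_not_generic: "negligible {x. \<not> generic n x}"
proof -
  have h: "negligible (\<Union>k::int. {x::real^2. a \<bullet> x = of_int k * mesh n})" if "a \<noteq> 0" for a
    by (intro negligible_countable_Union) (use that in \<open>auto intro!: negligible_hyperplane\<close>)
  have 1: "{x::real^2. x $ 1 / mesh n \<in> \<int>} \<subseteq> (\<Union>k::int. {x. vector [1, 0] \<bullet> x = of_int k * mesh n})"
    by (auto simp: inner_vec_def sum_2 elim!: Ints_cases) (auto simp: field_simps)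
  have 2: "{x::real^2. x $ 2 / mesh n \<in> \<int>} \<subseteq> (\<Union>k::int. {x. vector [0, 1] \<bullet> x = of_int k * mesh n})"
    by (auto simp: inner_vec_def sum_2 elim!: Ints_cases) (auto simp: field_simps)
  have 3: "{x::real^2. x $ 1 / mesh n + x $ 2 / mesh n \<in> \<int>} \<subseteq> (\<Union>k::int. {x. vector [1, 1] \<bullet> x = of_int k * mesh n})"
    by (auto simp: inner_vec_def sum_2 elim!: Ints_cases) (auto simp: field_simps)
  have nz: "(vector [1, 0] :: real^2) \<noteq> 0" "(vector [0, 1] :: real^2) \<noteq> 0" "(vector [1, 1] :: real^2) \<noteq> 0"
    by (auto simp: vec_eq_iff forall_2)
  have "{x. \<not> generic n x} = {x. x $ 1 / mesh n \<in> \<int>} \<union> {x. x $ 2 / mesh n \<in> \<int>} \<union> {x. x $ 1 / mesh n + x $ 2 / mesh n \<in> \<int>}"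
    by (auto simp: generic_def)
  then show ?thesis
    using negligible_subset[OF h[OF nz(1)] 1] negligible_subset[OF h[OF nz(2)] 2] negligible_subset[OF h[OF nz(3)] 3]
    by (simp add: negligible_Un)
qed

lemma AE_generic: "AE x in lebesgue. generic n x"
  using negligible_not_generic[of n] by (auto simp: negligible_iff_null_sets intro: AE_I')

lemma up_meas [measurable]: "Measurable.pred borel (up n)"
  unfolding up_def[abs_def] frac_def by measurable

lemma hgrad_meas [measurable]: "hgrad k n p \<in> borel_measurable borel"
  unfolding hgrad_def[abs_def] gr_def gr1_def flr_def fst_diff snd_diff fst_conv snd_conv by measurable

lemma hatf_continuous: "continuous_on UNIV (hatf n p)"
  unfolding hatf_def[abs_def] by (intro continuous_intros) auto

lemma hatf_meas [measurable]: "hatf n p \<in> borel_measurable borel"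
  by (rule borel_measurable_continuous_onI[OF hatf_continuous])

lemma near_meas [measurable]: "Measurable.pred borel (near n p)"
  unfolding near_def[abs_def] flr_def mem_Times_iff fst_diff snd_diff fst_conv snd_conv by measurable

lemma flr_meas [measurable]: "Measurable.pred borel (\<lambda>x. flr n x = c)"
  unfolding flr_def prod_eq_iff fst_conv snd_conv by measurable

section \<open>Half-open triangles and their area\<close>

definition Tri :: "nat \<Rightarrow> bool \<Rightarrow> int \<times> int \<Rightarrow> (real^2) set" where
  "Tri n u c = {x. flr n x = c \<and> up n x = u}"

lemma Tri_borel [measurable]: "Tri n u c \<in> sets borel"
  unfolding Tri_def by measurable

text \<open>Off the mesh lines \<open>Tri\<close> coincides with a closed right triangle with legs
  \<open>mesh n\<close>.\<close>

lemma measure_Tri: "measure lebesgue (Tri n u c) = (mesh n)\<^sup>2 / 2" "emeasure lebesgue (Tri n u c) < \<infinity>"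
proof -
  \<comment> \<open>The vertex at the right angle: the corner \<open>c\<close> below the
    antidiagonal, the opposite corner above it.\<close>
  define P where "P = (if u then pt n c else pt n (c + (1, 1)))"
  define d e :: "real^2" where "d = (if u then axis 1 1 else - axis 1 1)" and "e = (if u then axis 2 1 else - axis 2 1)"
  define T where "T = convex hull {P, P + mesh n *\<^sub>R d, P + mesh n *\<^sub>R e}"
  have "measure lborel T = (mesh n)\<^sup>2 / 2"
    unfolding T_def content_triangle using mesh_pos[of n]
    by (simp add: d_def e_def axis_def power2_eq_square abs_mult)
  moreover have cT: "compact T" unfolding T_def by (intro compact_convex_hull) auto
  moreover have "T \<in> sets borel" using cT by (simp add: borel_compact)
  ultimately have mT: "measure lebesgue T = (mesh n)\<^sup>2 / 2" by simp
  have iff: "x \<in> Tri n u c \<longleftrightarrow> x \<in> T" if g: "generic n x" for x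
  proof -
    let ?U = "x $ 1 / mesh n - of_int (fst c)" and ?V = "x $ 2 / mesh n - of_int (snd c)"
    note gc = generic_cell[OF g]
    have nz: "?U \<noteq> 0" "?V \<noteq> 0" "?U \<noteq> 1" "?V \<noteq> 1" "?U + ?V \<noteq> 1"
    proof -
      have "x $ 1 / mesh n \<noteq> of_int (fst c)" "x $ 2 / mesh n \<noteq> of_int (snd c)" "x $ 1 / mesh n \<noteq> of_int (fst c + 1)"
        "x $ 2 / mesh n \<noteq> of_int (snd c + 1)" "x $ 1 / mesh n + x $ 2 / mesh n \<noteq> of_int (fst c + snd c + 1)"
        using g unfolding generic_def by (metis Ints_of_int)+
      then show "?U \<noteq> 0" "?V \<noteq> 0" "?U \<noteq> 1" "?V \<noteq> 1" "?U + ?V \<noteq> 1" by auto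
    qed
    have fc: "flr n x = c \<longleftrightarrow> 0 < ?U \<and> ?U < 1 \<and> 0 < ?V \<and> ?V < 1"
    proof
      assume "flr n x = c"
      then show "0 < ?U \<and> ?U < 1 \<and> 0 < ?V \<and> ?V < 1" using gc by auto
    next
      assume "0 < ?U \<and> ?U < 1 \<and> 0 < ?V \<and> ?V < 1"
      then show "flr n x = c"
        by (auto simp: flr_def prod_eq_iff floor_eq_iff)
    qed
    have tri: "x \<in> Tri n u c \<longleftrightarrow> 0 < ?U \<and> ?U < 1 \<and> 0 < ?V \<and> ?V < 1 \<and> (?U + ?V < 1 \<longleftrightarrow> u)"
    proof (cases "flr n x = c")
      case True
      then have "up n x \<longleftrightarrow> ?U + ?V < 1" by (auto simp: up_def frac_def flr_def)
      then show ?thesis using True fc by (auto simp: Tri_def)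
    next
      case False
      then show ?thesis using fc by (auto simp: Tri_def)
    qed
    have T: "x \<in> T \<longleftrightarrow> (\<exists>s t. 0 \<le> s \<and> 0 \<le> t \<and> s + t \<le> 1 \<and>
       (x $ 1 - P $ 1) / mesh n = s * d $ 1 + t * e $ 1 \<and> (x $ 2 - P $ 2) / mesh n = s * d $ 2 + t * e $ 2)"
      unfolding T_def by (rule triangle_iff[OF mesh_pos])
    show ?thesis
    proof (cases u)
      case True
      have "(x $ 1 - P $ 1) / mesh n = ?U" "(x $ 2 - P $ 2) / mesh n = ?V"
        using True by (simp_all add: P_def pt_def diff_divide_distrib)
      then have "x \<in> T \<longleftrightarrow> 0 \<le> ?U \<and> 0 \<le> ?V \<and> ?U + ?V \<le> 1"
        unfolding T using True by (auto simp: d_def e_def axis_def)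
      then show ?thesis unfolding tri using True nz by auto
    next
      case False
      have "(x $ 1 - P $ 1) / mesh n = ?U - 1" "(x $ 2 - P $ 2) / mesh n = ?V - 1"
        using False by (simp_all add: P_def pt_def diff_divide_distrib add_divide_distrib ring_distribs)
      then have "x \<in> T \<longleftrightarrow> (\<exists>s t. 0 \<le> s \<and> 0 \<le> t \<and> s + t \<le> 1 \<and> ?U - 1 = - s \<and> ?V - 1 = - t)"
        unfolding T using False by (simp add: d_def e_def axis_def)
      also have "\<dots> \<longleftrightarrow> ?U \<le> 1 \<and> ?V \<le> 1 \<and> ?U + ?V \<ge> 1"
      proof
        assume "?U \<le> 1 \<and> ?V \<le> 1 \<and> ?U + ?V \<ge> 1"
        then show "\<exists>s t. 0 \<le> s \<and> 0 \<le> t \<and> s + t \<le> 1 \<and> ?U - 1 = - s \<and> ?V - 1 = - t"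
          by (intro exI[of _ "1 - ?U"] exI[of _ "1 - ?V"]) auto
      qed auto
      finally show ?thesis unfolding tri using False nz by auto
    qed
  qed
  have ae: "AE x in lebesgue. x \<in> Tri n u c \<longleftrightarrow> x \<in> T"
    using AE_generic[of n] by eventually_elim (rule iff)
  have "measure lebesgue (Tri n u c) = measure lebesgue T"
    by (rule measure_eq_AE[OF ae]) (use cT in \<open>auto simp: borel_compact\<close>)
  then show "measure lebesgue (Tri n u c) = (mesh n)\<^sup>2 / 2" using mT by simp
  have "emeasure lebesgue (Tri n u c) = emeasure lebesgue T"
    by (rule emeasure_eq_AE[OF ae]) (use cT in \<open>auto simp: borel_compact\<close>)
  also have "\<dots> < \<infinity>" using emeasure_bounded_finite[OF compact_imp_bounded[OF cT]] cT by (simp add: borel_compact)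
  finally show "emeasure lebesgue (Tri n u c) < \<infinity>" .
qed

section \<open>Riemann sums over the grid\<close>

text \<open>Completeness of Lebesgue measure. It gives measurability of integrands that are under
  control only almost everywhere, such as those with pointwise gradients, unspecified on mesh
  lines.\<close>

lemma borel_measurable_AE_lebesgue:
  fixes f g :: "'a::euclidean_space \<Rightarrow> 'b::topological_space"
  assumes f: "f \<in> borel_measurable lebesgue" and ae: "AE x in lebesgue. f x = g x"
  shows "g \<in> borel_measurable lebesgue"
proof (rule measurableI)
  fix S :: "'b set" assume S: "S \<in> sets borel"
  have sets: "f -` S \<inter> space lebesgue \<in> sets lebesgue" by (rule measurable_sets[OF f S])
  have eq: "AE x in lebesgue. x \<in> f -` S \<inter> space lebesgue \<longleftrightarrow> x \<in> g -` S \<inter> space lebesgue"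
    using ae by eventually_elim simp
  show "g -` S \<inter> space lebesgue \<in> sets lebesgue"
    by (rule completion.in_sets_AE[OF eq sets]) auto
qed simp

lemma mesh_tendsto: "mesh \<longlonglongrightarrow> 0"
  using LIMSEQ_inverse_real_of_nat by (simp add: mesh_def[abs_def] inverse_eq_divide add.commute)

lemma mesh_le_1: "mesh n \<le> 1"
  by (simp add: mesh_def)

lemma pt_coord [simp]: "pt n c $ 1 = of_int (fst c) * mesh n" "pt n c $ 2 = of_int (snd c) * mesh n"
  by (simp_all add: pt_def)

lemma pt_flr_dist:
  "\<bar>pt n (flr n x) $ k - x $ k\<bar> \<le> mesh n"
proof -
  have *: "\<bar>of_int \<lfloor>r / mesh n\<rfloor> * mesh n - r\<bar> \<le> mesh n" for r
  proof -
    have "\<bar>of_int \<lfloor>r / mesh n\<rfloor> - r / mesh n\<bar> \<le> 1" by linarith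
    then have "\<bar>of_int \<lfloor>r / mesh n\<rfloor> - r / mesh n\<bar> * mesh n \<le> 1 * mesh n"
      using mesh_pos[of n] by (intro mult_right_mono) auto
    moreover have "\<bar>of_int \<lfloor>r / mesh n\<rfloor> - r / mesh n\<bar> * mesh n = \<bar>of_int \<lfloor>r / mesh n\<rfloor> * mesh n - r\<bar>"
    proof -
      have "(of_int \<lfloor>r / mesh n\<rfloor> - r / mesh n) * mesh n = of_int \<lfloor>r / mesh n\<rfloor> * mesh n - r"
        by (simp add: left_diff_distrib)
      then show ?thesis using mesh_pos[of n] by (metis abs_mult abs_of_pos)
    qed
    ultimately show ?thesis by simp
  qed
  show ?thesis using exhaust_2[of k] *[of "x $ 1"] *[of "x $ 2"] by (auto simp: flr_def)
qed

lemma pt_flr_add_dist: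
  assumes "d \<in> {-1, 0, 1} \<times> {-1, 0, 1}"
  shows "\<bar>pt n (flr n x + d) $ k - x $ k\<bar> \<le> 2 * mesh n"
proof -
  have d: "\<bar>real_of_int (fst d)\<bar> \<le> 1" "\<bar>real_of_int (snd d)\<bar> \<le> 1" using assms by auto
  have *: "\<bar>(r + e) * mesh n - y\<bar> \<le> 2 * mesh n" if "\<bar>r * mesh n - y\<bar> \<le> mesh n" "\<bar>e\<bar> \<le> 1" for r e y
  proof -
    have "\<bar>e * mesh n\<bar> \<le> 1 * mesh n"
      unfolding abs_mult using that mesh_pos[of n] by (intro mult_mono) auto
    then show ?thesis using that(1) by (simp add: distrib_right)
  qed
  show ?thesis
    using exhaust_2[of k] pt_flr_dist[of n x 1] pt_flr_dist[of n x 2] *[OF _ d(1)] *[OF _ d(2)] by auto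
qed

lemma norm_le_2:
  fixes v :: "real^2"
  assumes "\<And>k. \<bar>v $ k\<bar> \<le> e"
  shows "norm v \<le> 2 * e"
  using norm_le_l1_cart[of v] assms[of 1] assms[of 2] by (simp add: sum_2)

definition cell :: "nat \<Rightarrow> int \<times> int \<Rightarrow> (real^2) set" where
  "cell n c = {x. flr n x = c}"

lemma cell_borel [measurable]: "cell n c \<in> sets borel"
  unfolding cell_def by measurable

lemma cell_Tri: "cell n c = Tri n True c \<union> Tri n False c" "Tri n True c \<inter> Tri n False c = {}"
  by (auto simp: cell_def Tri_def)

lemma measure_cell: "measure lebesgue (cell n c) = (mesh n)\<^sup>2" "emeasure lebesgue (cell n c) < \<infinity>"
proof -
  have fin: "emeasure lebesgue (Tri n u c) \<noteq> \<infinity>" for u using measure_Tri(2)[of n u c] by simp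
  have s: "Tri n u c \<in> sets lebesgue" for u by simp
  show "measure lebesgue (cell n c) = (mesh n)\<^sup>2"
    unfolding cell_Tri(1) measure_Union[OF fin fin s s cell_Tri(2)] measure_Tri by simp
  have "emeasure lebesgue (cell n c) \<le> emeasure lebesgue (Tri n True c) + emeasure lebesgue (Tri n False c)"
    unfolding cell_Tri(1) by (rule emeasure_subadditive) auto
  also have "\<dots> < \<infinity>" using measure_Tri(2)[of n _ c] by (simp add: ennreal_add_less_top)
  finally show "emeasure lebesgue (cell n c) < \<infinity>" .
qed

lemma content_cell: "measure lborel (cell n c) = (mesh n)\<^sup>2"
  using measure_cell(1)[of n c] by simp

lemma content_Tri: "measure lborel (Tri n u c) = (mesh n)\<^sup>2 / 2"
  using measure_Tri(1)[of n u c] by simp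

lemma integral_indicator_cell:
  "integrable lebesgue (indicator (cell n c) :: _ \<Rightarrow> real)" "(LINT x|lebesgue. indicator (cell n c) x) = (mesh n)\<^sup>2"
  using measure_cell[of n c] by (auto intro: integrable_real_indicator)

lemma integral_indicator_Tri:
  "integrable lebesgue (indicator (Tri n u c) :: _ \<Rightarrow> real)" "(LINT x|lebesgue. indicator (Tri n u c) x) = (mesh n)\<^sup>2 / 2"
  using measure_Tri[of n u c] by (auto intro: integrable_real_indicator)

section \<open>The domain, its admissible grid points and their count\<close>

locale region =
  fixes \<Omega> :: "(real^2) set"
  assumes sub: "\<Omega> \<subseteq> cbox 0 1" and closed: "closed \<Omega>" and pj: "frontier \<Omega> \<in> null_sets lebesgue"
    and pos: "emeasure lebesgue \<Omega> > 0"
begin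

definition Xi :: "nat \<Rightarrow> (real^2) set" where "Xi n = set (grid_in n \<Omega>)"

lemma finite_Xi [simp]: "finite (Xi n)" by (simp add: Xi_def)

lemma Xi_iff: "p \<in> Xi n \<longleftrightarrow> p \<in> set (grid n) \<and> patch n p \<subseteq> \<Omega>"
  by (auto simp: Xi_def grid_in_def)

lemma XiD: "p \<in> Xi n \<Longrightarrow> p \<in> set (grid n)" "p \<in> Xi n \<Longrightarrow> patch n p \<subseteq> \<Omega>" "p \<in> Xi n \<Longrightarrow> patch n p \<subseteq> cbox 0 1"
  using sub by (auto simp: Xi_iff)

lemma Xi_pt: "p \<in> Xi n \<Longrightarrow> pt n (flr n p) = p"
  using grid_pt XiD(1) by blast

lemma Xi_sub: "p \<in> Xi n \<Longrightarrow> p \<in> \<Omega>"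
  using XiD(2) center_in_patch by blast

lemma distinct_grid_in: "distinct (grid_in n \<Omega>)"
proof -
  have "inj_on (grid_point n) (set (List.product [0..<n + 2] [0..<n + 2]))"
    by (rule inj_onI) (auto simp: grid_point_def vec_eq_iff forall_2)
  then have "distinct (grid n)"
    by (simp add: grid_def distinct_map distinct_product)
  then show ?thesis by (simp add: grid_in_def)
qed

lemma card_Xi: "card (Xi n) = length (grid_in n \<Omega>)"
  by (simp add: Xi_def distinct_card distinct_grid_in)

lemma AE_not_frontier: "AE x in lebesgue. x \<notin> frontier \<Omega>"
  using pj by (rule AE_not_in)

lemma not_frontier_cases:
  assumes "x \<notin> frontier \<Omega>"
  obtains "x \<in> interior \<Omega>" | "x \<notin> \<Omega>"
  using assms closed by (auto simp: frontier_def)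

lemma eventually_in:
  assumes x: "x \<in> interior \<Omega>"
  shows "\<forall>\<^sub>F n in sequentially. \<forall>d\<in>{-1, 0, 1} \<times> {-1, 0, 1}. pt n (flr n x + d) \<in> Xi n"
proof -
  obtain r where r: "r > 0" "ball x r \<subseteq> \<Omega>" using x by (meson mem_interior)
  \<comment> \<open>A neighbour is within 2 mesh widths of \<open>x\<close> in each coordinate and
    its patch within 3, which is at most 6 in norm.\<close>
  have "\<forall>\<^sub>F n in sequentially. mesh n < r / 6"
    using order_tendstoD(2)[OF mesh_tendsto, of "r / 6"] r by simp
  then show ?thesis
  proof eventually_elim
    case (elim n)
    show ?case
    proof
      fix d :: "int \<times> int" assume d: "d \<in> {-1, 0, 1} \<times> {-1, 0, 1}"
      define q where "q = pt n (flr n x + d)"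
      have qx: "\<bar>q $ k - x $ k\<bar> \<le> 2 * mesh n" for k
        unfolding q_def by (rule pt_flr_add_dist[OF d])
      have pat: "patch n q \<subseteq> \<Omega>"
      proof
        fix y assume y: "y \<in> patch n q"
        have "\<bar>(y - x) $ k\<bar> \<le> 3 * mesh n" for k
          using patch_bounds[OF y, of k] qx[of k] by simp
        then have "norm (y - x) \<le> 2 * (3 * mesh n)" by (rule norm_le_2)
        then have "y \<in> ball x r" using elim by (simp add: dist_norm norm_minus_commute)
        then show "y \<in> \<Omega>" using r by blast
      qed
      then have "q \<in> cbox 0 1" using sub center_in_patch by blast
      then have b: "0 \<le> q $ k" "q $ k \<le> 1" for k by (auto simp: mem_box_cart)
      have ex: "\<exists>i\<le>n + 1. real i * mesh n = of_int z * mesh n" if "0 \<le> of_int z * mesh n" "of_int z * mesh n \<le> 1" for z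
      proof (intro exI conjI)
        have "0 \<le> z" using that(1) mesh_pos[of n] by (simp add: zero_le_mult_iff)
        then show "real (nat z) * mesh n = of_int z * mesh n" by simp
        have "of_int z \<le> real n + 1" using that(2) by (simp add: mesh_def field_simps)
        then have "z \<le> int n + 1" by linarith
        then show "nat z \<le> n + 1" by linarith
      qed
      obtain i j where "i \<le> n + 1" "real i * mesh n = q $ 1" "j \<le> n + 1" "real j * mesh n = q $ 2"
        using ex[of "fst (flr n x + d)"] ex[of "snd (flr n x + d)"] b[of 1] b[of 2] unfolding q_def pt_coord by metis
      then have "q \<in> set (grid n)" unfolding grid_iff by metis
      then show "pt n (flr n x + d) \<in> Xi n" using pat unfolding Xi_iff q_def by blast
    qed
  qed
qed

lemma eventually_out:
  assumes x: "x \<notin> \<Omega>"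
  shows "\<forall>\<^sub>F n in sequentially. pt n (flr n x) \<notin> Xi n"
proof -
  have "open (- \<Omega>)" using closed by (simp add: open_Compl)
  then obtain r where r: "r > 0" "ball x r \<subseteq> - \<Omega>" using x open_contains_ball by blast
  have "\<forall>\<^sub>F n in sequentially. mesh n < r / 2"
    using order_tendstoD(2)[OF mesh_tendsto, of "r / 2"] r by simp
  then show ?thesis
  proof eventually_elim
    case (elim n)
    have "norm (pt n (flr n x) - x) \<le> 2 * mesh n"
      by (rule norm_le_2) (use pt_flr_dist in auto)
    then have "pt n (flr n x) \<in> ball x r" using elim by (simp add: dist_norm norm_minus_commute)
    then show ?case using r Xi_sub by blast
  qed
qed

text \<open>The sum is the integral of a step function with value \<open>\<phi> n p\<close> on the
  square with lower left corner \<open>p\<close>. At interior points this corner is eventually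
  admissible, at exterior points eventually not, and the frontier is a null set: this is where
  Jordan measurability enters. The summand may depend on \<open>n\<close>, which allows indicators
  of sets of grid points.\<close>

lemma riemann_sum:
  fixes \<phi> :: "nat \<Rightarrow> real^2 \<Rightarrow> real" and g :: "real^2 \<Rightarrow> real"
  assumes bd: "\<And>n p. \<bar>\<phi> n p\<bar> \<le> B" and g: "g \<in> borel_measurable borel"
    and lim: "\<And>x. x \<in> interior \<Omega> \<Longrightarrow> (\<lambda>n. \<phi> n (pt n (flr n x))) \<longlonglongrightarrow> g x"
  shows "(\<lambda>n. (mesh n)\<^sup>2 * (\<Sum>p\<in>Xi n. \<phi> n p)) \<longlonglongrightarrow> (LINT x:interior \<Omega>|lebesgue. g x)"
proof -
  define G where "G = (\<lambda>n x. \<Sum>p\<in>Xi n. \<phi> n p * indicator (cell n (flr n p)) x)"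
  have int: "(LINT x|lebesgue. G n x) = (mesh n)\<^sup>2 * (\<Sum>p\<in>Xi n. \<phi> n p)" for n
    unfolding G_def by (subst Bochner_Integration.integral_sum)
      (auto simp: integral_indicator_cell content_cell sum_distrib_right mult.commute)
  have G_eq: "G n x = (if pt n (flr n x) \<in> Xi n then \<phi> n (pt n (flr n x)) else 0)" for n x
  proof -
    have "G n x = (\<Sum>p\<in>Xi n. if p = pt n (flr n x) then \<phi> n p else 0)"
      unfolding G_def by (intro sum.cong refl) (use Xi_pt in \<open>auto simp: cell_def indicator_def\<close>)
    then show ?thesis by (simp add: sum.delta)
  qed
  \<comment> \<open>The dominating box contains the square of every grid point of the unit square,
    because \<open>mesh n \<le> 1\<close>.\<close>
  have "(\<lambda>n. LINT x|lebesgue. G n x) \<longlonglongrightarrow> (LINT x|lebesgue. indicator (interior \<Omega>) x *\<^sub>R g x)"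
  proof (rule integral_dominated_convergence[where w = "\<lambda>x. \<bar>B\<bar> * indicator (cbox (-1) 2) x"])
    show "(\<lambda>x. indicator (interior \<Omega>) x *\<^sub>R g x) \<in> borel_measurable lebesgue"
      using g by (intro measurable_completion) (auto intro!: borel_measurable_times)
    show "integrable lebesgue (\<lambda>x::real^2. \<bar>B\<bar> * indicator (cbox (-1) 2) x :: real)"
      using emeasure_lborel_cbox_finite[of "-1 :: real^2" 2]
      by (intro integrable_mult_right integrable_real_indicator) (auto simp: less_top)
    show "G n \<in> borel_measurable lebesgue" for n
      unfolding G_def by (intro measurable_completion) measurable
    show "AE x in lebesgue. (\<lambda>n. G n x) \<longlonglongrightarrow> indicator (interior \<Omega>) x *\<^sub>R g x"
      using AE_not_frontier
    proof eventually_elim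
      case (elim x)
      then show ?case
      proof (cases rule: not_frontier_cases)
        case 1
        have "\<forall>\<^sub>F n in sequentially. G n x = \<phi> n (pt n (flr n x))"
          using eventually_in[OF 1]
          by eventually_elim (auto simp: G_eq dest: bspec[of _ _ "(0, 0)"] simp flip: zero_prod_def)
        then show ?thesis using lim[OF 1] 1 by (simp add: tendsto_cong)
      next
        case 2
        then have "x \<notin> interior \<Omega>" using interior_subset by blast
        moreover have "\<forall>\<^sub>F n in sequentially. G n x = 0"
          using eventually_out[OF 2] by eventually_elim (simp add: G_eq)
        ultimately show ?thesis by (simp add: tendsto_eventually)
      qed
    qed
    show "AE x in lebesgue. norm (G n x) \<le> \<bar>B\<bar> * indicator (cbox (-1) 2) x" for n
    proof (rule AE_I2)
      fix x
      show "norm (G n x) \<le> \<bar>B\<bar> * indicator (cbox (-1) 2) x"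
      proof (cases "pt n (flr n x) \<in> Xi n")
        case True
        then have "pt n (flr n x) \<in> cbox 0 1" using Xi_sub sub by blast
        then have "-1 \<le> x $ k \<and> x $ k \<le> 2" for k
          using pt_flr_dist[of n x k] mesh_le_1[of n] by (auto simp: mem_box_cart abs_le_iff dest!: spec[of _ k])
        then have "x \<in> cbox (-1) 2" by (simp add: mem_box_cart)
        then show ?thesis using True bd[of n "pt n (flr n x)"] by (simp add: G_eq)
      qed (simp add: G_eq)
    qed
  qed
  then show ?thesis by (simp add: int set_lebesgue_integral_def)
qed

lemma interior_null_diff: "measure lebesgue (interior \<Omega>) > 0" "emeasure lebesgue (interior \<Omega>) < \<infinity>"
  "0 < emeasure lebesgue (interior \<Omega>)"
proof -
  have b: "bounded \<Omega>" using sub bounded_cbox bounded_subset by blast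
  show fin: "emeasure lebesgue (interior \<Omega>) < \<infinity>"
    using emeasure_bounded_finite[OF bounded_subset[OF b interior_subset]] by (simp add: less_top)
  have "emeasure lebesgue \<Omega> = emeasure lebesgue (interior \<Omega>)"
  proof (rule emeasure_eq_AE)
    show "AE x in lebesgue. x \<in> \<Omega> \<longleftrightarrow> x \<in> interior \<Omega>"
      using AE_not_frontier
    proof eventually_elim
      case (elim x)
      then show ?case using interior_subset by (cases rule: not_frontier_cases) blast+
    qed
    show "\<Omega> \<in> sets lebesgue" using closed by (simp add: borel_closed)
  qed simp
  with pos show "0 < emeasure lebesgue (interior \<Omega>)" by simp
  with fin show "measure lebesgue (interior \<Omega>) > 0"
    by (simp add: measure_def enn2real_positive_iff)
qed

lemma card_limit: "(\<lambda>n. (mesh n)\<^sup>2 * real (card (Xi n))) \<longlonglongrightarrow> measure lebesgue (interior \<Omega>)"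
  using riemann_sum[of "\<lambda>_ _. 1" 1 "\<lambda>_. 1"] by (simp add: set_lebesgue_integral_def)

text \<open>The grid points at which the matrix row lacks some of the entries of a translation invariant stencil.\<close>

definition Bad :: "nat \<Rightarrow> (real^2) set" where
  "Bad n = {p \<in> Xi n. \<not> (\<forall>d\<in>{-1, 0, 1} \<times> {-1, 0, 1}. pt n (flr n p + d) \<in> Xi n)}"

text \<open>Around an interior point all nine neighbours are eventually admissible, so the indicator
  of \<open>Bad\<close> tends to zero there.\<close>

lemma bad_limit: "(\<lambda>n. (mesh n)\<^sup>2 * real (card (Bad n))) \<longlonglongrightarrow> 0"
proof -
  have "(\<lambda>n. (mesh n)\<^sup>2 * (\<Sum>p\<in>Xi n. indicator (Bad n) p)) \<longlonglongrightarrow> (LINT x:interior \<Omega>|lebesgue. 0)"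
  proof (rule riemann_sum[of _ 1])
    fix x assume x: "x \<in> interior \<Omega>"
    show "(\<lambda>n. indicator (Bad n) (pt n (flr n x)) :: real) \<longlonglongrightarrow> 0"
    proof (rule tendsto_eventually)
      show "\<forall>\<^sub>F n in sequentially. indicator (Bad n) (pt n (flr n x)) = (0 :: real)"
        using eventually_in[OF x]
      proof eventually_elim
        case (elim n)
        then have "pt n (flr n x) \<notin> Bad n" unfolding Bad_def flr_pt mem_Collect_eq by blast
        then show ?case by simp
      qed
    qed
  qed (auto simp: indicator_def)
  moreover have "(\<Sum>p\<in>Xi n. indicator (Bad n) p) = real (card (Bad n))" for n
    by (simp add: indicator_def sum.If_cases Bad_def Int_def cong: conj_cong)
  ultimately show ?thesis by simp
qed

end

section \<open>Matrix entries\<close>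

text \<open>The integrand of the entry in row \<open>q\<close> and column \<open>p\<close>, with
  explicit gradients and hats; unlike the pointwise gradient it is specified on the mesh lines
  too.\<close>

definition cf :: "(real^2 \<Rightarrow> complex^2^2) \<Rightarrow> (real^2 \<Rightarrow> complex^2) \<Rightarrow> (real^2 \<Rightarrow> complex) \<Rightarrow>
    nat \<Rightarrow> real^2 \<Rightarrow> real^2 \<Rightarrow> real^2 \<Rightarrow> complex" where
  "cf A b c n q p x =
     (\<Sum>i\<in>UNIV. \<Sum>j\<in>UNIV. of_real (hgrad i n p x * hgrad j n q x) * A x $ i $ j)
     + (\<Sum>i\<in>UNIV. of_real (hgrad i n p x * hatf n q x) * b x $ i)
     + of_real (hatf n p x * hatf n q x) * c x"

text \<open>A common majorant of the integrands \<open>cf\<close>: gradients of hats are at most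
  \<open>1 / mesh n\<close> in each component, hats at most 1.\<close>

definition dens :: "(real^2 \<Rightarrow> complex^2^2) \<Rightarrow> (real^2 \<Rightarrow> complex^2) \<Rightarrow> (real^2 \<Rightarrow> complex) \<Rightarrow> nat \<Rightarrow> real^2 \<Rightarrow> real" where
  "dens A b c n x = (\<Sum>i\<in>UNIV. \<Sum>j\<in>UNIV. cmod (A x $ i $ j)) / (mesh n)\<^sup>2 + (\<Sum>i\<in>UNIV. cmod (b x $ i)) / mesh n + cmod (c x)"

lemma cf_diff:
  "cf (\<lambda>x. A x - A' x) (\<lambda>x. b x - b' x) (\<lambda>x. c x - c' x) n q p x = cf A b c n q p x - cf A' b' c' n q p x"
  by (simp add: cf_def algebra_simps sum_subtractf)

lemma integrable_bounded_mult:
  fixes f :: "'a::euclidean_space \<Rightarrow> complex" and m :: "'a \<Rightarrow> real"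
  assumes f: "integrable lebesgue f" and m: "m \<in> borel_measurable borel" and B: "\<And>x. \<bar>m x\<bar> \<le> B"
  shows "integrable lebesgue (\<lambda>x. of_real (m x) * f x)"
proof (rule Bochner_Integration.integrable_bound[of _ "\<lambda>x. B * cmod (f x)"])
  show "integrable lebesgue (\<lambda>x. B * cmod (f x))" using f by simp
  have m': "m \<in> borel_measurable lebesgue" using m by (intro measurable_completion) simp
  show "(\<lambda>x. of_real (m x) * f x) \<in> borel_measurable lebesgue"
    using f m' by (intro borel_measurable_times measurable_compose[OF m' borel_measurable_of_real]) (auto intro: borel_measurable_integrable)
  show "AE x in lebesgue. norm (of_real (m x) * f x) \<le> norm (B * cmod (f x))"
  proof (rule AE_I2)
    fix x
    have "0 \<le> B" using B[of x] by linarith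
    then show "norm (of_real (m x) * f x) \<le> norm (B * cmod (f x))"
      using mult_right_mono[OF B[of x], of "cmod (f x)"] by (simp add: norm_mult abs_mult)
  qed
qed

lemma near_iff_cell: "near n p x \<longleftrightarrow> (\<exists>a\<in>{0, 1} \<times> {0, 1}. x \<in> cell n (flr n p - a))"
proof
  assume "near n p x"
  then show "\<exists>a\<in>{0, 1} \<times> {0, 1}. x \<in> cell n (flr n p - a)"
    unfolding near_def cell_def by (intro bexI[of _ "flr n p - flr n x"]) auto
next
  assume "\<exists>a\<in>{0, 1} \<times> {0, 1}. x \<in> cell n (flr n p - a)"
  then show "near n p x" unfolding near_def cell_def by auto
qed

definition nearset :: "nat \<Rightarrow> real^2 \<Rightarrow> (real^2) set" where "nearset n p = {x. near n p x}"

lemma nearset_borel [measurable]: "nearset n p \<in> sets borel"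
  unfolding nearset_def by measurable

lemma nearset_UN: "nearset n p = (\<Union>a\<in>{0, 1} \<times> {0, 1}. cell n (flr n p - a))"
  using near_iff_cell by (auto simp: nearset_def)

lemma measure_nearset_le: "measure lebesgue (nearset n p) \<le> 4 * (mesh n)\<^sup>2" "emeasure lebesgue (nearset n p) < \<infinity>"
proof -
  have f: "cell n c \<in> lmeasurable" for c using measure_cell(2)[of n c] by (auto intro: fmeasurableI)
  have "nearset n p \<in> lmeasurable" unfolding nearset_UN by (intro fmeasurable.finite_UN) (use f in auto)
  then show "emeasure lebesgue (nearset n p) < \<infinity>" by (rule fmeasurableD2[THEN less_top[THEN iffD1], simplified infinity_ennreal_def[symmetric]])
  have "measure lebesgue (nearset n p) \<le> (\<Sum>a\<in>{0, 1} \<times> {0, 1}. measure lebesgue (cell n (flr n p - a)))"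
    unfolding nearset_UN by (rule measure_UNION_le) auto
  also have "\<dots> = 4 * (mesh n)\<^sup>2"
    unfolding measure_cell(1) by simp
  finally show "measure lebesgue (nearset n p) \<le> 4 * (mesh n)\<^sup>2" .
qed

lemma dens_nonneg: "0 \<le> dens A b c n x"
  unfolding dens_def using mesh_pos[of n] by (intro add_nonneg_nonneg divide_nonneg_nonneg sum_nonneg) auto

lemma cf_bound:
  assumes "p \<in> set (grid n)" "q \<in> set (grid n)"
  shows "cmod (cf A b c n q p x) \<le> indicator (nearset n p) x * indicator (nearset n q) x * dens A b c n x"
proof (cases "near n p x \<and> near n q x")
  case True
  have h: "0 < mesh n" by (rule mesh_pos)
  have 1: "cmod (of_real (hgrad i n p x * hgrad j n q x) * A x $ i $ j) \<le> cmod (A x $ i $ j) / (mesh n)\<^sup>2" for i j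
  proof -
    have "\<bar>hgrad i n p x\<bar> * \<bar>hgrad j n q x\<bar> \<le> (1 / mesh n) * (1 / mesh n)"
      using h abs_hgrad_le by (intro mult_mono) auto
    then have "\<bar>hgrad i n p x * hgrad j n q x\<bar> * cmod (A x $ i $ j) \<le> (1 / (mesh n)\<^sup>2) * cmod (A x $ i $ j)"
      by (intro mult_right_mono) (auto simp: abs_mult power2_eq_square)
    then show ?thesis by (simp add: norm_mult abs_mult)
  qed
  have 2: "cmod (of_real (hgrad i n p x * hatf n q x) * b x $ i) \<le> cmod (b x $ i) / mesh n" for i
  proof -
    have "\<bar>hgrad i n p x\<bar> * \<bar>hatf n q x\<bar> \<le> (1 / mesh n) * 1"
      using h abs_hgrad_le hatf_bounds[of n q x] by (intro mult_mono) auto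
    then have "\<bar>hgrad i n p x * hatf n q x\<bar> * cmod (b x $ i) \<le> (1 / mesh n) * cmod (b x $ i)"
      by (intro mult_right_mono) (auto simp: abs_mult)
    then show ?thesis by (simp add: norm_mult abs_mult)
  qed
  have 3: "cmod (of_real (hatf n p x * hatf n q x) * c x) \<le> cmod (c x)"
  proof -
    have "\<bar>hatf n p x\<bar> * \<bar>hatf n q x\<bar> \<le> 1 * 1"
      using hatf_bounds[of n q x] hatf_bounds[of n p x] by (intro mult_mono) auto
    then have "\<bar>hatf n p x * hatf n q x\<bar> * cmod (c x) \<le> 1 * cmod (c x)"
      by (intro mult_right_mono) (auto simp: abs_mult)
    then show ?thesis by (simp add: norm_mult abs_mult)
  qed
  have "cmod (cf A b c n q p x) \<le> dens A b c n x"
    unfolding cf_def dens_def sum_divide_distrib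
    by (intro order_trans[OF norm_triangle_ineq] add_mono order_trans[OF norm_sum] sum_mono 1 2 3)
  then show ?thesis using True by (simp add: nearset_def)
next
  case False
  then have "cf A b c n q p x = 0"
    using hatf_near[OF assms(1), of x] hatf_near[OF assms(2), of x] hgrad_near[of n p x] hgrad_near[of n q x]
    by (auto simp: cf_def)
  then show ?thesis using dens_nonneg by (simp add: mult_nonneg_nonneg)
qed

lemma integrable_vec_nth: "integrable M f \<Longrightarrow> integrable M (\<lambda>x. f x $ i)"
  for f :: "'a \<Rightarrow> ('b::euclidean_space)^2"
  by (rule integrable_bounded_linear[OF bounded_linear_vec_nth])

lemma integrable_cf:
  assumes A: "integrable lebesgue A" and b: "integrable lebesgue b" and c: "integrable lebesgue c"
  shows "integrable lebesgue (cf A b c n q p)"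
proof -
  have h: "0 < mesh n" by (rule mesh_pos)
  have 1: "\<bar>hgrad i n p x * hgrad j n q x\<bar> \<le> (1 / mesh n) * (1 / mesh n)" for i j x
    unfolding abs_mult using h abs_hgrad_le by (intro mult_mono) auto
  have 2: "\<bar>hgrad i n p x * hatf n q x\<bar> \<le> (1 / mesh n) * 1" for i x
    unfolding abs_mult using h abs_hgrad_le hatf_bounds[of n q x] by (intro mult_mono) auto
  have 3: "\<bar>hatf n p x * hatf n q x\<bar> \<le> 1 * 1" for x
    unfolding abs_mult using hatf_bounds[of n q x] hatf_bounds[of n p x] by (intro mult_mono) auto
  show ?thesis
    unfolding cf_def[abs_def]
    by (intro Bochner_Integration.integrable_add Bochner_Integration.integrable_sum)
       (rule integrable_bounded_mult, (intro integrable_vec_nth A b c), measurable, rule 1 2 3)+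
qed

lemma integrable_dens:
  assumes A: "integrable lebesgue A" and b: "integrable lebesgue b" and c: "integrable lebesgue c"
  shows "integrable lebesgue (dens A b c n)"
  unfolding dens_def[abs_def]
  by (intro Bochner_Integration.integrable_add integrable_divide Bochner_Integration.integrable_sum
      integrable_norm integrable_vec_nth A b c)

text \<open>The contribution of \<open>A $ i $ j\<close> to the entry with \<open>p - q = h d\<close> when \<open>A\<close> is constant: \<open>h\<^sup>2 / 2\<close> is the
  area of a triangle, and \<open>a\<close> is the position of \<open>q\<close> relative to its square.\<close>

definition cK :: "2 \<Rightarrow> 2 \<Rightarrow> int \<times> int \<Rightarrow> real" where
  "cK i j d = (1/2) * (\<Sum>a\<in>{0, 1} \<times> {0, 1}. \<Sum>u\<in>UNIV. gr i u (a + d) * gr j u a)"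

context region
begin

text \<open>The matrix entry as a linear functional of the coefficients, which become free
  parameters so that differences and frozen coefficients can be inserted.\<close>

definition ent :: "(real^2 \<Rightarrow> complex^2^2) \<Rightarrow> (real^2 \<Rightarrow> complex^2) \<Rightarrow> (real^2 \<Rightarrow> complex) \<Rightarrow>
    nat \<Rightarrow> real^2 \<Rightarrow> real^2 \<Rightarrow> complex" where
  "ent A b c n q p = (LINT x|lebesgue. indicator (interior \<Omega>) x *\<^sub>R cf A b c n q p x)"

lemma integrable_ind: "integrable lebesgue f \<Longrightarrow> integrable lebesgue (\<lambda>x. indicator (interior \<Omega>) x *\<^sub>R f x)"
  for f :: "real^2 \<Rightarrow> 'b::{banach, second_countable_topology}"
  by (rule integrable_mult_indicator) auto

text \<open>Off the mesh lines the gradients are the explicit ones, and on the interior cutting the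
  coefficients off outside the domain changes nothing.\<close>

lemma P1_matrix_entry:
  assumes A: "integrable lebesgue (\<lambda>x. indicator \<Omega> x *\<^sub>R A x)" and b: "integrable lebesgue (\<lambda>x. indicator \<Omega> x *\<^sub>R b x)"
    and c: "integrable lebesgue (\<lambda>x. indicator \<Omega> x *\<^sub>R c x)"
    and rs: "r < length (grid_in n \<Omega>)" "s < length (grid_in n \<Omega>)"
  shows "P1_matrix \<Omega> A b c n $$ (r, s)
    = ent (\<lambda>x. indicator \<Omega> x *\<^sub>R A x) (\<lambda>x. indicator \<Omega> x *\<^sub>R b x) (\<lambda>x. indicator \<Omega> x *\<^sub>R c x) n (grid_in n \<Omega> ! r) (grid_in n \<Omega> ! s)"
proof -
  let ?q = "grid_in n \<Omega> ! r" and ?p = "grid_in n \<Omega> ! s"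
  let ?A = "\<lambda>x. indicator \<Omega> x *\<^sub>R A x" and ?b = "\<lambda>x. indicator \<Omega> x *\<^sub>R b x" and ?c = "\<lambda>x. indicator \<Omega> x *\<^sub>R c x"
  have q: "?q \<in> Xi n" and p: "?p \<in> Xi n" using rs by (auto simp: Xi_def)
  let ?I = "\<lambda>x. scalar_product (grad (hat n ?p) x) (A x *v grad (hat n ?q) x)
          + scalar_product (grad (hat n ?p) x) (b x) * of_real (hat n ?q x)
          + c x * of_real (hat n ?p x) * of_real (hat n ?q x)"
  have ae: "AE x in lebesgue. indicator (interior \<Omega>) x *\<^sub>R cf ?A ?b ?c n ?q ?p x = indicator (interior \<Omega>) x *\<^sub>R ?I x"
    using AE_generic[of n]
  proof eventually_elim
    case (elim x)
    show ?case
    proof (cases "x \<in> interior \<Omega>")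
      case True
      then have "x \<in> \<Omega>" using interior_subset by blast
      moreover note hats = hat_eq_hatf[OF XiD(1)[OF p] XiD(3)[OF p]] hat_eq_hatf[OF XiD(1)[OF q] XiD(3)[OF q]]
      have grads: "grad (hatf n ?p) x $ k = of_real (hgrad k n ?p x)" "grad (hatf n ?q) x $ k = of_real (hgrad k n ?q x)" for k
        using grad_hat[OF XiD(1)[OF p] XiD(3)[OF p] elim] grad_hat[OF XiD(1)[OF q] XiD(3)[OF q] elim]
        unfolding hats by blast+
      ultimately have "cf ?A ?b ?c n ?q ?p x = ?I x"
        by (simp add: cf_def scalar_product_def matrix_vector_mult_def sum_2 hats grads algebra_simps)
      then show ?thesis by simp
    qed simp
  qed
  have m: "(\<lambda>x. indicator (interior \<Omega>) x *\<^sub>R cf ?A ?b ?c n ?q ?p x) \<in> borel_measurable lebesgue"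
    by (rule borel_measurable_integrable[OF integrable_ind[OF integrable_cf[OF A b c]]])
  have "P1_matrix \<Omega> A b c n $$ (r, s) = (LINT x|lebesgue. indicator (interior \<Omega>) x *\<^sub>R ?I x)"
    using rs by (simp add: P1_matrix_def Let_def set_lebesgue_integral_def)
  also have "\<dots> = ent ?A ?b ?c n ?q ?p"
    unfolding ent_def
    by (rule integral_cong_AE[OF borel_measurable_AE_lebesgue[OF m ae] m]) (use ae in \<open>auto elim: eventually_mono\<close>)
  finally show ?thesis .
qed

lemma ent_diff:
  assumes "integrable lebesgue A" "integrable lebesgue b" "integrable lebesgue c"
    "integrable lebesgue A'" "integrable lebesgue b'" "integrable lebesgue c'"
  shows "ent A b c n q p - ent A' b' c' n q p = ent (\<lambda>x. A x - A' x) (\<lambda>x. b x - b' x) (\<lambda>x. c x - c' x) n q p"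
  unfolding ent_def cf_diff scaleR_diff_right
  by (rule Bochner_Integration.integral_diff[symmetric]) (intro integrable_ind integrable_cf assms)+

lemma ent_bound:
  assumes i: "integrable lebesgue A" "integrable lebesgue b" "integrable lebesgue c"
    and p: "p \<in> Xi n" and q: "q \<in> Xi n"
  shows "cmod (ent A b c n q p) \<le> (LINT x|lebesgue. indicator (nearset n p) x * (indicator (nearset n q) x * dens A b c n x))"
    and "integrable lebesgue (\<lambda>x. indicator (nearset n p) x * (indicator (nearset n q) x * dens A b c n x))"
proof -
  have "integrable lebesgue (\<lambda>x. indicator (nearset n p) x *\<^sub>R (indicator (nearset n q) x *\<^sub>R dens A b c n x))"
    by (intro integrable_mult_indicator integrable_dens i) auto
  then show int: "integrable lebesgue (\<lambda>x. indicator (nearset n p) x * (indicator (nearset n q) x * dens A b c n x))"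
    by simp
  have "cmod (ent A b c n q p) \<le> (LINT x|lebesgue. cmod (indicator (interior \<Omega>) x *\<^sub>R cf A b c n q p x))"
    unfolding ent_def by (rule integral_norm_bound)
  also have "\<dots> \<le> (LINT x|lebesgue. indicator (nearset n p) x * (indicator (nearset n q) x * dens A b c n x))"
  proof (rule integral_mono)
    show "integrable lebesgue (\<lambda>x. cmod (indicator (interior \<Omega>) x *\<^sub>R cf A b c n q p x))"
      by (intro integrable_norm integrable_ind integrable_cf i)
    fix x
    have "cmod (indicator (interior \<Omega>) x *\<^sub>R cf A b c n q p x) \<le> cmod (cf A b c n q p x)"
      by (simp add: indicator_def)
    also have "\<dots> \<le> indicator (nearset n p) x * indicator (nearset n q) x * dens A b c n x"
      by (rule cf_bound[OF XiD(1)[OF p] XiD(1)[OF q]])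
    finally show "cmod (indicator (interior \<Omega>) x *\<^sub>R cf A b c n q p x)
        \<le> indicator (nearset n p) x * (indicator (nearset n q) x * dens A b c n x)" by (simp add: mult.assoc)
  qed (rule int)
  finally show "cmod (ent A b c n q p) \<le> (LINT x|lebesgue. indicator (nearset n p) x * (indicator (nearset n q) x * dens A b c n x))" .
qed

lemma sum_near_le: "(\<Sum>p\<in>Xi n. indicator (nearset n p) x) \<le> (4::real)"
proof -
  have "(\<Sum>p\<in>Xi n. indicator (nearset n p) x) = real (card {p \<in> Xi n. near n p x})"
    by (simp add: nearset_def indicator_def sum.If_cases Int_def)
  also have "card {p \<in> Xi n. near n p x} \<le> card ((\<lambda>a. pt n (flr n x + a)) ` ({0, 1} \<times> {0, 1}))"
  proof (rule card_mono)
    show "{p \<in> Xi n. near n p x} \<subseteq> (\<lambda>a. pt n (flr n x + a)) ` ({0, 1} \<times> {0, 1})"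
    proof
      fix p assume "p \<in> {p \<in> Xi n. near n p x}"
      then have "p = pt n (flr n x + (flr n p - flr n x))" "flr n p - flr n x \<in> {0, 1} \<times> {0, 1}"
        using Xi_pt by (auto simp: near_def)
      then show "p \<in> (\<lambda>a. pt n (flr n x + a)) ` ({0, 1} \<times> {0, 1})" by (rule image_eqI)
    qed
  qed simp
  also have "\<dots> \<le> card ({0, 1 :: int} \<times> {0, 1 :: int})" by (rule card_image_le) simp
  also have "\<dots> = 4" by simp
  finally show ?thesis by simp
qed

text \<open>A point lies in one square and is near at most its four corners, so at most 16 pairs of
  grid points have an integrand that is nonzero there.\<close>

lemma ent_sum_bound:
  assumes i: "integrable lebesgue A" "integrable lebesgue b" "integrable lebesgue c"
  shows "(\<Sum>q\<in>Xi n. \<Sum>p\<in>Xi n. cmod (ent A b c n q p)) \<le> 16 * (LINT x|lebesgue. dens A b c n x)"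
proof -
  have "(\<Sum>q\<in>Xi n. \<Sum>p\<in>Xi n. cmod (ent A b c n q p))
      \<le> (\<Sum>q\<in>Xi n. \<Sum>p\<in>Xi n. LINT x|lebesgue. indicator (nearset n p) x * (indicator (nearset n q) x * dens A b c n x))"
    by (intro sum_mono ent_bound i)
  also have "\<dots> = (LINT x|lebesgue. (\<Sum>q\<in>Xi n. \<Sum>p\<in>Xi n. indicator (nearset n p) x * (indicator (nearset n q) x * dens A b c n x)))"
  proof -
    have "(\<Sum>q\<in>Xi n. \<Sum>p\<in>Xi n. LINT x|lebesgue. indicator (nearset n p) x * (indicator (nearset n q) x * dens A b c n x))
        = (\<Sum>q\<in>Xi n. LINT x|lebesgue. (\<Sum>p\<in>Xi n. indicator (nearset n p) x * (indicator (nearset n q) x * dens A b c n x)))"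
      by (intro sum.cong refl Bochner_Integration.integral_sum[symmetric] ent_bound(2)[OF i])
    also have "\<dots> = (LINT x|lebesgue. (\<Sum>q\<in>Xi n. \<Sum>p\<in>Xi n. indicator (nearset n p) x * (indicator (nearset n q) x * dens A b c n x)))"
      by (intro Bochner_Integration.integral_sum[symmetric] Bochner_Integration.integrable_sum ent_bound(2)[OF i])
    finally show ?thesis .
  qed
  also have "\<dots> \<le> (LINT x|lebesgue. 16 * dens A b c n x)"
  proof (rule integral_mono)
    show "integrable lebesgue (\<lambda>x. \<Sum>q\<in>Xi n. \<Sum>p\<in>Xi n. indicator (nearset n p) x * (indicator (nearset n q) x * dens A b c n x))"
      by (intro Bochner_Integration.integrable_sum ent_bound i)
    show "integrable lebesgue (\<lambda>x. 16 * dens A b c n x)" using integrable_dens[OF i] by simp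
    fix x
    have "(\<Sum>q\<in>Xi n. \<Sum>p\<in>Xi n. indicator (nearset n p) x * (indicator (nearset n q) x * dens A b c n x))
        = (\<Sum>p\<in>Xi n. indicator (nearset n p) x) * (\<Sum>q\<in>Xi n. indicator (nearset n q) x) * dens A b c n x"
      unfolding sum_product by (subst sum.swap) (simp only: sum_distrib_right mult.assoc)
    also have "\<dots> \<le> 4 * 4 * dens A b c n x"
      by (intro mult_right_mono mult_mono sum_near_le dens_nonneg sum_nonneg) auto
    finally show "(\<Sum>q\<in>Xi n. \<Sum>p\<in>Xi n. indicator (nearset n p) x * (indicator (nearset n q) x * dens A b c n x)) \<le> 16 * dens A b c n x"
      by simp
  qed
  finally show ?thesis by simp
qed

text \<open>Products of gradients are constant on each triangle. The patch of \<open>q\<close> lies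
  in the domain, so restricting the integral to the interior discards only a null set of the support
  and every admissible pair sees the full stencil, even close to the boundary.\<close>

lemma ent_const:
  assumes p: "p \<in> Xi n" and q: "q \<in> Xi n"
  shows "ent (\<lambda>x. indicator \<Omega> x *\<^sub>R B) (\<lambda>_. 0) (\<lambda>_. 0) n q p = (\<Sum>i\<in>UNIV. \<Sum>j\<in>UNIV. of_real (cK i j (flr n p - flr n q)) * B $ i $ j)"
proof -
  let ?d = "flr n p - flr n q"
  define T where "T = (\<lambda>i j x. \<Sum>a\<in>{0, 1} \<times> {0, 1}. \<Sum>u\<in>UNIV. (gr i u (a + ?d) * gr j u a / (mesh n)\<^sup>2) * indicator (Tri n u (flr n q - a)) x :: real)"
  have T_int: "integrable lebesgue (T i j)" for i j
    unfolding T_def by (intro Bochner_Integration.integrable_sum integrable_mult_right integral_indicator_Tri)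
  have T_val: "(LINT x|lebesgue. T i j x) = cK i j ?d" for i j
  proof -
    have "(LINT x|lebesgue. T i j x) = (\<Sum>a\<in>{0, 1} \<times> {0, 1}. \<Sum>u\<in>UNIV. (gr i u (a + ?d) * gr j u a / (mesh n)\<^sup>2) * ((mesh n)\<^sup>2 / 2))"
      unfolding T_def integral_indicator_Tri(2)[symmetric]
      by (subst Bochner_Integration.integral_sum, (intro Bochner_Integration.integrable_sum integrable_mult_right integral_indicator_Tri(1)),
          intro sum.cong refl, subst Bochner_Integration.integral_sum, (intro integrable_mult_right integral_indicator_Tri(1)), simp add: content_Tri)
    also have "\<dots> = cK i j ?d"
      unfolding cK_def sum_distrib_left by (intro sum.cong refl) simp
    finally show ?thesis .
  qed
  have prod: "hgrad i n p x * hgrad j n q x = T i j x" for i j x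
  proof (cases "near n q x")
    case True
    let ?a = "flr n q - flr n x"
    have "T i j x = (\<Sum>a\<in>{0, 1} \<times> {0, 1}. if a = ?a then gr i (up n x) (a + ?d) * gr j (up n x) a / (mesh n)\<^sup>2 else 0)"
      unfolding T_def
    proof (intro sum.cong refl)
      fix a :: "int \<times> int"
      have "x \<in> Tri n u (flr n q - a) \<longleftrightarrow> a = ?a \<and> u = up n x" for u
        by (auto simp: Tri_def algebra_simps)
      then have "(\<Sum>u\<in>UNIV. (gr i u (a + ?d) * gr j u a / (mesh n)\<^sup>2) * indicator (Tri n u (flr n q - a)) x)
          = (\<Sum>u\<in>UNIV. if u = up n x then (if a = ?a then gr i (up n x) (a + ?d) * gr j (up n x) a / (mesh n)\<^sup>2 else 0) else 0)"
        by (intro sum.cong refl) (auto simp: indicator_def)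
      then show "(\<Sum>u\<in>UNIV. (gr i u (a + ?d) * gr j u a / (mesh n)\<^sup>2) * indicator (Tri n u (flr n q - a)) x)
          = (if a = ?a then gr i (up n x) (a + ?d) * gr j (up n x) a / (mesh n)\<^sup>2 else 0)" by simp
    qed
    also have "\<dots> = gr i (up n x) (?a + ?d) * gr j (up n x) ?a / (mesh n)\<^sup>2"
      using True unfolding near_def by (subst sum.delta) auto
    also have "?a + ?d = flr n p - flr n x" by simp
    finally show ?thesis by (simp add: hgrad_def power2_eq_square)
  next
    case False
    have "T i j x = 0"
      unfolding T_def
    proof (intro sum.neutral ballI)
      fix a u assume "a \<in> {0, 1 :: int} \<times> {0, 1 :: int}"
      then have "x \<notin> cell n (flr n q - a)" using False near_iff_cell by blast
      then show "(gr i u (a + ?d) * gr j u a / (mesh n)\<^sup>2) * indicator (Tri n u (flr n q - a)) x = 0"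
        by (auto simp: cell_def Tri_def)
    qed
    then show ?thesis using hgrad_near[OF False] by simp
  qed
  have ae: "AE x in lebesgue. indicator (interior \<Omega>) x *\<^sub>R cf (\<lambda>x. indicator \<Omega> x *\<^sub>R B) (\<lambda>_. 0) (\<lambda>_. 0) n q p x
      = (\<Sum>i\<in>UNIV. \<Sum>j\<in>UNIV. of_real (T i j x) * B $ i $ j)"
    using AE_generic[of n] AE_not_frontier
  proof eventually_elim
    case (elim x)
    show ?case
    proof (cases "x \<in> interior \<Omega>")
      case True
      then have "x \<in> \<Omega>" using interior_subset by blast
      then show ?thesis using True by (simp add: cf_def prod del: of_real_mult)
    next
      case False
      then have "x \<notin> \<Omega>" by (intro notI) (rule not_frontier_cases[OF elim(2)], auto)
      then have "hgrad j n q x = 0" for j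
        using hgrad_patch[OF XiD(1)[OF q] elim(1)] XiD(2)[OF q] by blast
      then have "T i j x = 0" for i j using prod[of i x j] by simp
      then show ?thesis using False by simp
    qed
  qed
  have int: "integrable lebesgue (\<lambda>x. of_real (T i j x) * B $ i $ j)" for i j
    using T_int[of i j] by (intro integrable_mult_left) simp
  have m: "(\<lambda>x. \<Sum>i\<in>UNIV. \<Sum>j\<in>UNIV. of_real (T i j x) * B $ i $ j) \<in> borel_measurable lebesgue"
    by (intro borel_measurable_integrable Bochner_Integration.integrable_sum int)
  have "ent (\<lambda>x. indicator \<Omega> x *\<^sub>R B) (\<lambda>_. 0) (\<lambda>_. 0) n q p = (LINT x|lebesgue. (\<Sum>i\<in>UNIV. \<Sum>j\<in>UNIV. of_real (T i j x) * B $ i $ j))"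
    unfolding ent_def
    by (rule integral_cong_AE[OF borel_measurable_AE_lebesgue[OF m] m ae]) (use ae in \<open>auto elim: eventually_mono\<close>)
  also have "\<dots> = (\<Sum>i\<in>UNIV. \<Sum>j\<in>UNIV. of_real (LINT x|lebesgue. T i j x) * B $ i $ j)"
    by (simp add: int Bochner_Integration.integral_sum Bochner_Integration.integrable_sum)
  finally show ?thesis unfolding T_val .
qed

lemma integrable_ind_bounded:
  fixes f :: "real^2 \<Rightarrow> 'b::{banach, second_countable_topology}"
  assumes "f \<in> borel_measurable borel" "\<And>x. x \<in> \<Omega> \<Longrightarrow> norm (f x) \<le> K"
  shows "integrable lebesgue (\<lambda>x. indicator \<Omega> x *\<^sub>R f x)"
proof (rule Bochner_Integration.integrable_bound[of _ "\<lambda>x. K * indicator \<Omega> x"])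
  have b: "bounded \<Omega>" using sub bounded_cbox bounded_subset by blast
  have s: "\<Omega> \<in> sets borel" using closed by (simp add: borel_closed)
  show "integrable lebesgue (\<lambda>x. K * indicator \<Omega> x :: real)"
    using emeasure_bounded_finite[OF b] s by (intro integrable_mult_right integrable_real_indicator) (auto simp: less_top)
  show "(\<lambda>x. indicator \<Omega> x *\<^sub>R f x) \<in> borel_measurable lebesgue"
    using s assms(1) by (intro measurable_completion) (auto intro!: borel_measurable_scaleR)
  show "AE x in lebesgue. norm (indicator \<Omega> x *\<^sub>R f x) \<le> norm (K * indicator \<Omega> x)"
    using assms(2) by (auto simp: indicator_def intro: order_trans[OF _ abs_ge_self])
qed

text \<open>After freezing the coefficient at \<open>B\<close> the majorant is at most
  \<open>4 * e / (mesh n)\<^sup>2\<close> on the squares around \<open>q\<close>, whose total area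
  is at most \<open>4 * (mesh n)\<^sup>2\<close>. With \<open>B = 0\<close> this is a plain bound on
  the entry.\<close>

lemma ent_approx:
  assumes p: "p \<in> Xi n" and q: "q \<in> Xi n"
    and A: "continuous_on UNIV A" and K: "\<And>x. x \<in> \<Omega> \<Longrightarrow> norm (A x) \<le> K"
    and close: "\<And>x i j. near n q x \<Longrightarrow> cmod (A x $ i $ j - B $ i $ j) \<le> e" and e: "0 \<le> e"
  shows "cmod (ent (\<lambda>x. indicator \<Omega> x *\<^sub>R A x) (\<lambda>_. 0) (\<lambda>_. 0) n q p
      - (\<Sum>i\<in>UNIV. \<Sum>j\<in>UNIV. of_real (cK i j (flr n p - flr n q)) * B $ i $ j)) \<le> 16 * e"
proof -
  have Ai: "integrable lebesgue (\<lambda>x. indicator \<Omega> x *\<^sub>R A x)"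
    using K A by (intro integrable_ind_bounded borel_measurable_continuous_onI)
  have Bi: "integrable lebesgue (\<lambda>x. indicator \<Omega> x *\<^sub>R B)"
    by (rule integrable_ind_bounded[of _ "norm B"]) auto
  let ?D = "\<lambda>x. indicator \<Omega> x *\<^sub>R A x - indicator \<Omega> x *\<^sub>R B"
  have Di: "integrable lebesgue ?D" using Ai Bi by simp
  have dens: "dens ?D (\<lambda>_. 0) (\<lambda>_. 0) n x \<le> 4 * e / (mesh n)\<^sup>2" if "near n q x" for x
  proof -
    have "(\<Sum>i\<in>UNIV. \<Sum>j\<in>UNIV. cmod (?D x $ i $ j)) \<le> (\<Sum>i\<in>(UNIV::2 set). \<Sum>j\<in>(UNIV::2 set). e)"
      using close[OF that] e by (intro sum_mono) (auto simp: indicator_def)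
    then show ?thesis by (simp add: dens_def divide_right_mono)
  qed
  have "ent (\<lambda>x. indicator \<Omega> x *\<^sub>R A x) (\<lambda>_. 0) (\<lambda>_. 0) n q p
      - (\<Sum>i\<in>UNIV. \<Sum>j\<in>UNIV. of_real (cK i j (flr n p - flr n q)) * B $ i $ j) = ent ?D (\<lambda>_. 0) (\<lambda>_. 0) n q p"
    unfolding ent_const[OF p q, symmetric] by (subst ent_diff) (use Ai Bi in auto)
  also have "cmod \<dots> \<le> (LINT x|lebesgue. indicator (nearset n p) x * (indicator (nearset n q) x * dens ?D (\<lambda>_. 0) (\<lambda>_. 0) n x))"
    by (rule ent_bound(1)[OF Di _ _ p q]) auto
  also have "\<dots> \<le> (LINT x|lebesgue. 4 * e / (mesh n)\<^sup>2 * indicator (nearset n q) x)"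
  proof (rule integral_mono[OF ent_bound(2)[OF Di _ _ p q]])
    show "integrable lebesgue (\<lambda>x. 4 * e / (mesh n)\<^sup>2 * indicator (nearset n q) x)"
      using measure_nearset_le(2) by (intro integrable_mult_right integrable_real_indicator) auto
    fix x
    have "dens ?D (\<lambda>_. 0) (\<lambda>_. 0) n x \<le> 4 * e / (mesh n)\<^sup>2" if "x \<in> nearset n q" using dens that by (simp add: nearset_def)
    moreover have "0 \<le> 4 * e / (mesh n)\<^sup>2" using e by simp
    ultimately show "indicator (nearset n p) x * (indicator (nearset n q) x * dens ?D (\<lambda>_. 0) (\<lambda>_. 0) n x) \<le> 4 * e / (mesh n)\<^sup>2 * indicator (nearset n q) x"
      by (cases "x \<in> nearset n p"; cases "x \<in> nearset n q") auto
  qed auto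
  also have "\<dots> = 4 * e / (mesh n)\<^sup>2 * measure lebesgue (nearset n q)" by simp
  also have "\<dots> \<le> 4 * e / (mesh n)\<^sup>2 * (4 * (mesh n)\<^sup>2)"
    using e measure_nearset_le(1) by (intro mult_left_mono) auto
  also have "\<dots> = 16 * e" by simp
  finally show ?thesis .
qed

lemma ent_far:
  assumes p: "p \<in> Xi n" and q: "q \<in> Xi n" and far: "flr n p - flr n q \<notin> {-1, 0, 1} \<times> {-1, 0, 1}"
  shows "ent A b c n q p = 0"
proof -
  have "cf A b c n q p x = 0" for x
  proof -
    have "\<not> (near n p x \<and> near n q x)"
    proof
      assume "near n p x \<and> near n q x"
      then have "flr n p - flr n q \<in> {-1, 0, 1} \<times> {-1, 0, 1}"
        unfolding near_def mem_Times_iff by auto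
      with far show False by simp
    qed
    then show ?thesis
      using hatf_near[OF XiD(1)[OF p], of x] hatf_near[OF XiD(1)[OF q], of x] hgrad_near[of n p x] hgrad_near[of n q x]
      by (auto simp: cf_def)
  qed
  then show ?thesis by (simp add: ent_def)
qed

end

section \<open>The symbol as a kernel\<close>

definition offsets :: "(int \<times> int) set" where "offsets = {-1, 0, 1} \<times> {-1, 0, 1}"

definition ph :: "real^2 \<Rightarrow> int \<times> int \<Rightarrow> complex" where
  "ph \<theta> c = cis (\<theta> $ 1 * of_int (fst c) + \<theta> $ 2 * of_int (snd c))"

text \<open>The translation invariant stencil of a constant coefficient matrix: by
  \<open>ent_const\<close>, the entry with \<open>flr n p - flr n q = d\<close>.\<close>

definition rr :: "complex^2^2 \<Rightarrow> int \<times> int \<Rightarrow> complex" where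
  "rr B d = (\<Sum>i\<in>UNIV. \<Sum>j\<in>UNIV. of_real (cK i j d) * B $ i $ j)"

text \<open>The symbol for a constant coefficient matrix, as the Fourier series of the stencil (see \<open>P1_symbol_kap\<close>).\<close>

definition kap :: "complex^2^2 \<Rightarrow> real^2 \<Rightarrow> complex" where
  "kap B \<theta> = (\<Sum>d\<in>offsets. rr B d * ph \<theta> d)"

definition Theta :: "(real^2) set" where
  "Theta = cbox (vector [-pi, -pi]) (vector [pi, pi])"

definition fk :: "real \<Rightarrow> real \<Rightarrow> complex \<Rightarrow> real" where
  "fk s t z = 1 / ((cmod (z - of_real t))\<^sup>2 + s)"

definition HB :: "real \<Rightarrow> real \<Rightarrow> complex^2^2 \<Rightarrow> real" where
  "HB s t B = (LINT \<theta>:Theta|lborel. fk s t (kap B \<theta>))"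

definition mnorm :: "complex^2^2 \<Rightarrow> real" where
  "mnorm B = (\<Sum>i\<in>UNIV. \<Sum>j\<in>UNIV. cmod (B $ i $ j))"

lemma offsets_finite [simp]: "finite offsets" "card offsets = 9"
  by (simp_all add: offsets_def card_cartesian_product)

lemma ph_add: "ph \<theta> (c + d) = ph \<theta> c * ph \<theta> d"
  by (simp add: ph_def cis_mult algebra_simps)

lemma cmod_ph [simp]: "cmod (ph \<theta> c) = 1"
  by (simp add: ph_def)

lemma cnj_ph: "cnj (ph \<theta> c) = ph \<theta> (- c)"
  by (simp add: ph_def cis_cnj algebra_simps)

lemma ph_continuous: "continuous_on S (\<lambda>\<theta>. ph \<theta> c)"
  unfolding ph_def by (intro continuous_intros)

lemma abs_cK_le: "\<bar>cK i j d\<bar> \<le> 4"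
proof -
  have "\<bar>\<Sum>a\<in>{0, 1} \<times> {0, 1}. \<Sum>u\<in>UNIV. gr i u (a + d) * gr j u a\<bar> \<le> (\<Sum>a\<in>{0, 1 :: int} \<times> {0, 1 :: int}. \<Sum>u\<in>(UNIV :: bool set). 1)"
    by (intro order_trans[OF sum_abs] sum_mono order_trans[OF sum_abs])
       (simp add: abs_mult mult_le_one abs_gr_le)
  then show ?thesis by (simp add: cK_def)
qed

lemma rr_diff: "rr B d - rr B' d = rr (B - B') d"
  by (simp add: rr_def algebra_simps sum_subtractf)

lemma cmod_rr_le: "cmod (rr B d) \<le> 4 * mnorm B"
  unfolding rr_def mnorm_def sum_distrib_left
  by (intro order_trans[OF norm_sum] sum_mono) (simp add: norm_mult abs_cK_le mult_right_mono)

lemma kap_diff_le: "cmod (kap B \<theta> - kap B' \<theta>) \<le> 36 * mnorm (B - B')"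
proof -
  have "kap B \<theta> - kap B' \<theta> = (\<Sum>d\<in>offsets. rr (B - B') d * ph \<theta> d)"
    by (simp add: kap_def rr_diff[symmetric] algebra_simps sum_subtractf)
  also have "cmod \<dots> \<le> (\<Sum>d\<in>offsets. 4 * mnorm (B - B'))"
    by (intro order_trans[OF norm_sum] sum_mono) (simp add: norm_mult cmod_rr_le)
  finally show ?thesis by simp
qed

lemma kap_continuous: "continuous_on S (\<lambda>\<theta>. kap B \<theta>)"
  unfolding kap_def by (intro continuous_intros ph_continuous)

lemma fk_bounds: "1 \<le> s \<Longrightarrow> 0 \<le> fk s t z" "1 \<le> s \<Longrightarrow> fk s t z \<le> 1"
  by (auto simp: fk_def divide_le_eq add_nonneg_pos intro: add_increasing)

text \<open>With denominators X and Y and distances a and b to \<open>t\<close>, the difference is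
  (b - a)(a + b)/(XY). As \<open>s \<ge> 1\<close>, both X and Y are at least 1 with 2a below X and
  2b below Y, so a + b is at most XY and the constant is 1.\<close>

lemma fk_lipschitz:
  assumes s: "1 \<le> s"
  shows "\<bar>fk s t z - fk s t z'\<bar> \<le> cmod (z - z')"
proof -
  let ?a = "cmod (z - of_real t)" and ?b = "cmod (z' - of_real t)"
  define X Y where "X = ?a\<^sup>2 + s" and "Y = ?b\<^sup>2 + s"
  have XY: "X \<ge> 1" "Y \<ge> 1" using s by (auto simp: X_def Y_def intro: add_increasing)
  have "2 * ?a \<le> X" "2 * ?b \<le> Y"
    using s zero_le_power2[of "?a - 1"] zero_le_power2[of "?b - 1"]
    by (auto simp: X_def Y_def power2_eq_square algebra_simps)
  moreover have "X \<le> X * Y" "Y \<le> X * Y" using XY by (simp_all add: mult_le_cancel_left1 mult_le_cancel_right1)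
  ultimately have ab: "?a + ?b \<le> X * Y" by linarith
  have "fk s t z - fk s t z' = (Y - X) / (X * Y)"
  proof -
    have "fk s t z = 1 / X" "fk s t z' = 1 / Y" by (simp_all add: fk_def X_def Y_def)
    then show ?thesis using XY by (simp add: diff_frac_eq)
  qed
  also have "Y - X = (?b - ?a) * (?a + ?b)" by (simp add: X_def Y_def power2_eq_square algebra_simps)
  finally have "\<bar>fk s t z - fk s t z'\<bar> = \<bar>?b - ?a\<bar> * ((?a + ?b) / (X * Y))"
    using XY by (simp add: abs_mult)
  also have "\<dots> \<le> \<bar>?b - ?a\<bar> * 1"
    using ab XY by (intro mult_left_mono) (auto simp: divide_le_eq)
  also have "\<dots> \<le> cmod ((z' - of_real t) - (z - of_real t))" using norm_triangle_ineq3[of "z' - of_real t" "z - of_real t"] by simp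
  finally show ?thesis by (simp add: norm_minus_commute)
qed

lemma fk_continuous: "1 \<le> s \<Longrightarrow> continuous_on S g \<Longrightarrow> continuous_on S (\<lambda>x. fk s t (g x))"
  unfolding fk_def by (intro continuous_intros) (auto simp: add_nonneg_eq_0_iff)

lemma compact_Theta [simp]: "compact Theta" by (simp add: Theta_def)

lemma integrable_Theta:
  fixes f :: "real^2 \<Rightarrow> 'b::{banach, second_countable_topology}"
  shows "continuous_on UNIV f \<Longrightarrow> set_integrable lborel Theta f"
  unfolding set_integrable_def by (rule borel_integrable_compact) (auto intro: continuous_on_subset)

lemma measure_Theta: "measure lborel Theta = (2 * pi)\<^sup>2"
proof -
  have "cbox (vector [-pi, -pi]) (vector [pi, pi] :: real^2) \<noteq> {}"
    by (simp add: interval_ne_empty_cart forall_2)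
  then show ?thesis
    unfolding Theta_def by (subst content_cbox_cart) (auto simp: UNIV_2 power2_eq_square)
qed

lemma integral_cis_int:
  "integral {-pi..pi} (\<lambda>u. cis (u * of_int a)) = (if a = 0 then of_real (2 * pi) else 0)"
proof (cases "a = 0")
  case True
  then show ?thesis by (simp add: scaleR_conv_of_real)
next
  case False
  have "((\<lambda>u. cis (u * of_int a)) has_integral
      (cis (pi * of_int a) / (\<i> * of_int a) - cis (- pi * of_int a) / (\<i> * of_int a))) {-pi..pi}"
  proof (rule fundamental_theorem_of_calculus)
    fix x :: real assume "x \<in> {-pi..pi}"
    have "((\<lambda>u. exp (\<i> * of_real u * of_int a) / (\<i> * of_int a)) has_vector_derivative exp (\<i> * of_real x * of_int a)) (at x within {-pi..pi})"
      using False by (auto intro!: derivative_eq_intros has_vector_derivative_real_field simp: field_simps)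
    then show "((\<lambda>u. cis (u * of_int a) / (\<i> * of_int a)) has_vector_derivative cis (x * of_int a)) (at x within {-pi..pi})"
      by (simp add: cis_conv_exp mult.assoc)
  qed simp
  moreover have "cis (pi * of_int a) = cis (- pi * of_int a)"
  proof -
    have "cis (2 * pi * of_int a) = 1" by (simp add: cis_multiple_2pi)
    moreover have "cis (pi * of_int a) = cis (2 * pi * of_int a) * cis (- pi * of_int a)"
      unfolding cis_mult by (rule arg_cong[where f = cis]) simp
    ultimately show ?thesis by (simp only: mult_1)
  qed
  ultimately show ?thesis using False by (simp add: integral_unique)
qed

lemma image_vec_pair: "(\<lambda>(u, v). vector [u, v] :: real^2) ` cbox (a, b) (c, d) = cbox (vector [a, b]) (vector [c, d])"
proof (intro Set.set_eqI iffI)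
  fix x :: "real^2" assume "x \<in> cbox (vector [a, b]) (vector [c, d])"
  then have "(x $ 1, x $ 2) \<in> cbox (a, b) (c, d)" "x = (\<lambda>(u, v). vector [u, v]) (x $ 1, x $ 2)"
    by (auto simp: mem_box_cart forall_2 vec_eq_iff cbox_Pair_eq)
  then show "x \<in> (\<lambda>(u, v). vector [u, v]) ` cbox (a, b) (c, d)" by blast
qed (auto simp: mem_box_cart forall_2 cbox_Pair_eq)

lemma image_pair_vec: "(\<lambda>x::real^2. (x $ 1, x $ 2)) ` cbox a b = cbox (a $ 1, a $ 2) (b $ 1, b $ 2)"
proof (intro Set.set_eqI iffI)
  fix y assume y: "y \<in> cbox (a $ 1, a $ 2) (b $ 1, b $ 2)"
  then have "vector [fst y, snd y] \<in> cbox a b" "y = (\<lambda>x::real^2. (x $ 1, x $ 2)) (vector [fst y, snd y])"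
    by (auto simp: mem_box_cart forall_2 cbox_Pair_eq)
  then show "y \<in> (\<lambda>x::real^2. (x $ 1, x $ 2)) ` cbox a b" by blast
qed (auto simp: mem_box_cart forall_2 cbox_Pair_eq)

text \<open>Fubini on pairs of reals, transported to vectors by the coordinate map, which preserves
  content. Averaging over all frequencies is what isolates the diagonal of the resolvent
  later.\<close>

lemma ph_orthogonal: "(LINT \<theta>:Theta|lborel. ph \<theta> c) = (if c = 0 then of_real ((2 * pi)\<^sup>2) else 0)"
proof -
  obtain a b where c: "c = (a, b)" by (cases c)
  let ?f = "\<lambda>(u, v). cis (u * of_int a) * cis (v * of_int b)"
  let ?I = "\<lambda>a. if a = (0::int) then complex_of_real (2 * pi) else 0"
  have cont: "continuous_on (cbox (-pi, -pi) (pi, pi)) ?f"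
    unfolding case_prod_unfold by (intro continuous_intros)
  have "integral (cbox (-pi, -pi) (pi, pi)) ?f = integral (cbox (-pi) pi) (\<lambda>u. integral (cbox (-pi) pi) (\<lambda>v. cis (u * of_int a) * cis (v * of_int b)))"
    using integral_prod_continuous[OF cont] by simp
  also have "\<dots> = integral {-pi..pi} (\<lambda>u. cis (u * of_int a)) * integral {-pi..pi} (\<lambda>v. cis (v * of_int b))"
    by (simp add: integral_mult_left integral_mult_right)
  also have "\<dots> = ?I a * ?I b" unfolding integral_cis_int ..
  finally have hi: "(?f has_integral (?I a * ?I b)) (cbox (-pi, -pi) (pi, pi))"
    using integrable_continuous[OF cont] has_integral_integral by metis
  have "((\<lambda>x::real^2. ?f (x $ 1, x $ 2)) has_integral (1 / 1) *\<^sub>R (?I a * ?I b)) ((\<lambda>(u, v). vector [u, v] :: real^2) ` cbox (-pi, -pi) (pi, pi))"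
  proof (rule has_integral_twiddle[OF _ _ _ _ _ _ _ hi])
    show "content ((\<lambda>x::real^2. (x $ 1, x $ 2)) ` cbox u v) = 1 * content (cbox u v)" for u v
    proof (cases "cbox u v = {}")
      case False
      then have "u $ 1 \<le> v $ 1" "u $ 2 \<le> v $ 2" by (auto simp: interval_ne_empty_cart)
      then show ?thesis
        unfolding image_pair_vec content_Pair using False
        by (subst content_cbox_cart) (auto simp: UNIV_2)
    qed simp
    show "\<exists>w z. (\<lambda>x::real^2. (x $ 1, x $ 2)) ` cbox u v = cbox w z" for u v
      using image_pair_vec by blast
    show "\<exists>w z. (\<lambda>(u, v). vector [u, v] :: real^2) ` cbox u v = cbox w z" for u v
      using image_vec_pair[of "fst u" "snd u" "fst v" "snd v"] by auto
    show "isCont (\<lambda>x::real^2. (x $ 1, x $ 2)) x" for x by (intro continuous_intros)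
  qed (auto simp: vec_eq_iff forall_2)
  then have "((\<lambda>\<theta>. ph \<theta> c) has_integral (?I a * ?I b)) Theta"
    by (simp add: image_vec_pair Theta_def ph_def c cis_mult)
  then have "integral Theta (\<lambda>\<theta>. ph \<theta> c) = ?I a * ?I b" by (rule integral_unique)
  then show ?thesis
    using set_borel_integral_eq_integral(2)[OF integrable_Theta[OF ph_continuous[of UNIV c]]]
    by (simp add: c zero_prod_def power2_eq_square)
qed

lemma HB_lipschitz:
  assumes s: "1 \<le> s"
  shows "\<bar>HB s t B - HB s t B'\<bar> \<le> (2 * pi)\<^sup>2 * (36 * mnorm (B - B'))"
proof -
  have i: "set_integrable lborel Theta (\<lambda>\<theta>. fk s t (kap B \<theta>))" for B
    by (intro integrable_Theta fk_continuous s kap_continuous)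
  have "\<bar>HB s t B - HB s t B'\<bar> = \<bar>LINT \<theta>:Theta|lborel. fk s t (kap B \<theta>) - fk s t (kap B' \<theta>)\<bar>"
    unfolding HB_def by (subst set_integral_diff(2)[OF i i]) simp
  also have "\<dots> \<le> (LINT \<theta>:Theta|lborel. \<bar>fk s t (kap B \<theta>) - fk s t (kap B' \<theta>)\<bar>)"
    using set_integral_norm_bound[OF set_integral_diff(1)[OF i i]] by simp
  also have "\<dots> \<le> (LINT \<theta>:Theta|lborel. 36 * mnorm (B - B'))"
  proof (rule set_integral_mono)
    show "set_integrable lborel Theta (\<lambda>\<theta>. \<bar>fk s t (kap B \<theta>) - fk s t (kap B' \<theta>)\<bar>)"
      using set_integral_diff(1)[OF i i] by (rule set_integrable_abs)
    show "set_integrable lborel Theta (\<lambda>_. 36 * mnorm (B - B'))" by (rule integrable_Theta) simp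
  qed (use fk_lipschitz[OF s] kap_diff_le in \<open>blast intro: order_trans\<close>)
  also have "\<dots> = (2 * pi)\<^sup>2 * (36 * mnorm (B - B'))"
    by (simp add: set_lebesgue_integral_def measure_Theta)
  finally show ?thesis .
qed

lemma HB_bounds: assumes "1 \<le> s" shows "0 \<le> HB s t B" "HB s t B \<le> (2 * pi)\<^sup>2"
proof -
  have i: "set_integrable lborel Theta (\<lambda>\<theta>. fk s t (kap B \<theta>))"
    by (intro integrable_Theta fk_continuous assms kap_continuous)
  show "0 \<le> HB s t B"
    unfolding HB_def set_lebesgue_integral_def by (rule Bochner_Integration.integral_nonneg) (simp add: fk_bounds assms)
  have "HB s t B \<le> (LINT \<theta>:Theta|lborel. 1)"
    unfolding HB_def by (rule set_integral_mono[OF i integrable_Theta]) (auto simp: fk_bounds assms)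
  then show "HB s t B \<le> (2 * pi)\<^sup>2" by (simp add: set_lebesgue_integral_def measure_Theta)
qed

lemma mnorm_le: "mnorm B \<le> 4 * norm B"
proof -
  have "cmod (B $ i $ j) \<le> norm B" for i j
    using Finite_Cartesian_Product.norm_nth_le[of "B $ i" j] Finite_Cartesian_Product.norm_nth_le[of B i] by linarith
  then have "mnorm B \<le> (\<Sum>i\<in>(UNIV::2 set). \<Sum>j\<in>(UNIV::2 set). norm B)"
    unfolding mnorm_def by (intro sum_mono)
  then show ?thesis by simp
qed

lemma mnorm_nonneg: "0 \<le> mnorm B"
  unfolding mnorm_def by (intro sum_nonneg) auto

lemma HB_continuous: "1 \<le> s \<Longrightarrow> continuous_on UNIV (HB s t)"
proof -
  assume s: "1 \<le> s"
  have "((\<lambda>B. HB s t B) \<longlongrightarrow> HB s t B0) (at B0)" for B0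
  proof (rule LIM_zero_cancel, rule Lim_null_comparison)
    show "\<forall>\<^sub>F B in at B0. norm (HB s t B - HB s t B0) \<le> (2 * pi)\<^sup>2 * (36 * (4 * norm (B - B0)))"
      using HB_lipschitz[OF s, of t] mnorm_le by (intro always_eventually allI) (auto intro!: order_trans[OF HB_lipschitz[OF s]] mult_left_mono)
    show "((\<lambda>B. (2 * pi)\<^sup>2 * (36 * (4 * norm (B - B0)))) \<longlongrightarrow> 0) (at B0)"
      by (auto intro!: tendsto_eq_intros)
  qed
  then show ?thesis by (simp add: continuous_on_eq_continuous_at isCont_def)
qed

section \<open>Tent-shaped windows\<close>

definition win :: "real \<Rightarrow> real^2 \<Rightarrow> real" where "win r x = max 0 (r - norm x)"

lemma win_bounds: "0 \<le> win r x" "0 \<le> r \<Longrightarrow> win r x \<le> r" "r \<le> norm x \<Longrightarrow> win r x = 0"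
  by (auto simp: win_def)

text \<open>Slope one: moving the window by a stencil offset costs only a multiple of the mesh size,
  which is all that separates a wave packet from a plane wave on the scale of the stencil.\<close>

lemma win_lipschitz: "\<bar>win r x - win r y\<bar> \<le> norm (x - y)"
  using norm_triangle_ineq3[of x y] by (auto simp: win_def max_def)

lemma win_continuous [continuous_intros]: "continuous_on S g \<Longrightarrow> continuous_on S (\<lambda>x. win r (g x))"
  unfolding win_def by (intro continuous_intros)

text \<open>The total weight a grid point receives from all window positions, the same for every
  point by translation invariance.\<close>

definition winc :: "real \<Rightarrow> real" where "winc r = (LINT y|lborel. (win r (y :: real^2))\<^sup>2)"

lemma win_translate: "(LINT y|lborel. (win r (p - y))\<^sup>2) = winc r"
proof -
  have m: "(\<lambda>y::real^2. (win r y)\<^sup>2) \<in> borel_measurable borel"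
    by (intro borel_measurable_continuous_onI continuous_intros)
  have "winc r = (LINT y|distr lborel borel ((+) (- p)). (win r y)\<^sup>2)"
    unfolding lborel_distr_plus winc_def ..
  also have "\<dots> = (LINT y|lborel. (win r (- p + y))\<^sup>2)"
    by (rule integral_distr) (use m in auto)
  also have "\<dots> = (LINT y|lborel. (win r (p - y))\<^sup>2)"
    by (intro Bochner_Integration.integral_cong refl) (simp add: win_def norm_minus_commute)
  finally show ?thesis by simp
qed

lemma win_integrable:
  assumes f: "continuous_on UNIV f"
  shows "integrable lborel (\<lambda>y. (win r (p - y))\<^sup>2 * f y)"
proof -
  have "integrable lborel (\<lambda>y. indicator (cball p \<bar>r\<bar>) y *\<^sub>R ((win r (p - y))\<^sup>2 * f y))"
    by (rule borel_integrable_compact) (auto intro!: continuous_intros continuous_on_subset[OF f])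
  moreover have eq: "indicator (cball p \<bar>r\<bar>) y *\<^sub>R ((win r (p - y))\<^sup>2 * f y) = (win r (p - y))\<^sup>2 * f y" for y
  proof (cases "norm (p - y) \<le> \<bar>r\<bar>")
    case False
    then have "r \<le> norm (p - y)" by linarith
    then show ?thesis using win_bounds(3)[of r "p - y"] by simp
  qed (simp add: dist_norm)
  ultimately show ?thesis by (simp only: eq)
qed

lemma winc_pos: assumes "0 < r" shows "0 < winc r"
proof -
  have i: "integrable lborel (\<lambda>y::real^2. (win r y)\<^sup>2)"
    using win_integrable[of "\<lambda>_. 1" r 0] by (simp add: win_def)
  have nn: "winc r \<ge> 0" unfolding winc_def by (rule Bochner_Integration.integral_nonneg) simp
  have "winc r \<noteq> 0"
  proof
    assume "winc r = 0"
    then have "AE y in lborel. (win r (y :: real^2))\<^sup>2 = 0"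
      unfolding winc_def using integral_nonneg_eq_0_iff_AE[OF i] by simp
    then have "AE y in lborel. (y :: real^2) \<notin> ball 0 r"
      by eventually_elim (auto simp: win_def max_def split: if_splits)
    then have "emeasure lborel (ball (0 :: real^2) r) = 0"
      by (subst (asm) AE_iff_null_sets[symmetric]) (auto simp: null_sets_def)
    then have "negligible (ball (0 :: real^2) r)"
      by (simp add: negligible_iff_null_sets null_sets_def)
    then show False using open_not_negligible[of "ball (0 :: real^2) r"] assms by simp
  qed
  with nn show ?thesis by simp
qed

text \<open>The stencil coefficients are evaluated one by one. The offsets (1, 1) and (-1, -1) drop
  out since no triangle has both of these grid points as vertices; the stencil is even in the
  offset, which reconciles the signs of the exponents.\<close>

lemma P1_symbol_kap: "P1_symbol \<Omega> A (x, \<theta>) = kap (zero_extension \<Omega> A x) \<theta>"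
proof -
  define B where "B = zero_extension \<Omega> A x"
  have g: "gr 1 u a = gr1 u (fst a) (snd a)" "gr 2 u a = gr1 u (snd a) (fst a)" for u a by (simp_all add: gr_def)
  have sq: "(\<Sum>a\<in>{0, 1 :: int} \<times> {0, 1 :: int}. F a) = F (0, 0) + F (0, 1) + F (1, 0) + F (1, 1)" for F :: "int \<times> int \<Rightarrow> real"
    by (simp add: sum.cartesian_product[symmetric, of "\<lambda>a b. F (a, b)", simplified])
  have ck: "cK i j d = (1/2) * ((gr i True d * gr j True 0 + gr i False d * gr j False 0)
     + (gr i True ((0, 1) + d) * gr j True (0, 1) + gr i False ((0, 1) + d) * gr j False (0, 1))
     + (gr i True ((1, 0) + d) * gr j True (1, 0) + gr i False ((1, 0) + d) * gr j False (1, 0))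
     + (gr i True ((1, 1) + d) * gr j True (1, 1) + gr i False ((1, 1) + d) * gr j False (1, 1)))" for i j d
    unfolding cK_def sq by (simp add: UNIV_bool zero_prod_def[symmetric])
  have s9: "(\<Sum>d\<in>offsets. F d) = F (-1, -1) + F (-1, 0) + F (-1, 1) + F (0, -1) + F (0, 0) + F (0, 1) + F (1, -1) + F (1, 0) + F (1, 1)" for F :: "int \<times> int \<Rightarrow> complex"
    by (simp add: offsets_def)
  let ?\<beta> = "\<lambda>u v. scalar_product u (B *v v)"
  let ?B1 = "vector [1, 1] :: complex^2" and ?B2 = "vector [1, 0] :: complex^2" and ?B3 = "vector [0, 1] :: complex^2"
  have rv: "rr B (-1, -1) = 0" "rr B (1, 1) = 0" "rr B (0, 0) = ?\<beta> ?B1 ?B1 + ?\<beta> ?B2 ?B2 + ?\<beta> ?B3 ?B3"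
    "rr B (0, 1) = - (1/2) * ?\<beta> ?B3 ?B1 - (1/2) * ?\<beta> ?B1 ?B3" "rr B (0, -1) = - (1/2) * ?\<beta> ?B3 ?B1 - (1/2) * ?\<beta> ?B1 ?B3"
    "rr B (1, 0) = - (1/2) * ?\<beta> ?B1 ?B2 - (1/2) * ?\<beta> ?B2 ?B1" "rr B (-1, 0) = - (1/2) * ?\<beta> ?B1 ?B2 - (1/2) * ?\<beta> ?B2 ?B1"
    "rr B (1, -1) = (1/2) * ?\<beta> ?B2 ?B3 + (1/2) * ?\<beta> ?B3 ?B2" "rr B (-1, 1) = (1/2) * ?\<beta> ?B2 ?B3 + (1/2) * ?\<beta> ?B3 ?B2"
    by (simp_all add: rr_def ck sum_2 g gr1_def scalar_product_def matrix_vector_mult_def algebra_simps)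
  have pv: "ph \<theta> (0, 0) = 1" "ph \<theta> (0, 1) = exp (\<i> * of_real (\<theta> $ 2))" "ph \<theta> (0, -1) = exp (- \<i> * of_real (\<theta> $ 2))"
    "ph \<theta> (1, 0) = exp (\<i> * of_real (\<theta> $ 1))" "ph \<theta> (-1, 0) = exp (- \<i> * of_real (\<theta> $ 1))"
    "ph \<theta> (1, -1) = exp (\<i> * of_real (\<theta> $ 1) - \<i> * of_real (\<theta> $ 2))" "ph \<theta> (-1, 1) = exp (- \<i> * of_real (\<theta> $ 1) + \<i> * of_real (\<theta> $ 2))"
    by (simp_all add: ph_def cis_conv_exp algebra_simps)
  show ?thesis
    unfolding kap_def s9 B_def[symmetric] rv pv P1_symbol_def Let_def prod.case by (simp add: algebra_simps)
qed

section \<open>Local Fourier quasimodes\<close>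

lemma weighted_AM_GM:
  fixes a b \<epsilon> :: real
  assumes "0 < \<epsilon>"
  shows "a * b \<le> \<epsilon> / 2 * a\<^sup>2 + b\<^sup>2 / (2 * \<epsilon>)"
proof -
  have "0 \<le> (\<epsilon> * a - b)\<^sup>2" by simp
  then have "2 * \<epsilon> * (a * b) \<le> \<epsilon>\<^sup>2 * a\<^sup>2 + b\<^sup>2" by (simp add: power2_eq_square algebra_simps)
  then have "a * b \<le> (\<epsilon>\<^sup>2 * a\<^sup>2 + b\<^sup>2) / (2 * \<epsilon>)" using assms by (simp add: pos_le_divide_eq mult.commute)
  also have "\<dots> = \<epsilon> / 2 * a\<^sup>2 + b\<^sup>2 / (2 * \<epsilon>)" using assms by (simp add: add_divide_distrib power2_eq_square)
  finally show ?thesis .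
qed

context region
begin

text \<open>A wave packet with window centred at \<open>y\<close> and frequency \<open>\<theta>\<close>.\<close>

definition coh :: "nat \<Rightarrow> real \<Rightarrow> real^2 \<Rightarrow> real^2 \<Rightarrow> real^2 \<Rightarrow> complex" where
  "coh n r y \<theta> p = of_real (win r (p - y)) * ph \<theta> (flr n p)"

definition smat :: "(real^2 \<Rightarrow> real^2 \<Rightarrow> complex) \<Rightarrow> nat \<Rightarrow> complex mat" where
  "smat K n = Matrix.mat (card (Xi n)) (card (Xi n)) (\<lambda>(i, j). K (grid_in n \<Omega> ! i) (grid_in n \<Omega> ! j))"

lemma smat_carrier [simp]: "smat K n \<in> carrier_mat (card (Xi n)) (card (Xi n))"
  by (simp add: smat_def)

lemma sum_grid_in: "(\<Sum>i<card (Xi n). F (grid_in n \<Omega> ! i)) = (\<Sum>p\<in>Xi n. F p)"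
proof -
  have "bij_betw ((!) (grid_in n \<Omega>)) {..<card (Xi n)} (Xi n)"
    by (rule bij_betw_nth) (auto simp: distinct_grid_in distinct_card Xi_def)
  then show ?thesis by (rule sum.reindex_bij_betw)
qed

lemma nth_Xi: "i < card (Xi n) \<Longrightarrow> grid_in n \<Omega> ! i \<in> Xi n"
  by (simp add: distinct_grid_in distinct_card Xi_def)

text \<open>In a good row the residual has nine terms, each consisting of a coefficient error
  \<open>e\<close> times the window and a window variation \<open>2 * mesh n\<close> times
  \<open>k0\<close>; squaring the sum gives 162 = 2 * 9^2 and 648 = 2 * 18^2. In a bad row only the
  crude bound \<open>18 * k0\<close> is available, to be paid for by the scarcity of such rows. The
  row \<open>k\<close> and the stencil \<open>\<rho>\<close> are abstract so that the adjoint is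
  covered too.\<close>

lemma row_estimate:
  assumes q: "q \<in> Xi n" and r: "0 < r" "r \<le> 1" and e: "0 \<le> e"
    and far: "\<And>p. p \<in> Xi n \<Longrightarrow> flr n p - flr n q \<notin> offsets \<Longrightarrow> k p = 0"
    and kb: "\<And>p. p \<in> Xi n \<Longrightarrow> cmod (k p) \<le> k0" and cb: "\<And>d. cmod (\<rho> d) \<le> k0"
    and close: "\<And>p. win r (q - y) \<noteq> 0 \<Longrightarrow> p \<in> Xi n \<Longrightarrow> flr n p - flr n q \<in> offsets \<Longrightarrow> cmod (k p - \<rho> (flr n p - flr n q)) \<le> e"
  shows "(cmod ((\<Sum>p\<in>Xi n. k p * coh n r y \<theta> p) - (\<Sum>d\<in>offsets. \<rho> d * ph \<theta> d) * coh n r y \<theta> q))\<^sup>2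
    \<le> 162 * e\<^sup>2 * (win r (q - y))\<^sup>2 + 648 * k0\<^sup>2 * (mesh n)\<^sup>2 + 324 * k0\<^sup>2 * indicator (Bad n) q"
proof -
  define g where "g = (\<lambda>d. pt n (flr n q + d))"
  let ?w = "win r (q - y)"
  have k0: "0 \<le> k0" using cb[of 0] norm_ge_zero order_trans by blast
  have w1: "win r z \<le> 1" for z using win_bounds(2)[of r z] r by linarith
  have flg: "flr n (g d) = flr n q + d" for d by (simp add: g_def)
  have inj: "inj_on g offsets" by (rule inj_onI) (metis add_left_cancel flg)
  have restrict: "(\<Sum>p\<in>Xi n. F p) = (\<Sum>p\<in>Xi n \<inter> g ` offsets. F p)" if "\<And>p. p \<in> Xi n \<Longrightarrow> flr n p - flr n q \<notin> offsets \<Longrightarrow> F p = 0" for F :: "_ \<Rightarrow> complex"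
  proof (rule sum.mono_neutral_right)
    show "\<forall>p\<in>Xi n - Xi n \<inter> g ` offsets. F p = 0"
    proof
      fix p assume p: "p \<in> Xi n - Xi n \<inter> g ` offsets"
      have "p = g (flr n p - flr n q)" using p Xi_pt by (simp add: g_def)
      then have "flr n p - flr n q \<notin> offsets" using p by blast
      then show "F p = 0" using that p by blast
    qed
  qed auto
  let ?z = "(\<Sum>p\<in>Xi n. k p * coh n r y \<theta> p) - (\<Sum>d\<in>offsets. \<rho> d * ph \<theta> d) * coh n r y \<theta> q"
  have coh1: "cmod (coh n r y \<theta> p) \<le> 1" for p
    using w1 win_bounds(1) by (simp add: coh_def norm_mult)
  have far': "k p * coh n r y \<theta> p = 0" if "p \<in> Xi n" "flr n p - flr n q \<notin> offsets" for p
    using far that by simp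
  have rs: "(\<Sum>p\<in>Xi n. k p * coh n r y \<theta> p) = (\<Sum>p\<in>Xi n \<inter> g ` offsets. k p * coh n r y \<theta> p)"
    by (rule restrict) (rule far')
  show ?thesis
  proof (cases "q \<in> Bad n")
    case True
    have "cmod (\<Sum>p\<in>Xi n. k p * coh n r y \<theta> p) \<le> (\<Sum>p\<in>Xi n \<inter> g ` offsets. k0 * 1)"
      unfolding rs
    proof (intro order_trans[OF norm_sum] sum_mono)
      fix p assume "p \<in> Xi n \<inter> g ` offsets"
      then show "cmod (k p * coh n r y \<theta> p) \<le> k0 * 1"
        unfolding norm_mult by (intro mult_mono kb coh1 k0) auto
    qed
    also have "\<dots> \<le> 9 * k0"
    proof -
      have "card (Xi n \<inter> g ` offsets) \<le> card (g ` offsets)" by (intro card_mono) auto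
      also have "\<dots> \<le> 9" using card_image_le[of offsets g] by simp
      finally have "real (card (Xi n \<inter> g ` offsets)) \<le> 9" by simp
      then show ?thesis using k0 by (simp add: mult_right_mono)
    qed
    finally have 1: "cmod (\<Sum>p\<in>Xi n. k p * coh n r y \<theta> p) \<le> 9 * k0" .
    have "cmod (\<Sum>d\<in>offsets. \<rho> d * ph \<theta> d) \<le> (\<Sum>d\<in>offsets. k0)"
      by (intro order_trans[OF norm_sum] sum_mono) (simp add: norm_mult cb)
    then have "cmod (\<Sum>d\<in>offsets. \<rho> d * ph \<theta> d) * cmod (coh n r y \<theta> q) \<le> (9 * k0) * 1"
      using coh1 k0 by (intro mult_mono) auto
    then have "cmod ?z \<le> 18 * k0"
      using 1 norm_triangle_ineq4[of "\<Sum>p\<in>Xi n. k p * coh n r y \<theta> p" "(\<Sum>d\<in>offsets. \<rho> d * ph \<theta> d) * coh n r y \<theta> q"]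
      by (simp add: norm_mult)
    then have "(cmod ?z)\<^sup>2 \<le> (18 * k0)\<^sup>2" by (intro power_mono) auto
    also have "\<dots> = 324 * k0\<^sup>2" by (simp add: power_mult_distrib)
    finally have "(cmod ?z)\<^sup>2 \<le> 324 * k0\<^sup>2" .
    moreover have ind: "indicator (Bad n) q = (1 :: real)" using True by simp
    moreover have "0 \<le> 162 * e\<^sup>2 * ?w\<^sup>2" "0 \<le> 648 * k0\<^sup>2 * (mesh n)\<^sup>2" by simp_all
    ultimately show ?thesis unfolding ind by linarith
  next
    case False
    then have sub: "g ` offsets \<subseteq> Xi n" using q by (auto simp: Bad_def g_def offsets_def)
    then have "Xi n \<inter> g ` offsets = g ` offsets" by blast
    then have S: "(\<Sum>p\<in>Xi n. k p * coh n r y \<theta> p) = (\<Sum>d\<in>offsets. k (g d) * coh n r y \<theta> (g d))"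
      unfolding rs by (simp add: sum.reindex[OF inj])
    have z: "?z = ph \<theta> (flr n q) * (\<Sum>d\<in>offsets. ph \<theta> d * (k (g d) * of_real (win r (g d - y)) - \<rho> d * of_real ?w))"
      unfolding S unfolding coh_def flg ph_add by (simp add: sum_distrib_left sum_distrib_right sum_subtractf algebra_simps)
    have entry: "cmod (k (g d) * of_real (win r (g d - y)) - \<rho> d * of_real ?w) \<le> e * ?w + 2 * k0 * mesh n" if d: "d \<in> offsets" for d
    proof -
      have gd: "g d \<in> Xi n" using sub d by blast
      have "k (g d) * of_real (win r (g d - y)) - \<rho> d * of_real ?w
          = (k (g d) - \<rho> d) * of_real ?w + k (g d) * of_real (win r (g d - y) - ?w)"
        by (simp add: algebra_simps)
      also have "cmod \<dots> \<le> cmod (k (g d) - \<rho> d) * ?w + cmod (k (g d)) * \<bar>win r (g d - y) - ?w\<bar>"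
        by (rule order_trans[OF norm_triangle_ineq]) (simp add: norm_mult win_bounds(1) del: of_real_diff)
      also have "\<dots> \<le> e * ?w + k0 * (2 * mesh n)"
      proof (intro add_mono)
        show "cmod (k (g d) - \<rho> d) * ?w \<le> e * ?w"
        proof (cases "?w = 0")
          case False
          then have "cmod (k (g d) - \<rho> d) \<le> e" using close[OF False gd] d by (simp add: flg)
          then show ?thesis by (intro mult_right_mono win_bounds)
        qed simp
        have "\<bar>(g d - q) $ l\<bar> \<le> mesh n" for l
        proof -
          have "q $ 1 = of_int (fst (flr n q)) * mesh n" "q $ 2 = of_int (snd (flr n q)) * mesh n"
            using arg_cong[OF Xi_pt[OF q], of "\<lambda>v. v $ 1"] arg_cong[OF Xi_pt[OF q], of "\<lambda>v. v $ 2"] by simp_all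
          then have "(g d - q) $ 1 = of_int (fst d) * mesh n" "(g d - q) $ 2 = of_int (snd d) * mesh n"
            by (simp_all add: g_def distrib_right)
          moreover have "\<bar>real_of_int (fst d)\<bar> \<le> 1" "\<bar>real_of_int (snd d)\<bar> \<le> 1" using d by (auto simp: offsets_def)
          ultimately show ?thesis using exhaust_2[of l] mesh_pos[of n] by (auto simp: abs_mult mult_le_cancel_right1)
        qed
        then have "norm (g d - q) \<le> 2 * mesh n" by (rule norm_le_2)
        then have "\<bar>win r (g d - y) - ?w\<bar> \<le> 2 * mesh n" using win_lipschitz[of r "g d - y" "q - y"] by simp
        then show "cmod (k (g d)) * \<bar>win r (g d - y) - ?w\<bar> \<le> k0 * (2 * mesh n)"
          by (intro mult_mono kb gd k0) auto
      qed
      finally show ?thesis by simp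
    qed
    have "cmod ?z \<le> (\<Sum>d\<in>offsets. e * ?w + 2 * k0 * mesh n)"
      unfolding z norm_mult cmod_ph mult_1
      by (intro order_trans[OF norm_sum] sum_mono) (simp add: norm_mult entry)
    then have "cmod ?z \<le> 9 * (e * ?w) + 18 * k0 * mesh n" by simp
    then have "(cmod ?z)\<^sup>2 \<le> (9 * (e * ?w) + 18 * k0 * mesh n)\<^sup>2" by (intro power_mono) auto
    also have "\<dots> \<le> 2 * (9 * (e * ?w))\<^sup>2 + 2 * (18 * k0 * mesh n)\<^sup>2"
      using zero_le_power2[of "9 * (e * ?w) - 18 * k0 * mesh n"] by (simp add: power2_eq_square algebra_simps)
    also have "\<dots> = 162 * e\<^sup>2 * ?w\<^sup>2 + 648 * k0\<^sup>2 * (mesh n)\<^sup>2" by (simp add: power_mult_distrib)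
    finally show ?thesis using False by simp
  qed
qed

text \<open>The squared row residuals of the matrix and of its adjoint are summed and fed into
  \<open>quasimode\<close>. The constant 163 is 1 from the weighted mean inequality plus 162 from
  the rows.\<close>

lemma coherent_pointwise:
  fixes \<theta> y :: "real^2" and B :: "complex^2^2"
  assumes r: "0 < r" "r \<le> 1" and e: "0 \<le> e" "e \<le> \<epsilon>" "0 < \<epsilon>" and s: "1 \<le> s"
    and far: "\<And>q p. q \<in> Xi n \<Longrightarrow> p \<in> Xi n \<Longrightarrow> flr n p - flr n q \<notin> offsets \<Longrightarrow> K q p = 0"
    and kb: "\<And>q p. q \<in> Xi n \<Longrightarrow> p \<in> Xi n \<Longrightarrow> cmod (K q p) \<le> k0" and cb: "\<And>d. cmod (rr B d) \<le> k0"
    and close: "\<And>q p. q \<in> Xi n \<Longrightarrow> p \<in> Xi n \<Longrightarrow> norm (q - y) < r \<or> norm (p - y) < r \<Longrightarrow>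
      flr n p - flr n q \<in> offsets \<Longrightarrow> cmod (K q p - rr B (flr n p - flr n q)) \<le> e"
    and R: "is_resolvent (card (Xi n)) (\<lambda>i j. shift_mat t (smat K n) $$ (i, j)) s R"
  defines "v \<equiv> \<lambda>i. coh n r y \<theta> (grid_in n \<Omega> ! i)" and "N \<equiv> \<Sum>q\<in>Xi n. (win r (q - y))\<^sup>2"
    and "Q \<equiv> 648 * k0\<^sup>2 * (mesh n)\<^sup>2 * real (card (Xi n)) + 324 * k0\<^sup>2 * real (card (Bad n))"
  shows "cmod (ip (card (Xi n)) v (mv (card (Xi n)) R v) - of_real (N * fk s t (kap B \<theta>))) \<le> 163 * \<epsilon> * N + Q / \<epsilon>"
proof -
  let ?d = "card (Xi n)" and ?M = "\<lambda>i j. shift_mat t (smat K n) $$ (i, j)" and ?\<kappa> = "kap B \<theta> - of_real t"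
  let ?z = "\<lambda>i. mv ?d ?M v i - ?\<kappa> * v i" and ?z' = "\<lambda>i. mv ?d (adj ?M) v i - cnj ?\<kappa> * v i"
  have nz: "norm (q - y) < r" if "win r (q - y) \<noteq> 0" for q using that by (auto simp: win_def)
  have N: "(nrm ?d v)\<^sup>2 = N"
    unfolding nrm_sq v_def N_def sum_grid_in[of "\<lambda>p. (cmod (coh n r y \<theta> p))\<^sup>2"]
    by (simp add: coh_def norm_mult win_bounds(1))
  have Bad: "Bad n \<subseteq> Xi n" by (auto simp: Bad_def)
  have tot: "(\<Sum>q\<in>Xi n. 162 * e\<^sup>2 * (win r (q - y))\<^sup>2 + 648 * k0\<^sup>2 * (mesh n)\<^sup>2 + 324 * k0\<^sup>2 * indicator (Bad n) q) = 162 * e\<^sup>2 * N + Q"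
  proof -
    have "(\<Sum>q\<in>Xi n. indicator (Bad n) q :: real) = real (card (Bad n))"
      using Bad by (simp add: indicator_def sum.If_cases Int_absorb1)
    then show ?thesis by (simp add: sum.distrib N_def Q_def sum_distrib_left[symmetric])
  qed
  have za: "(nrm ?d ?z)\<^sup>2 \<le> 162 * e\<^sup>2 * N + Q"
  proof -
    have "?z i = (\<Sum>p\<in>Xi n. K (grid_in n \<Omega> ! i) p * coh n r y \<theta> p) - (\<Sum>d\<in>offsets. rr B d * ph \<theta> d) * coh n r y \<theta> (grid_in n \<Omega> ! i)" if i: "i < ?d" for i
    proof -
      have "mv ?d (\<lambda>i j. smat K n $$ (i, j)) v i = (\<Sum>j<?d. K (grid_in n \<Omega> ! i) (grid_in n \<Omega> ! j) * coh n r y \<theta> (grid_in n \<Omega> ! j))"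
        unfolding mv_def v_def using i by (intro sum.cong) (auto simp: smat_def)
      then show ?thesis
        unfolding mv_shift_mat(1)[OF smat_carrier i] sum_grid_in[of "\<lambda>p. K (grid_in n \<Omega> ! i) p * coh n r y \<theta> p"]
        by (simp add: kap_def v_def algebra_simps)
    qed
    then have "(nrm ?d ?z)\<^sup>2 = (\<Sum>i<?d. (cmod ((\<Sum>p\<in>Xi n. K (grid_in n \<Omega> ! i) p * coh n r y \<theta> p) - (\<Sum>d\<in>offsets. rr B d * ph \<theta> d) * coh n r y \<theta> (grid_in n \<Omega> ! i)))\<^sup>2)"
      unfolding nrm_sq by (intro sum.cong) auto
    also have "\<dots> = (\<Sum>q\<in>Xi n. (cmod ((\<Sum>p\<in>Xi n. K q p * coh n r y \<theta> p) - (\<Sum>d\<in>offsets. rr B d * ph \<theta> d) * coh n r y \<theta> q))\<^sup>2)"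
      by (rule sum_grid_in)
    also have "\<dots> \<le> 162 * e\<^sup>2 * N + Q"
      unfolding tot[symmetric]
      by (intro sum_mono row_estimate r e far kb cb) (use close nz in auto)
    finally show ?thesis .
  qed
  have zb: "(nrm ?d ?z')\<^sup>2 \<le> 162 * e\<^sup>2 * N + Q"
  proof -
    have neg: "(\<Sum>d\<in>offsets. F (- d)) = (\<Sum>d\<in>offsets. F d)" for F :: "int \<times> int \<Rightarrow> complex"
      by (rule sum.reindex_bij_witness[of _ uminus uminus]) (auto simp: offsets_def)
    \<comment> \<open>The adjoint stencil at \<open>d\<close> is the conjugate of the original at
      \<open>-d\<close>, and its symbol is the conjugate symbol.\<close>
    have ck: "cnj (kap B \<theta>) = (\<Sum>d\<in>offsets. cnj (rr B (- d)) * ph \<theta> d)"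
      unfolding kap_def using neg[of "\<lambda>d. cnj (rr B (- d)) * ph \<theta> d"] by (simp add: cnj_ph)
    have "?z' i = (\<Sum>p\<in>Xi n. cnj (K p (grid_in n \<Omega> ! i)) * coh n r y \<theta> p) - (\<Sum>d\<in>offsets. cnj (rr B (- d)) * ph \<theta> d) * coh n r y \<theta> (grid_in n \<Omega> ! i)" if i: "i < ?d" for i
    proof -
      have "mv ?d (adj (\<lambda>i j. smat K n $$ (i, j))) v i = (\<Sum>j<?d. cnj (K (grid_in n \<Omega> ! j) (grid_in n \<Omega> ! i)) * coh n r y \<theta> (grid_in n \<Omega> ! j))"
        unfolding mv_def v_def adj_def using i by (intro sum.cong) (auto simp: smat_def)
      then show ?thesis
        unfolding mv_shift_mat(2)[OF smat_carrier i] sum_grid_in[of "\<lambda>p. cnj (K p (grid_in n \<Omega> ! i)) * coh n r y \<theta> p"] ck[symmetric]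
        by (simp add: v_def algebra_simps)
    qed
    then have "(nrm ?d ?z')\<^sup>2 = (\<Sum>i<?d. (cmod ((\<Sum>p\<in>Xi n. cnj (K p (grid_in n \<Omega> ! i)) * coh n r y \<theta> p) - (\<Sum>d\<in>offsets. cnj (rr B (- d)) * ph \<theta> d) * coh n r y \<theta> (grid_in n \<Omega> ! i)))\<^sup>2)"
      unfolding nrm_sq by (intro sum.cong) auto
    also have "\<dots> = (\<Sum>q\<in>Xi n. (cmod ((\<Sum>p\<in>Xi n. cnj (K p q) * coh n r y \<theta> p) - (\<Sum>d\<in>offsets. cnj (rr B (- d)) * ph \<theta> d) * coh n r y \<theta> q))\<^sup>2)"
      by (rule sum_grid_in)
    also have "\<dots> \<le> 162 * e\<^sup>2 * N + Q"
      unfolding tot[symmetric]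
    proof (intro sum_mono row_estimate r e)
      fix q p assume q: "q \<in> Xi n" and p: "p \<in> Xi n"
      have sym: "flr n q - flr n p \<in> offsets \<longleftrightarrow> flr n p - flr n q \<in> offsets" 
      proof -
        have "d \<in> offsets \<Longrightarrow> - d \<in> offsets" for d by (auto simp: offsets_def)
        then show ?thesis by (metis minus_diff_eq)
      qed
      show "cnj (K p q) = 0" if "flr n p - flr n q \<notin> offsets" using far[OF p q] that sym by simp
      show "cmod (cnj (K p q)) \<le> k0" using kb[OF p q] by simp
      show "cmod (cnj (K p q) - cnj (rr B (- (flr n p - flr n q)))) \<le> e" if "win r (q - y) \<noteq> 0" "flr n p - flr n q \<in> offsets"
      proof -
        have "cmod (K p q - rr B (flr n q - flr n p)) \<le> e"
          using close[OF p q] nz[OF that(1)] that(2) sym by blast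
        then show ?thesis by (simp flip: complex_cnj_diff)
      qed
      show "cmod (cnj (rr B (- d))) \<le> k0" for d using cb[of "- d"] by simp
    qed
    finally show ?thesis .
  qed
  have zz: "(nrm ?d ?z)\<^sup>2 + (nrm ?d ?z')\<^sup>2 \<le> 2 * (162 * e\<^sup>2 * N + Q)"
    unfolding mult_2 by (rule add_mono[OF za zb])
  have fk: "(nrm ?d v)\<^sup>2 / ((cmod ?\<kappa>)\<^sup>2 + s) = N * fk s t (kap B \<theta>)" by (simp add: N fk_def)
  have "cmod (ip ?d v (mv ?d R v) - of_real (N * fk s t (kap B \<theta>))) \<le> nrm ?d v * (nrm ?d ?z + nrm ?d ?z')"
    using quasimode[OF R s, of v ?\<kappa>] unfolding fk .
  also have "\<dots> = nrm ?d v * nrm ?d ?z + nrm ?d v * nrm ?d ?z'" by (simp add: distrib_left)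
  \<comment> \<open>The product of norms is split so that the bound becomes linear in
    \<open>N\<close> and \<open>Q\<close>; it can then be integrated over the window position
    explicitly, also where the packet is small or zero.\<close>
  also have "\<dots> \<le> (\<epsilon> / 2 * N + (nrm ?d ?z)\<^sup>2 / (2 * \<epsilon>)) + (\<epsilon> / 2 * N + (nrm ?d ?z')\<^sup>2 / (2 * \<epsilon>))"
    unfolding N[symmetric] by (intro add_mono weighted_AM_GM e)
  also have "\<dots> = \<epsilon> * N + ((nrm ?d ?z)\<^sup>2 + (nrm ?d ?z')\<^sup>2) / (2 * \<epsilon>)" by (simp add: add_divide_distrib)
  also have "\<dots> \<le> \<epsilon> * N + 2 * (162 * e\<^sup>2 * N + Q) / (2 * \<epsilon>)"
    using zz e by (intro add_mono divide_right_mono) auto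
  also have "\<dots> = \<epsilon> * N + 162 * (e * e / \<epsilon>) * N + Q / \<epsilon>"
    using e by (simp add: field_simps power2_eq_square)
  also have "\<dots> \<le> \<epsilon> * N + 162 * \<epsilon> * N + Q / \<epsilon>"
  proof -
    have "e * e \<le> \<epsilon> * \<epsilon>" using e by (intro mult_mono) auto
    then have "e * e / \<epsilon> \<le> \<epsilon>" using e by (simp add: divide_le_eq)
    moreover have "0 \<le> N" unfolding N_def by (intro sum_nonneg) simp
    ultimately show ?thesis by (intro add_mono mult_right_mono mult_left_mono) auto
  qed
  finally show ?thesis by (simp add: algebra_simps)
qed

text \<open>Distinct grid points have distinct integer indices, so integration over the frequency
  annihilates all off-diagonal entries of the resolvent. The diagonal remains, weighted by the
  squared window.\<close>

lemma coherent_theta: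
  fixes y :: "real^2" and B :: "complex^2^2"
  assumes r: "0 < r" "r \<le> 1" and e: "0 \<le> e" "e \<le> \<epsilon>" "0 < \<epsilon>" and s: "1 \<le> s"
    and far: "\<And>q p. q \<in> Xi n \<Longrightarrow> p \<in> Xi n \<Longrightarrow> flr n p - flr n q \<notin> offsets \<Longrightarrow> K q p = 0"
    and kb: "\<And>q p. q \<in> Xi n \<Longrightarrow> p \<in> Xi n \<Longrightarrow> cmod (K q p) \<le> k0" and cb: "\<And>d. cmod (rr B d) \<le> k0"
    and close: "\<And>q p. q \<in> Xi n \<Longrightarrow> p \<in> Xi n \<Longrightarrow> norm (q - y) < r \<or> norm (p - y) < r \<Longrightarrow>
      flr n p - flr n q \<in> offsets \<Longrightarrow> cmod (K q p - rr B (flr n p - flr n q)) \<le> e"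
    and R: "is_resolvent (card (Xi n)) (\<lambda>i j. shift_mat t (smat K n) $$ (i, j)) s R"
  defines "N \<equiv> \<Sum>q\<in>Xi n. (win r (q - y))\<^sup>2"
    and "Q \<equiv> 648 * k0\<^sup>2 * (mesh n)\<^sup>2 * real (card (Xi n)) + 324 * k0\<^sup>2 * real (card (Bad n))"
  shows "cmod (of_real ((2 * pi)\<^sup>2) * (\<Sum>i<card (Xi n). R i i * of_real ((win r (grid_in n \<Omega> ! i - y))\<^sup>2)) - of_real (N * HB s t B))
    \<le> (2 * pi)\<^sup>2 * (163 * \<epsilon> * N + Q / \<epsilon>)"
proof -
  let ?d = "card (Xi n)" and ?p = "\<lambda>i. grid_in n \<Omega> ! i"
  define w where "w = (\<lambda>i. win r (?p i - y))"
  define v where "v = (\<lambda>\<theta> i. coh n r y \<theta> (?p i))"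
  define c where "c = (\<lambda>i j. R i j * of_real (w i * w j))"
  have J: "ip ?d (v \<theta>) (mv ?d R (v \<theta>)) = (\<Sum>i<?d. \<Sum>j<?d. c i j * ph \<theta> (flr n (?p j) - flr n (?p i)))" for \<theta>
    by (simp add: ip_def mv_def v_def coh_def c_def w_def sum_distrib_left cnj_ph ph_add[of \<theta> _ "- _", simplified] mult_ac)
  have cont: "continuous_on UNIV (\<lambda>\<theta>. ip ?d (v \<theta>) (mv ?d R (v \<theta>)))"
    unfolding J by (intro continuous_intros ph_continuous)
  have fi: "continuous_on UNIV (\<lambda>\<theta>. complex_of_real (N * fk s t (kap B \<theta>)))"
    by (intro continuous_intros fk_continuous s kap_continuous)
  have int: "(LINT \<theta>:Theta|lborel. ip ?d (v \<theta>) (mv ?d R (v \<theta>))) = of_real ((2 * pi)\<^sup>2) * (\<Sum>i<?d. R i i * of_real ((w i)\<^sup>2))"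
  proof -
    have ii: "integrable lborel (\<lambda>\<theta>. c i j * (indicator Theta \<theta> *\<^sub>R ph \<theta> a))" for i j a
      using integrable_Theta[OF ph_continuous[of UNIV a]] by (intro integrable_mult_right) (simp add: set_integrable_def)
    have "(LINT \<theta>:Theta|lborel. ip ?d (v \<theta>) (mv ?d R (v \<theta>)))
        = (LINT \<theta>|lborel. (\<Sum>i<?d. \<Sum>j<?d. c i j * (indicator Theta \<theta> *\<^sub>R ph \<theta> (flr n (?p j) - flr n (?p i)))))"
      unfolding J set_lebesgue_integral_def by (simp add: scaleR_sum_right)
    also have "\<dots> = (\<Sum>i<?d. \<Sum>j<?d. LINT \<theta>|lborel. c i j * (indicator Theta \<theta> *\<^sub>R ph \<theta> (flr n (?p j) - flr n (?p i))))"
      by (subst Bochner_Integration.integral_sum, (intro Bochner_Integration.integrable_sum ii),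
          intro sum.cong refl, subst Bochner_Integration.integral_sum, (intro ii), rule refl)
    also have "\<dots> = (\<Sum>i<?d. \<Sum>j<?d. if j = i then c i i * of_real ((2 * pi)\<^sup>2) else 0)"
    proof (intro sum.cong refl)
      fix i j assume ij: "i \<in> {..<?d}" "j \<in> {..<?d}"
      have "flr n (?p j) - flr n (?p i) = 0 \<longleftrightarrow> j = i"
      proof
        assume "flr n (?p j) - flr n (?p i) = 0"
        then have "?p j = ?p i" using Xi_pt nth_Xi ij by (metis eq_iff_diff_eq_0 lessThan_iff)
        then show "j = i" using ij distinct_grid_in by (simp add: nth_eq_iff_index_eq card_Xi)
      qed simp
      then show "(LINT \<theta>|lborel. c i j * (indicator Theta \<theta> *\<^sub>R ph \<theta> (flr n (?p j) - flr n (?p i)))) = (if j = i then c i i * of_real ((2 * pi)\<^sup>2) else 0)"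
        using ph_orthogonal[of "flr n (?p j) - flr n (?p i)"]
        unfolding set_lebesgue_integral_def integral_mult_right_zero by (simp only: if_distrib[of "\<lambda>x. _ * x"] mult_zero_right cong: if_cong)
    qed
    also have "\<dots> = of_real ((2 * pi)\<^sup>2) * (\<Sum>i<?d. R i i * of_real ((w i)\<^sup>2))"
      by (simp add: c_def sum_distrib_left power2_eq_square mult_ac)
    finally show ?thesis .
  qed
  have HBint: "(LINT \<theta>:Theta|lborel. complex_of_real (N * fk s t (kap B \<theta>))) = of_real (N * HB s t B)"
    unfolding HB_def set_integral_complex_of_real by simp
  have "cmod (of_real ((2 * pi)\<^sup>2) * (\<Sum>i<?d. R i i * of_real ((w i)\<^sup>2)) - of_real (N * HB s t B))
      = cmod (LINT \<theta>:Theta|lborel. ip ?d (v \<theta>) (mv ?d R (v \<theta>)) - of_real (N * fk s t (kap B \<theta>)))"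
    unfolding int[symmetric] HBint[symmetric]
    by (subst set_integral_diff(2)) (use integrable_Theta cont fi in auto)
  also have "\<dots> \<le> (LINT \<theta>:Theta|lborel. cmod (ip ?d (v \<theta>) (mv ?d R (v \<theta>)) - of_real (N * fk s t (kap B \<theta>))))"
    by (rule set_integral_norm_bound) (intro set_integral_diff(1) integrable_Theta cont fi)
  also have "\<dots> \<le> (LINT \<theta>:Theta|lborel. 163 * \<epsilon> * N + Q / \<epsilon>)"
  proof (rule set_integral_mono)
    show "set_integrable lborel Theta (\<lambda>\<theta>. cmod (ip ?d (v \<theta>) (mv ?d R (v \<theta>)) - of_real (N * fk s t (kap B \<theta>))))"
      by (intro integrable_Theta continuous_on_norm continuous_on_diff cont fi)
    show "set_integrable lborel Theta (\<lambda>_. 163 * \<epsilon> * N + Q / \<epsilon>)" by (rule integrable_Theta) simp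
    fix \<theta>
    show "cmod (ip ?d (v \<theta>) (mv ?d R (v \<theta>)) - of_real (N * fk s t (kap B \<theta>))) \<le> 163 * \<epsilon> * N + Q / \<epsilon>"
      unfolding v_def N_def Q_def by (rule coherent_pointwise[OF r e s far kb cb close R])
  qed
  also have "\<dots> = (2 * pi)\<^sup>2 * (163 * \<epsilon> * N + Q / \<epsilon>)"
    by (simp add: set_lebesgue_integral_def measure_Theta)
  finally show ?thesis unfolding w_def .
qed

end

lemma measure_cbox_unit: "measure lborel (cbox (-1) (2 :: real^2)) = 9"
proof -
  have "cbox (-1) (2 :: real^2) \<noteq> {}" by (simp add: interval_ne_empty_cart)
  then show ?thesis by (subst content_cbox_cart) (auto simp: UNIV_2)
qed

lemma tendsto_0_eventually_le:
  fixes D :: "nat \<Rightarrow> real"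
  assumes "\<And>\<epsilon>. 0 < \<epsilon> \<Longrightarrow> \<forall>\<^sub>F n in sequentially. \<bar>D n\<bar> \<le> C * \<epsilon>"
  shows "D \<longlonglongrightarrow> 0"
proof (rule LIMSEQ_I)
  fix r :: real assume r: "0 < r"
  define \<epsilon> where "\<epsilon> = r / (2 * (\<bar>C\<bar> + 1))"
  have \<epsilon>: "0 < \<epsilon>" using r by (simp add: \<epsilon>_def)
  have "C * \<epsilon> \<le> (\<bar>C\<bar> + 1) * \<epsilon>" using \<epsilon> by (intro mult_right_mono) auto
  also have "\<dots> = r / 2" by (simp add: \<epsilon>_def field_simps)
  finally have lt: "C * \<epsilon> < r" using r by simp
  have "\<forall>\<^sub>F n in sequentially. norm (D n - 0) < r"
    using assms[OF \<epsilon>] by eventually_elim (use lt in simp)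
  then show "\<exists>N. \<forall>n\<ge>N. norm (D n - 0) < r" by (simp add: eventually_sequentially)
qed

context region
begin

text \<open>Integration over the window position gives every grid point the same weight
  \<open>winc r\<close>, which turns the weighted diagonal into the trace. On the side of the symbol
  the coefficient at \<open>y\<close> is replaced by that at the grid point, at the cost
  \<open>l\<close>, since only nearby \<open>y\<close> carry weight.\<close>

lemma coherent_trace:
  assumes A: "continuous_on UNIV A" and r: "0 < r" "r \<le> 1" and e: "0 \<le> e" "e \<le> \<epsilon>" "0 < \<epsilon>" and s: "1 \<le> s"
    and far: "\<And>q p. q \<in> Xi n \<Longrightarrow> p \<in> Xi n \<Longrightarrow> flr n p - flr n q \<notin> offsets \<Longrightarrow> K q p = 0"
    and kb: "\<And>q p. q \<in> Xi n \<Longrightarrow> p \<in> Xi n \<Longrightarrow> cmod (K q p) \<le> k0"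
    and cb: "\<And>y d. y \<in> cbox (-1) 2 \<Longrightarrow> cmod (rr (A y) d) \<le> k0"
    and close: "\<And>q p y. q \<in> Xi n \<Longrightarrow> p \<in> Xi n \<Longrightarrow> norm (q - y) < r \<or> norm (p - y) < r \<Longrightarrow>
      flr n p - flr n q \<in> offsets \<Longrightarrow> cmod (K q p - rr (A y) (flr n p - flr n q)) \<le> e"
    and osc: "\<And>q y. q \<in> Xi n \<Longrightarrow> norm (q - y) < r \<Longrightarrow> \<bar>HB s t (A y) - HB s t (A q)\<bar> \<le> (2 * pi)\<^sup>2 * l"
  defines "Q \<equiv> 648 * k0\<^sup>2 * (mesh n)\<^sup>2 * real (card (Xi n)) + 324 * k0\<^sup>2 * real (card (Bad n))"
  shows "\<bar>rtr s (shift_mat t (smat K n)) - (\<Sum>q\<in>Xi n. HB s t (A q)) / (2 * pi)\<^sup>2\<bar>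
    \<le> real (card (Xi n)) * (163 * \<epsilon> + l) + 9 * Q / (\<epsilon> * winc r)"
proof -
  let ?d = "card (Xi n)" and ?p = "\<lambda>i. grid_in n \<Omega> ! i" and ?c = "winc r" and ?\<pi> = "(2 * pi)\<^sup>2"
  have s0: "0 < s" using s by simp
  obtain R where R: "is_resolvent ?d (\<lambda>i j. shift_mat t (smat K n) $$ (i, j)) s R"
      "(\<Sum>i<?d. R i i) = of_real (rtr s (shift_mat t (smat K n)))"
    using resolvent_exists[OF shift_mat_carrier[OF smat_carrier] s0] by blast
  define N where "N = (\<lambda>y. \<Sum>q\<in>Xi n. (win r (q - y))\<^sup>2)"
  define J where "J = (\<lambda>y. of_real ?\<pi> * (\<Sum>i<?d. R i i * of_real ((win r (?p i - y))\<^sup>2)))"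
  have Hc: "continuous_on UNIV (\<lambda>y. HB s t (A y))"
    by (rule continuous_on_compose2[OF HB_continuous[OF s] A]) auto
  have wi: "integrable lborel (\<lambda>y. (win r (q - y))\<^sup>2)" for q
    using win_integrable[of "\<lambda>_. 1" r q] by simp
  have wHi: "integrable lborel (\<lambda>y. (win r (q - y))\<^sup>2 * HB s t (A y))" for q
    by (rule win_integrable[OF Hc])
  have Ni: "integrable lborel N" unfolding N_def by (intro Bochner_Integration.integrable_sum wi)
  have NH: "N y * HB s t (A y) = (\<Sum>q\<in>Xi n. (win r (q - y))\<^sup>2 * HB s t (A y))" for y
    by (simp add: N_def sum_distrib_right)
  have NHi: "integrable lborel (\<lambda>y. N y * HB s t (A y))"
    unfolding NH by (intro Bochner_Integration.integrable_sum wHi)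
  have Ji: "integrable lborel J"
    unfolding J_def by (intro integrable_mult_right Bochner_Integration.integrable_sum integrable_of_real wi)
  have Nint: "(LINT y|lborel. N y) = real ?d * ?c"
    unfolding N_def by (simp add: Bochner_Integration.integral_sum wi win_translate)
  have Jint: "(LINT y|lborel. J y) = of_real (?\<pi> * (?c * rtr s (shift_mat t (smat K n))))"
  proof -
    have "(LINT y|lborel. J y) = of_real ?\<pi> * (\<Sum>i<?d. R i i * of_real ?c)"
      unfolding J_def integral_mult_right_zero
      by (subst Bochner_Integration.integral_sum, (intro integrable_mult_right integrable_of_real wi))
         (simp only: integral_mult_right_zero integral_complex_of_real win_translate)
    then show ?thesis by (simp add: R(2)[symmetric] sum_distrib_left mult_ac)
  qed
  have supp: "win r (q - y) = 0" if "q \<in> Xi n" "y \<notin> cbox (-1) 2" for q y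
  proof (rule win_bounds(3), rule ccontr)
    assume a: "\<not> r \<le> norm (q - y)"
    have "q \<in> cbox 0 1" using that(1) Xi_sub sub by blast
    then have b: "0 \<le> q $ k" "q $ k \<le> 1" for k by (auto simp: mem_box_cart)
    have c: "\<bar>q $ k - y $ k\<bar> \<le> 1" for k
      using component_le_norm_cart[of "q - y" k] a r by simp
    have "-1 \<le> y $ k \<and> y $ k \<le> 2" for k using b[of k] c[of k] by linarith
    then have "y \<in> cbox (-1) 2" by (simp add: mem_box_cart)
    with that(2) show False by simp
  qed
  have bound: "cmod (J y - of_real (N y * HB s t (A y))) \<le> ?\<pi> * (163 * \<epsilon> * N y + Q / \<epsilon> * indicator (cbox (-1) 2) y)" for y
  proof (cases "y \<in> cbox (-1) 2")
    case True
    then show ?thesis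
      using coherent_theta[OF r e s far kb cb close R(1), of y] by (simp add: J_def N_def Q_def)
  next
    case False
    then have "N y = 0" "J y = 0"
      using supp nth_Xi by (auto simp: N_def J_def intro!: sum.neutral)
    then show ?thesis using False by simp
  qed
  have bi: "integrable lborel (\<lambda>y. ?\<pi> * (163 * \<epsilon> * N y + Q / \<epsilon> * indicator (cbox (-1) 2) y))"
    using emeasure_lborel_cbox_finite[of "-1 :: real^2" 2]
    by (intro integrable_mult_right Bochner_Integration.integrable_add Ni integrable_real_indicator) (auto simp: less_top)
  have "cmod ((LINT y|lborel. J y) - of_real (LINT y|lborel. N y * HB s t (A y)))
      = cmod (LINT y|lborel. J y - of_real (N y * HB s t (A y)))"
    using Ji NHi by (subst Bochner_Integration.integral_diff) (auto simp: integral_complex_of_real simp del: of_real_mult)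
  also have "\<dots> \<le> (LINT y|lborel. cmod (J y - of_real (N y * HB s t (A y))))" by (rule integral_norm_bound)
  also have "\<dots> \<le> (LINT y|lborel. ?\<pi> * (163 * \<epsilon> * N y + Q / \<epsilon> * indicator (cbox (-1) 2) y))"
    using bound bi Ji NHi
    by (intro integral_mono integrable_norm Bochner_Integration.integrable_diff integrable_of_real) auto
  \<comment> \<open>The 9 is the area of the box that contains the supports of all windows, as
    \<open>r \<le> 1\<close>.\<close>
  also have "\<dots> = ?\<pi> * (163 * \<epsilon> * (real ?d * ?c) + Q / \<epsilon> * 9)"
    using Ni emeasure_lborel_cbox_finite[of "-1 :: real^2" 2]
    by (subst integral_mult_right_zero, subst Bochner_Integration.integral_add)
       (auto simp: Nint measure_cbox_unit less_top intro!: integrable_mult_right integrable_real_indicator)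
  finally have 1: "\<bar>?\<pi> * (?c * rtr s (shift_mat t (smat K n))) - (LINT y|lborel. N y * HB s t (A y))\<bar>
      \<le> ?\<pi> * (163 * \<epsilon> * (real ?d * ?c) + Q / \<epsilon> * 9)"
    unfolding Jint by (simp only: of_real_diff[symmetric] norm_of_real)
  have "(LINT y|lborel. N y * HB s t (A y)) = (\<Sum>q\<in>Xi n. LINT y|lborel. (win r (q - y))\<^sup>2 * HB s t (A y))"
    unfolding NH by (rule Bochner_Integration.integral_sum) (rule wHi)
  then have "\<bar>(LINT y|lborel. N y * HB s t (A y)) - ?c * (\<Sum>q\<in>Xi n. HB s t (A q))\<bar>
      \<le> (\<Sum>q\<in>Xi n. \<bar>(LINT y|lborel. (win r (q - y))\<^sup>2 * HB s t (A y)) - ?c * HB s t (A q)\<bar>)"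
    by (simp only: sum_distrib_left sum_subtractf[symmetric] sum_abs)
  also have "\<dots> \<le> (\<Sum>q\<in>Xi n. ?c * (?\<pi> * l))"
  proof (rule sum_mono)
    fix q assume q: "q \<in> Xi n"
    have "(LINT y|lborel. (win r (q - y))\<^sup>2 * HB s t (A y)) - ?c * HB s t (A q)
        = (LINT y|lborel. (win r (q - y))\<^sup>2 * HB s t (A y) - (win r (q - y))\<^sup>2 * HB s t (A q))"
      by (subst Bochner_Integration.integral_diff) (auto simp: win_translate wHi wi intro!: integrable_mult_left)
    also have "\<bar>\<dots>\<bar> \<le> (LINT y|lborel. \<bar>(win r (q - y))\<^sup>2 * HB s t (A y) - (win r (q - y))\<^sup>2 * HB s t (A q)\<bar>)"
      by (rule integral_abs_bound)
    also have "\<dots> \<le> (LINT y|lborel. (win r (q - y))\<^sup>2 * (?\<pi> * l))"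
    proof (rule integral_mono)
      show "integrable lborel (\<lambda>y. \<bar>(win r (q - y))\<^sup>2 * HB s t (A y) - (win r (q - y))\<^sup>2 * HB s t (A q)\<bar>)"
        by (intro integrable_abs Bochner_Integration.integrable_diff wHi integrable_mult_left wi)
      show "integrable lborel (\<lambda>y. (win r (q - y))\<^sup>2 * (?\<pi> * l))" by (intro integrable_mult_left wi)
      fix y
      show "\<bar>(win r (q - y))\<^sup>2 * HB s t (A y) - (win r (q - y))\<^sup>2 * HB s t (A q)\<bar> \<le> (win r (q - y))\<^sup>2 * (?\<pi> * l)"
      proof (cases "norm (q - y) < r")
        case True
        have "\<bar>(win r (q - y))\<^sup>2 * HB s t (A y) - (win r (q - y))\<^sup>2 * HB s t (A q)\<bar> = (win r (q - y))\<^sup>2 * \<bar>HB s t (A y) - HB s t (A q)\<bar>"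
          by (simp add: abs_mult flip: right_diff_distrib)
        then show ?thesis using osc[OF q True] by (simp add: mult_left_mono)
      next
        case False
        then show ?thesis using win_bounds(3)[of r "q - y"] by simp
      qed
    qed
    also have "\<dots> = ?c * (?\<pi> * l)" by (simp add: win_translate)
    finally show "\<bar>(LINT y|lborel. (win r (q - y))\<^sup>2 * HB s t (A y)) - ?c * HB s t (A q)\<bar> \<le> ?c * (?\<pi> * l)" .
  qed
  also have "\<dots> = ?\<pi> * (?c * real ?d * l)" by simp
  finally have 2: "\<bar>(LINT y|lborel. N y * HB s t (A y)) - ?c * (\<Sum>q\<in>Xi n. HB s t (A q))\<bar> \<le> ?\<pi> * (?c * real ?d * l)" .
  define T where "T = rtr s (shift_mat t (smat K n)) - (\<Sum>q\<in>Xi n. HB s t (A q)) / ?\<pi>"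
  have c: "0 < ?c" by (rule winc_pos[OF r(1)])
  have \<pi>: "0 < ?\<pi>" by simp
  have "?\<pi> * ?c * T = ?\<pi> * (?c * rtr s (shift_mat t (smat K n))) - ?c * (\<Sum>q\<in>Xi n. HB s t (A q))"
    by (simp add: T_def right_diff_distrib)
  then have "\<bar>?\<pi> * ?c * T\<bar> \<le> ?\<pi> * (163 * \<epsilon> * (real ?d * ?c) + Q / \<epsilon> * 9) + ?\<pi> * (?c * real ?d * l)"
    using 1 2 by linarith
  also have "\<dots> = ?\<pi> * ?c * (real ?d * (163 * \<epsilon> + l) + 9 * Q / (\<epsilon> * ?c))"
    using c e by (simp add: field_simps)
  also have "\<bar>?\<pi> * ?c * T\<bar> = ?\<pi> * ?c * \<bar>T\<bar>" using c \<pi> by (simp only: abs_mult abs_of_pos)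
  finally have "\<bar>T\<bar> \<le> real ?d * (163 * \<epsilon> + l) + 9 * Q / (\<epsilon> * ?c)"
    using mult_pos_pos[OF \<pi> c] by (simp only: mult_le_cancel_left_pos)
  then show ?thesis by (simp add: T_def)
qed

text \<open>The order of the choices matters: uniform continuity fixes the window radius
  \<open>r\<close> for a given \<open>\<epsilon>\<close>, and only then does \<open>n\<close> grow,
  so that \<open>Q\<close> disappears in spite of the division by
  \<open>\<epsilon> * winc r\<close>.\<close>

lemma continuous_limit:
  assumes A: "continuous_on UNIV A" and s: "1 \<le> s"
  shows "(\<lambda>n. (mesh n)\<^sup>2 * rtr s (shift_mat t (smat (ent (\<lambda>x. indicator \<Omega> x *\<^sub>R A x) (\<lambda>_. 0) (\<lambda>_. 0) n) n)))
    \<longlonglongrightarrow> (LINT x:interior \<Omega>|lebesgue. HB s t (A x)) / (2 * pi)\<^sup>2"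
proof -
  let ?K = "\<lambda>n. ent (\<lambda>x. indicator \<Omega> x *\<^sub>R A x) (\<lambda>_. 0) (\<lambda>_. 0) n"
  have Hc: "continuous_on UNIV (\<lambda>y. HB s t (A y))"
    by (rule continuous_on_compose2[OF HB_continuous[OF s] A]) auto
  have ptlim: "(\<lambda>n. pt n (flr n x)) \<longlonglongrightarrow> x" for x
  proof (rule LIM_zero_cancel, rule Lim_null_comparison)
    show "\<forall>\<^sub>F n in sequentially. norm (pt n (flr n x) - x) \<le> 2 * mesh n"
      by (intro always_eventually allI norm_le_2) (use pt_flr_dist in auto)
    show "(\<lambda>n. 2 * mesh n) \<longlonglongrightarrow> 0" using tendsto_mult_left[OF mesh_tendsto, of 2] by simp
  qed
  have rs: "(\<lambda>n. (mesh n)\<^sup>2 * (\<Sum>q\<in>Xi n. HB s t (A q))) \<longlonglongrightarrow> (LINT x:interior \<Omega>|lebesgue. HB s t (A x))"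
  proof (rule riemann_sum[of "\<lambda>_ p. HB s t (A p)" "(2 * pi)\<^sup>2"])
    show "\<bar>HB s t (A p)\<bar> \<le> (2 * pi)\<^sup>2" for p using HB_bounds[OF s, of t "A p"] by simp
    show "(\<lambda>x. HB s t (A x)) \<in> borel_measurable borel" by (rule borel_measurable_continuous_onI[OF Hc])
    show "(\<lambda>n. HB s t (A (pt n (flr n x)))) \<longlonglongrightarrow> HB s t (A x)" for x
      using continuous_on_tendsto_compose[OF Hc ptlim[of x]] by simp
  qed
  let ?m = "measure lebesgue (interior \<Omega>)"
  define D where "D = (\<lambda>n. (mesh n)\<^sup>2 * rtr s (shift_mat t (smat (?K n) n)) - (mesh n)\<^sup>2 * (\<Sum>q\<in>Xi n. HB s t (A q)) / (2 * pi)\<^sup>2)"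
  have "D \<longlonglongrightarrow> 0"
  proof (rule tendsto_0_eventually_le)
    fix \<epsilon> :: real assume \<epsilon>: "0 < \<epsilon>"
    \<comment> \<open>Compensates the factor 16 lost in \<open>ent_approx\<close>.\<close>
    define e0 where "e0 = \<epsilon> / 16"
    have e0: "0 < e0" using \<epsilon> by (simp add: e0_def)
    have cpt: "compact (cball (0 :: real^2) 10)" by simp
    have "uniformly_continuous_on (cball 0 10) A"
      by (rule compact_uniformly_continuous[OF _ cpt]) (rule continuous_on_subset[OF A], simp)
    then obtain \<delta> where \<delta>: "0 < \<delta>" "\<And>x y. x \<in> cball 0 10 \<Longrightarrow> y \<in> cball 0 10 \<Longrightarrow> dist x y < \<delta> \<Longrightarrow> dist (A x) (A y) < e0"
      using e0 unfolding uniformly_continuous_on_def by metis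
    have "bounded (A ` cball 0 10)"
      by (intro compact_imp_bounded compact_continuous_image continuous_on_subset[OF A] cpt) auto
    then obtain k1 where k1: "\<And>x. x \<in> cball 0 10 \<Longrightarrow> norm (A x) \<le> k1" unfolding bounded_iff by blast
    have k10: "0 \<le> k1" using order_trans[OF norm_ge_zero k1[of 0]] by simp
    \<comment> \<open>Once \<open>mesh n < r\<close>, the points at which \<open>A\<close> is
      compared below are less than \<open>5 * r\<close> apart, well within
      \<open>\<delta>\<close>.\<close>
    define r where "r = min 1 (\<delta> / 10)"
    have r: "0 < r" "r \<le> 1" "10 * r \<le> \<delta>" using \<delta> by (auto simp: r_def)
    define Q where "Q = (\<lambda>n. 648 * (16 * k1)\<^sup>2 * (mesh n)\<^sup>2 * real (card (Xi n)) + 324 * (16 * k1)\<^sup>2 * real (card (Bad n)))"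
    have entry: "cmod (B $ i $ j) \<le> norm B" for B :: "complex^2^2" and i j
      using Finite_Cartesian_Product.norm_nth_le[of "B $ i" j] Finite_Cartesian_Product.norm_nth_le[of B i] by linarith
    have Xb: "norm q \<le> 2" if "q \<in> Xi n" for q n
    proof -
      have "q \<in> cbox 0 1" using that Xi_sub sub by blast
      then have "\<bar>q $ k\<bar> \<le> 1" for k by (auto simp: mem_box_cart)
      then show ?thesis using norm_le_2[of q 1] by simp
    qed
    have nb: "norm (x - q) \<le> 2 * mesh n" if "near n q x" "q \<in> Xi n" for x q n
      by (rule norm_le_2) (use near_bounds[OF XiD(1)[OF that(2)] that(1)] in simp)
    have DD: "\<bar>D n\<bar> \<le> (mesh n)\<^sup>2 * (real (card (Xi n)) * (163 * \<epsilon> + 36 * (4 * e0)) + 9 * Q n / (\<epsilon> * winc r))" if h: "mesh n < r" for n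
    proof -
      have far: "?K n q p = 0" if "q \<in> Xi n" "p \<in> Xi n" "flr n p - flr n q \<notin> offsets" for q p
        using ent_far[OF that(2,1)] that(3) unfolding offsets_def by blast
      have close: "cmod (?K n q p - rr (A y) (flr n p - flr n q)) \<le> \<epsilon>"
        if q: "q \<in> Xi n" and p: "p \<in> Xi n" and y: "norm (q - y) < r \<or> norm (p - y) < r" and d: "flr n p - flr n q \<in> offsets" for q p y
      proof -
        have "\<bar>(p - q) $ k\<bar> \<le> mesh n" for k
        proof -
          have "q $ 1 = of_int (fst (flr n q)) * mesh n" "q $ 2 = of_int (snd (flr n q)) * mesh n"
            "p $ 1 = of_int (fst (flr n p)) * mesh n" "p $ 2 = of_int (snd (flr n p)) * mesh n"
            using arg_cong[OF Xi_pt[OF q], of "\<lambda>v. v $ 1"] arg_cong[OF Xi_pt[OF q], of "\<lambda>v. v $ 2"]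
              arg_cong[OF Xi_pt[OF p], of "\<lambda>v. v $ 1"] arg_cong[OF Xi_pt[OF p], of "\<lambda>v. v $ 2"] by simp_all
          then have "(p - q) $ 1 = of_int (fst (flr n p - flr n q)) * mesh n" "(p - q) $ 2 = of_int (snd (flr n p - flr n q)) * mesh n"
            by (simp_all add: left_diff_distrib)
          moreover have "\<bar>real_of_int (fst (flr n p - flr n q))\<bar> \<le> 1" "\<bar>real_of_int (snd (flr n p - flr n q))\<bar> \<le> 1"
            using d by (auto simp: offsets_def mem_Times_iff simp del: fst_diff snd_diff of_int_diff)
          ultimately show ?thesis
            using exhaust_2[of k] mesh_pos[of n] by (auto simp: abs_mult mult_le_cancel_right1 simp del: fst_diff snd_diff of_int_diff)
        qed
        then have pq: "norm (p - q) \<le> 2 * mesh n" by (rule norm_le_2)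
        have qy: "norm (q - y) < 3 * r"
        proof (cases "norm (q - y) < r")
          case True then show ?thesis using r by simp
        next
          case False
          then have "norm (p - y) < r" using y by blast
          moreover have "norm (q - y) \<le> norm (q - p) + norm (p - y)" using norm_triangle_ineq[of "q - p" "p - y"] by simp
          ultimately show ?thesis using pq h by (simp add: norm_minus_commute)
        qed
        have "cmod (?K n q p - (\<Sum>i\<in>UNIV. \<Sum>j\<in>UNIV. of_real (cK i j (flr n p - flr n q)) * A y $ i $ j)) \<le> 16 * e0"
        proof (rule ent_approx[OF p q A])
          show "norm (A x) \<le> k1" if "x \<in> \<Omega>" for x
          proof (rule k1)
            have "x \<in> cbox 0 1" using that sub by blast
            then have "\<bar>x $ k\<bar> \<le> 1" for k by (auto simp: mem_box_cart)
            then show "x \<in> cball 0 10" using norm_le_2[of x 1] by simp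
          qed
          show "cmod (A x $ i $ j - A y $ i $ j) \<le> e0" if "near n q x" for x i j
          proof -
            have xq: "norm (x - q) \<le> 2 * mesh n" by (rule nb[OF that q])
            have "norm (x - y) \<le> norm (x - q) + norm (q - y)" using norm_triangle_ineq[of "x - q" "q - y"] by simp
            then have "dist x y < \<delta>" using xq qy h r by (simp add: dist_norm)
            moreover have "x \<in> cball 0 10" using norm_triangle_ineq[of "x - q" q] xq Xb[OF q] h r by simp
            moreover have "y \<in> cball 0 10" using norm_triangle_ineq4[of q "q - y"] qy Xb[OF q] r by simp
            ultimately have "dist (A x) (A y) < e0" by (rule \<delta>(2)[rotated 2])
            then show ?thesis using entry[of "A x - A y" i j] by (simp add: dist_norm)
          qed
        qed (use e0 in simp)
        then show ?thesis by (simp add: rr_def e0_def)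
      qed
      have kb: "cmod (?K n q p) \<le> 16 * k1" if q: "q \<in> Xi n" and p: "p \<in> Xi n" for q p
      proof -
        \<comment> \<open>Comparison with the zero matrix yields a bound on the entries that is
          uniform in \<open>n\<close>.\<close>
        have "cmod (?K n q p - (\<Sum>i\<in>UNIV. \<Sum>j\<in>UNIV. of_real (cK i j (flr n p - flr n q)) * (0 :: complex^2^2) $ i $ j)) \<le> 16 * k1"
        proof (rule ent_approx[OF p q A _ _ k10])
          show "norm (A x) \<le> k1" if "x \<in> \<Omega>" for x
          proof (rule k1)
            have "x \<in> cbox 0 1" using that sub by blast
            then have "\<bar>x $ k\<bar> \<le> 1" for k by (auto simp: mem_box_cart)
            then show "x \<in> cball 0 10" using norm_le_2[of x 1] by simp
          qed
          show "cmod (A x $ i $ j - 0 $ i $ j) \<le> k1" if "near n q x" for x i j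
          proof -
            have "x \<in> cball 0 10" using norm_triangle_ineq[of "x - q" q] nb[OF that q] Xb[OF q] h r by simp
            then show ?thesis using entry[of "A x" i j] k1[of x] by simp
          qed
        qed
        then show ?thesis by simp
      qed
      have cb: "cmod (rr (A y) d) \<le> 16 * k1" if "y \<in> cbox (-1) 2" for y d
      proof -
        have "\<bar>y $ k\<bar> \<le> 2" for k
          using that by (auto simp: mem_box_cart abs_le_iff dest!: spec[of _ k])
        then have "y \<in> cball 0 10" using norm_le_2[of y 2] by simp
        then show ?thesis using cmod_rr_le[of "A y" d] mnorm_le[of "A y"] k1[of y] by simp
      qed
      have osc: "\<bar>HB s t (A y) - HB s t (A q)\<bar> \<le> (2 * pi)\<^sup>2 * (36 * (4 * e0))" if q: "q \<in> Xi n" and y: "norm (q - y) < r" for q y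
      proof -
        have "y \<in> cball 0 10" "q \<in> cball 0 10" using norm_triangle_ineq4[of q "q - y"] y Xb[OF q] r by simp_all
        moreover have "dist y q < \<delta>" using y r by (simp add: dist_norm norm_minus_commute)
        ultimately have "norm (A y - A q) \<le> e0" using \<delta>(2)[of y q] by (simp add: dist_norm)
        then have "mnorm (A y - A q) \<le> 4 * e0" using mnorm_le[of "A y - A q"] by linarith
        then show ?thesis by (intro order_trans[OF HB_lipschitz[OF s]] mult_left_mono) auto
      qed
      have "\<bar>rtr s (shift_mat t (smat (?K n) n)) - (\<Sum>q\<in>Xi n. HB s t (A q)) / (2 * pi)\<^sup>2\<bar>
          \<le> real (card (Xi n)) * (163 * \<epsilon> + 36 * (4 * e0)) + 9 * Q n / (\<epsilon> * winc r)"
        unfolding Q_def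
        by (rule coherent_trace[OF A r(1,2) _ order_refl \<epsilon> s far kb cb close osc]) (use \<epsilon> in simp)
      moreover have "\<bar>D n\<bar> = (mesh n)\<^sup>2 * \<bar>rtr s (shift_mat t (smat (?K n) n)) - (\<Sum>q\<in>Xi n. HB s t (A q)) / (2 * pi)\<^sup>2\<bar>"
        by (simp add: D_def abs_mult flip: right_diff_distrib times_divide_eq_right)
      ultimately show ?thesis by (simp add: mult_left_mono)
    qed
    have Qlim: "(\<lambda>n. (mesh n)\<^sup>2 * (9 * Q n / (\<epsilon> * winc r))) \<longlonglongrightarrow> 0"
    proof -
      have "(\<lambda>n. 9 / (\<epsilon> * winc r) * (648 * (16 * k1)\<^sup>2 * ((mesh n)\<^sup>2 * ((mesh n)\<^sup>2 * real (card (Xi n)))) + 324 * (16 * k1)\<^sup>2 * ((mesh n)\<^sup>2 * real (card (Bad n)))))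
          \<longlonglongrightarrow> 9 / (\<epsilon> * winc r) * (648 * (16 * k1)\<^sup>2 * (0\<^sup>2 * ?m) + 324 * (16 * k1)\<^sup>2 * 0)"
        by (intro tendsto_intros mesh_tendsto card_limit bad_limit)
      then show ?thesis by (simp add: Q_def algebra_simps add_divide_distrib)
    qed
    have "\<forall>\<^sub>F n in sequentially. (mesh n)\<^sup>2 * (9 * Q n / (\<epsilon> * winc r)) < \<epsilon>"
      by (rule order_tendstoD(2)[OF Qlim \<epsilon>])
    moreover have "\<forall>\<^sub>F n in sequentially. (mesh n)\<^sup>2 * real (card (Xi n)) < ?m + 1"
      by (rule order_tendstoD(2)[OF card_limit]) simp
    moreover have "\<forall>\<^sub>F n in sequentially. mesh n < r"
      by (rule order_tendstoD(2)[OF mesh_tendsto r(1)])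
    \<comment> \<open>Here 172 is 163 plus 9, the latter from \<open>36 * (4 * e0)\<close>, and the
      final \<open>\<epsilon>\<close> is the share of \<open>Q\<close>.\<close>
    ultimately show "\<forall>\<^sub>F n in sequentially. \<bar>D n\<bar> \<le> (172 * (?m + 1) + 1) * \<epsilon>"
    proof eventually_elim
      case (elim n)
      have "\<bar>D n\<bar> \<le> (mesh n)\<^sup>2 * real (card (Xi n)) * (172 * \<epsilon>) + (mesh n)\<^sup>2 * (9 * Q n / (\<epsilon> * winc r))"
        using DD[OF elim(3)] by (simp add: e0_def algebra_simps)
      also have "\<dots> \<le> (?m + 1) * (172 * \<epsilon>) + \<epsilon>"
        using elim(1,2) \<epsilon> by (intro add_mono mult_right_mono) auto
      finally show ?case by (simp add: algebra_simps)
    qed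
  qed
  then have "(\<lambda>n. D n + (mesh n)\<^sup>2 * (\<Sum>q\<in>Xi n. HB s t (A q)) / (2 * pi)\<^sup>2) \<longlonglongrightarrow> 0 + (LINT x:interior \<Omega>|lebesgue. HB s t (A x)) / (2 * pi)\<^sup>2"
    by (intro tendsto_add tendsto_divide rs tendsto_const) auto
  then show ?thesis by (simp add: D_def)
qed

end

section \<open>Integrable coefficients\<close>

text \<open>The almost everywhere approximation serves twice: its pointwise limit is a Borel
  version, and after truncation it becomes approximation in the mean.\<close>

lemma borel_representative:
  fixes F :: "'a::euclidean_space \<Rightarrow> 'b::euclidean_space"
  assumes "F \<in> borel_measurable lebesgue"
  obtains G where "\<And>n::nat. continuous_on UNIV (G n)" "AE x in lebesgue. (\<lambda>n. G n x) \<longlonglongrightarrow> F x"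
proof -
  have "F measurable_on UNIV" by (rule lebesgue_measurable_imp_measurable_on[OF assms]) simp
  then obtain N G where N: "negligible N" and G: "\<And>n::nat. continuous_on UNIV (G n)"
    and lim: "\<And>x. x \<notin> N \<Longrightarrow> (\<lambda>n. G n x) \<longlonglongrightarrow> F x"
    unfolding measurable_on_def by auto
  have "AE x in lebesgue. x \<notin> N" using N by (intro AE_not_in) (simp add: negligible_iff_null_sets)
  then have "AE x in lebesgue. (\<lambda>n. G n x) \<longlonglongrightarrow> F x" by eventually_elim (rule lim)
  with G show ?thesis by (rule that)
qed

lemma borel_version:
  fixes F :: "'a::euclidean_space \<Rightarrow> 'b::euclidean_space"
  assumes "F \<in> borel_measurable lebesgue"
  obtains F' where "F' \<in> borel_measurable borel" "AE x in lebesgue. F x = F' x"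
proof -
  obtain G where G: "\<And>n::nat. continuous_on UNIV (G n)" "AE x in lebesgue. (\<lambda>n. G n x) \<longlonglongrightarrow> F x"
    by (rule borel_representative[OF assms]) blast
  have "(\<lambda>x. lim (\<lambda>n. G n x)) \<in> borel_measurable borel"
    by (rule borel_measurable_lim_metric) (rule borel_measurable_continuous_onI[OF G(1)])
  moreover have "AE x in lebesgue. F x = lim (\<lambda>n. G n x)"
    using G(2) by eventually_elim (simp add: limI)
  ultimately show ?thesis by (rule that)
qed

text \<open>The radial retraction onto the ball of radius \<open>K\<close>. It is continuous, so it
  makes approximants bounded without making them discontinuous.\<close>

definition trunc :: "real \<Rightarrow> 'a::real_normed_vector \<Rightarrow> 'a" where
  "trunc K v = (K / max K (norm v)) *\<^sub>R v"

lemma trunc_id: "0 < K \<Longrightarrow> norm v \<le> K \<Longrightarrow> trunc K v = v"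
  by (simp add: trunc_def max_absorb1)

lemma norm_trunc_le: "0 < K \<Longrightarrow> norm (trunc K v) \<le> K"
proof -
  assume K: "0 < K"
  have m: "0 < max K (norm v)" using K by simp
  have "norm (trunc K v) = K * (norm v / max K (norm v))" using K by (simp add: trunc_def)
  also have "\<dots> \<le> K * 1" using K m by (intro mult_left_mono) (auto simp: divide_le_eq_1)
  finally show ?thesis by simp
qed

lemma norm_trunc_diff_le: "0 < K \<Longrightarrow> norm (v - trunc K v) \<le> norm v"
proof -
  assume K: "0 < K"
  have m: "0 < max K (norm v)" using K by simp
  have "v - trunc K v = (1 - K / max K (norm v)) *\<^sub>R v" by (simp add: trunc_def scaleR_left_diff_distrib)
  moreover have "\<bar>1 - K / max K (norm v)\<bar> \<le> 1"
    using K m by (simp add: abs_le_iff divide_le_eq_1 zero_le_divide_iff)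
  ultimately show ?thesis by (simp add: mult_left_le_one_le)
qed

lemma continuous_on_trunc: "0 < K \<Longrightarrow> continuous_on UNIV (trunc K)"
  unfolding trunc_def by (intro continuous_intros) (auto simp: max_def)

context region
begin

lemma Omega_borel: "\<Omega> \<in> sets borel" using closed by (simp add: borel_closed)

lemma integrable_indicator_Omega: "integrable lebesgue (\<lambda>x. indicator \<Omega> x *\<^sub>R (c :: real))"
  by (rule integrable_ind_bounded[of _ "\<bar>c\<bar>"]) auto

text \<open>The function is truncated first, with an error dominated by the function itself; then
  the truncated continuous approximants converge to the truncation, dominated by
  \<open>2 * K\<close> on the bounded domain. Each error may be \<open>e / 8\<close>, because
  passing from the norm to \<open>mnorm\<close> costs a factor 4.\<close>

lemma L1_approximation:
  fixes A :: "real^2 \<Rightarrow> complex^2^2"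
  assumes Ai: "integrable lebesgue (\<lambda>x. indicator \<Omega> x *\<^sub>R A x)" and e: "0 < e"
  obtains g where "continuous_on UNIV g" "(LINT x|lebesgue. mnorm (indicator \<Omega> x *\<^sub>R A x - indicator \<Omega> x *\<^sub>R g x)) < e"
proof -
  let ?F = "\<lambda>x. indicator \<Omega> x *\<^sub>R A x"
  have Fm: "?F \<in> borel_measurable lebesgue" using Ai by (rule borel_measurable_integrable)
  obtain G where G: "\<And>n::nat. continuous_on UNIV (G n)" "AE x in lebesgue. (\<lambda>n. G n x) \<longlonglongrightarrow> ?F x"
    by (rule borel_representative[OF Fm]) blast
  have tm: "(\<lambda>x. trunc K (f x)) \<in> borel_measurable lebesgue" if "0 < K" "f \<in> borel_measurable lebesgue" for K and f :: "real^2 \<Rightarrow> complex^2^2"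
    by (rule borel_measurable_continuous_on[OF continuous_on_trunc[OF that(1)] that(2)])
  have "(\<lambda>k. LINT x|lebesgue. norm (?F x - trunc (real (Suc k)) (?F x))) \<longlonglongrightarrow> (LINT x|(lebesgue :: (real^2) measure). 0)"
  proof (rule integral_dominated_convergence[where w = "\<lambda>x. norm (?F x)"])
    show "(\<lambda>x. norm (?F x - trunc (real (Suc k)) (?F x))) \<in> borel_measurable lebesgue" for k
      using tm[OF _ Fm, of "real (Suc k)"] Fm by (simp add: borel_measurable_diff)
    show "AE x in lebesgue. (\<lambda>k. norm (?F x - trunc (real (Suc k)) (?F x))) \<longlonglongrightarrow> 0"
    proof (intro AE_I2 tendsto_eventually)
      fix x
      show "\<forall>\<^sub>F k in sequentially. norm (?F x - trunc (real (Suc k)) (?F x)) = 0"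
        using eventually_ge_at_top[of "nat \<lceil>norm (?F x)\<rceil>"]
      proof eventually_elim
        case (elim k)
        have "norm (?F x) \<le> real (Suc k)" using elim by linarith
        then show ?case by (subst trunc_id) auto
      qed
    qed
    show "AE x in lebesgue. norm (norm (?F x - trunc (real (Suc k)) (?F x))) \<le> norm (?F x)" for k
      unfolding real_norm_def abs_norm_cancel by (intro AE_I2 norm_trunc_diff_le) simp
  qed (use integrable_norm[OF Ai] in auto)
  then have "(\<lambda>k. LINT x|lebesgue. norm (?F x - trunc (real (Suc k)) (?F x))) \<longlonglongrightarrow> 0" by simp
  then have "\<forall>\<^sub>F k in sequentially. (LINT x|lebesgue. norm (?F x - trunc (real (Suc k)) (?F x))) < e / 8"
    by (rule order_tendstoD) (use e in simp)
  then obtain k where k: "(LINT x|lebesgue. norm (?F x - trunc (real (Suc k)) (?F x))) < e / 8"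
    unfolding eventually_sequentially by blast
  define K where "K = real (Suc k)"
  have K: "0 < K" by (simp add: K_def)
  let ?H = "\<lambda>n x. indicator \<Omega> x *\<^sub>R norm (trunc K (?F x) - trunc K (G n x))"
  have Gm: "G n \<in> borel_measurable lebesgue" for n
    by (intro measurable_completion) (simp add: borel_measurable_continuous_onI[OF G(1)])
  have Oi: "indicator \<Omega> \<in> borel_measurable lebesgue" using Omega_borel by (intro measurable_completion) simp
  have Hm: "?H n \<in> borel_measurable lebesgue" for n
    by (intro borel_measurable_scaleR borel_measurable_indicator measurable_compose[OF _ borel_measurable_norm] borel_measurable_diff tm K Fm Gm)
       (use Omega_borel in auto)
  have Hb: "norm (?H n x) \<le> indicator \<Omega> x *\<^sub>R (2 * K)" for n x
    using norm_triangle_ineq4[of "trunc K (?F x)" "trunc K (G n x)"] norm_trunc_le[OF K, of "?F x"] norm_trunc_le[OF K, of "G n x"]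
    by (auto simp: indicator_def)
  have "(\<lambda>n. LINT x|lebesgue. ?H n x) \<longlonglongrightarrow> (LINT x|(lebesgue :: (real^2) measure). 0)"
  proof (rule integral_dominated_convergence[where w = "\<lambda>x. indicator \<Omega> x *\<^sub>R (2 * K)"])
    show "AE x in lebesgue. (\<lambda>n. ?H n x) \<longlonglongrightarrow> 0"
      using G(2)
    proof eventually_elim
      case (elim x)
      have "(\<lambda>n. trunc K (G n x)) \<longlonglongrightarrow> trunc K (?F x)"
        using continuous_on_tendsto_compose[OF continuous_on_trunc[OF K] elim] by simp
      then have "(\<lambda>n. norm (trunc K (?F x) - trunc K (G n x))) \<longlonglongrightarrow> norm (trunc K (?F x) - trunc K (?F x))"
        by (intro tendsto_intros)
      then have "(\<lambda>n. ?H n x) \<longlonglongrightarrow> indicator \<Omega> x *\<^sub>R norm (trunc K (?F x) - trunc K (?F x))"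
        by (intro tendsto_scaleR tendsto_const)
      then show ?case by simp
    qed
    show "AE x in lebesgue. norm (?H n x) \<le> indicator \<Omega> x *\<^sub>R (2 * K)" for n by (rule AE_I2) (rule Hb)
  qed (use Hm integrable_indicator_Omega in auto)
  then have "(\<lambda>n. LINT x|lebesgue. ?H n x) \<longlonglongrightarrow> 0" by simp
  then have "\<forall>\<^sub>F n in sequentially. (LINT x|lebesgue. ?H n x) < e / 8"
    by (rule order_tendstoD) (use e in simp)
  then obtain n where n: "(LINT x|lebesgue. ?H n x) < e / 8"
    unfolding eventually_sequentially by blast
  define g where "g = (\<lambda>x. trunc K (G n x))"
  have g: "continuous_on UNIV g"
    unfolding g_def by (rule continuous_on_compose2[OF continuous_on_trunc[OF K] G(1)]) auto
  have gi: "integrable lebesgue (\<lambda>x. indicator \<Omega> x *\<^sub>R g x)"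
    by (rule integrable_ind_bounded[of _ K]) (use g norm_trunc_le[OF K] in \<open>auto simp: g_def intro: borel_measurable_continuous_onI\<close>)
  have Hi: "integrable lebesgue (?H n)"
    by (rule Bochner_Integration.integrable_bound[OF integrable_indicator_Omega[of "2 * K"] Hm])
       (rule AE_I2, rule order_trans[OF Hb], simp)
  have Ti: "integrable lebesgue (\<lambda>x. norm (?F x - trunc K (?F x)))"
    by (rule Bochner_Integration.integrable_bound[OF integrable_norm[OF Ai]])
       (intro measurable_compose[OF _ borel_measurable_norm] borel_measurable_diff Fm tm K,
        unfold real_norm_def abs_norm_cancel, intro AE_I2 norm_trunc_diff_le K)
  have mi: "integrable lebesgue (\<lambda>x. mnorm (?F x - indicator \<Omega> x *\<^sub>R g x))"
    unfolding mnorm_def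
    by (intro Bochner_Integration.integrable_sum integrable_norm integrable_vec_nth Bochner_Integration.integrable_diff Ai gi)
  have "(LINT x|lebesgue. mnorm (?F x - indicator \<Omega> x *\<^sub>R g x)) \<le> (LINT x|lebesgue. 4 * (norm (?F x - trunc K (?F x)) + ?H n x))"
  proof (rule integral_mono[OF mi])
    show "integrable lebesgue (\<lambda>x. 4 * (norm (?F x - trunc K (?F x)) + ?H n x))"
      by (intro integrable_mult_right Bochner_Integration.integrable_add Ti Hi)
    fix x
    have "norm (?F x - indicator \<Omega> x *\<^sub>R g x) \<le> norm (?F x - trunc K (?F x)) + ?H n x"
    proof (cases "x \<in> \<Omega>")
      case True
      then show ?thesis using norm_triangle_ineq[of "?F x - trunc K (?F x)" "trunc K (?F x) - g x"] by (simp add: g_def)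
    qed simp
    then show "mnorm (?F x - indicator \<Omega> x *\<^sub>R g x) \<le> 4 * (norm (?F x - trunc K (?F x)) + ?H n x)"
      by (intro order_trans[OF mnorm_le] mult_left_mono) simp_all
  qed
  also have "\<dots> = 4 * ((LINT x|lebesgue. norm (?F x - trunc K (?F x))) + (LINT x|lebesgue. ?H n x))"
    by (simp only: integral_mult_right_zero Bochner_Integration.integral_add[OF Ti Hi])
  also have "\<dots> < e" using k n e by (simp add: K_def)
  finally show ?thesis by (rule that[OF g])
qed

lemma P1_matrix_smat:
  assumes "integrable lebesgue (\<lambda>x. indicator \<Omega> x *\<^sub>R A x)" "integrable lebesgue (\<lambda>x. indicator \<Omega> x *\<^sub>R b x)"
    "integrable lebesgue (\<lambda>x. indicator \<Omega> x *\<^sub>R c x)"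
  shows "P1_matrix \<Omega> A b c n = smat (ent (\<lambda>x. indicator \<Omega> x *\<^sub>R A x) (\<lambda>x. indicator \<Omega> x *\<^sub>R b x) (\<lambda>x. indicator \<Omega> x *\<^sub>R c x) n) n"
proof (rule eq_matI)
  fix i j assume "i < dim_row (smat (ent (\<lambda>x. indicator \<Omega> x *\<^sub>R A x) (\<lambda>x. indicator \<Omega> x *\<^sub>R b x) (\<lambda>x. indicator \<Omega> x *\<^sub>R c x) n) n)"
    "j < dim_col (smat (ent (\<lambda>x. indicator \<Omega> x *\<^sub>R A x) (\<lambda>x. indicator \<Omega> x *\<^sub>R b x) (\<lambda>x. indicator \<Omega> x *\<^sub>R c x) n) n)"
  then have ij: "i < length (grid_in n \<Omega>)" "j < length (grid_in n \<Omega>)" by (simp_all add: smat_def card_Xi)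
  show "P1_matrix \<Omega> A b c n $$ (i, j) = smat (ent (\<lambda>x. indicator \<Omega> x *\<^sub>R A x) (\<lambda>x. indicator \<Omega> x *\<^sub>R b x) (\<lambda>x. indicator \<Omega> x *\<^sub>R c x) n) n $$ (i, j)"
    unfolding P1_matrix_entry[OF assms ij] using ij by (simp add: smat_def card_Xi)
qed (simp_all add: smat_def P1_matrix_def Let_def card_Xi)

lemma smat_rtr_perturb:
  assumes "1 \<le> s"
  shows "\<bar>rtr s (shift_mat t (smat K n)) - rtr s (shift_mat t (smat K' n))\<bar> \<le> 2 * (\<Sum>q\<in>Xi n. \<Sum>p\<in>Xi n. cmod (K q p - K' q p))"
proof -
  let ?d = "card (Xi n)" and ?p = "\<lambda>i. grid_in n \<Omega> ! i"
  have "(\<Sum>i<?d. \<Sum>j<?d. cmod (shift_mat t (smat K n) $$ (i, j) - shift_mat t (smat K' n) $$ (i, j)))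
      = (\<Sum>i<?d. \<Sum>j<?d. cmod (K (?p i) (?p j) - K' (?p i) (?p j)))"
    by (intro sum.cong refl) (auto simp: shift_mat_def smat_def)
  also have "\<dots> = (\<Sum>q\<in>Xi n. \<Sum>p\<in>Xi n. cmod (K q p - K' q p))"
    unfolding sum_grid_in[of "\<lambda>p. cmod (K _ p - K' _ p)"] by (rule sum_grid_in)
  finally show ?thesis
    using rtr_perturb[OF shift_mat_carrier[OF smat_carrier] shift_mat_carrier[OF smat_carrier] assms, of t K n t K'] by simp
qed

lemma integral_dens:
  assumes A: "integrable lebesgue A" and b: "integrable lebesgue b" and c: "integrable lebesgue c"
  shows "(LINT x|lebesgue. dens A b c n x) = (LINT x|lebesgue. mnorm (A x)) / (mesh n)\<^sup>2
    + (LINT x|lebesgue. (\<Sum>i\<in>UNIV. cmod (b x $ i))) / mesh n + (LINT x|lebesgue. cmod (c x))"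
proof -
  have 1: "integrable lebesgue (\<lambda>x. mnorm (A x) / (mesh n)\<^sup>2)"
    unfolding mnorm_def by (intro integrable_divide Bochner_Integration.integrable_sum integrable_norm integrable_vec_nth A)
  have 2: "integrable lebesgue (\<lambda>x. (\<Sum>i\<in>UNIV. cmod (b x $ i)) / mesh n)"
    by (intro integrable_divide Bochner_Integration.integrable_sum integrable_norm integrable_vec_nth b)
  show ?thesis
    unfolding dens_def mnorm_def[symmetric]
    by (subst Bochner_Integration.integral_add, (intro Bochner_Integration.integrable_add 1 2), intro integrable_norm c,
        subst Bochner_Integration.integral_add[OF 1 2]) simp
qed

text \<open>The entrywise distance to the matrix of a continuous coefficient, times
  \<open>(mesh n)\<^sup>2\<close>, is a constant times
  \<open>m + mesh n * \<beta> + (mesh n)\<^sup>2 * \<gamma>\<close>: the lower order terms vanish in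
  the limit, and both sides of the claim are Lipschitz in the remaining distance
  \<open>m\<close>.\<close>

lemma l1_limit:
  assumes A: "integrable lebesgue (\<lambda>x. indicator \<Omega> x *\<^sub>R A x)" and b: "integrable lebesgue (\<lambda>x. indicator \<Omega> x *\<^sub>R b x)"
    and c: "integrable lebesgue (\<lambda>x. indicator \<Omega> x *\<^sub>R c x)" and s: "1 \<le> s"
  shows "(\<lambda>n. (mesh n)\<^sup>2 * rtr s (shift_mat t (P1_matrix \<Omega> A b c n)))
    \<longlonglongrightarrow> (LINT x:interior \<Omega>|lebesgue. HB s t (A x)) / (2 * pi)\<^sup>2"
proof -
  let ?A = "\<lambda>x. indicator \<Omega> x *\<^sub>R A x" and ?b = "\<lambda>x. indicator \<Omega> x *\<^sub>R b x" and ?c = "\<lambda>x. indicator \<Omega> x *\<^sub>R c x"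
  define L where "L = (\<lambda>A. (LINT x:interior \<Omega>|lebesgue. HB s t (A x)) / (2 * pi)\<^sup>2)"
  define \<beta> where "\<beta> = (LINT x|lebesgue. (\<Sum>i\<in>UNIV. cmod (?b x $ i)))"
  define \<gamma> where "\<gamma> = (LINT x|lebesgue. cmod (?c x))"
  have HBi: "integrable lebesgue (\<lambda>x. indicator (interior \<Omega>) x *\<^sub>R HB s t (f x))"
    if "integrable lebesgue f" for f :: "real^2 \<Rightarrow> complex^2^2"
  proof (rule Bochner_Integration.integrable_bound[OF integrable_ind_bounded[of "\<lambda>_. (2 * pi)\<^sup>2" "(2 * pi)\<^sup>2"]])
    show "(\<lambda>x. indicator (interior \<Omega>) x *\<^sub>R HB s t (f x)) \<in> borel_measurable lebesgue"
      by (intro borel_measurable_scaleR borel_measurable_indicator borel_measurable_continuous_on[OF HB_continuous[OF s]] borel_measurable_integrable that) auto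
    show "AE x in lebesgue. norm (indicator (interior \<Omega>) x *\<^sub>R HB s t (f x)) \<le> norm (indicator \<Omega> x *\<^sub>R (2 * pi)\<^sup>2)"
    proof (rule AE_I2)
      fix x
      show "norm (indicator (interior \<Omega>) x *\<^sub>R HB s t (f x)) \<le> norm (indicator \<Omega> x *\<^sub>R (2 * pi)\<^sup>2)"
        using HB_bounds[OF s, of t "f x"] interior_subset[of \<Omega>] by (auto simp: indicator_def)
    qed
  qed auto
  have "(\<lambda>n. (mesh n)\<^sup>2 * rtr s (shift_mat t (P1_matrix \<Omega> A b c n)) - L A) \<longlonglongrightarrow> 0"
  proof (rule tendsto_0_eventually_le)
    fix \<epsilon> :: real assume \<epsilon>: "0 < \<epsilon>"
    obtain g where g: "continuous_on UNIV g" "(LINT x|lebesgue. mnorm (?A x - indicator \<Omega> x *\<^sub>R g x)) < \<epsilon>"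
      by (rule L1_approximation[OF A \<epsilon>]) blast
    let ?g = "\<lambda>x. indicator \<Omega> x *\<^sub>R g x"
    define m where "m = (LINT x|lebesgue. mnorm (?A x - ?g x))"
    have gi: "integrable lebesgue ?g"
    proof -
      have "compact \<Omega>" using sub closed bounded_cbox bounded_subset compact_eq_bounded_closed by blast
      then have "bounded (g ` \<Omega>)" by (intro compact_imp_bounded compact_continuous_image continuous_on_subset[OF g(1)]) auto
      then obtain K where "\<And>x. x \<in> \<Omega> \<Longrightarrow> norm (g x) \<le> K" unfolding bounded_iff by blast
      then show ?thesis by (intro integrable_ind_bounded borel_measurable_continuous_onI g(1))
    qed
    have z: "integrable lebesgue (\<lambda>_::real^2. 0 :: complex^2)" "integrable lebesgue (\<lambda>_::real^2. 0 :: complex)" by simp_all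
    have mi: "integrable lebesgue (\<lambda>x. mnorm (?A x - ?g x))"
      unfolding mnorm_def by (intro Bochner_Integration.integrable_sum integrable_norm integrable_vec_nth Bochner_Integration.integrable_diff A gi)
    let ?S = "\<lambda>n. shift_mat t (smat (ent ?g (\<lambda>_. 0) (\<lambda>_. 0) n) n)"
    have pert: "\<bar>(mesh n)\<^sup>2 * rtr s (shift_mat t (P1_matrix \<Omega> A b c n)) - (mesh n)\<^sup>2 * rtr s (?S n)\<bar> \<le> 32 * (m + mesh n * \<beta> + (mesh n)\<^sup>2 * \<gamma>)" for n
    proof -
      have "\<bar>rtr s (shift_mat t (P1_matrix \<Omega> A b c n)) - rtr s (?S n)\<bar> \<le> 2 * (\<Sum>q\<in>Xi n. \<Sum>p\<in>Xi n. cmod (ent (\<lambda>x. ?A x - ?g x) ?b ?c n q p))"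
        unfolding P1_matrix_smat[OF A b c]
        using smat_rtr_perturb[OF s, of t "ent ?A ?b ?c n" n "ent ?g (\<lambda>_. 0) (\<lambda>_. 0) n"]
        unfolding ent_diff[OF A b c gi z] by simp
      also have "\<dots> \<le> 2 * (16 * (LINT x|lebesgue. dens (\<lambda>x. ?A x - ?g x) ?b ?c n x))"
        by (intro mult_left_mono ent_sum_bound b c Bochner_Integration.integrable_diff A gi) simp
      also have "(LINT x|lebesgue. dens (\<lambda>x. ?A x - ?g x) ?b ?c n x) = m / (mesh n)\<^sup>2 + \<beta> / mesh n + \<gamma>"
        unfolding m_def \<beta>_def \<gamma>_def by (rule integral_dens[OF Bochner_Integration.integrable_diff[OF A gi] b c])
      finally have "(mesh n)\<^sup>2 * \<bar>rtr s (shift_mat t (P1_matrix \<Omega> A b c n)) - rtr s (?S n)\<bar> \<le> (mesh n)\<^sup>2 * (2 * (16 * (m / (mesh n)\<^sup>2 + \<beta> / mesh n + \<gamma>)))"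
        by (intro mult_left_mono) auto
      also have "\<dots> = 32 * (m + mesh n * \<beta> + (mesh n)\<^sup>2 * \<gamma>)"
        by (simp add: field_simps power2_eq_square)
      finally show ?thesis by (simp add: abs_mult flip: right_diff_distrib)
    qed
    have LL: "\<bar>L A - L g\<bar> \<le> 36 * m"
    proof -
      have eq: "(LINT x:interior \<Omega>|lebesgue. HB s t (f x)) = (LINT x|lebesgue. indicator (interior \<Omega>) x *\<^sub>R HB s t (indicator \<Omega> x *\<^sub>R f x))" for f
        unfolding set_lebesgue_integral_def
        using interior_subset[of \<Omega>] by (intro Bochner_Integration.integral_cong refl) (auto simp: indicator_def)
      have "\<bar>(LINT x:interior \<Omega>|lebesgue. HB s t (A x)) - (LINT x:interior \<Omega>|lebesgue. HB s t (g x))\<bar>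
          = \<bar>LINT x|lebesgue. indicator (interior \<Omega>) x *\<^sub>R HB s t (?A x) - indicator (interior \<Omega>) x *\<^sub>R HB s t (?g x)\<bar>"
        unfolding eq by (subst Bochner_Integration.integral_diff[OF HBi[OF A] HBi[OF gi]]) simp
      also have "\<dots> \<le> (LINT x|lebesgue. \<bar>indicator (interior \<Omega>) x *\<^sub>R HB s t (?A x) - indicator (interior \<Omega>) x *\<^sub>R HB s t (?g x)\<bar>)"
        by (rule integral_abs_bound)
      also have "\<dots> \<le> (LINT x|lebesgue. (2 * pi)\<^sup>2 * (36 * mnorm (?A x - ?g x)))"
      proof (rule integral_mono)
        show "integrable lebesgue (\<lambda>x. \<bar>indicator (interior \<Omega>) x *\<^sub>R HB s t (?A x) - indicator (interior \<Omega>) x *\<^sub>R HB s t (?g x)\<bar>)"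
          by (intro integrable_abs Bochner_Integration.integrable_diff HBi A gi)
        show "integrable lebesgue (\<lambda>x. (2 * pi)\<^sup>2 * (36 * mnorm (?A x - ?g x)))" by (intro integrable_mult_right mi)
        fix x
        show "\<bar>indicator (interior \<Omega>) x *\<^sub>R HB s t (?A x) - indicator (interior \<Omega>) x *\<^sub>R HB s t (?g x)\<bar> \<le> (2 * pi)\<^sup>2 * (36 * mnorm (?A x - ?g x))"
          using HB_lipschitz[OF s, of t "?A x" "?g x"] mnorm_nonneg[of "?A x - ?g x"]
          by (cases "x \<in> interior \<Omega>") (auto simp del: mult_eq_0_iff)
      qed
      also have "\<dots> = (2 * pi)\<^sup>2 * (36 * m)" unfolding m_def integral_mult_right_zero ..
      finally have "\<bar>(LINT x:interior \<Omega>|lebesgue. HB s t (A x)) - (LINT x:interior \<Omega>|lebesgue. HB s t (g x))\<bar> \<le> 36 * m * (2 * pi)\<^sup>2"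
        by (simp only: mult.commute)
      then have "\<bar>(LINT x:interior \<Omega>|lebesgue. HB s t (A x)) - (LINT x:interior \<Omega>|lebesgue. HB s t (g x))\<bar> / (2 * pi)\<^sup>2 \<le> 36 * m"
        by (subst pos_divide_le_eq) auto
      moreover have "\<bar>L A - L g\<bar> = \<bar>(LINT x:interior \<Omega>|lebesgue. HB s t (A x)) - (LINT x:interior \<Omega>|lebesgue. HB s t (g x))\<bar> / (2 * pi)\<^sup>2"
        unfolding L_def diff_divide_distrib[symmetric] abs_divide by simp
      ultimately show ?thesis by simp
    qed
    have cl: "(\<lambda>n. (mesh n)\<^sup>2 * rtr s (?S n)) \<longlonglongrightarrow> L g"
      unfolding L_def by (rule continuous_limit[OF g(1) s])
    have "(\<lambda>n. \<bar>(mesh n)\<^sup>2 * rtr s (?S n) - L g\<bar>) \<longlonglongrightarrow> \<bar>L g - L g\<bar>"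
      by (intro tendsto_intros cl)
    then have "\<forall>\<^sub>F n in sequentially. \<bar>(mesh n)\<^sup>2 * rtr s (?S n) - L g\<bar> < \<epsilon>"
      by (rule order_tendstoD) (use \<epsilon> in simp)
    moreover have "\<forall>\<^sub>F n in sequentially. 32 * (mesh n * \<beta> + (mesh n)\<^sup>2 * \<gamma>) < \<epsilon>"
    proof -
      have "(\<lambda>n. 32 * (mesh n * \<beta> + (mesh n)\<^sup>2 * \<gamma>)) \<longlonglongrightarrow> 32 * (0 * \<beta> + 0\<^sup>2 * \<gamma>)"
        by (intro tendsto_intros mesh_tendsto)
      then show ?thesis by (rule order_tendstoD) (use \<epsilon> in simp)
    qed
    \<comment> \<open>The 70 adds up 32 from the trace perturbation, 36 from the limit functional,
      and one each for the lower order terms and the continuous case.\<close>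
    ultimately show "\<forall>\<^sub>F n in sequentially. \<bar>(mesh n)\<^sup>2 * rtr s (shift_mat t (P1_matrix \<Omega> A b c n)) - L A\<bar> \<le> 70 * \<epsilon>"
    proof eventually_elim
      case (elim n)
      have "m < \<epsilon>" using g(2) by (simp add: m_def)
      then show ?case using elim pert[of n] LL \<epsilon> unfolding distrib_left by linarith
    qed
  qed
  then show ?thesis unfolding L_def by (rule LIM_zero_cancel)
qed

end

section \<open>The symbol on the product domain\<close>

lemma Theta_pos: "emeasure lebesgue Theta = ennreal ((2 * pi)\<^sup>2)"
proof -
  have "emeasure lborel Theta \<noteq> \<infinity>" using emeasure_bounded_finite[OF compact_imp_bounded[OF compact_Theta]] by (simp add: less_top)
  then have "emeasure lborel Theta = ennreal (measure lborel Theta)" by (simp add: emeasure_eq_ennreal_measure)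
  moreover have "Theta \<in> sets borel" by (simp add: borel_compact)
  ultimately show ?thesis by (simp add: measure_Theta)
qed

lemma null_set_fst:
  assumes "AE x in lborel. P (x :: 'a::euclidean_space)"
  shows "AE z in (lborel :: ('a \<times> 'b::euclidean_space) measure). P (fst z)"
proof -
  obtain N where N: "{x. \<not> P x} \<subseteq> N" "N \<in> null_sets lborel"
    using AE_E[OF assms] by (auto simp: null_sets_def)
  have "emeasure (lborel \<Otimes>\<^sub>M lborel) (N \<times> (UNIV :: 'b set)) = emeasure lborel N * emeasure lborel (UNIV :: 'b set)"
    by (rule lborel.emeasure_pair_measure_Times) (use N in auto)
  then have "N \<times> (UNIV :: 'b set) \<in> null_sets lborel"
    using N by (auto simp: null_sets_def lborel_prod intro!: borel_Times)
  then show ?thesis by (rule AE_I') (use N in auto)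
qed

lemma kap_pair_measurable:
  assumes B: "B \<in> borel_measurable borel"
  shows "(\<lambda>z :: (real^2) \<times> (real^2). kap (B (fst z)) (snd z)) \<in> borel_measurable borel"
proof -
  have f: "(fst :: (real^2) \<times> (real^2) \<Rightarrow> _) \<in> borel_measurable borel"
    by (intro borel_measurable_continuous_onI continuous_intros)
  have e: "(\<lambda>z :: (real^2) \<times> (real^2). B (fst z) $ i $ j) \<in> borel_measurable borel" for i j
  proof -
    have c: "(\<lambda>v :: complex^2^2. v $ i $ j) \<in> borel_measurable borel"
      by (intro borel_measurable_continuous_onI continuous_intros)
    show ?thesis using measurable_compose[OF measurable_compose[OF f B] c] by simp
  qed
  have p: "(\<lambda>z :: (real^2) \<times> (real^2). ph (snd z) d) \<in> borel_measurable borel" for d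
    unfolding ph_def by (intro borel_measurable_continuous_onI continuous_intros)
  show ?thesis
    unfolding kap_def rr_def by (intro borel_measurable_sum borel_measurable_times borel_measurable_const e p)
qed

lemma fk_measurable: "1 \<le> s \<Longrightarrow> fk s t \<in> borel_measurable borel"
  by (intro borel_measurable_continuous_onI fk_continuous) auto

context region
begin

abbreviation "Dom \<equiv> symbol_domain \<Omega>"

lemma Dom_eq: "Dom = interior \<Omega> \<times> Theta"
  by (simp add: symbol_domain_def Theta_def)

lemma Dom_borel: "Dom \<in> sets borel"
  unfolding Dom_eq by (intro borel_Times) (auto simp: borel_compact)

lemma emeasure_Dom: "emeasure lebesgue Dom = emeasure lebesgue (interior \<Omega>) * ennreal ((2 * pi)\<^sup>2)"
proof -
  have "emeasure (lborel \<Otimes>\<^sub>M lborel) Dom = emeasure lborel (interior \<Omega>) * emeasure lborel Theta"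
    unfolding Dom_eq by (rule lborel.emeasure_pair_measure_Times) (auto simp: borel_compact)
  then show ?thesis using Dom_borel Theta_pos by (simp add: lborel_prod borel_compact)
qed

lemma measure_Dom: "measure lebesgue Dom = measure lebesgue (interior \<Omega>) * (2 * pi)\<^sup>2"
  unfolding measure_def emeasure_Dom enn2real_mult by simp

lemma Dom_finite: "emeasure lebesgue Dom < \<infinity>" "0 < emeasure lebesgue Dom"
proof -
  have "0 < ennreal ((2 * pi)\<^sup>2)" by (simp add: ennreal_less_zero_iff)
  then show "emeasure lebesgue Dom < \<infinity>" "0 < emeasure lebesgue Dom"
    unfolding emeasure_Dom using interior_null_diff by (auto simp: ennreal_mult_less_top ennreal_zero_less_mult_iff)
qed

text \<open>\<open>A\<close> is only Lebesgue measurable, while product measures and Fubini are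
  applied to Borel functions; a Borel version changes the symbol on a set of the form null set times
  space, again a null set.\<close>

lemma symbol_borel_version:
  assumes A: "integrable lebesgue (\<lambda>x. indicator \<Omega> x *\<^sub>R A x)"
  obtains B where "B \<in> borel_measurable borel" "AE x in lborel. indicator \<Omega> x *\<^sub>R A x = B x"
    "AE z in lebesgue. kap (B (fst z)) (snd z) = P1_symbol \<Omega> A z"
proof -
  obtain B where B: "B \<in> borel_measurable borel" "AE x in lebesgue. indicator \<Omega> x *\<^sub>R A x = B x"
    by (rule borel_version[OF borel_measurable_integrable[OF A]]) blast
  have B2: "AE x in lborel. indicator \<Omega> x *\<^sub>R A x = B x" using B(2) by (simp add: AE_completion_iff)
  have "AE z in lebesgue. indicator \<Omega> (fst z) *\<^sub>R A (fst z) = B (fst z)"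
    by (rule AE_completion[OF null_set_fst[OF B2]])
  then have "AE z in lebesgue. kap (B (fst z)) (snd z) = P1_symbol \<Omega> A z"
  proof eventually_elim
    case (elim z)
    have "zero_extension \<Omega> A (fst z) = indicator \<Omega> (fst z) *\<^sub>R A (fst z)" by (simp add: zero_extension_def)
    then show ?case using P1_symbol_kap[of \<Omega> A "fst z" "snd z"] elim by simp
  qed
  then show ?thesis using that B(1) B2 by blast
qed

lemma symbol_measurable:
  assumes A: "integrable lebesgue (\<lambda>x. indicator \<Omega> x *\<^sub>R A x)"
  shows "P1_symbol \<Omega> A \<in> borel_measurable lebesgue"
proof -
  obtain B where B: "B \<in> borel_measurable borel" "AE z in lebesgue. kap (B (fst z)) (snd z) = P1_symbol \<Omega> A z"
    by (rule symbol_borel_version[OF A]) blast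
  have "(\<lambda>z. kap (B (fst z)) (snd z)) \<in> borel_measurable lebesgue"
    by (intro measurable_completion) (use kap_pair_measurable[OF B(1)] in simp)
  then show ?thesis by (rule borel_measurable_AE_lebesgue[OF _ B(2)])
qed

text \<open>Fubini for the Borel version, with inner integral \<open>HB\<close>; the frequency
  average in the trace limit thus becomes an integral over the domain of the symbol.\<close>

lemma symbol_integral:
  assumes A: "integrable lebesgue (\<lambda>x. indicator \<Omega> x *\<^sub>R A x)" and s: "1 \<le> s"
  shows "(LINT z|lebesgue_on Dom. fk s t (P1_symbol \<Omega> A z)) = (LINT x:interior \<Omega>|lebesgue. HB s t (A x))"
proof -
  obtain B where B: "B \<in> borel_measurable borel" "AE x in lborel. indicator \<Omega> x *\<^sub>R A x = B x"
      "AE z in lebesgue. kap (B (fst z)) (snd z) = P1_symbol \<Omega> A z"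
    by (rule symbol_borel_version[OF A]) blast
  define G where "G = (\<lambda>z :: (real^2) \<times> (real^2). indicator Dom z *\<^sub>R fk s t (kap (B (fst z)) (snd z)))"
  have G: "G \<in> borel_measurable borel"
    unfolding G_def using Dom_borel measurable_compose[OF kap_pair_measurable[OF B(1)] fk_measurable[OF s]]
    by (intro borel_measurable_scaleR borel_measurable_indicator) auto
  have DI: "integrable lborel (indicator Dom :: _ \<Rightarrow> real)"
    using Dom_borel Dom_finite(1) by (intro integrable_real_indicator) (auto simp: less_top)
  have Gi: "integrable lborel G"
    by (rule Bochner_Integration.integrable_bound[OF DI]) (use G fk_bounds[OF s, of t] in \<open>auto simp: G_def indicator_def\<close>)
  have Gm: "G \<in> borel_measurable lebesgue" using G by (intro measurable_completion) simp
  have ae: "AE z in lebesgue. G z = indicator Dom z *\<^sub>R fk s t (P1_symbol \<Omega> A z)"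
    using B(3) by eventually_elim (simp add: G_def)
  have "(LINT z|lebesgue_on Dom. fk s t (P1_symbol \<Omega> A z)) = (LINT z|lebesgue. indicator Dom z *\<^sub>R fk s t (P1_symbol \<Omega> A z))"
    using Dom_borel by (intro integral_restrict_space) auto
  also have "\<dots> = (LINT z|lebesgue. G z)"
    by (rule integral_cong_AE[OF borel_measurable_AE_lebesgue[OF Gm ae] Gm]) (use ae in \<open>auto elim: eventually_mono\<close>)
  also have "\<dots> = (LINT z|lborel. G z)"
    using G by (intro integral_completion) simp
  also have "\<dots> = (LINT z|(lborel \<Otimes>\<^sub>M lborel). G z)" by (simp add: lborel_prod)
  also have "\<dots> = (LINT x|lborel. LINT \<theta>|lborel. G (x, \<theta>))"
    by (rule lborel_pair.integral_fst'[symmetric]) (use Gi in \<open>simp add: lborel_prod\<close>)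
  also have "\<dots> = (LINT x|lborel. indicator (interior \<Omega>) x *\<^sub>R HB s t (B x))"
  proof (rule Bochner_Integration.integral_cong[OF refl])
    fix x
    have "G (x, \<theta>) = indicator (interior \<Omega>) x *\<^sub>R (indicator Theta \<theta> *\<^sub>R fk s t (kap (B x) \<theta>))" for \<theta>
      by (simp add: G_def Dom_eq indicator_times)
    then show "(LINT \<theta>|lborel. G (x, \<theta>)) = indicator (interior \<Omega>) x *\<^sub>R HB s t (B x)"
      by (simp only: HB_def set_lebesgue_integral_def integral_scaleR_right)
  qed
  also have "\<dots> = (LINT x|lebesgue. indicator (interior \<Omega>) x *\<^sub>R HB s t (B x))"
  proof (rule integral_completion[symmetric])
    show "(\<lambda>x. indicator (interior \<Omega>) x *\<^sub>R HB s t (B x)) \<in> borel_measurable lborel"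
      using measurable_compose[OF B(1) borel_measurable_continuous_onI[OF HB_continuous[OF s]]]
      by (intro borel_measurable_scaleR borel_measurable_indicator) auto
  qed
  also have "\<dots> = (LINT x:interior \<Omega>|lebesgue. HB s t (A x))"
    unfolding set_lebesgue_integral_def
  proof (rule integral_cong_AE)
    have aeB: "AE x in lebesgue. indicator (interior \<Omega>) x *\<^sub>R HB s t (B x) = indicator (interior \<Omega>) x *\<^sub>R HB s t (A x)"
      using AE_completion[OF B(2)]
    proof eventually_elim
      case (elim x)
      then show ?case using interior_subset[of \<Omega>] by (auto simp: indicator_def split: if_splits)
    qed
    show m: "(\<lambda>x. indicator (interior \<Omega>) x *\<^sub>R HB s t (B x)) \<in> borel_measurable lebesgue"
      using measurable_compose[OF B(1) borel_measurable_continuous_onI[OF HB_continuous[OF s]]]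
      by (intro measurable_completion borel_measurable_scaleR borel_measurable_indicator) auto
    show "(\<lambda>x. indicator (interior \<Omega>) x *\<^sub>R HB s t (A x)) \<in> borel_measurable lebesgue"
      by (rule borel_measurable_AE_lebesgue[OF m aeB])
    show "AE x in lebesgue. indicator (interior \<Omega>) x *\<^sub>R HB s t (B x) = indicator (interior \<Omega>) x *\<^sub>R HB s t (A x)" by (rule aeB)
  qed
  finally show ?thesis .
qed

text \<open>For Hermitian \<open>A\<close> the second order integrand at \<open>(q, p)\<close> is
  the conjugate of the one at \<open>(p, q)\<close>, so it cancels pointwise.\<close>

lemma ent_hermitian:
  assumes b: "integrable lebesgue b" and c: "integrable lebesgue c" and A: "integrable lebesgue A"
    and herm: "\<And>x i j. A x $ j $ i = cnj (A x $ i $ j)"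
  shows "ent A b c n q p - cnj (ent A b c n p q) = ent (\<lambda>_. 0) b c n q p - cnj (ent (\<lambda>_. 0) b c n p q)"
proof -
  have z: "integrable lebesgue (\<lambda>_ :: real^2. 0 :: complex^2^2)" by simp
  have pw: "cf A b c n q p x - cnj (cf A b c n p q x) = cf (\<lambda>_. 0) b c n q p x - cnj (cf (\<lambda>_. 0) b c n p q x)" for x
  proof -
    let ?S = "\<lambda>q p. (\<Sum>i\<in>UNIV. \<Sum>j\<in>UNIV. of_real (hgrad i n p x * hgrad j n q x) * A x $ i $ j)"
    have "cnj (?S p q) = (\<Sum>i\<in>UNIV. \<Sum>j\<in>UNIV. of_real (hgrad i n q x * hgrad j n p x) * A x $ j $ i)"
      by (simp add: herm[symmetric])
    also have "\<dots> = (\<Sum>j\<in>UNIV. \<Sum>i\<in>UNIV. of_real (hgrad i n q x * hgrad j n p x) * A x $ j $ i)"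
      by (rule sum.swap)
    also have "\<dots> = ?S q p" by (simp add: mult_ac)
    finally show ?thesis unfolding cf_def complex_cnj_add by simp
  qed
  have e: "ent A' b c n q p - cnj (ent A' b c n p q)
      = (LINT x|lebesgue. indicator (interior \<Omega>) x *\<^sub>R (cf A' b c n q p x - cnj (cf A' b c n p q x)))"
    if "integrable lebesgue A'" for A'
  proof -
    have i: "integrable lebesgue (\<lambda>x. indicator (interior \<Omega>) x *\<^sub>R cf A' b c n q p x)" for q p
      by (intro integrable_ind integrable_cf that b c)
    have ic: "integrable lebesgue (\<lambda>x. indicator (interior \<Omega>) x *\<^sub>R cnj (cf A' b c n p q x))"
      using complex_integrable_cnj[of lebesgue "\<lambda>x. indicator (interior \<Omega>) x *\<^sub>R cf A' b c n p q x"] i by simp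
    have "cnj (ent A' b c n p q) = (LINT x|lebesgue. indicator (interior \<Omega>) x *\<^sub>R cnj (cf A' b c n p q x))"
      using Bochner_Integration.integral_cnj[of lebesgue "\<lambda>x. indicator (interior \<Omega>) x *\<^sub>R cf A' b c n p q x"]
      by (simp add: ent_def)
    then show ?thesis
      unfolding scaleR_diff_right Bochner_Integration.integral_diff[OF i ic] by (simp add: ent_def)
  qed
  show ?thesis unfolding e[OF A] e[OF z] pw ..
qed

text \<open>Absolute continuity of the integral, uniformly over all grid points: the part of
  \<open>\<beta>\<close> above a level \<open>k\<close> has small integral everywhere, and the part
  below is at most \<open>k\<close> on an area of order \<open>(mesh n)\<^sup>2\<close>.\<close>

lemma small_patches:
  fixes \<beta> :: "real^2 \<Rightarrow> real"
  assumes \<beta>: "integrable lebesgue \<beta>" and nn: "\<And>x. 0 \<le> \<beta> x" and e: "0 < e"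
  shows "\<forall>\<^sub>F n in sequentially. \<forall>q. (LINT x|lebesgue. indicator (nearset n q) x * \<beta> x) \<le> e"
proof -
  have m: "\<beta> \<in> borel_measurable lebesgue" using \<beta> by (rule borel_measurable_integrable)
  have "(\<lambda>k. LINT x|lebesgue. \<beta> x - min (\<beta> x) (real k)) \<longlonglongrightarrow> (LINT x|(lebesgue :: (real^2) measure). 0)"
  proof (rule integral_dominated_convergence[where w = \<beta>])
    show "AE x in lebesgue. (\<lambda>k. \<beta> x - min (\<beta> x) (real k)) \<longlonglongrightarrow> 0"
    proof (intro AE_I2 tendsto_eventually)
      fix x
      show "\<forall>\<^sub>F k in sequentially. \<beta> x - min (\<beta> x) (real k) = 0"
        using eventually_ge_at_top[of "nat \<lceil>\<beta> x\<rceil>"]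
      proof eventually_elim
        case (elim k)
        then have "\<beta> x \<le> real k" by linarith
        then show ?case by simp
      qed
    qed
    show "AE x in lebesgue. norm (\<beta> x - min (\<beta> x) (real k)) \<le> \<beta> x" for k
      using nn by (intro AE_I2) (auto simp: min_def)
  qed (use m \<beta> in \<open>auto intro!: borel_measurable_diff borel_measurable_min\<close>)
  then have "(\<lambda>k. LINT x|lebesgue. \<beta> x - min (\<beta> x) (real k)) \<longlonglongrightarrow> 0" by simp
  then have "\<forall>\<^sub>F k in sequentially. (LINT x|lebesgue. \<beta> x - min (\<beta> x) (real k)) < e / 2"
    by (rule order_tendstoD) (use e in simp)
  then obtain k where k: "(LINT x|lebesgue. \<beta> x - min (\<beta> x) (real k)) < e / 2"
    unfolding eventually_sequentially by blast
  have ti: "integrable lebesgue (\<lambda>x. \<beta> x - min (\<beta> x) (real k))"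
    by (rule Bochner_Integration.integrable_bound[OF \<beta>])
       (use m nn in \<open>auto simp: min_def intro!: borel_measurable_diff borel_measurable_min\<close>)
  have "(\<lambda>n. real k * (4 * (mesh n)\<^sup>2)) \<longlonglongrightarrow> real k * (4 * 0\<^sup>2)" by (intro tendsto_intros mesh_tendsto)
  then have "\<forall>\<^sub>F n in sequentially. real k * (4 * (mesh n)\<^sup>2) < e / 2"
    by (rule order_tendstoD) (use e in simp)
  then show ?thesis
  proof eventually_elim
    case (elim n)
    show ?case
    proof
      fix q
      have ni: "integrable lebesgue (\<lambda>x. real k * indicator (nearset n q) x)"
        using measure_nearset_le(2) by (intro integrable_mult_right integrable_real_indicator) auto
      have "(LINT x|lebesgue. indicator (nearset n q) x * \<beta> x) \<le> (LINT x|lebesgue. (\<beta> x - min (\<beta> x) (real k)) + real k * indicator (nearset n q) x)"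
      proof (rule integral_mono)
        show "integrable lebesgue (\<lambda>x. indicator (nearset n q) x * \<beta> x)"
          using integrable_mult_indicator[OF _ \<beta>, of "nearset n q"] by simp
        show "integrable lebesgue (\<lambda>x. (\<beta> x - min (\<beta> x) (real k)) + real k * indicator (nearset n q) x)"
          by (intro Bochner_Integration.integrable_add ti ni)
        show "indicator (nearset n q) x * \<beta> x \<le> (\<beta> x - min (\<beta> x) (real k)) + real k * indicator (nearset n q) x" for x
          using nn[of x] by (auto simp: indicator_def min_def)
      qed
      also have "\<dots> = (LINT x|lebesgue. \<beta> x - min (\<beta> x) (real k)) + (LINT x|lebesgue. real k * indicator (nearset n q) x)"
        by (rule Bochner_Integration.integral_add[OF ti ni])
      also have "\<dots> \<le> e / 2 + real k * (4 * (mesh n)\<^sup>2)"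
        using k measure_nearset_le(1)[of n q] by (intro add_mono) (auto intro: mult_left_mono)
      finally show "(LINT x|lebesgue. indicator (nearset n q) x * \<beta> x) \<le> e" using elim by simp
    qed
  qed
qed

text \<open>An integrable \<open>b\<close> gives no square integrability to work with, so the sum of
  squares is bounded by the largest entry times the sum of entries. The former is o(1/h) by
  \<open>small_patches\<close>, the latter O(1/h) by \<open>ent_sum_bound\<close>, and the product
  is o(h^-2).\<close>

lemma hermitian_defect_limit:
  assumes A: "integrable lebesgue (\<lambda>x. indicator \<Omega> x *\<^sub>R A x)" and b: "integrable lebesgue (\<lambda>x. indicator \<Omega> x *\<^sub>R b x)"
    and c: "integrable lebesgue (\<lambda>x. indicator \<Omega> x *\<^sub>R c x)"
    and herm: "\<And>x i j. x \<in> \<Omega> \<Longrightarrow> A x $ j $ i = cnj (A x $ i $ j)"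
  defines "S \<equiv> P1_matrix \<Omega> A b c"
  shows "(\<lambda>n. (mesh n)\<^sup>2 * (\<Sum>i<card (Xi n). \<Sum>j<card (Xi n). (cmod (S n $$ (i, j) - cnj (S n $$ (j, i))))\<^sup>2)) \<longlonglongrightarrow> 0"
proof -
  let ?A = "\<lambda>x. indicator \<Omega> x *\<^sub>R A x" and ?b = "\<lambda>x. indicator \<Omega> x *\<^sub>R b x" and ?c = "\<lambda>x. indicator \<Omega> x *\<^sub>R c x"
  define Y where "Y = (\<lambda>n q p. ent (\<lambda>_. 0) ?b ?c n q p)"
  define \<beta> where "\<beta> = (\<lambda>x. \<Sum>i\<in>UNIV. cmod (?b x $ i))"
  define b1 where "b1 = (LINT x|lebesgue. \<beta> x)"
  define c1 where "c1 = (LINT x|lebesgue. cmod (?c x))"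
  have z: "integrable lebesgue (\<lambda>_ :: real^2. 0 :: complex^2^2)" by simp
  have \<beta>i: "integrable lebesgue \<beta>" unfolding \<beta>_def by (intro Bochner_Integration.integrable_sum integrable_norm integrable_vec_nth b)
  have \<beta>0: "0 \<le> \<beta> x" for x unfolding \<beta>_def by (intro sum_nonneg) auto
  have pos: "0 \<le> b1" "0 \<le> c1" unfolding b1_def c1_def using \<beta>0 by (auto intro!: Bochner_Integration.integral_nonneg)
  have hA: "?A x $ j $ i = cnj (?A x $ i $ j)" for x i j using herm[of x j i] by (cases "x \<in> \<Omega>") auto
  let ?F = "\<lambda>n. \<Sum>i<card (Xi n). \<Sum>j<card (Xi n). (cmod (S n $$ (i, j) - cnj (S n $$ (j, i))))\<^sup>2"
  have F: "?F n \<le> 4 * (\<Sum>q\<in>Xi n. \<Sum>p\<in>Xi n. (cmod (Y n q p))\<^sup>2)" for n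
  proof -
    let ?d = "card (Xi n)" and ?p = "\<lambda>i. grid_in n \<Omega> ! i"
    have "?F n = (\<Sum>i<?d. \<Sum>j<?d. (cmod (Y n (?p i) (?p j) - cnj (Y n (?p j) (?p i))))\<^sup>2)"
      unfolding S_def P1_matrix_smat[OF A b c]
      by (intro sum.cong refl) (auto simp: smat_def Y_def ent_hermitian[OF b c A hA])
    also have "\<dots> = (\<Sum>q\<in>Xi n. \<Sum>p\<in>Xi n. (cmod (Y n q p - cnj (Y n p q)))\<^sup>2)"
      unfolding sum_grid_in[of "\<lambda>p. (cmod (Y n _ p - cnj (Y n p _)))\<^sup>2"]
      by (rule sum_grid_in[of "\<lambda>q. \<Sum>p\<in>Xi n. (cmod (Y n q p - cnj (Y n p q)))\<^sup>2"])
    also have "\<dots> \<le> (\<Sum>q\<in>Xi n. \<Sum>p\<in>Xi n. 2 * (cmod (Y n q p))\<^sup>2 + 2 * (cmod (Y n p q))\<^sup>2)"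
    proof (intro sum_mono)
      fix q p
      have "cmod (Y n q p - cnj (Y n p q)) \<le> cmod (Y n q p) + cmod (Y n p q)"
        using norm_triangle_ineq4[of "Y n q p" "cnj (Y n p q)"] by simp
      then have "(cmod (Y n q p - cnj (Y n p q)))\<^sup>2 \<le> (cmod (Y n q p) + cmod (Y n p q))\<^sup>2" by (intro power_mono) auto
      also have "\<dots> \<le> 2 * (cmod (Y n q p))\<^sup>2 + 2 * (cmod (Y n p q))\<^sup>2"
        using zero_le_power2[of "cmod (Y n q p) - cmod (Y n p q)"] by (simp add: power2_eq_square algebra_simps)
      finally show "(cmod (Y n q p - cnj (Y n p q)))\<^sup>2 \<le> 2 * (cmod (Y n q p))\<^sup>2 + 2 * (cmod (Y n p q))\<^sup>2" .
    qed
    also have "\<dots> = 4 * (\<Sum>q\<in>Xi n. \<Sum>p\<in>Xi n. (cmod (Y n q p))\<^sup>2)"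
      using sum.swap[of "\<lambda>q p. (cmod (Y n p q))\<^sup>2" "Xi n" "Xi n"] by (simp add: sum.distrib flip: sum_distrib_left)
    finally show ?thesis .
  qed
  show ?thesis
  proof (rule tendsto_0_eventually_le)
    fix \<epsilon> :: real assume \<epsilon>: "0 < \<epsilon>"
    have "(\<lambda>n. mesh n * c1) \<longlonglongrightarrow> 0 * c1" by (intro tendsto_intros mesh_tendsto)
    then have ev1: "\<forall>\<^sub>F n in sequentially. mesh n * c1 < min \<epsilon> 1"
      by (rule order_tendstoD) (use \<epsilon> in simp)
    have ev2: "\<forall>\<^sub>F n in sequentially. \<forall>q. (LINT x|lebesgue. indicator (nearset n q) x * \<beta> x) \<le> \<epsilon>"
      by (rule small_patches[OF \<beta>i \<beta>0 \<epsilon>])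
    from ev1 ev2 show "\<forall>\<^sub>F n in sequentially. \<bar>(mesh n)\<^sup>2 * ?F n\<bar> \<le> (128 * (b1 + 1)) * \<epsilon>"
    proof eventually_elim
      case (elim n)
      have h: "0 < mesh n" by (rule mesh_pos)
      have mx: "cmod (Y n q p) \<le> \<epsilon> / mesh n + c1" if q: "q \<in> Xi n" and p: "p \<in> Xi n" for q p
      proof -
        have i1: "integrable lebesgue (\<lambda>x. indicator (nearset n q) x * \<beta> x / mesh n)"
          using integrable_mult_indicator[OF _ \<beta>i, of "nearset n q"] by simp
        have i2: "integrable lebesgue (\<lambda>x. cmod (?c x))" using c by (rule integrable_norm)
        have "cmod (Y n q p) \<le> (LINT x|lebesgue. indicator (nearset n p) x * (indicator (nearset n q) x * dens (\<lambda>_. 0) ?b ?c n x))"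
          unfolding Y_def by (rule ent_bound(1)[OF z b c p q])
        also have "\<dots> \<le> (LINT x|lebesgue. indicator (nearset n q) x * \<beta> x / mesh n + cmod (?c x))"
        proof (rule integral_mono[OF ent_bound(2)[OF z b c p q] Bochner_Integration.integrable_add[OF i1 i2]])
          fix x
          have "dens (\<lambda>_. 0) ?b ?c n x = \<beta> x / mesh n + cmod (?c x)" by (simp add: dens_def \<beta>_def)
          moreover have "0 \<le> \<beta> x / mesh n" using \<beta>0 h by simp
          ultimately show "indicator (nearset n p) x * (indicator (nearset n q) x * dens (\<lambda>_. 0) ?b ?c n x)
              \<le> indicator (nearset n q) x * \<beta> x / mesh n + cmod (?c x)"
            by (cases "x \<in> nearset n p"; cases "x \<in> nearset n q") simp_all
        qed
        also have "\<dots> = (LINT x|lebesgue. indicator (nearset n q) x * \<beta> x) / mesh n + c1"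
          unfolding Bochner_Integration.integral_add[OF i1 i2] c1_def by simp
        also have "\<dots> \<le> \<epsilon> / mesh n + c1"
          using elim(2) h by (intro add_mono divide_right_mono) auto
        finally show ?thesis .
      qed
      have tot: "(\<Sum>q\<in>Xi n. \<Sum>p\<in>Xi n. cmod (Y n q p)) \<le> 16 * (b1 / mesh n + c1)"
      proof -
        have "(\<Sum>q\<in>Xi n. \<Sum>p\<in>Xi n. cmod (Y n q p)) \<le> 16 * (LINT x|lebesgue. dens (\<lambda>_. 0) ?b ?c n x)"
          unfolding Y_def by (rule ent_sum_bound[OF z b c])
        also have "(LINT x|lebesgue. dens (\<lambda>_. 0) ?b ?c n x) = b1 / mesh n + c1"
          unfolding integral_dens[OF z b c] b1_def \<beta>_def c1_def by (simp add: mnorm_def)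
        finally show ?thesis .
      qed
      have "(\<Sum>q\<in>Xi n. \<Sum>p\<in>Xi n. (cmod (Y n q p))\<^sup>2) \<le> (\<Sum>q\<in>Xi n. \<Sum>p\<in>Xi n. (\<epsilon> / mesh n + c1) * cmod (Y n q p))"
        unfolding power2_eq_square by (intro sum_mono mult_right_mono mx) auto
      also have "\<dots> = (\<epsilon> / mesh n + c1) * (\<Sum>q\<in>Xi n. \<Sum>p\<in>Xi n. cmod (Y n q p))" by (simp add: sum_distrib_left)
      also have "\<dots> \<le> (\<epsilon> / mesh n + c1) * (16 * (b1 / mesh n + c1))"
        using tot \<epsilon> h pos by (intro mult_left_mono add_nonneg_nonneg) auto
      finally have "(mesh n)\<^sup>2 * ?F n \<le> (mesh n)\<^sup>2 * (4 * ((\<epsilon> / mesh n + c1) * (16 * (b1 / mesh n + c1))))"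
        using F[of n] by (intro mult_left_mono) auto
      also have "\<dots> = 64 * ((\<epsilon> + mesh n * c1) * (b1 + mesh n * c1))"
        using h by (simp add: field_simps power2_eq_square)
      also have "\<dots> \<le> 64 * ((2 * \<epsilon>) * (b1 + 1))"
        using elim(1) \<epsilon> h pos by (intro mult_left_mono mult_mono) auto
      also have "\<dots> = (128 * (b1 + 1)) * \<epsilon>" by simp
      finally show ?case by (simp add: sum_nonneg)
    qed
  qed
qed

end

section \<open>The asymptotic distribution\<close>

lemma compactly_supported_bound:
  fixes F :: "'a::real_normed_vector \<Rightarrow> complex"
  assumes "compactly_supported F"
  obtains K where "0 \<le> K" "\<And>x. K < norm x \<Longrightarrow> F x = 0"
proof -
  have "bounded {x. F x \<noteq> 0}"
    using assms unfolding compactly_supported_def by (blast intro: bounded_subset[OF compact_imp_bounded closure_subset])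
  then obtain K where "\<And>x. F x \<noteq> 0 \<Longrightarrow> norm x \<le> K" unfolding bounded_iff by auto
  then show ?thesis by (intro that[of "max 0 K"]) force+
qed

text \<open>Close to the real axis uniform continuity gives \<open>e\<close>; farther away the crude
  bound \<open>2 * B\<close> is charged to the squared imaginary part, whose sum over the
  eigenvalues the Hermitian defect controls.\<close>

lemma compactly_supported_near_real:
  fixes F :: "complex \<Rightarrow> complex"
  assumes F: "compactly_supported F" and e: "0 < e"
  obtains C where "0 \<le> C" "\<And>z. cmod (F z - F (of_real (Re z))) \<le> e + C * (Im z)\<^sup>2"
proof -
  have c: "continuous_on UNIV F" using F by (simp add: compactly_supported_def)
  obtain K where K: "0 \<le> K" "\<And>x. K < norm x \<Longrightarrow> F x = 0" using compactly_supported_bound[OF F] by blast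
  have "uniformly_continuous_on (cball 0 (K + 1)) F"
    by (intro compact_uniformly_continuous continuous_on_subset[OF c]) auto
  then obtain \<delta>0 where \<delta>0: "\<delta>0 > 0"
      "\<And>z w. z \<in> cball 0 (K + 1) \<Longrightarrow> w \<in> cball 0 (K + 1) \<Longrightarrow> dist w z < \<delta>0 \<Longrightarrow> dist (F w) (F z) < e"
    unfolding uniformly_continuous_on_def using e by meson
  \<comment> \<open>With \<open>\<delta> \<le> 1\<close>, a point of modulus above
    \<open>K + 1\<close> and imaginary part below \<open>\<delta>\<close> has its real part outside
    the support as well.\<close>
  define \<delta> where "\<delta> = min \<delta>0 1"
  have \<delta>: "0 < \<delta>" "\<delta> \<le> 1" "\<delta> \<le> \<delta>0" using \<delta>0(1) by (auto simp: \<delta>_def)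
  have "bounded (F ` cball 0 K)"
    by (intro compact_imp_bounded compact_continuous_image continuous_on_subset[OF c]) auto
  then obtain B where B: "\<And>z. z \<in> cball 0 K \<Longrightarrow> cmod (F z) \<le> B" unfolding bounded_iff by blast
  have B0: "0 \<le> B" using order_trans[OF norm_ge_zero B[of 0]] K(1) by simp
  have B': "cmod (F z) \<le> B" for z using B[of z] K(2)[of z] B0 by (cases "K < cmod z") auto
  have eq: "cmod (z - of_real (Re z)) = \<bar>Im z\<bar>" for z by (simp add: cmod_def)
  show ?thesis
  proof (rule that[of "2 * B / \<delta>\<^sup>2"])
    show "0 \<le> 2 * B / \<delta>\<^sup>2" using B0 by simp
    fix z
    show "cmod (F z - F (of_real (Re z))) \<le> e + 2 * B / \<delta>\<^sup>2 * (Im z)\<^sup>2"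
    proof (cases "\<bar>Im z\<bar> < \<delta>")
      case True
      have "cmod (F z - F (of_real (Re z))) \<le> e"
      proof (cases "cmod z \<le> K + 1")
        case True
        then have "of_real (Re z) \<in> cball (0 :: complex) (K + 1)" using abs_Re_le_cmod[of z] by simp
        then have "dist (F z) (F (of_real (Re z))) < e"
          using True \<delta> \<open>\<bar>Im z\<bar> < \<delta>\<close> eq[of z] by (intro \<delta>0(2)) (auto simp: dist_norm)
        then show ?thesis by (simp add: dist_norm)
      next
        case False
        have "cmod z \<le> cmod (of_real (Re z)) + cmod (z - of_real (Re z))"
          by (rule norm_triangle_sub)
        then have "K < cmod (of_real (Re z))" using False True \<delta> unfolding eq by linarith
        then show ?thesis using K(2)[of z] K(2)[of "of_real (Re z)"] False e by simp
      qed
      also have "\<dots> \<le> e + 2 * B / \<delta>\<^sup>2 * (Im z)\<^sup>2" using B0 by simp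
      finally show ?thesis .
    next
      case False
      have "\<delta>\<^sup>2 \<le> (Im z)\<^sup>2" using False \<delta> power_mono[of \<delta> "\<bar>Im z\<bar>" 2] by simp
      then have "2 * B * \<delta>\<^sup>2 \<le> 2 * B * (Im z)\<^sup>2" using B0 by (intro mult_left_mono) auto
      then have "2 * B \<le> 2 * B / \<delta>\<^sup>2 * (Im z)\<^sup>2" using \<delta> by (simp add: field_simps)
      moreover have "cmod (F z - F (of_real (Re z))) \<le> B + B"
        by (rule order_trans[OF norm_triangle_ineq4 add_mono]) (rule B')+
      ultimately show ?thesis using e by linarith
    qed
  qed
qed

lemma P1_symbol_real:
  assumes "\<And>x i j. x \<in> \<Omega> \<Longrightarrow> A x $ j $ i = cnj (A x $ i $ j)"
  shows "of_real (Re (P1_symbol \<Omega> A z)) = P1_symbol \<Omega> A z"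
proof -
  obtain x \<theta> where z: "z = (x, \<theta>)" by (cases z)
  define B where "B = zero_extension \<Omega> A x"
  have h: "cnj (B $ i $ j) = B $ j $ i" for i j
    using assms[of x j i] by (simp add: B_def zero_extension_def)
  have "cnj (P1_symbol \<Omega> A z) = P1_symbol \<Omega> A z"
    unfolding z P1_symbol_def Let_def case_prod_conv B_def[symmetric]
    by (simp add: scalar_product_def matrix_vector_mult_def sum_2 vector_2 exp_cnj h)
       (simp add: algebra_simps)
  then show ?thesis by (metis Reals_cnj_iff of_real_Re)
qed

context region
begin

lemma Dom_lebesgue: "Dom \<in> sets lebesgue"
  using Dom_borel by simp

lemma measure_Dom_pos: "0 < measure lebesgue Dom"
  using Dom_finite by (simp add: measure_def enn2real_positive_iff)

lemma measure_interior_pos: "0 < measure lebesgue (interior \<Omega>)"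
  using measure_Dom_pos unfolding measure_Dom by (simp add: zero_less_mult_iff)

lemma finite_measure_Dom: "finite_measure (lebesgue_on Dom)"
  using Dom_finite(1) Dom_lebesgue by (intro finite_measure_lebesgue_on fmeasurableI) auto

lemma measure_space_Dom: "measure (lebesgue_on Dom) (space (lebesgue_on Dom)) = measure lebesgue Dom"
  using Dom_lebesgue by (simp add: measure_restrict_space space_restrict_space)

lemma card_at_top: "filterlim (\<lambda>n. card (Xi n)) at_top sequentially"
proof -
  have "filterlim (\<lambda>n. 1 + real n) at_top sequentially"
    by (rule filterlim_tendsto_add_at_top[OF tendsto_const filterlim_real_sequentially])
  then have "filterlim (\<lambda>n. (1 + real n)\<^sup>2) at_top sequentially"
    by (intro filterlim_pow_at_top) auto
  then have "filterlim (\<lambda>n. ((mesh n)\<^sup>2 * real (card (Xi n))) * (1 + real n)\<^sup>2) at_top sequentially"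
    by (rule filterlim_tendsto_pos_mult_at_top[OF card_limit measure_interior_pos])
  moreover have "((mesh n)\<^sup>2 * real (card (Xi n))) * (1 + real n)\<^sup>2 = real (card (Xi n))" for n
  proof -
    have "mesh n * (1 + real n) = 1" by (simp add: mesh_def)
    then have "(mesh n)\<^sup>2 * (1 + real n)\<^sup>2 = 1" by (metis power_mult_distrib power_one)
    then show ?thesis by (metis mult.assoc mult.commute mult_1)
  qed
  ultimately show ?thesis unfolding filterlim_sequentially_iff_filterlim_real by simp
qed

lemma card_pos: "\<forall>\<^sub>F n in sequentially. 0 < card (Xi n)"
  using card_at_top[unfolded filterlim_at_top, rule_format, of 1] by eventually_elim simp

lemma per_card_limit:
  assumes "(\<lambda>n. (mesh n)\<^sup>2 * a n) \<longlonglongrightarrow> L"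
  shows "(\<lambda>n. a n / real (card (Xi n))) \<longlonglongrightarrow> L / measure lebesgue (interior \<Omega>)"
proof -
  have "(\<lambda>n. ((mesh n)\<^sup>2 * a n) / ((mesh n)\<^sup>2 * real (card (Xi n)))) \<longlonglongrightarrow> L / measure lebesgue (interior \<Omega>)"
    using measure_interior_pos by (intro tendsto_divide assms card_limit) simp
  moreover have "((mesh n)\<^sup>2 * a n) / ((mesh n)\<^sup>2 * real (card (Xi n))) = a n / real (card (Xi n))" for n
    using mesh_pos[of n] by simp
  ultimately show ?thesis by simp
qed

end

locale P1_problem = region \<Omega> for \<Omega> +
  fixes A :: "real^2 \<Rightarrow> complex^2^2" and b :: "real^2 \<Rightarrow> complex^2" and c :: "real^2 \<Rightarrow> complex"
  assumes A: "integrable lebesgue (\<lambda>x. indicator \<Omega> x *\<^sub>R A x)"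
    and b: "integrable lebesgue (\<lambda>x. indicator \<Omega> x *\<^sub>R b x)"
    and c: "integrable lebesgue (\<lambda>x. indicator \<Omega> x *\<^sub>R c x)"
begin

abbreviation "S \<equiv> P1_matrix \<Omega> A b c"
abbreviation "symb \<equiv> P1_symbol \<Omega> A"

lemma S_carrier: "S n \<in> carrier_mat (card (Xi n)) (card (Xi n))"
  by (simp add: P1_matrix_def Let_def card_Xi)

lemma sym_measurable: "symb \<in> borel_measurable (lebesgue_on Dom)"
  by (rule measurable_restrict_space1[OF symbol_measurable[OF A]])

lemma dim_row_S: "dim_row (S n) = card (Xi n)"
  using S_carrier by blast

lemma setting: "symbol_setting S symb Dom"
  unfolding symbol_setting_def dim_row_S
proof (intro conjI allI)
  show "square_mat (S n)" for n using S_carrier[of n] by (metis carrier_matD square_mat.simps)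
qed (rule card_at_top Dom_lebesgue Dom_finite sym_measurable)+

text \<open>Division by the number of grid points merges the factor \<open>(2 * pi)\<^sup>2\<close>
  and the area of the interior into the measure of the product domain.\<close>

lemma fk_limit:
  assumes "1 \<le> s" "(\<lambda>n. (mesh n)\<^sup>2 * a n) \<longlonglongrightarrow> (LINT x:interior \<Omega>|lebesgue. HB s t (A x)) / (2 * pi)\<^sup>2"
  shows "(\<lambda>n. a n / real (card (Xi n))) \<longlonglongrightarrow> (LINT z|lebesgue_on Dom. fk s t (symb z)) / measure lebesgue Dom"
  using per_card_limit[OF assms(2)] unfolding symbol_integral[OF A assms(1)] measure_Dom
  by (simp add: mult.commute)

lemma recip_bounded: "1 \<le> s \<Longrightarrow> bounded (range (\<lambda>x :: real. 1 / ((x - t)\<^sup>2 + s)))"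
  unfolding bounded_iff by (intro exI[of _ 1]) (auto simp: divide_le_eq abs_of_pos add_nonneg_pos intro: add_increasing)

lemma singular_values_S:
  "size (singular_values (S n)) = card (Xi n)" "\<sigma> \<in># singular_values (S n) \<Longrightarrow> 0 \<le> \<sigma>"
  using gram_schur[OF S_carrier, of n] by auto

text \<open>The unshifted resolvent sums determine the averages of even test functions, and as
  singular values are nonnegative, \<open>F\<close> may be replaced by its even version.\<close>

lemma sv_limit:
  fixes F :: "real \<Rightarrow> complex"
  assumes F: "compactly_supported F"
  shows "(\<lambda>n. (\<Sum>s\<in>#singular_values (S n). F s) / of_nat (dim_row (S n)))
    \<longlonglongrightarrow> (LINT z:Dom|lebesgue. F (cmod (symb z))) / of_real (measure lebesgue Dom)"
proof -
  interpret empirical "lebesgue_on Dom" "\<lambda>n. singular_values (S n)" "\<lambda>z. cmod (symb z)"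
  proof (rule empirical.intro)
    show "finite_measure (lebesgue_on Dom)" by (rule finite_measure_Dom)
    show "(\<lambda>z. cmod (symb z)) \<in> borel_measurable (lebesgue_on Dom)"
      by (rule measurable_compose[OF sym_measurable borel_measurable_norm])
    show "0 < measure (lebesgue_on Dom) (space (lebesgue_on Dom))"
      unfolding measure_space_Dom by (rule measure_Dom_pos)
    show "\<forall>\<^sub>F n in sequentially. singular_values (S n) \<noteq> {#}"
      using card_pos unfolding singular_values_S(1)[symmetric] by eventually_elim auto
  qed
  have base: "conv (\<lambda>x. 1 / (x\<^sup>2 + s))" if s: "1 \<le> s" for s
    unfolding conv_def
  proof (intro conjI)
    show "bounded (range (\<lambda>x :: real. 1 / (x\<^sup>2 + s)))" using recip_bounded[OF s, of 0] by simp
    show "(\<lambda>x :: real. 1 / (x\<^sup>2 + s)) \<in> borel_measurable borel" by measurable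
    have "(\<lambda>n. rtr s (S n) / real (card (Xi n))) \<longlonglongrightarrow> (LINT z|lebesgue_on Dom. fk s 0 (symb z)) / measure lebesgue Dom"
      by (rule fk_limit[OF s]) (use l1_limit[OF A b c s, of 0] shift_mat_0[OF S_carrier] in simp)
    then show "(\<lambda>n. avg n (\<lambda>x. 1 / (x\<^sup>2 + s))) \<longlonglongrightarrow> mean (\<lambda>x. 1 / (x\<^sup>2 + s))"
      unfolding avg_def mean_def measure_space_Dom singular_values_S(1) rtr_def fk_def by simp
  qed
  obtain K where K: "\<And>x. K < norm x \<Longrightarrow> F x = 0" using compactly_supported_bound[OF F] by blast
  have F': "continuous_on UNIV F" using F by (simp add: compactly_supported_def)
  have "conv (\<lambda>x. Re (F \<bar>x\<bar>))" "conv (\<lambda>x. Im (F \<bar>x\<bar>))"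
    using conv_abs_compact[of "\<lambda>x. x" "\<lambda>x. Re (F x)" K] conv_abs_compact[of "\<lambda>x. x" "\<lambda>x. Im (F x)" K]
      base K F' by (auto intro: continuous_intros)
  then have "(\<lambda>n. (\<Sum>s\<in>#singular_values (S n). F \<bar>s\<bar>) / of_nat (size (singular_values (S n))))
      \<longlonglongrightarrow> (LINT z|lebesgue_on Dom. F \<bar>cmod (symb z)\<bar>) / of_real (measure (lebesgue_on Dom) (space (lebesgue_on Dom)))"
    by (rule conv_complex[of "\<lambda>x. F \<bar>x\<bar>"])
  moreover have "(\<Sum>s\<in>#singular_values (S n). F \<bar>s\<bar>) = (\<Sum>s\<in>#singular_values (S n). F s)" for n
    using singular_values_S(2) by (intro arg_cong[where f = sum_mset] image_mset_cong) simp
  ultimately show ?thesis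
    using Dom_lebesgue unfolding measure_space_Dom
    by (simp add: singular_values_S(1) dim_row_S set_lebesgue_integral_def integral_restrict_space)
qed

lemma ev_limit:
  fixes F :: "complex \<Rightarrow> complex"
  assumes herm: "\<And>x i j. x \<in> \<Omega> \<Longrightarrow> A x $ j $ i = cnj (A x $ i $ j)" and F: "compactly_supported F"
  shows "(\<lambda>n. (\<Sum>z\<in>#eigenvalues (S n). F z) / of_nat (dim_row (S n)))
    \<longlonglongrightarrow> (LINT z:Dom|lebesgue. F (symb z)) / of_real (measure lebesgue Dom)"
proof -
  let ?E = "\<lambda>n. eigenvalues (S n)"
  define D where "D n = (\<Sum>i<card (Xi n). \<Sum>j<card (Xi n). (cmod (S n $$ (i, j) - cnj (S n $$ (j, i))))\<^sup>2)" for n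
  have D: "(\<lambda>n. (mesh n)\<^sup>2 * D n) \<longlonglongrightarrow> 0"
    unfolding D_def by (rule hermitian_defect_limit[OF A b c herm])
  have sE: "size (?E n) = card (Xi n)" for n
    by (rule eigenvalues_list[OF S_carrier[of n]]) simp
  interpret empirical "lebesgue_on Dom" "\<lambda>n. image_mset Re (?E n)" "\<lambda>z. Re (symb z)"
  proof (rule empirical.intro)
    show "finite_measure (lebesgue_on Dom)" by (rule finite_measure_Dom)
    show "(\<lambda>z. Re (symb z)) \<in> borel_measurable (lebesgue_on Dom)"
      using sym_measurable by simp
    show "0 < measure (lebesgue_on Dom) (space (lebesgue_on Dom))"
      unfolding measure_space_Dom by (rule measure_Dom_pos)
    show "\<forall>\<^sub>F n in sequentially. image_mset Re (?E n) \<noteq> {#}"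
      using card_pos unfolding sE[symmetric] by eventually_elim auto
  qed
  have base: "conv (\<lambda>x. 1 / ((x - t)\<^sup>2 + s))" if s: "1 \<le> s" for s t
    unfolding conv_def
  proof (intro conjI)
    show "bounded (range (\<lambda>x :: real. 1 / ((x - t)\<^sup>2 + s)))" by (rule recip_bounded[OF s])
    show "(\<lambda>x :: real. 1 / ((x - t)\<^sup>2 + s)) \<in> borel_measurable borel" by measurable
    define a where "a n = (\<Sum>z\<in>#?E n. 1 / ((Re z - t)\<^sup>2 + s))" for n
    \<comment> \<open>The scale \<open>(mesh n)\<^sup>2\<close> is shared between the two square
      roots: under one it normalises the dimension, which converges, under the other the defect,
      which vanishes.\<close>
    have "(\<lambda>n. (mesh n)\<^sup>2 * (a n - rtr s (shift_mat t (S n)))) \<longlonglongrightarrow> 0"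
    proof (rule Lim_null_comparison)
      show "\<forall>\<^sub>F n in sequentially. norm ((mesh n)\<^sup>2 * (a n - rtr s (shift_mat t (S n))))
          \<le> 2 * sqrt ((mesh n)\<^sup>2 * real (card (Xi n))) * sqrt ((mesh n)\<^sup>2 * D n)"
      proof (intro always_eventually allI)
        fix n
        have h: "0 < mesh n" by (rule mesh_pos)
        have "norm ((mesh n)\<^sup>2 * (a n - rtr s (shift_mat t (S n)))) = (mesh n)\<^sup>2 * \<bar>rtr s (shift_mat t (S n)) - a n\<bar>"
          by (simp add: abs_mult abs_minus_commute)
        also have "\<dots> \<le> (mesh n)\<^sup>2 * (2 * sqrt (real (card (Xi n))) * sqrt (D n))"
          unfolding a_def D_def by (intro mult_left_mono eigenvalues_hermitian_defect(1) S_carrier s) simp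
        also have "\<dots> = 2 * sqrt ((mesh n)\<^sup>2 * real (card (Xi n))) * sqrt ((mesh n)\<^sup>2 * D n)"
          using h by (simp add: real_sqrt_mult power2_eq_square)
        finally show "norm ((mesh n)\<^sup>2 * (a n - rtr s (shift_mat t (S n))))
          \<le> 2 * sqrt ((mesh n)\<^sup>2 * real (card (Xi n))) * sqrt ((mesh n)\<^sup>2 * D n)" .
      qed
      have "(\<lambda>n. 2 * sqrt ((mesh n)\<^sup>2 * real (card (Xi n))) * sqrt ((mesh n)\<^sup>2 * D n))
          \<longlonglongrightarrow> 2 * sqrt (measure lebesgue (interior \<Omega>)) * sqrt 0"
        by (intro tendsto_intros card_limit D)
      then show "(\<lambda>n. 2 * sqrt ((mesh n)\<^sup>2 * real (card (Xi n))) * sqrt ((mesh n)\<^sup>2 * D n)) \<longlonglongrightarrow> 0" by simp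
    qed
    from tendsto_add[OF this l1_limit[OF A b c s, of t]]
    have "(\<lambda>n. (mesh n)\<^sup>2 * a n) \<longlonglongrightarrow> (LINT x:interior \<Omega>|lebesgue. HB s t (A x)) / (2 * pi)\<^sup>2"
      by (simp add: algebra_simps)
    from fk_limit[OF s this]
    have l: "(\<lambda>n. a n / real (card (Xi n))) \<longlonglongrightarrow> (LINT z|lebesgue_on Dom. fk s t (symb z)) / measure lebesgue Dom" .
    have fk: "fk s t (symb z) = 1 / ((Re (symb z) - t)\<^sup>2 + s)" for z
    proof -
      have "cmod (symb z - of_real t) = \<bar>Re (symb z) - t\<bar>"
        by (subst P1_symbol_real[OF herm, symmetric]) (simp_all only: of_real_diff[symmetric] norm_of_real)
      then show ?thesis by (simp add: fk_def)
    qed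
    show "(\<lambda>n. avg n (\<lambda>x. 1 / ((x - t)\<^sup>2 + s))) \<longlonglongrightarrow> mean (\<lambda>x. 1 / ((x - t)\<^sup>2 + s))"
      using l unfolding fk avg_def mean_def measure_space_Dom size_image_mset sE a_def
      by (simp add: image_mset.compositionality o_def)
  qed
  obtain K where K: "\<And>x. K < norm x \<Longrightarrow> F x = 0" using compactly_supported_bound[OF F] by blast
  have F': "continuous_on UNIV (\<lambda>x :: real. F (of_real x))"
    using F unfolding compactly_supported_def
    by (intro continuous_on_compose2[of UNIV F UNIV of_real] continuous_intros) auto
  have "conv (\<lambda>x. Re (F (of_real x)))" "conv (\<lambda>x. Im (F (of_real x)))"
    using K by (auto intro!: conv_compact[of _ K] base continuous_on_Re[OF F'] continuous_on_Im[OF F'])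
  then have "(\<lambda>n. (\<Sum>x\<in>#image_mset Re (?E n). F (of_real x)) / of_nat (size (image_mset Re (?E n))))
      \<longlonglongrightarrow> (LINT z|lebesgue_on Dom. F (of_real (Re (symb z)))) / of_real (measure (lebesgue_on Dom) (space (lebesgue_on Dom)))"
    by (rule conv_complex[of "\<lambda>x. F (of_real x)"])
  then have re: "(\<lambda>n. (\<Sum>z\<in>#?E n. F (of_real (Re z))) / of_nat (card (Xi n)))
      \<longlonglongrightarrow> (LINT z|lebesgue_on Dom. F (symb z)) / of_real (measure lebesgue Dom)"
    unfolding measure_space_Dom by (simp add: sE P1_symbol_real[OF herm] image_mset.compositionality o_def)
  define R where "R n = (\<Sum>z\<in>#?E n. F z) / of_nat (card (Xi n)) - (\<Sum>z\<in>#?E n. F (of_real (Re z))) / of_nat (card (Xi n))" for n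
  have "(\<lambda>n. cmod (R n)) \<longlonglongrightarrow> 0"
  proof (rule tendsto_0_eventually_le)
    fix e :: real assume e: "0 < e"
    \<comment> \<open>On average the first part contributes \<open>e\<close>, and the second at most
      \<open>C\<close> times the defect per eigenvalue, which tends to zero.\<close>
    obtain C where C: "0 \<le> C" "\<And>z. cmod (F z - F (of_real (Re z))) \<le> e + C * (Im z)\<^sup>2"
      using compactly_supported_near_real[OF F e] by blast
    have "(\<lambda>n. C * (D n / real (card (Xi n)))) \<longlonglongrightarrow> C * (0 / measure lebesgue (interior \<Omega>))"
      by (intro tendsto_intros per_card_limit[OF D])
    then have "\<forall>\<^sub>F n in sequentially. C * (D n / real (card (Xi n))) < e"
      by (rule order_tendstoD) (use e in simp)
    with card_pos show "\<forall>\<^sub>F n in sequentially. \<bar>cmod (R n)\<bar> \<le> 2 * e"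
    proof eventually_elim
      case (elim n)
      have sum: "cmod ((\<Sum>z\<in>#M. F z) - (\<Sum>z\<in>#M. F (of_real (Re z)))) \<le> e * real (size M) + C * (\<Sum>z\<in>#M. (Im z)\<^sup>2)" for M
      proof (induction M)
        case (add w M)
        have "cmod ((F w - F (of_real (Re w))) + ((\<Sum>z\<in>#M. F z) - (\<Sum>z\<in>#M. F (of_real (Re z)))))
            \<le> (e + C * (Im w)\<^sup>2) + (e * real (size M) + C * (\<Sum>z\<in>#M. (Im z)\<^sup>2))"
          by (rule order_trans[OF norm_triangle_ineq add_mono[OF C(2) add]])
        then show ?case by (simp add: algebra_simps)
      qed simp
      have "cmod (R n) = cmod ((\<Sum>z\<in>#?E n. F z) - (\<Sum>z\<in>#?E n. F (of_real (Re z)))) / real (card (Xi n))"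
        unfolding R_def by (simp add: norm_divide flip: diff_divide_distrib)
      also have "\<dots> \<le> (e * real (card (Xi n)) + C * D n) / real (card (Xi n))"
      proof (rule divide_right_mono)
        have "C * (\<Sum>z\<in>#?E n. (Im z)\<^sup>2) \<le> C * D n"
          unfolding D_def by (intro mult_left_mono eigenvalues_hermitian_defect(2)[OF S_carrier, of 1] C) simp
        then show "cmod ((\<Sum>z\<in>#?E n. F z) - (\<Sum>z\<in>#?E n. F (of_real (Re z)))) \<le> e * real (card (Xi n)) + C * D n"
          using sum[of "?E n"] unfolding sE by linarith
      qed simp
      also have "\<dots> = e + C * (D n / real (card (Xi n)))"
        using elim(1) by (simp add: add_divide_distrib del: card_0_eq of_nat_eq_0_iff)
      also have "\<dots> \<le> 2 * e" using elim(2) by linarith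
      finally show ?case by simp
    qed
  qed
  then have "R \<longlonglongrightarrow> 0" by (simp add: tendsto_norm_zero_iff)
  from tendsto_add[OF this re]
  have "(\<lambda>n. (\<Sum>z\<in>#?E n. F z) / of_nat (card (Xi n)))
      \<longlonglongrightarrow> (LINT z|lebesgue_on Dom. F (symb z)) / of_real (measure lebesgue Dom)"
    by (simp add: R_def)
  then show ?thesis
    using Dom_lebesgue by (simp add: dim_row_S set_lebesgue_integral_def integral_restrict_space)
qed

end

theorem theorem6p2:
  fixes \<Omega> :: "(real^2) set"
    and A :: "real^2 \<Rightarrow> complex^2^2"
    and b :: "real^2 \<Rightarrow> complex^2"
    and c :: "real^2 \<Rightarrow> complex"
  assumes "\<Omega> \<subseteq> cbox 0 1"
    and "closed \<Omega>"
    and "peano_jordan_measurable \<Omega>"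
    and "emeasure lebesgue \<Omega> > 0"
    and "A absolutely_integrable_on \<Omega>"
    and "b absolutely_integrable_on \<Omega>"
    and "c absolutely_integrable_on \<Omega>"
  shows "sv_distributed (P1_matrix \<Omega> A b c) (P1_symbol \<Omega> A) (symbol_domain \<Omega>) \<and>
    ((\<forall>x\<in>\<Omega>. \<forall>i j. A x $ j $ i = cnj (A x $ i $ j)) \<longrightarrow>
      ev_distributed (P1_matrix \<Omega> A b c) (P1_symbol \<Omega> A) (symbol_domain \<Omega>))"
proof -
  interpret P1_problem \<Omega> A b c
    using assms by unfold_locales (auto simp: peano_jordan_measurable_def set_integrable_def)
  show ?thesis
    unfolding sv_distributed_def ev_distributed_def
    using setting sv_limit ev_limit by blast
qed

end
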